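(* Let $\kappa\in\mathbb{R}$ and let $\mathcal{F}_\varepsilon$, $\varepsilon\in(0,1)$, and $\mathcal{F}_0$ be the functionals on $H^1(\mathcal{M},\mathbb{S}^2)$ defined in the context. Then: (i) (Equicoercivity) there exists a nonempty set $\mathcal{K}\subset H^1(\mathcal{M},\mathbb{S}^2)$, compact for the weak topology of $H^1(\mathcal{M},\mathbb{R}^3)$, such that $\inf_{H^1(\mathcal{M},\mathbb{S}^2)}\mathcal{F}_\varepsilon=\inf_{\mathcal{K}}\mathcal{F}_\varepsilon$ for every $\varepsilon\in(0,1)$; (ii) ($\Gamma$-convergence) for every sequence $\varepsilon_n\to0$: for every $\mathbf{u}\in H^1(\mathcal{M},\mathbb{S}^2)$ and every sequence $\mathbf{u}_n\in H^1(\mathcal{M},\mathbb{S}^2)$ with $\mathbf{u}_n\rightharpoonup\mathbf{u}$ weakly in $H^1(\mathcal{M},\mathbb{R}^3)$ one has $\mathcal{F}_0(\mathbf{u})\le\liminf_n\mathcal{F}_{\varepsilon_n}(\mathbf{u}_n)$; and for every $\mathbf{u}\in H^1(\mathcal{M},\mathbb{S}^2)$ there exists a sequence $\mathbf{u}_n\in H^1(\mathcal{M},\mathbb{S}^2)$ with $\mathbf{u}_n\rightharpoonup\mathbf{u}$ weakly in $H^1(\mathcal{M},\mathbb{R}^3)$ and $\limsup_n\mathcal{F}_{\varepsilon_n}(\mathbf{u}_n)\le\mathcal{F}_0(\mathbf{u})$; (iii) if, for every $\varepsilon\in(0,1)$, $\mathbf{u}_\varepsilon\in H^1(\mathcal{M},\mathbb{S}^2)$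 is a minimizer of $\mathcal{F}_\varepsilon$, then for every sequence $\varepsilon_n\to0$ there is a subsequence along which $\mathbf{u}_{\varepsilon_n}$ converges strongly in $H^1(\mathcal{M},\mathbb{R}^3)$ to a minimizer of $\mathcal{F}_0$.
   Context: Let $\omega\subset\mathbb{R}^2$ be a bounded domain with Lipschitz boundary, $I=(0,1)$, $\mathcal{M}=\omega\times I$, with points $(\sigma,s)$, $\sigma\in\omega$, $s\in I$. $H^1(\mathcal{M},\mathbb{S}^2)=\{\mathbf{u}\in H^1(\mathcal{M},\mathbb{R}^3):|\mathbf{u}|=1\text{ a.e.}\}$, with topologies induced from $H^1(\mathcal{M},\mathbb{R}^3)$. For $\mathbf{m}\in L^2(\mathbb{R}^3,\mathbb{R}^3)$, the stray field $\mathbf{h}_{\mathsf d}[\mathbf{m}]$ is the unique $\mathbf{h}\in L^2(\mathbb{R}^3,\mathbb{R}^3)$ with $\operatorname{curl}\mathbf{h}=0$ and $\operatorname{div}(\mathbf{h}+\mathbf{m})=0$ in the sense of distributions on $\mathbb{R}^3$. Let $\Phi_\varepsilon(\sigma,s)=(\sigma,\varepsilon s)$ on $\mathbb{R}^3$ and, for $\mathbf{u}\in H^1(\mathcal{M},\mathbb{S}^2)$, $\mathbf{h}_\varepsilon[\mathbf{u}\chi_{\mathcal{M}}]:=\mathbf{h}_{\mathsf d}[(\mathbf{u}\chi_{\mathcal{M}})\circ\Phi_\varepsilon^{-1}]\circ\Phi_\varepsilon$, where $\mathbf{u}\chi_{\mathcal{M}}$ is the extension by zero. Let $\nabla_\varepsilon=(\partial_1,\partial_2,\varepsilon^{-1}\partial_s)^{T}$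 and $\operatorname{curl}_\varepsilon\mathbf{u}=\nabla_\varepsilon\times\mathbf{u}$. Define $$\mathcal{F}_\varepsilon(\mathbf{u})=\frac12\int_{\mathcal{M}}|\nabla_\varepsilon\mathbf{u}|^2\,dx+\kappa\int_{\mathcal{M}}\operatorname{curl}_\varepsilon\mathbf{u}\cdot\mathbf{u}\,dx+\frac12\int_{\mathbb{R}^3}|\mathbf{h}_\varepsilon[\mathbf{u}\chi_{\mathcal{M}}]|^2\,dx .$$ Let $e_1,e_2,e_3$ be the standard basis, $\nabla_\omega=(\partial_1,\partial_2)$ and $\operatorname{curl}_\omega\mathbf{u}=e_1\times\partial_1\mathbf{u}+e_2\times\partial_2\mathbf{u}$. Define $\mathcal{F}_0(\mathbf{u})=+\infty$ if $\mathbf{u}\in H^1(\mathcal{M},\mathbb{S}^2)$ depends on $s$, and, if $\mathbf{u}$ is independent of $s$ (identified with an element of $H^1(\omega,\mathbb{S}^2)$), $$\mathcal{F}_0(\mathbf{u})=\frac12\int_\omega|\nabla_\omega\mathbf{u}|^2\,d\sigma+\kappa\int_\omega\operatorname{curl}_\omega\mathbf{u}\cdot\mathbf{u}\,d\sigma+\frac{1+\kappa^2}{2}\int_\omega(\mathbf{u}\cdot e_3)^2\,d\sigma-\frac{\kappa^2}{2}|\omega|.$$ *)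

theory Defs
  imports "HOL-Analysis.Analysis"
begin

definition lipschitz_domain2 :: "(real^2) set \<Rightarrow> bool" where
  "lipschitz_domain2 \<Omega> \<longleftrightarrow> open \<Omega> \<and> bounded \<Omega> \<and> connected \<Omega> \<and> \<Omega> \<noteq> {} \<and>
     (\<forall>p \<in> frontier \<Omega>. \<exists>R r \<delta> L (g :: real \<Rightarrow> real).
        orthogonal_transformation R \<and> 0 < r \<and> 0 < \<delta> \<and>
        L-lipschitz_on UNIV g \<and> g 0 = 0 \<and> (\<forall>t. \<bar>t\<bar> < r \<longrightarrow> \<bar>g t\<bar> < \<delta>) \<and>
        (\<forall>y :: real^2. \<bar>y$1\<bar> < r \<and> \<bar>y$2\<bar> < \<delta> \<longrightarrow> (p + R y \<in> \<Omega> \<longleftrightarrow> y$2 < g (y$1))))"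

definition dir_deriv :: "('a::euclidean_space \<Rightarrow> real) \<Rightarrow> 'a \<Rightarrow> 'a \<Rightarrow> real" where
  "dir_deriv \<phi> b x = deriv (\<lambda>t. \<phi> (x + t *\<^sub>R b)) 0"

definition smooth_fun :: "('a::euclidean_space \<Rightarrow> real) \<Rightarrow> bool" where
  "smooth_fun \<phi> \<longleftrightarrow> (\<exists>D :: 'a list \<Rightarrow> 'a \<Rightarrow> real. D [] = \<phi> \<and> (\<forall>l. continuous_on UNIV (D l)) \<and>
     (\<forall>l b x. b \<in> Basis \<longrightarrow> ((\<lambda>t. D l (x + t *\<^sub>R b)) has_real_derivative D (b # l) x) (at 0)))"

definition test_fun :: "'a::euclidean_space set \<Rightarrow> ('a \<Rightarrow> real) \<Rightarrow> bool" where
  "test_fun U \<phi> \<longleftrightarrow> smooth_fun \<phi> \<and> compact (closure {x. \<phi> x \<noteq> 0}) \<and> closure {x. \<phi> x \<noteq> 0} \<subseteq> U"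

definition L2 :: "'a::euclidean_space set \<Rightarrow> ('a \<Rightarrow> real) \<Rightarrow> bool" where
  "L2 U f \<longleftrightarrow> f \<in> borel_measurable (lebesgue_on U) \<and> integrable (lebesgue_on U) (\<lambda>x. (f x)^2)"

definition weak_pd :: "'a::euclidean_space set \<Rightarrow> 'a \<Rightarrow> ('a \<Rightarrow> real) \<Rightarrow> ('a \<Rightarrow> real) \<Rightarrow> bool" where
  "weak_pd U b f g \<longleftrightarrow> (\<forall>\<phi>. test_fun U \<phi> \<longrightarrow>
      (\<integral>x. f x * dir_deriv \<phi> b x \<partial>lebesgue_on U) = - (\<integral>x. g x * \<phi> x \<partial>lebesgue_on U))"

definition H1 :: "'a::euclidean_space set \<Rightarrow> ('a \<Rightarrow> real) \<Rightarrow> bool" where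
  "H1 U f \<longleftrightarrow> L2 U f \<and> (\<forall>b\<in>Basis. \<exists>g. L2 U g \<and> weak_pd U b f g)"

definition wpd :: "'a::euclidean_space set \<Rightarrow> 'a \<Rightarrow> ('a \<Rightarrow> real) \<Rightarrow> 'a \<Rightarrow> real" where
  "wpd U b f = (SOME g. L2 U g \<and> weak_pd U b f g)"

definition H1v :: "'a::euclidean_space set \<Rightarrow> ('a \<Rightarrow> real^3) \<Rightarrow> bool" where
  "H1v U u \<longleftrightarrow> (\<forall>j. H1 U (\<lambda>x. u x $ j))"

definition H1S2 :: "'a::euclidean_space set \<Rightarrow> ('a \<Rightarrow> real^3) \<Rightarrow> bool" where
  "H1S2 U u \<longleftrightarrow> H1v U u \<and> (AE x in lebesgue_on U. norm (u x) = 1)"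

definition H1_inner :: "'a::euclidean_space set \<Rightarrow> ('a \<Rightarrow> real^3) \<Rightarrow> ('a \<Rightarrow> real^3) \<Rightarrow> real" where
  "H1_inner U u v = (\<Sum>j\<in>UNIV. (\<integral>x. u x $ j * v x $ j \<partial>lebesgue_on U)
      + (\<Sum>b\<in>Basis. \<integral>x. wpd U b (\<lambda>y. u y $ j) x * wpd U b (\<lambda>y. v y $ j) x \<partial>lebesgue_on U))"

definition H1_weak_conv :: "'a::euclidean_space set \<Rightarrow> (nat \<Rightarrow> 'a \<Rightarrow> real^3) \<Rightarrow> ('a \<Rightarrow> real^3) \<Rightarrow> bool" where
  "H1_weak_conv U us u \<longleftrightarrow> (\<forall>v. H1v U v \<longrightarrow> (\<lambda>n. H1_inner U (us n) v) \<longlonglongrightarrow> H1_inner U u v)"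

definition H1_strong_conv :: "'a::euclidean_space set \<Rightarrow> (nat \<Rightarrow> 'a \<Rightarrow> real^3) \<Rightarrow> ('a \<Rightarrow> real^3) \<Rightarrow> bool" where
  "H1_strong_conv U us u \<longleftrightarrow>
     (\<lambda>n. H1_inner U (\<lambda>x. us n x - u x) (\<lambda>x. us n x - u x)) \<longlonglongrightarrow> 0"

text \<open>Weak topology of H^1(U,R^3): initial topology of the functionals u \<mapsto> <u,v>_{H^1}
  (by Riesz, these are all continuous linear functionals).\<close>
definition H1_weak_topology :: "'a::euclidean_space set \<Rightarrow> ('a \<Rightarrow> real^3) topology" where
  "H1_weak_topology U = topology_generated_by
     {{u. H1v U u \<and> H1_inner U u v \<in> V} | v V. H1v U v \<and> open V}"

definition L2v :: "'a::euclidean_space set \<Rightarrow> ('a \<Rightarrow> real^3) \<Rightarrow> bool" where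
  "L2v U h \<longleftrightarrow> (\<forall>j. L2 U (\<lambda>x. h x $ j))"

text \<open>curl h = 0 and div (h + m) = 0 in the sense of distributions on R^3\<close>
definition is_stray_field :: "(real^3 \<Rightarrow> real^3) \<Rightarrow> (real^3 \<Rightarrow> real^3) \<Rightarrow> bool" where
  "is_stray_field m h \<longleftrightarrow> L2v UNIV h \<and>
     (\<forall>\<phi>. test_fun UNIV \<phi> \<longrightarrow>
        (\<forall>i j. (\<integral>x. h x $ i * dir_deriv \<phi> (axis j 1) x - h x $ j * dir_deriv \<phi> (axis i 1) x \<partial>lebesgue) = 0)
      \<and> (\<integral>x. (\<Sum>i\<in>UNIV. (h x $ i + m x $ i) * dir_deriv \<phi> (axis i 1) x) \<partial>lebesgue) = 0)"

definition stray_field :: "(real^3 \<Rightarrow> real^3) \<Rightarrow> real^3 \<Rightarrow> real^3" where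
  "stray_field m = (SOME h. is_stray_field m h)"

definition proj2 :: "real^3 \<Rightarrow> real^2" where
  "proj2 x = (\<chi> i. if i = 1 then x $ 1 else x $ 2)"

definition film :: "(real^2) set \<Rightarrow> (real^3) set" where
  "film \<omega> = {x. proj2 x \<in> \<omega> \<and> 0 < x $ 3 \<and> x $ 3 < 1}"

definition scale3 :: "real \<Rightarrow> real^3 \<Rightarrow> real^3" where
  "scale3 c x = (\<chi> i. if i = 3 then c * x $ i else x $ i)"

definition zero_ext :: "(real^3) set \<Rightarrow> (real^3 \<Rightarrow> real^3) \<Rightarrow> real^3 \<Rightarrow> real^3" where
  "zero_ext M u x = (if x \<in> M then u x else 0)"

definition h_eps :: "real \<Rightarrow> (real^3 \<Rightarrow> real^3) \<Rightarrow> real^3 \<Rightarrow> real^3" where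
  "h_eps \<epsilon> m = stray_field (m \<circ> scale3 (1 / \<epsilon>)) \<circ> scale3 \<epsilon>"

definition grad_eps :: "(real^3) set \<Rightarrow> real \<Rightarrow> 3 \<Rightarrow> (real^3 \<Rightarrow> real^3) \<Rightarrow> real^3 \<Rightarrow> real^3" where
  "grad_eps M \<epsilon> i u x = (\<chi> j. (if i = 3 then 1 / \<epsilon> else 1) * wpd M (axis i 1) (\<lambda>y. u y $ j) x)"

definition curl_eps :: "(real^3) set \<Rightarrow> real \<Rightarrow> (real^3 \<Rightarrow> real^3) \<Rightarrow> real^3 \<Rightarrow> real^3" where
  "curl_eps M \<epsilon> u x = (\<Sum>i\<in>UNIV. cross3 (axis i 1) (grad_eps M \<epsilon> i u x))"

definition F_eps :: "(real^2) set \<Rightarrow> real \<Rightarrow> real \<Rightarrow> (real^3 \<Rightarrow> real^3) \<Rightarrow> real" where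
  "F_eps \<omega> \<kappa> \<epsilon> u =
     1/2 * (\<integral>x. (\<Sum>i\<in>UNIV. (norm (grad_eps (film \<omega>) \<epsilon> i u x))^2) \<partial>lebesgue_on (film \<omega>))
   + \<kappa> * (\<integral>x. curl_eps (film \<omega>) \<epsilon> u x \<bullet> u x \<partial>lebesgue_on (film \<omega>))
   + 1/2 * (\<integral>x. (norm (h_eps \<epsilon> (zero_ext (film \<omega>) u) x))^2 \<partial>lebesgue)"

definition grad2 :: "(real^2) set \<Rightarrow> 2 \<Rightarrow> (real^2 \<Rightarrow> real^3) \<Rightarrow> real^2 \<Rightarrow> real^3" where
  "grad2 \<omega> i v \<sigma> = (\<chi> j. wpd \<omega> (axis i 1) (\<lambda>y. v y $ j) \<sigma>)"

definition curl2 :: "(real^2) set \<Rightarrow> (real^2 \<Rightarrow> real^3) \<Rightarrow> real^2 \<Rightarrow> real^3" where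
  "curl2 \<omega> v \<sigma> = cross3 (axis 1 1) (grad2 \<omega> 1 v \<sigma>) + cross3 (axis 2 1) (grad2 \<omega> 2 v \<sigma>)"

definition F0_2d :: "(real^2) set \<Rightarrow> real \<Rightarrow> (real^2 \<Rightarrow> real^3) \<Rightarrow> real" where
  "F0_2d \<omega> \<kappa> v =
     1/2 * (\<integral>\<sigma>. (norm (grad2 \<omega> 1 v \<sigma>))^2 + (norm (grad2 \<omega> 2 v \<sigma>))^2 \<partial>lebesgue_on \<omega>)
   + \<kappa> * (\<integral>\<sigma>. curl2 \<omega> v \<sigma> \<bullet> v \<sigma> \<partial>lebesgue_on \<omega>)
   + (1 + \<kappa>^2) / 2 * (\<integral>\<sigma>. (v \<sigma> \<bullet> axis 3 1)^2 \<partial>lebesgue_on \<omega>)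
   - \<kappa>^2 / 2 * measure lebesgue \<omega>"

definition indep_s :: "(real^2) set \<Rightarrow> (real^3 \<Rightarrow> real^3) \<Rightarrow> (real^2 \<Rightarrow> real^3) \<Rightarrow> bool" where
  "indep_s \<omega> u v \<longleftrightarrow> (AE x in lebesgue_on (film \<omega>). u x = v (proj2 x))"

definition F_0 :: "(real^2) set \<Rightarrow> real \<Rightarrow> (real^3 \<Rightarrow> real^3) \<Rightarrow> ereal" where
  "F_0 \<omega> \<kappa> u = (if \<exists>v. indep_s \<omega> u v then ereal (F0_2d \<omega> \<kappa> (SOME v. indep_s \<omega> u v)) else \<infinity>)"

end

theory Submission
  imports Defs "HOL-Library.Diagonal_Subsequence"
begin

text \<open>
  The gradient and chiral terms combine into a square: \<open>F\<^sub>\<epsilon>\<close> contains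
  \<open>1/2 \<integral> |\<epsilon>\<^sup>-\<^sup>1 \<partial>\<^sub>s u + \<kappa> u \<times> e\<^sub>3|\<^sup>2\<close>, up to the zeroth-order term
  \<open>- \<kappa>\<^sup>2/2 \<integral> |u \<times> e\<^sub>3|\<^sup>2\<close>. Dropping this square gives the liminf inequality and the extra anisotropy of the
  limit, while rotating \<open>u\<close> about \<open>e\<^sub>3\<close> by the angle \<open>\<kappa> \<epsilon> s\<close> makes it vanish and gives recovery
  sequences. The remaining derivative terms are bounded by the energy, so that maps of bounded energy are bounded
  in \<open>H\<^sup>1\<close> with \<open>\<partial>\<^sub>s u\<close> tending to zero.

  Sobolev maps are identified with their graphs \<open>(u, \<nabla>u)\<close> in a Hilbert space of classes of square integrable
  functions on the whole space. Compactness in \<open>L\<^sup>2\<close> needs no boundary regularity: Rellich's theorem is applied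
  to cut-offs in the interior, and \<open>|u| = 1\<close> excludes concentration at the boundary.

  The stray field is, up to sign, the orthogonal projection of \<open>m\<close> onto the closure of the gradients. Its rescaling
  has norm bounded by that of \<open>m\<close>; a weak limit \<open>h\<close> satisfies \<open>\<partial>\<^sub>s h\<^sub>1 = \<partial>\<^sub>s h\<^sub>2 = 0\<close> and
  \<open>\<partial>\<^sub>s (h\<^sub>3 + m\<^sub>3) = 0\<close>, hence \<open>h = - m\<^sub>3 e\<^sub>3\<close> since a square integrable function invariant under
  translations in one direction vanishes.
\<close>

section \<open>Hilbert spaces\<close>

text \<open>Maps are raw functions, and \<open>wpd\<close>, \<open>stray_field\<close> and the
  planar profile in \<open>F_0\<close> are chosen by SOME. Every quantity must therefore first be
  seen to depend on almost-everywhere classes only; this is why the energies are rewritten as inner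
  products of classes before any limit is taken. The stray field equations are tested with smooth
  functions, while the energy identity uses the field itself as a test function. This is justified
  once curl-free square integrable fields are known to be limits of gradients, which is where
  Liouville's theorem enters. The chiral term is linear in the gradient, with u as bounded
  coefficient: Young's inequality absorbs it for coercivity, and strong convergence of u makes it
  weakly continuous. In the limit the in-plane squares are replaced by their tangents at the limit
  map. These affine minorants pass to weak limits and give the lower bound; twice the gap to the
  energy is the squared distance of the in-plane gradients plus the completed square, so convergence
  of the minimal energies yields strong convergence.\<close>

lemma subspace_closure:
  fixes S :: "'a::real_normed_vector set"
  assumes "subspace S" shows "subspace (closure S)"
  unfolding subspace_def
proof (intro conjI ballI allI)
  show "0 \<in> closure S" using assms closure_subset subspace_0 by blast
  fix x y assume xy: "x \<in> closure S" "y \<in> closure S"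
  from xy obtain f g where f: "\<And>n. f n \<in> S" "f \<longlonglongrightarrow> x" and g: "\<And>n. g n \<in> S" "g \<longlonglongrightarrow> y"
    by (auto simp: closure_sequential)
  have "(\<lambda>n. f n + g n) \<longlonglongrightarrow> x + y" using f g by (intro tendsto_intros)
  moreover have "\<And>n. f n + g n \<in> S" using f g assms subspace_add by blast
  ultimately show "x + y \<in> closure S" unfolding closure_sequential by (intro exI[of _ "\<lambda>n. f n + g n"]) blast
next
  fix c :: real and x assume x: "x \<in> closure S"
  from x obtain f where f: "\<And>n. f n \<in> S" "f \<longlonglongrightarrow> x" by (auto simp: closure_sequential)
  have "(\<lambda>n. c *\<^sub>R f n) \<longlonglongrightarrow> c *\<^sub>R x" using f by (intro tendsto_intros)
  moreover have "\<And>n. c *\<^sub>R f n \<in> S" using f assms subspace_scale by blast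
  ultimately show "c *\<^sub>R x \<in> closure S" unfolding closure_sequential by (intro exI[of _ "\<lambda>n. c *\<^sub>R f n"]) blast
qed

text \<open>A minimising sequence for the distance to \<open>S\<close> is Cauchy by the
  parallelogram law, because midpoints stay in the subspace; the first variation at its limit gives
  orthogonality.\<close>

lemma orthogonal_projection_exists:
  fixes S :: "'a::{real_inner,complete_space} set"
  assumes S: "subspace S" "closed S"
  shows "\<exists>p\<in>S. \<forall>s\<in>S. inner (x - p) s = 0"
proof -
  define d where "d = (INF s\<in>S. (norm (x - s))\<^sup>2)"
  have bdd: "bdd_below ((\<lambda>s. (norm (x - s))\<^sup>2) ` S)" by (rule bdd_belowI[of _ 0]) auto
  have ne: "S \<noteq> {}" using S subspace_0 by blast
  have dle: "d \<le> (norm (x - s))\<^sup>2" if "s \<in> S" for s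
    unfolding d_def by (rule cINF_lower[OF bdd that])
  have "\<exists>s\<in>S. (norm (x - s))\<^sup>2 < d + 1 / real (Suc n)" for n
  proof -
    have "Inf ((\<lambda>s. (norm (x - s))\<^sup>2) ` S) < d + 1 / real (Suc n)" unfolding d_def by simp
    from cInf_lessD[OF _ this] ne show ?thesis by auto
  qed
  then obtain f where fS: "\<And>n. f n \<in> S" and fd: "\<And>n. (norm (x - f n))\<^sup>2 < d + 1 / real (Suc n)" by metis
  have dist2: "(norm (f m - f n))\<^sup>2 \<le> 2 * (1 / real (Suc m) + 1 / real (Suc n))" for m n
  proof -
    have mid: "(1/2) *\<^sub>R (f m + f n) \<in> S" using S fS by (meson subspace_add subspace_scale)
    have "(norm (f m - f n))\<^sup>2 + 4 * (norm (x - (1/2) *\<^sub>R (f m + f n)))\<^sup>2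
        = 2 * (norm (x - f m))\<^sup>2 + 2 * (norm (x - f n))\<^sup>2"
      unfolding power2_norm_eq_inner by (simp add: inner_simps algebra_simps inner_commute)
    with dle[OF mid] fd[of m] fd[of n] show ?thesis by simp
  qed
  have "Cauchy f"
  proof (rule metric_CauchyI)
    fix e :: real assume "0 < e"
    obtain N where N: "1 / real (Suc N) < e\<^sup>2 / 4" using \<open>0 < e\<close> nat_approx_posE[of "e\<^sup>2/4"] by auto
    have "dist (f m) (f n) < e" if "N \<le> m" "N \<le> n" for m n
    proof -
      have "1 / real (Suc m) \<le> 1 / real (Suc N)" "1 / real (Suc n) \<le> 1 / real (Suc N)"
        using that by (auto simp: frac_le)
      then have "2 * (1 / real (Suc m) + 1 / real (Suc n)) \<le> 4 * (1 / real (Suc N))" by argo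
      also have "\<dots> < e\<^sup>2" using N by argo
      finally have "(norm (f m - f n))\<^sup>2 < e\<^sup>2" using dist2[of m n] by simp
      then show ?thesis using \<open>0 < e\<close> by (simp add: dist_norm power2_less_imp_less)
    qed
    then show "\<exists>M. \<forall>m\<ge>M. \<forall>n\<ge>M. dist (f m) (f n) < e" by blast
  qed
  then obtain p where p: "f \<longlonglongrightarrow> p" using Cauchy_convergent convergent_def by blast
  have pS: "p \<in> S" using S(2) fS p closed_sequentially by blast
  have "(\<lambda>n. (norm (x - f n))\<^sup>2) \<longlonglongrightarrow> (norm (x - p))\<^sup>2" using p by (intro tendsto_intros)
  moreover have "(\<lambda>n. d + 1 / real (Suc n)) \<longlonglongrightarrow> d + 0"
    by (intro tendsto_intros LIMSEQ_Suc lim_1_over_n)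
  ultimately have pd: "(norm (x - p))\<^sup>2 \<le> d" using fd
    by (metis (no_types, lifting) LIMSEQ_le add_0_right less_imp_le)
  have "inner (x - p) s = 0" if s: "s \<in> S" for s
  proof (cases "s = 0")
    case False
    \<comment> \<open>\<open>t\<close> minimises the squared distance from \<open>x\<close> along
      the line through \<open>p\<close> in direction \<open>s\<close>, so minimality of
      \<open>p\<close> forces \<open>t = 0\<close>.\<close>
    define t where "t = inner (x - p) s / (norm s)\<^sup>2"
    have "p + t *\<^sub>R s \<in> S" using S pS s by (meson subspace_add subspace_scale)
    from order_trans[OF pd dle[OF this]] have "(norm (x - p))\<^sup>2 \<le> (norm (x - p - t *\<^sub>R s))\<^sup>2"
      unfolding diff_diff_eq .
    also have "\<dots> = (norm (x - p))\<^sup>2 - 2 * t * inner (x - p) s + t\<^sup>2 * (norm s)\<^sup>2"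
      unfolding power2_norm_eq_inner by (simp add: inner_simps algebra_simps inner_commute power2_eq_square)
    finally have "2 * t * inner (x - p) s \<le> t\<^sup>2 * (norm s)\<^sup>2" by simp
    moreover have "t * (norm s)\<^sup>2 = inner (x - p) s" using False by (simp add: t_def)
    ultimately have "2 * t * (t * (norm s)\<^sup>2) \<le> t * (t * (norm s)\<^sup>2)" by (simp add: power2_eq_square mult_ac)
    then have "t * t * (norm s)\<^sup>2 \<le> 0" by (simp add: algebra_simps)
    then have "t = 0" using False by (smt (verit) mult_pos_pos not_real_square_gt_zero zero_less_norm_iff zero_less_power)
    then show ?thesis using False by (simp add: t_def)
  qed simp
  with pS show ?thesis by blast
qed

text \<open>Turns a density claim into a uniqueness claim: the error of the projection onto the
  closure of \<open>S\<close> lies in \<open>V\<close> and is orthogonal to \<open>S\<close>. It is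
  applied to test functions in L2 and to gradients among curl-free fields.\<close>

lemma orthogonal_subset_dense:
  fixes S V :: "'a::{real_inner,complete_space} set"
  assumes "subspace S" "S \<subseteq> V" "subspace V" "closed V"
    and orth: "\<And>x. x \<in> V \<Longrightarrow> (\<And>s. s \<in> S \<Longrightarrow> inner x s = 0) \<Longrightarrow> x = 0"
  shows "V \<subseteq> closure S"
proof
  fix x assume x: "x \<in> V"
  obtain p where p: "p \<in> closure S" "\<forall>s\<in>closure S. inner (x - p) s = 0"
    using orthogonal_projection_exists[OF subspace_closure[OF assms(1)] closed_closure] by blast
  have "closure S \<subseteq> V" using assms by (simp add: closure_minimal)
  then have "x - p \<in> V" using x p assms subspace_diff by blast
  moreover have "\<And>s. s \<in> S \<Longrightarrow> inner (x - p) s = 0" using p closure_subset by blast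
  ultimately have "x - p = 0" by (rule orth)
  then show "x \<in> closure S" using p by simp
qed

text \<open>The kernel has codimension one, so a single vector \<open>z\<close> orthogonal to it
  represents \<open>l\<close> after scaling.\<close>

lemma riesz_representation:
  fixes l :: "'a::{real_inner,complete_space} \<Rightarrow> real"
  assumes "bounded_linear l"
  shows "\<exists>x. \<forall>v. l v = inner x v"
proof (cases "\<forall>v. l v = 0")
  case True
  then show ?thesis by (intro exI[of _ 0]) simp
next
  case False
  interpret bounded_linear l by fact
  define S where "S = {v. l v = 0}"
  have "subspace S" unfolding S_def subspace_def by (auto simp: zero add scaleR)
  moreover have "closed S" unfolding S_def
    by (rule closed_Collect_eq) (auto intro!: continuous_intros linear_continuous_on assms)
  ultimately have P: "\<And>x. \<exists>p\<in>S. \<forall>s\<in>S. inner (x - p) s = 0" by (rule orthogonal_projection_exists)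
  from False obtain w where w: "l w \<noteq> 0" by blast
  from P[of w] obtain p where p: "p \<in> S" "\<forall>s\<in>S. inner (w - p) s = 0" by blast
  define z where "z = w - p"
  have lz: "l z \<noteq> 0" using w p by (simp add: z_def diff S_def)
  then have z0: "z \<noteq> 0" using zero by auto
  have "l v = inner ((l z / inner z z) *\<^sub>R z) v" for v
  proof -
    have "v - (l v / l z) *\<^sub>R z \<in> S" using lz by (simp add: S_def diff scaleR)
    then have "inner z (v - (l v / l z) *\<^sub>R z) = 0" using p z_def by blast
    then have "inner z v = l v / l z * inner z z" by (simp add: inner_simps)
    then show ?thesis using lz z0 by (simp add: field_simps)
  qed
  then show ?thesis by blast
qed

section \<open>Weak sequential convergence\<close>

definition weakly :: "(nat \<Rightarrow> 'a::real_inner) \<Rightarrow> 'a \<Rightarrow> bool" where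
  "weakly f x \<longleftrightarrow> (\<forall>v. (\<lambda>n. inner (f n) v) \<longlonglongrightarrow> inner x v)"

lemma weaklyD: "weakly f x \<Longrightarrow> (\<lambda>n. inner (f n) v) \<longlonglongrightarrow> inner x v"
  by (simp add: weakly_def)

text \<open>An epsilon/3 argument: the uniform bound makes the pairing with a nearby vector of the
  span a uniformly good substitute.\<close>

lemma inner_limit_on_closure_span:
  fixes f :: "nat \<Rightarrow> 'a::real_inner"
  assumes bd: "\<And>n. norm (f n) \<le> C"
    and conv: "\<And>w. w \<in> W \<Longrightarrow> convergent (\<lambda>n. inner (f n) w)"
    and v: "v \<in> closure (span W)"
  shows "convergent (\<lambda>n. inner (f n) v)"
proof -
  have sp: "convergent (\<lambda>n. inner (f n) w)" if "w \<in> span W" for w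
    using that
  proof (induction rule: span_induct_alt)
    case base then show ?case by (simp add: convergent_const)
  next
    case (step c x y)
    then show ?case using conv by (auto simp: inner_simps intro!: convergent_add convergent_mult convergent_const)
  qed
  have C: "0 \<le> C" using bd[of 0] norm_ge_zero order_trans by blast
  have "Cauchy (\<lambda>n. inner (f n) v)"
  proof (rule metric_CauchyI)
    fix e :: real assume e: "0 < e"
    \<comment> \<open>\<open>C + 1\<close> keeps the denominator positive when
      \<open>C = 0\<close>.\<close>
    define \<delta> where "\<delta> = e / (3 * (C + 1))"
    have \<delta>: "0 < \<delta>" using e C by (simp add: \<delta>_def)
    then obtain w where w: "w \<in> span W" "dist w v < \<delta>" using v closure_approachable by blast
    from sp[OF w(1)] have "Cauchy (\<lambda>n. inner (f n) w)" by (simp add: convergent_Cauchy)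
    then obtain M where M: "\<forall>m\<ge>M. \<forall>n\<ge>M. dist (inner (f m) w) (inner (f n) w) < e/3"
      using e metric_CauchyD[of _ "e/3"] by (metis divide_pos_pos zero_less_numeral)
    have close: "\<bar>inner (f n) v - inner (f n) w\<bar> \<le> e / 3" for n
    proof -
      have "\<bar>inner (f n) v - inner (f n) w\<bar> = \<bar>inner (f n) (v - w)\<bar>" by (simp add: inner_simps)
      also have "\<dots> \<le> norm (f n) * norm (v - w)" by (rule Cauchy_Schwarz_ineq2)
      also have "\<dots> \<le> (C + 1) * \<delta>"
        using bd[of n] w(2) C \<delta> by (intro mult_mono) (auto simp: dist_norm norm_minus_commute)
      also have "\<dots> = (C + 1) / (C + 1) * (e / 3)" unfolding \<delta>_def times_divide_times_eq by (simp add: mult_ac)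
      also have "\<dots> = e / 3" using C by simp
      finally show ?thesis .
    qed
    have "dist (inner (f m) v) (inner (f n) v) < e" if "m \<ge> M" "n \<ge> M" for m n
    proof -
      have "\<bar>inner (f m) w - inner (f n) w\<bar> < e / 3" using M that unfolding dist_real_def by blast
      with close[of m] close[of n] show ?thesis unfolding dist_real_def by linarith
    qed
    then show "\<exists>M. \<forall>m\<ge>M. \<forall>n\<ge>M. dist (inner (f m) v) (inner (f n) v) < e" by blast
  qed
  then show ?thesis by (rule Cauchy_convergent)
qed

text \<open>The closed span of the sequence takes over the role of a separable space: a diagonal
  subsequence makes all pairings with the members \<open>f k\<close> converge, and vectors
  orthogonal to the span pair to zero. Riesz supplies the limit.\<close>

lemma weakly_compact:
  fixes f :: "nat \<Rightarrow> 'a::{real_inner,complete_space}"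
  assumes bd: "\<And>n. norm (f n) \<le> C"
  shows "\<exists>r x. strict_mono (r :: nat \<Rightarrow> nat) \<and> weakly (f \<circ> r) x"
proof -
  let ?P = "\<lambda>k s. convergent (\<lambda>n. inner (f (s n)) (f k))"
  interpret subseqs ?P
  proof
    fix k and s :: "nat \<Rightarrow> nat" assume "strict_mono s"
    have "bounded (range (\<lambda>n. inner (f (s n)) (f k)))"
    proof (rule boundedI)
      fix y assume "y \<in> range (\<lambda>n. inner (f (s n)) (f k))"
      then obtain n where "y = inner (f (s n)) (f k)" by blast
      then show "norm y \<le> C * C"
        using Cauchy_Schwarz_ineq2[of "f (s n)" "f k"] bd[of "s n"] bd[of k]
        by (smt (verit) mult_mono norm_ge_zero real_norm_def)
    qed
    then obtain l r where "strict_mono (r :: nat \<Rightarrow> nat)" "((\<lambda>n. inner (f (s n)) (f k)) \<circ> r) \<longlonglongrightarrow> l"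
      using bounded_imp_convergent_subsequence by blast
    then show "\<exists>r. strict_mono r \<and> ?P k (s \<circ> r)" by (auto simp: o_def convergent_def)
  qed
  have conv: "convergent (\<lambda>n. inner (f (diagseq n)) (f k))" for k
  proof -
    \<comment> \<open>From index \<open>Suc k\<close> on, the diagonal sequence is a subsequence of
      the one extracted for \<open>f k\<close>.\<close>
    have "?P k (diagseq \<circ> (+) (Suc k))"
    proof (rule diagseq_holds)
      fix n and r s :: "nat \<Rightarrow> nat" assume "strict_mono r" and P: "?P n s"
      show "?P n (s \<circ> r)" using P LIMSEQ_subseq_LIMSEQ[OF _ \<open>strict_mono r\<close>]
        by (fastforce simp: convergent_def o_def)
    qed
    then have "convergent (\<lambda>n. inner (f (diagseq (n + Suc k))) (f k))" by (simp add: o_def add.commute)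
    then show ?thesis using convergent_ignore_initial_segment[of "\<lambda>n. inner (f (diagseq n)) (f k)" "Suc k"] by simp
  qed
  define g where "g = f \<circ> diagseq"
  define S where "S = closure (span (range f))"
  have gb: "norm (g n) \<le> C" for n using bd by (simp add: g_def)
  have convS: "convergent (\<lambda>n. inner (g n) v)" if "v \<in> S" for v
    by (rule inner_limit_on_closure_span[where W="range f"]) (use gb conv that in \<open>auto simp: S_def g_def\<close>)
  have conv_all: "convergent (\<lambda>n. inner (g n) v)" for v
  proof -
    obtain p where p: "p \<in> S" "\<forall>s\<in>S. inner (v - p) s = 0"
      unfolding S_def using orthogonal_projection_exists[OF subspace_closure[OF subspace_span] closed_closure] by blast
    have "g n \<in> S" for n unfolding S_def g_def
      using closure_subset span_superset by (metis comp_apply rangeI subsetD)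
    then have "inner (g n) v = inner (g n) p" for n
      using p(2) by (metis eq_iff_diff_eq_0 inner_commute inner_diff_left)
    then show ?thesis using convS[OF p(1)] by simp
  qed
  define l where "l v = lim (\<lambda>n. inner (g n) v)" for v
  have l: "(\<lambda>n. inner (g n) v) \<longlonglongrightarrow> l v" for v
    using conv_all[of v] by (simp add: l_def convergent_LIMSEQ_iff)
  have "bounded_linear l"
  proof (rule bounded_linear_intro[where K=C])
    fix x y show "l (x + y) = l x + l y"
      using LIMSEQ_unique[OF l[of "x + y"]] tendsto_add[OF l[of x] l[of y]] by (simp add: inner_simps)
  next
    fix c x show "l (c *\<^sub>R x) = c *\<^sub>R l x"
      using LIMSEQ_unique[OF l[of "c *\<^sub>R x"]] tendsto_mult[OF tendsto_const l[of x], of c] by (simp add: inner_simps)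
  next
    fix x
    have "\<bar>inner (g n) x\<bar> \<le> norm x * C" for n
      using Cauchy_Schwarz_ineq2[of "g n" x] gb[of n] by (smt (verit) mult.commute mult_right_mono norm_ge_zero)
    then show "norm (l x) \<le> norm x * C"
      using tendsto_rabs[OF l[of x]] by (simp add: LIMSEQ_le_const2)
  qed
  then obtain x where "\<And>v. l v = inner x v" using riesz_representation by blast
  then have "weakly g x" using l by (simp add: weakly_def)
  then show ?thesis using subseq_diagseq unfolding g_def by blast
qed

text \<open>Test the weak convergence with the limit \<open>x\<close> itself.\<close>

lemma weakly_norm_le_bound:
  fixes x :: "'a::real_inner"
  assumes w: "weakly f x" and bd: "\<And>n. norm (f n) \<le> C"
  shows "norm x \<le> C"
proof -
  have "inner x x \<le> C * norm x"
  proof (rule LIMSEQ_le_const2[OF weaklyD[OF w]], intro exI allI impI)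
    fix n show "inner (f n) x \<le> C * norm x"
      using norm_cauchy_schwarz[of "f n" x] bd[of n] by (smt (verit) mult_right_mono norm_ge_zero)
  qed
  moreover have "0 \<le> C" using bd[of 0] norm_ge_zero order_trans by blast
  ultimately show ?thesis by (cases "x = 0") (auto simp: dot_square_norm power2_eq_square)
qed

text \<open>The Radon-Riesz property: in the expansion of the squared norm of \<open>f n - x\<close>
  every term converges.\<close>

lemma weakly_strongly:
  fixes x :: "'a::real_inner"
  assumes w: "weakly f x" and bd: "(\<lambda>n. (norm (f n))\<^sup>2) \<longlonglongrightarrow> (norm x)\<^sup>2"
  shows "f \<longlonglongrightarrow> x"
proof -
  have "(\<lambda>n. (norm (f n))\<^sup>2 - 2 * inner (f n) x + (norm x)\<^sup>2) \<longlonglongrightarrow> (norm x)\<^sup>2 - 2 * inner x x + (norm x)\<^sup>2"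
    by (intro tendsto_add tendsto_diff tendsto_mult tendsto_const weaklyD[OF w] bd)
  moreover have "(norm (f n))\<^sup>2 - 2 * inner (f n) x + (norm x)\<^sup>2 = (norm (f n - x))\<^sup>2" for n
    by (simp add: power2_norm_eq_inner inner_simps inner_commute)
  ultimately have "(\<lambda>n. (norm (f n - x))\<^sup>2) \<longlonglongrightarrow> 0" by (simp add: power2_norm_eq_inner)
  then have "(\<lambda>n. norm (f n - x)) \<longlonglongrightarrow> 0"
    using tendsto_real_sqrt by fastforce
  then show ?thesis by (simp add: LIM_zero_iff tendsto_norm_zero_iff)
qed

text \<open>Lets products of a weakly convergent derivative and a strongly convergent map pass to
  the limit; it serves both the chiral term and the stray field energy.\<close>

lemma weakly_strongly_inner:
  fixes x :: "'a::real_inner"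
  assumes w: "weakly f x" and bd: "\<And>n. norm (f n) \<le> C" and g: "g \<longlonglongrightarrow> y"
  shows "(\<lambda>n. inner (f n) (g n)) \<longlonglongrightarrow> inner x y"
proof -
  have "(\<lambda>n. inner (f n) (g n - y)) \<longlonglongrightarrow> 0"
  proof (rule Lim_null_comparison)
    have "norm (inner (f n) (g n - y)) \<le> C * norm (g n - y)" for n
      using Cauchy_Schwarz_ineq2[of "f n" "g n - y"] mult_right_mono[OF bd[of n] norm_ge_zero[of "g n - y"]] by simp
    then show "\<forall>\<^sub>F n in sequentially. norm (inner (f n) (g n - y)) \<le> C * norm (g n - y)" by simp
    have "(\<lambda>n. C * norm (g n - y)) \<longlonglongrightarrow> C * norm (y - y)" using g by (intro tendsto_intros)
    then show "(\<lambda>n. C * norm (g n - y)) \<longlonglongrightarrow> 0" by simp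
  qed
  from tendsto_add[OF this weaklyD[OF w, of y]] show ?thesis by (simp add: inner_simps)
qed

lemma strongly_weakly: "f \<longlonglongrightarrow> x \<Longrightarrow> weakly f x"
  unfolding weakly_def by (auto intro!: tendsto_intros)

lemma weakly_fst: "weakly f (x :: 'a::real_inner \<times> 'b::real_inner) \<Longrightarrow> weakly (\<lambda>n. fst (f n)) (fst x)"
  unfolding weakly_def
proof
  fix v assume "\<forall>v. (\<lambda>n. inner (f n) v) \<longlonglongrightarrow> inner x v"
  then have "(\<lambda>n. inner (f n) (v, 0)) \<longlonglongrightarrow> inner x (v, 0)" by blast
  then show "(\<lambda>n. inner (fst (f n)) v) \<longlonglongrightarrow> inner (fst x) v" by (simp add: inner_prod_def)
qed

lemma weakly_snd: "weakly f (x :: 'a::real_inner \<times> 'b::real_inner) \<Longrightarrow> weakly (\<lambda>n. snd (f n)) (snd x)"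
  unfolding weakly_def
proof
  fix v assume "\<forall>v. (\<lambda>n. inner (f n) v) \<longlonglongrightarrow> inner x v"
  then have "(\<lambda>n. inner (f n) (0, v)) \<longlonglongrightarrow> inner x (0, v)" by blast
  then show "(\<lambda>n. inner (snd (f n)) v) \<longlonglongrightarrow> inner (snd x) v" by (simp add: inner_prod_def)
qed

lemma inner_vec_axis: "inner (x :: 'a::real_inner^'n::finite) (axis i v) = inner (x $ i) v"
proof -
  have "inner x (axis i v) = (\<Sum>j\<in>UNIV. if j = i then inner (x $ i) v else 0)"
    unfolding inner_vec_def axis_def by (intro sum.cong) auto
  then show ?thesis by simp
qed

lemma weakly_nth: "weakly f (x :: 'a::real_inner^'n::finite) \<Longrightarrow> weakly (\<lambda>n. f n $ i) (x $ i)"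
  unfolding weakly_def by (metis (no_types, lifting) ext inner_vec_axis)

lemma weakly_unique: "weakly f x \<Longrightarrow> weakly f y \<Longrightarrow> x = y"
  using LIMSEQ_unique unfolding weakly_def
  by (metis inner_diff_left inner_eq_zero_iff right_minus_eq)

section \<open>The space of square integrable functions\<close>

text \<open>Borel functions on all of space, so that translations and Fubini apply directly.
  Functions given on a set enter by zero extension and a Borel representative.\<close>

definition sqi :: "('a::euclidean_space \<Rightarrow> real) \<Rightarrow> bool" where
  "sqi f \<longleftrightarrow> f \<in> borel_measurable borel \<and> integrable lborel (\<lambda>x. (f x)\<^sup>2)"

lemma sqi_measurable [measurable_dest]: "sqi f \<Longrightarrow> f \<in> borel_measurable borel"
  by (simp add: sqi_def)

lemma sqi_square: "sqi f \<Longrightarrow> integrable lborel (\<lambda>x. (f x)\<^sup>2)"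
  by (simp add: sqi_def)

lemma square_integrable_mult:
  fixes f g :: "'a \<Rightarrow> real"
  assumes "f \<in> borel_measurable M" "g \<in> borel_measurable M"
    "integrable M (\<lambda>x. (f x)\<^sup>2)" "integrable M (\<lambda>x. (g x)\<^sup>2)"
  shows "integrable M (\<lambda>x. f x * g x)"
proof (rule Bochner_Integration.integrable_bound)
  show "integrable M (\<lambda>x. (f x)\<^sup>2 + (g x)\<^sup>2)" using assms by simp
  show "(\<lambda>x. f x * g x) \<in> borel_measurable M" using assms by simp
  show "AE x in M. norm (f x * g x) \<le> norm ((f x)\<^sup>2 + (g x)\<^sup>2)"
  proof (rule AE_I2)
    fix x show "norm (f x * g x) \<le> norm ((f x)\<^sup>2 + (g x)\<^sup>2)"
    proof -
      have "0 \<le> \<bar>f x\<bar> * \<bar>g x\<bar>" by simp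
      moreover have "2 * \<bar>f x\<bar> * \<bar>g x\<bar> \<le> (f x)\<^sup>2 + (g x)\<^sup>2"
        using sum_squares_bound[of "\<bar>f x\<bar>" "\<bar>g x\<bar>"] by simp
      ultimately have "\<bar>f x\<bar> * \<bar>g x\<bar> \<le> (f x)\<^sup>2 + (g x)\<^sup>2" by linarith
      then show ?thesis by (simp add: abs_mult)
    qed
  qed
qed

lemma square_integrable_add:
  fixes f g :: "'a \<Rightarrow> real"
  assumes "f \<in> borel_measurable M" "g \<in> borel_measurable M"
    "integrable M (\<lambda>x. (f x)\<^sup>2)" "integrable M (\<lambda>x. (g x)\<^sup>2)"
  shows "integrable M (\<lambda>x. (f x + g x)\<^sup>2)"
  using square_integrable_mult[OF assms] assms by (simp add: power2_sum mult.assoc)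

lemma sqi_mult: "sqi f \<Longrightarrow> sqi g \<Longrightarrow> integrable lborel (\<lambda>x. f x * g x)"
  unfolding sqi_def by (intro square_integrable_mult) auto

lemma sqi_add: "sqi f \<Longrightarrow> sqi g \<Longrightarrow> sqi (\<lambda>x. f x + g x)"
  using square_integrable_add[of f lborel g] unfolding sqi_def by (auto intro: borel_measurable_add)

lemma sqi_scale: "sqi f \<Longrightarrow> sqi (\<lambda>x. c * f x)"
  unfolding sqi_def by (auto simp: power_mult_distrib intro: borel_measurable_times)

lemma sqi_zero: "sqi (\<lambda>x. 0)"
  by (simp add: sqi_def)

quotient_type (overloaded) 'a l2 = "'a::euclidean_space \<Rightarrow> real" / partial: "\<lambda>f g. sqi f \<and> sqi g \<and> (AE x in lborel. f x = g x)"
proof (rule part_equivpI)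
  show "\<exists>x::'a \<Rightarrow> real. sqi x \<and> sqi x \<and> (AE xa in lborel. x xa = x xa)"
    by (rule exI[of _ "\<lambda>x. 0"]) (simp add: sqi_zero)
  show "symp (\<lambda>f g::'a \<Rightarrow> real. sqi f \<and> sqi g \<and> (AE x in lborel. f x = g x))"
    by (rule sympI) auto
  show "transp (\<lambda>f g::'a \<Rightarrow> real. sqi f \<and> sqi g \<and> (AE x in lborel. f x = g x))"
    by (rule transpI) auto
qed

instantiation l2 :: (euclidean_space) "{zero, plus, uminus, minus, scaleR}"
begin

lift_definition zero_l2 :: "'a l2" is "\<lambda>x. 0" by (simp add: sqi_zero)
lift_definition plus_l2 :: "'a l2 \<Rightarrow> 'a l2 \<Rightarrow> 'a l2" is "\<lambda>f g x. f x + g x"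
  by (auto intro: sqi_add)
lift_definition uminus_l2 :: "'a l2 \<Rightarrow> 'a l2" is "\<lambda>f x. - f x"
  using sqi_scale[of _ "-1"] by auto
lift_definition minus_l2 :: "'a l2 \<Rightarrow> 'a l2 \<Rightarrow> 'a l2" is "\<lambda>f g x. f x - g x"
  using sqi_add[OF _ sqi_scale[of _ "-1"]] by auto
lift_definition scaleR_l2 :: "real \<Rightarrow> 'a l2 \<Rightarrow> 'a l2" is "\<lambda>c f x. c * f x"
  by (auto intro: sqi_scale)
instance ..

end

instantiation l2 :: (euclidean_space) real_vector
begin

instance
proof
  fix x y z :: "'a l2" and r s :: real
  show "x + y + z = x + (y + z)" by transfer (auto simp: add.assoc intro: sqi_add)
  show "x + y = y + x" by transfer (auto simp: add.commute intro: sqi_add)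
  show "0 + x = x" by transfer auto
  show "- x + x = 0" by transfer (auto simp: sqi_zero)
  show "x - y = x + - y" by transfer (use sqi_add[OF _ sqi_scale[of _ "-1"]] in auto)
  show "r *\<^sub>R (x + y) = r *\<^sub>R x + r *\<^sub>R y" by transfer (auto simp: distrib_left intro!: sqi_add sqi_scale)
  show "(r + s) *\<^sub>R x = r *\<^sub>R x + s *\<^sub>R x" by transfer (auto simp: distrib_right intro!: sqi_add sqi_scale)
  show "r *\<^sub>R s *\<^sub>R x = (r * s) *\<^sub>R x" by transfer (auto simp: mult.assoc intro!: sqi_scale)
  show "1 *\<^sub>R x = x" by transfer auto
qed

end

instantiation l2 :: (euclidean_space) real_inner
begin

lift_definition inner_l2 :: "'a l2 \<Rightarrow> 'a l2 \<Rightarrow> real" is "\<lambda>f g. \<integral>x. f x * g x \<partial>lborel"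
  by (rule integral_cong_AE) (auto intro: sqi_measurable)
definition norm_l2 :: "'a l2 \<Rightarrow> real" where "norm_l2 x = sqrt (inner x x)"
definition dist_l2 :: "'a l2 \<Rightarrow> 'a l2 \<Rightarrow> real" where "dist_l2 x y = norm (x - y)"
definition sgn_l2 :: "'a l2 \<Rightarrow> 'a l2" where "sgn_l2 x = inverse (norm x) *\<^sub>R x"
definition uniformity_l2 :: "('a l2 \<times> 'a l2) filter" where
  "uniformity_l2 = (INF e\<in>{0 <..}. principal {(x, y). dist x y < e})"
definition open_l2 :: "'a l2 set \<Rightarrow> bool" where
  "open_l2 U = (\<forall>x\<in>U. eventually (\<lambda>(x', y). x' = x \<longrightarrow> y \<in> U) uniformity)"

instance
proof
  fix x y z :: "'a l2" and r s :: real and U :: "'a l2 set"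
  show "dist x y = norm (x - y)" by (rule dist_l2_def)
  show "sgn x = x /\<^sub>R norm x" by (rule sgn_l2_def)
  show "uniformity = (INF e\<in>{0 <..}. principal {(x :: 'a l2, y). dist x y < e})" by (rule uniformity_l2_def)
  show "open U \<longleftrightarrow> (\<forall>x\<in>U. \<forall>\<^sub>F (x', y) in uniformity. x' = x \<longrightarrow> y \<in> U)" by (rule open_l2_def)
  show "norm x = sqrt (inner x x)" by (rule norm_l2_def)
  show "inner x y = inner y x" by transfer (simp add: mult.commute)
  show "inner (x + y) z = inner x z + inner y z"
    by transfer (simp add: distrib_right Bochner_Integration.integral_add sqi_mult)
  show "inner (r *\<^sub>R x) y = r * inner x y" by transfer (simp add: mult.assoc)
  show "0 \<le> inner x x" by transfer simp
  show "(inner x x = 0) = (x = 0)"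
  proof transfer
    fix f :: "'a \<Rightarrow> real" assume "sqi f \<and> sqi f \<and> (AE x in lborel. f x = f x)"
    then have f: "sqi f" by simp
    have "(\<integral>x. f x * f x \<partial>lborel) = 0 \<longleftrightarrow> (AE x in lborel. f x * f x = 0)"
      by (rule integral_nonneg_eq_0_iff_AE) (use f sqi_mult in auto)
    then show "((\<integral>x. f x * f x \<partial>lborel) = 0) = (sqi f \<and> sqi (\<lambda>x. 0 :: real) \<and> (AE x in lborel. f x = 0))"
      using f by (auto simp: sqi_zero)
  qed
qed

end

text \<open>\<open>fn\<close> is the representative picked by the quotient, so algebraic identities
  for it hold only almost everywhere.\<close>

definition fn :: "'a::euclidean_space l2 \<Rightarrow> 'a \<Rightarrow> real" where "fn = rep_l2"
definition cls :: "('a::euclidean_space \<Rightarrow> real) \<Rightarrow> 'a l2" where "cls = abs_l2"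

lemma sqi_fn: "sqi (fn F)"
  unfolding fn_def using Quotient3_rep_reflp[OF Quotient3_l2] by blast

lemma cls_fn [simp]: "cls (fn F) = F"
  unfolding cls_def fn_def by (rule Quotient3_abs_rep[OF Quotient3_l2])

lemma fn_measurable [measurable]: "fn F \<in> borel_measurable borel"
  using sqi_fn sqi_def by blast

lemma fn_cls: "sqi f \<Longrightarrow> AE x in lborel. fn (cls f) x = f x"
  using Quotient3_rep_abs[OF Quotient3_l2, of f] by (simp add: fn_def cls_def)

lemma cls_eq_iff: "sqi f \<Longrightarrow> sqi g \<Longrightarrow> cls f = cls g \<longleftrightarrow> (AE x in lborel. f x = g x)"
  unfolding cls_def using Quotient3_rel[OF Quotient3_l2, of f g] by auto

lemma l2_eq_iff: "F = G \<longleftrightarrow> (AE x in lborel. fn F x = fn G x)"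
  using cls_eq_iff[OF sqi_fn sqi_fn, of F G] by simp

lemma inner_cls: "sqi f \<Longrightarrow> sqi g \<Longrightarrow> inner (cls f) (cls g) = (\<integral>x. f x * g x \<partial>lborel)"
  unfolding cls_def by (rule inner_l2.abs_eq) auto

lemma inner_fn: "inner F G = (\<integral>x. fn F x * fn G x \<partial>lborel)"
  using inner_cls[OF sqi_fn sqi_fn, of F G] by simp

lemma cls_add: "sqi f \<Longrightarrow> sqi g \<Longrightarrow> cls f + cls g = cls (\<lambda>x. f x + g x)"
  unfolding cls_def by (rule plus_l2.abs_eq) auto
lemma cls_diff: "sqi f \<Longrightarrow> sqi g \<Longrightarrow> cls f - cls g = cls (\<lambda>x. f x - g x)"
  unfolding cls_def by (rule minus_l2.abs_eq) auto
lemma cls_scale: "sqi f \<Longrightarrow> c *\<^sub>R cls f = cls (\<lambda>x. c * f x)"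
  unfolding cls_def by (rule scaleR_l2.abs_eq) auto
lemma cls_zero: "0 = cls (\<lambda>x. 0)"
  unfolding cls_def zero_l2_def by simp

lemma sqi_diff: "sqi f \<Longrightarrow> sqi g \<Longrightarrow> sqi (\<lambda>x. f x - g x)"
  using sqi_add[OF _ sqi_scale[of _ "-1"]] by auto

lemma norm_cls: "sqi f \<Longrightarrow> (norm (cls f))\<^sup>2 = (\<integral>x. (f x)\<^sup>2 \<partial>lborel)"
  unfolding power2_norm_eq_inner by (simp add: inner_cls power2_eq_square)

lemma AE_cls_I: "sqi f \<Longrightarrow> AE x in lborel. fn F x = f x \<Longrightarrow> F = cls f"
  using cls_eq_iff[OF sqi_fn, of f F] by simp

lemma norm_cls_nn: "sqi f \<Longrightarrow> ennreal ((norm (cls f))\<^sup>2) = (\<integral>\<^sup>+x. ennreal ((f x)\<^sup>2) \<partial>lborel)"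
  unfolding norm_cls by (rule nn_integral_eq_integral[symmetric]) (auto simp: sqi_square)

lemma tendsto_nn_norm:
  assumes "\<And>n. sqi (f n)" "sqi g"
    "(\<lambda>n. \<integral>x. (f n x - g x)\<^sup>2 \<partial>lborel) \<longlonglongrightarrow> 0"
  shows "(\<lambda>n. cls (f n)) \<longlonglongrightarrow> cls g"
proof -
  have "(\<lambda>n. (norm (cls (f n) - cls g))\<^sup>2) \<longlonglongrightarrow> 0"
    using assms by (simp add: cls_diff norm_cls sqi_diff)
  then have "(\<lambda>n. norm (cls (f n) - cls g)) \<longlonglongrightarrow> 0" using tendsto_real_sqrt by fastforce
  then show ?thesis by (simp add: LIM_zero_iff tendsto_norm_zero_iff)
qed

text \<open>The Riesz--Fischer argument: a subsequence with summable increments converges a.e., and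
  Fatou's lemma upgrades this to convergence in norm.\<close>

lemma fast_cauchy_converges:
  fixes F :: "nat \<Rightarrow> 'a::euclidean_space l2"
  assumes fast: "\<And>n. norm (F (Suc n) - F n) \<le> (1/2)^n" and C: "Cauchy F"
  shows "\<exists>G. F \<longlonglongrightarrow> G"
proof -
  define f where "f n = fn (F n)" for n
  have sf [simp]: "sqi (f n)" for n by (simp add: f_def sqi_fn)
  note sqi_measurable[OF sf, measurable]
  have Fc: "F n = cls (f n)" for n by (simp add: f_def)
  define a where "a n x = \<bar>f (Suc n) x - f n x\<bar>" for n x
  have sa: "sqi (a n)" for n
    using sqi_diff[OF sf[of "Suc n"] sf[of n]] unfolding sqi_def a_def by auto
  note sqi_measurable[OF sa, measurable]
  have na: "norm (cls (a n)) \<le> (1/2)^n" for n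
  proof -
    have "(norm (cls (a n)))\<^sup>2 = (norm (F (Suc n) - F n))\<^sup>2"
      unfolding Fc by (simp add: cls_diff norm_cls sa sqi_diff) (simp add: a_def)
    then show ?thesis using fast[of n] by simp
  qed
  \<comment> \<open>Partial sums of the absolute increments. Their norms stay below the geometric
    sum 2, hence the bound 4 on the integrated squares.\<close>
  define b where "b n x = (\<Sum>k<n. a k x)" for n x
  have b0: "0 \<le> b n x" for n x by (simp add: b_def a_def sum_nonneg)
  have bS: "b (Suc n) = (\<lambda>x. b n x + a n x)" for n by (auto simp: b_def)
  have sb: "sqi (b n)" for n
    by (induction n) (use sqi_zero sqi_add sa in \<open>auto simp: bS\<close>, simp add: b_def sqi_zero)
  note sqi_measurable[OF sb, measurable]
  have nb: "norm (cls (b n)) \<le> (\<Sum>k<n. (1/2)^k)" for n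
  proof (induction n)
    case 0
    have "b 0 = (\<lambda>x. 0)" by (simp add: b_def fun_eq_iff)
    then have "cls (b 0) = 0" by (simp add: cls_zero)
    then show ?case by simp
  next
    case (Suc n)
    have "cls (b (Suc n)) = cls (b n) + cls (a n)" by (simp add: bS cls_add sa sb)
    then show ?case using Suc na[of n] norm_triangle_ineq[of "cls (b n)" "cls (a n)"] by simp
  qed
  have nb2: "norm (cls (b n)) \<le> 2" for n
  proof -
    have "(\<Sum>k<n. (1/2)^k) \<le> (\<Sum>k. (1/2::real)^k)" by (rule sum_le_suminf) auto
    then show ?thesis using nb[of n] suminf_geometric[of "1/2::real"] by simp
  qed
  have "(\<integral>\<^sup>+x. (SUP n. ennreal ((b n x)\<^sup>2)) \<partial>lborel) = (SUP n. \<integral>\<^sup>+x. ennreal ((b n x)\<^sup>2) \<partial>lborel)"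
  proof (rule nn_integral_monotone_convergence_SUP)
    show "incseq (\<lambda>n x. ennreal ((b n x)\<^sup>2))"
      using b0 by (intro incseq_SucI le_funI ennreal_leI power_mono) (auto simp: bS a_def)
  qed auto
  also have "\<dots> \<le> ennreal 4"
  proof (rule SUP_least)
    fix n
    have "(norm (cls (b n)))\<^sup>2 \<le> 2\<^sup>2" using nb2[of n] by (intro power_mono) auto
    then show "(\<integral>\<^sup>+x. ennreal ((b n x)\<^sup>2) \<partial>lborel) \<le> ennreal 4"
      unfolding norm_cls_nn[OF sb, symmetric] by (intro ennreal_leI) simp
  qed
  finally have fin: "(\<integral>\<^sup>+x. (SUP n. ennreal ((b n x)\<^sup>2)) \<partial>lborel) < \<infinity>"
    by (simp add: le_less_trans)
  have "AE x in lborel. (SUP n. ennreal ((b n x)\<^sup>2)) \<noteq> \<infinity>"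
    by (rule nn_integral_PInf_AE) (use fin in auto)
  then have conv: "AE x in lborel. convergent (\<lambda>n. f n x)"
  proof eventually_elim
    fix x assume "(SUP n. ennreal ((b n x)\<^sup>2)) \<noteq> \<infinity>"
    then obtain c where c: "(SUP n. ennreal ((b n x)\<^sup>2)) = ennreal c" "0 \<le> c"
      by (metis ennreal_cases infinity_ennreal_def)
    have "b n x \<le> sqrt c" for n
    proof -
      have "ennreal ((b n x)\<^sup>2) \<le> ennreal c" unfolding c(1)[symmetric] by (rule SUP_upper) simp
      then show ?thesis using c(2) b0[of n x] by (simp add: real_le_rsqrt)
    qed
    then have "summable (\<lambda>k. a k x)"
      by (intro summableI_nonneg_bounded[where x="sqrt c"]) (auto simp: b_def a_def)
    then have "summable (\<lambda>k. f (Suc k) x - f k x)"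
      unfolding a_def by (rule summable_rabs_cancel)
    then have "convergent (\<lambda>n. \<Sum>k<n. f (Suc k) x - f k x)" by (simp add: summable_iff_convergent)
    then have "convergent (\<lambda>n. f n x - f 0 x)" using sum_lessThan_telescope[of "\<lambda>n. f n x"] by simp
    then show "convergent (\<lambda>n. f n x)" by (simp add: convergent_diff_const_right_iff)
  qed
  \<comment> \<open>The Cauchy condition is measurable in \<open>x\<close>, so the default 0 off the
    convergence set keeps \<open>g\<close> Borel.\<close>
  define g where "g x = (if Cauchy (\<lambda>n. f n x) then lim (\<lambda>n. f n x) else 0)" for x
  have gm [measurable]: "g \<in> borel_measurable borel"
    unfolding g_def by measurable
  have lim: "AE x in lborel. (\<lambda>n. f n x) \<longlonglongrightarrow> g x"
    using conv by eventually_elim (simp add: g_def convergent_LIMSEQ_iff Cauchy_convergent_iff)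
  have fatou: "(\<integral>\<^sup>+x. ennreal ((g x - f n x)\<^sup>2) \<partial>lborel) \<le> ennreal (e\<^sup>2)"
    if e: "\<And>m. m \<ge> n \<Longrightarrow> norm (F m - F n) \<le> e" for n e
  proof -
    have "(\<integral>\<^sup>+x. ennreal ((g x - f n x)\<^sup>2) \<partial>lborel)
       \<le> (\<integral>\<^sup>+x. liminf (\<lambda>m. ennreal ((f m x - f n x)\<^sup>2)) \<partial>lborel)"
    proof (rule nn_integral_mono_AE)
      show "AE x in lborel. ennreal ((g x - f n x)\<^sup>2) \<le> liminf (\<lambda>m. ennreal ((f m x - f n x)\<^sup>2))"
        using lim
      proof eventually_elim
        fix x assume "(\<lambda>n. f n x) \<longlonglongrightarrow> g x"
        then have "(\<lambda>m. ennreal ((f m x - f n x)\<^sup>2)) \<longlonglongrightarrow> ennreal ((g x - f n x)\<^sup>2)"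
          by (intro tendsto_ennrealI tendsto_intros)
        then show "ennreal ((g x - f n x)\<^sup>2) \<le> liminf (\<lambda>m. ennreal ((f m x - f n x)\<^sup>2))"
          by (metis lim_imp_Liminf order_refl sequentially_bot)
      qed
    qed
    also have "\<dots> \<le> liminf (\<lambda>m. \<integral>\<^sup>+x. ennreal ((f m x - f n x)\<^sup>2) \<partial>lborel)"
      by (rule nn_integral_liminf) auto
    also have "\<dots> \<le> ennreal (e\<^sup>2)"
    proof (rule Liminf_le)
      show "\<forall>\<^sub>F m in sequentially. (\<integral>\<^sup>+x. ennreal ((f m x - f n x)\<^sup>2) \<partial>lborel) \<le> ennreal (e\<^sup>2)"
        unfolding eventually_sequentially
      proof (intro exI allI impI)
        fix m assume "n \<le> m"
        then have "(norm (F m - F n))\<^sup>2 \<le> e\<^sup>2" using e by (simp add: power_mono)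
        then show "(\<integral>\<^sup>+x. ennreal ((f m x - f n x)\<^sup>2) \<partial>lborel) \<le> ennreal (e\<^sup>2)"
          unfolding Fc by (simp add: cls_diff norm_cls_nn[symmetric] sqi_diff ennreal_leI)
      qed
    qed simp
    finally show ?thesis .
  qed
  have "\<exists>N. \<forall>m\<ge>N. norm (F m - F N) \<le> 1"
    using CauchyD[OF C, of 1] by (meson less_imp_le order_refl zero_less_one)
  then obtain N where N: "\<And>m. m \<ge> N \<Longrightarrow> norm (F m - F N) \<le> 1" by blast
  \<comment> \<open>Fatou at the fixed index \<open>N\<close> puts \<open>g - f N\<close> into L2,
    hence also \<open>g\<close>.\<close>
  have "integrable lborel (\<lambda>x. (g x - f N x)\<^sup>2)"
    by (rule integrableI_bounded) (use fatou[OF N] in \<open>auto simp: le_less_trans\<close>)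
  then have "sqi (\<lambda>x. g x - f N x)" by (simp add: sqi_def)
  from sqi_add[OF this sf[of N]] have sg: "sqi g" by simp
  have "F \<longlonglongrightarrow> cls g"
  proof (rule metric_LIMSEQ_I)
    fix e :: real assume e: "0 < e"
    from CauchyD[OF C, of "e/2"] e obtain M where M: "\<forall>m\<ge>M. \<forall>n\<ge>M. norm (F m - F n) < e/2" by auto
    have "dist (F n) (cls g) < e" if "n \<ge> M" for n
    proof -
      have "ennreal ((norm (cls g - F n))\<^sup>2) \<le> ennreal ((e/2)\<^sup>2)"
        unfolding Fc cls_diff[OF sg sf] norm_cls_nn[OF sqi_diff[OF sg sf]]
        by (rule fatou) (use M that in \<open>auto simp: less_imp_le\<close>)
      then have "(norm (cls g - F n))\<^sup>2 \<le> (e/2)\<^sup>2" by (simp add: ennreal_le_iff)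
      then have "norm (cls g - F n) \<le> e/2" using e by (simp add: power2_le_iff_abs_le)
      then show ?thesis using e by (simp add: dist_norm norm_minus_commute)
    qed
    then show "\<exists>no. \<forall>n\<ge>no. dist (F n) (cls g) < e" by blast
  qed
  then show ?thesis by blast
qed

instance l2 :: (euclidean_space) complete_space
proof
  fix F :: "nat \<Rightarrow> 'a l2" assume C: "Cauchy F"
  have "\<forall>n. \<exists>N. \<forall>m\<ge>N. \<forall>k\<ge>N. norm (F m - F k) < (1/2)^n"
    using CauchyD[OF C] by (metis zero_less_divide_1_iff zero_less_numeral zero_less_power)
  then obtain N where N: "\<And>n m k. m \<ge> N n \<Longrightarrow> k \<ge> N n \<Longrightarrow> norm (F m - F k) < (1/2)^n" by metis
  \<comment> \<open>Summing the terms \<open>Suc (N k)\<close> makes \<open>r\<close> strictly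
    increasing while \<open>r n\<close> stays above \<open>N n\<close>.\<close>
  define r where "r n = (\<Sum>k\<le>n. Suc (N k))" for n
  have rN: "r n \<ge> N n" for n
  proof -
    have "Suc (N n) \<le> r n" unfolding r_def by (rule member_le_sum) auto
    then show ?thesis by simp
  qed
  have r: "strict_mono r" unfolding r_def by (rule strict_monoI_Suc) simp
  have "norm ((F \<circ> r) (Suc n) - (F \<circ> r) n) \<le> (1/2)^n" for n
    using N[of n "r (Suc n)" "r n"] rN[of n] strict_monoD[OF r, of n "Suc n"] by simp
  moreover have CC: "Cauchy (F \<circ> r)" using C r by (rule Cauchy_subseq_Cauchy)
  ultimately obtain G where "(F \<circ> r) \<longlonglongrightarrow> G" using fast_cauchy_converges by blast
  then have "F \<longlonglongrightarrow> G" using C r Cauchy_converges_subseq by blast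
  then show "convergent F" by (auto simp: convergent_def)
qed

section \<open>Embedding functions on a set\<close>

lemma lebesgue_borel_version:
  fixes f :: "'a::euclidean_space \<Rightarrow> real"
  assumes "f \<in> borel_measurable lebesgue" "integrable lebesgue (\<lambda>x. (f x)\<^sup>2)"
  shows "\<exists>g. sqi g \<and> (AE x in lebesgue. g x = f x)"
proof -
  obtain g where g: "g \<in> borel_measurable lborel" "AE x in lborel. f x = g x"
    using completion_ex_borel_measurable_real[OF assms(1)] by blast
  have ae: "AE x in lebesgue. g x = f x" using AE_completion[OF g(2)] by auto
  have gl: "g \<in> borel_measurable lebesgue" using g(1) by (rule measurable_completion)
  have "integrable lebesgue (\<lambda>x. (g x)\<^sup>2)"
    by (subst integrable_cong_AE[of _ lebesgue "\<lambda>x. (f x)\<^sup>2"]) (use ae gl assms in auto)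
  then have "sqi g" using g(1) by (auto simp: sqi_def integrable_completion)
  with ae show ?thesis by blast
qed

text \<open>The class of \<open>f\<close> extended by zero off \<open>U\<close>. The choice is among
  classes, so the result is determined as soon as \<open>f\<close> is square integrable on
  \<open>U\<close>.\<close>

definition emb :: "'a::euclidean_space set \<Rightarrow> ('a \<Rightarrow> real) \<Rightarrow> 'a l2" where
  "emb U f = (SOME F. AE x in lebesgue. fn F x = indicator U x * f x)"

lemma L2_iff:
  fixes f :: "'a::euclidean_space \<Rightarrow> real"
  assumes "U \<in> sets lebesgue"
  shows "L2 U f \<longleftrightarrow> (\<lambda>x. indicator U x * f x) \<in> borel_measurable lebesgue \<and> integrable lebesgue (\<lambda>x. (indicator U x * f x)\<^sup>2)"
proof -
  have "(indicator U x * f x)\<^sup>2 = indicator U x * (f x)\<^sup>2" for x by (auto simp: indicator_def)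
  then show ?thesis
    unfolding L2_def using assms by (simp add: borel_measurable_restrict_space_iff integrable_restrict_space)
qed

lemma fn_emb:
  fixes f :: "'a::euclidean_space \<Rightarrow> real"
  assumes U: "U \<in> sets lebesgue" and f: "L2 U f"
  shows "AE x in lebesgue. fn (emb U f) x = indicator U x * f x"
proof -
  from f obtain g where g: "sqi g" "AE x in lebesgue. g x = indicator U x * f x"
    using lebesgue_borel_version[of "\<lambda>x. indicator U x * f x"] unfolding L2_iff[OF U] by blast
  have "AE x in lebesgue. fn (cls g) x = indicator U x * f x"
    using AE_completion[OF fn_cls[OF g(1)]] g(2) by eventually_elim simp
  then show ?thesis unfolding emb_def by (rule someI)
qed

lemma emb_eqI:
  fixes f :: "'a::euclidean_space \<Rightarrow> real"
  assumes U: "U \<in> sets lebesgue" and f: "L2 U f" and F: "AE x in lebesgue. fn F x = indicator U x * f x"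
  shows "emb U f = F"
proof -
  have "AE x in lebesgue. fn (emb U f) x = fn F x" using F fn_emb[OF U f] by eventually_elim simp
  then show ?thesis unfolding l2_eq_iff AE_completion_iff .
qed

text \<open>Completeness of Lebesgue measure: preimages that differ by a null set are measurable
  together. It is needed for functions known only almost everywhere, such as the planar profile in
  \<open>F_0\<close>.\<close>

lemma borel_measurable_lebesgue_AE:
  fixes f g :: "'a::euclidean_space \<Rightarrow> real"
  assumes "AE x in lebesgue. f x = g x" "f \<in> borel_measurable lebesgue"
  shows "g \<in> borel_measurable lebesgue"
proof (rule measurableI)
  fix A :: "real set" assume A: "A \<in> sets borel"
  have "AE x in lebesgue. x \<in> f -` A \<inter> space lebesgue \<longleftrightarrow> x \<in> g -` A \<inter> space lebesgue"
    using assms(1) by eventually_elim simp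
  then show "g -` A \<inter> space lebesgue \<in> sets lebesgue"
    using completion.in_sets_AE[of "f -` A \<inter> space lebesgue" "g -` A \<inter> space lebesgue" lborel]
      measurable_sets[OF assms(2) A] by auto
qed simp

lemma L2_cong_AE:
  assumes "U \<in> sets lebesgue" "L2 U f" "AE x in lebesgue_on U. g x = f x"
  shows "L2 U g"
proof -
  have m: "g \<in> borel_measurable (lebesgue_on U)"
  proof -
    have "AE x in lebesgue. indicator U x * f x = indicator U x * g x"
      using assms(1,3) by (auto simp: AE_restrict_space_iff indicator_def elim: eventually_mono)
    moreover have "(\<lambda>x. indicator U x * f x) \<in> borel_measurable lebesgue" using assms L2_iff by blast
    ultimately have "(\<lambda>x. indicator U x * g x) \<in> borel_measurable lebesgue"
      by (rule borel_measurable_lebesgue_AE)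
    then show ?thesis using assms(1) by (simp add: borel_measurable_restrict_space_iff)
  qed
  moreover have "integrable (lebesgue_on U) (\<lambda>x. (g x)\<^sup>2)"
  proof (rule integrable_cong_AE_imp)
    show "integrable (lebesgue_on U) (\<lambda>x. (f x)\<^sup>2)" using assms by (simp add: L2_def)
    show "(\<lambda>x. (g x)\<^sup>2) \<in> borel_measurable (lebesgue_on U)" using m by (rule borel_measurable_power)
    show "AE x in lebesgue_on U. (f x)\<^sup>2 = (g x)\<^sup>2" using assms(3) by eventually_elim simp
  qed
  ultimately show ?thesis by (simp add: L2_def)
qed

lemma L2_add: "L2 U f \<Longrightarrow> L2 U g \<Longrightarrow> L2 U (\<lambda>x. f x + g x)"
  unfolding L2_def by (auto intro: borel_measurable_add square_integrable_add)

lemma L2_scale: "L2 U f \<Longrightarrow> L2 U (\<lambda>x. c * f x)"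
  unfolding L2_def by (auto intro: borel_measurable_times simp: power_mult_distrib)

lemma L2_diff: "L2 U f \<Longrightarrow> L2 U g \<Longrightarrow> L2 U (\<lambda>x. f x - g x)"
  using L2_add[OF _ L2_scale[of U g "-1"]] by simp

lemma L2_zero: "L2 U (\<lambda>x. 0)"
  by (simp add: L2_def)

lemma L2_mult_bounded:
  fixes f :: "'a::euclidean_space \<Rightarrow> real"
  assumes f: "L2 U f" and g: "g \<in> borel_measurable (lebesgue_on U)" and b: "\<And>x. \<bar>g x\<bar> \<le> C"
  shows "L2 U (\<lambda>x. g x * f x)"
  unfolding L2_def
proof
  show m: "(\<lambda>x. g x * f x) \<in> borel_measurable (lebesgue_on U)"
    using f g by (auto simp: L2_def intro: borel_measurable_times)
  show "integrable (lebesgue_on U) (\<lambda>x. (g x * f x)\<^sup>2)"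
  proof (rule Bochner_Integration.integrable_bound)
    show "integrable (lebesgue_on U) (\<lambda>x. C\<^sup>2 * (f x)\<^sup>2)" using f by (simp add: L2_def)
    show "(\<lambda>x. (g x * f x)\<^sup>2) \<in> borel_measurable (lebesgue_on U)" using m by (rule borel_measurable_power)
    show "AE x in lebesgue_on U. norm ((g x * f x)\<^sup>2) \<le> norm (C\<^sup>2 * (f x)\<^sup>2)"
    proof (rule AE_I2)
      fix x
      have "(g x)\<^sup>2 \<le> C\<^sup>2" using b[of x] power_mono[of "\<bar>g x\<bar>" C 2] by simp
      then show "norm ((g x * f x)\<^sup>2) \<le> norm (C\<^sup>2 * (f x)\<^sup>2)" by (simp add: power_mult_distrib mult_right_mono)
    qed
  qed
qed

lemma AE_lebesgue_on_iff:
  "U \<in> sets lebesgue \<Longrightarrow> (AE x in lebesgue_on U. P x) \<longleftrightarrow> (AE x in lebesgue. x \<in> U \<longrightarrow> P x)"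
  by (simp add: AE_restrict_space_iff)

lemma emb_eq_iff:
  fixes f :: "'a::euclidean_space \<Rightarrow> real"
  assumes U: "U \<in> sets lebesgue" and f: "L2 U f" and g: "L2 U g"
  shows "emb U f = emb U g \<longleftrightarrow> (AE x in lebesgue_on U. f x = g x)"
proof
  assume eq: "emb U f = emb U g"
  have "AE x in lebesgue. x \<in> U \<longrightarrow> f x = g x"
    using fn_emb[OF U f] fn_emb[OF U g] unfolding eq by eventually_elim auto
  then show "AE x in lebesgue_on U. f x = g x" unfolding AE_lebesgue_on_iff[OF U] .
next
  assume "AE x in lebesgue_on U. f x = g x"
  then have "AE x in lebesgue. x \<in> U \<longrightarrow> f x = g x" unfolding AE_lebesgue_on_iff[OF U] .
  with fn_emb[OF U g] have "AE x in lebesgue. fn (emb U g) x = indicator U x * f x"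
    by eventually_elim (auto simp: indicator_def)
  then show "emb U f = emb U g" by (rule emb_eqI[OF U f])
qed

lemma fn_add: "AE x in lebesgue. fn (F + G) x = fn F x + fn G x"
  using AE_completion[OF fn_cls[OF sqi_add[OF sqi_fn[of F] sqi_fn[of G]]]]
  by (simp add: cls_add[OF sqi_fn sqi_fn, symmetric])

lemma fn_diff: "AE x in lebesgue. fn (F - G) x = fn F x - fn G x"
  using AE_completion[OF fn_cls[OF sqi_diff[OF sqi_fn[of F] sqi_fn[of G]]]]
  by (simp add: cls_diff[OF sqi_fn sqi_fn, symmetric])

lemma fn_scale: "AE x in lebesgue. fn (c *\<^sub>R F) x = c * fn F x"
  using AE_completion[OF fn_cls[OF sqi_scale[OF sqi_fn[of F], of c]]]
  by (simp add: cls_scale[OF sqi_fn, symmetric])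

lemma fn_zero: "AE x in lebesgue. fn 0 x = 0"
  using AE_completion[OF fn_cls[OF sqi_zero]] by (simp add: cls_zero)

lemma emb_add:
  assumes U: "U \<in> sets lebesgue" and f: "L2 U f" and g: "L2 U g"
  shows "emb U (\<lambda>x. f x + g x) = emb U f + emb U g"
proof -
  have "AE x in lebesgue. fn (emb U f + emb U g) x = indicator U x * (f x + g x)"
    using fn_add[of "emb U f" "emb U g"] fn_emb[OF U f] fn_emb[OF U g] by eventually_elim (simp add: distrib_left)
  then show ?thesis by (rule emb_eqI[OF U L2_add[OF f g]])
qed

lemma emb_scale:
  assumes U: "U \<in> sets lebesgue" and f: "L2 U f"
  shows "emb U (\<lambda>x. c * f x) = c *\<^sub>R emb U f"
proof -
  have "AE x in lebesgue. fn (c *\<^sub>R emb U f) x = indicator U x * (c * f x)"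
    using fn_scale[of c "emb U f"] fn_emb[OF U f] by eventually_elim simp
  then show ?thesis by (rule emb_eqI[OF U L2_scale[OF f]])
qed

lemma emb_diff: "U \<in> sets lebesgue \<Longrightarrow> L2 U f \<Longrightarrow> L2 U g \<Longrightarrow> emb U (\<lambda>x. f x - g x) = emb U f - emb U g"
  using emb_add[of U f "\<lambda>x. -1 * g x"] emb_scale[of U g "-1"] L2_scale[of U g "-1"] by simp

lemma emb_zero: "U \<in> sets lebesgue \<Longrightarrow> emb U (\<lambda>x. 0) = 0"
  using emb_scale[of U "\<lambda>x. 0" 0] L2_zero[of U] by simp

lemma inner_lebesgue: "inner F G = (\<integral>x. fn F x * fn G x \<partial>lebesgue)"
  unfolding inner_fn by (rule integral_completion[symmetric]) simp

lemma inner_emb_left: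
  assumes U: "U \<in> sets lebesgue" and f: "L2 U f"
  shows "inner (emb U f) G = (\<integral>x. f x * fn G x \<partial>lebesgue_on U)"
proof -
  have "inner (emb U f) G = (\<integral>x. indicator U x *\<^sub>R (f x * fn G x) \<partial>lebesgue)"
    unfolding inner_lebesgue
  proof (rule integral_cong_AE)
    show "(\<lambda>x. fn (emb U f) x * fn G x) \<in> borel_measurable lebesgue"
      by (rule measurable_completion) simp
    have [measurable]: "fn G \<in> borel_measurable lebesgue" by (rule measurable_completion) simp
    have [measurable]: "(\<lambda>x. indicator U x * f x) \<in> borel_measurable lebesgue" using f L2_iff[OF U] by blast
    have "(\<lambda>x. (indicator U x * f x) * fn G x) \<in> borel_measurable lebesgue" by measurable
    then show "(\<lambda>x. indicator U x *\<^sub>R (f x * fn G x)) \<in> borel_measurable lebesgue" by (simp add: mult.assoc)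
    show "AE x in lebesgue. fn (emb U f) x * fn G x = indicator U x *\<^sub>R (f x * fn G x)"
      using fn_emb[OF U f] by eventually_elim simp
  qed
  then show ?thesis using U by (simp add: integral_restrict_space)
qed

lemma fn_measurable_lebesgue_on: "fn F \<in> borel_measurable (lebesgue_on U)"
  by (rule measurable_restrict_space1) (rule measurable_completion, simp)

lemma inner_emb:
  assumes U: "U \<in> sets lebesgue" and f: "L2 U f" and g: "L2 U g"
  shows "inner (emb U f) (emb U g) = (\<integral>x. f x * g x \<partial>lebesgue_on U)"
  unfolding inner_emb_left[OF U f]
proof (rule integral_cong_AE)
  note fn_measurable_lebesgue_on[measurable]
  have [measurable]: "f \<in> borel_measurable (lebesgue_on U)" "g \<in> borel_measurable (lebesgue_on U)"
    using f g by (simp_all add: L2_def)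
  show "(\<lambda>x. f x * fn (emb U g) x) \<in> borel_measurable (lebesgue_on U)"
    "(\<lambda>x. f x * g x) \<in> borel_measurable (lebesgue_on U)" by measurable
  have "AE x in lebesgue. x \<in> U \<longrightarrow> fn (emb U g) x = g x"
    using fn_emb[OF U g] by eventually_elim (auto simp: indicator_def)
  then have "AE x in lebesgue_on U. fn (emb U g) x = g x" unfolding AE_lebesgue_on_iff[OF U] .
  then show "AE x in lebesgue_on U. f x * fn (emb U g) x = f x * g x" by eventually_elim simp
qed

lemma norm_emb:
  assumes "U \<in> sets lebesgue" "L2 U f"
  shows "(norm (emb U f))\<^sup>2 = (\<integral>x. (f x)\<^sup>2 \<partial>lebesgue_on U)"
  unfolding power2_norm_eq_inner by (simp add: inner_emb assms power2_eq_square)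

lemma L2_fn:
  assumes U: "U \<in> sets lebesgue" shows "L2 U (fn F)"
proof -
  have i: "integrable lebesgue (\<lambda>x. (fn F x)\<^sup>2)"
    using sqi_square[OF sqi_fn[of F]] by (subst integrable_completion) auto
  show ?thesis unfolding L2_def
  proof
    show "fn F \<in> borel_measurable (lebesgue_on U)" by (rule fn_measurable_lebesgue_on)
    show "integrable (lebesgue_on U) (\<lambda>x. (fn F x)\<^sup>2)"
      using integrable_mult_indicator[OF U i] U by (simp add: integrable_restrict_space)
  qed
qed

lemma emb_UNIV_fn: "emb UNIV (fn F) = F"
  by (rule emb_eqI) (auto simp: L2_fn)

lemma L2_sqi: "sqi f \<Longrightarrow> L2 UNIV f"
  unfolding L2_def lebesgue_on_UNIV_eq sqi_def by (auto intro: measurable_completion simp: integrable_completion)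

lemma emb_UNIV_cls: "sqi f \<Longrightarrow> emb UNIV f = cls f"
  by (rule emb_eqI) (use AE_completion[OF fn_cls] L2_sqi in auto)

definition supp_in :: "'a::euclidean_space set \<Rightarrow> 'a l2 \<Rightarrow> bool" where
  "supp_in U F \<longleftrightarrow> (AE x in lebesgue. x \<notin> U \<longrightarrow> fn F x = 0)"

lemma supp_in_emb: "U \<in> sets lebesgue \<Longrightarrow> L2 U f \<Longrightarrow> supp_in U (emb U f)"
  unfolding supp_in_def using fn_emb[of U f] by (auto elim: eventually_mono)

lemma emb_supp_in:
  assumes "U \<in> sets lebesgue" "supp_in U F" shows "emb U (fn F) = F"
proof (rule emb_eqI[OF assms(1) L2_fn[OF assms(1)]])
  show "AE x in lebesgue. fn F x = indicator U x * fn F x"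
    using assms(2) unfolding supp_in_def by eventually_elim (auto simp: indicator_def)
qed

text \<open>Written as orthogonality, the support condition visibly defines a closed subspace and
  survives weak limits.\<close>

lemma supp_in_iff_orthogonal:
  assumes U: "U \<in> sets lebesgue"
  shows "supp_in U F \<longleftrightarrow> (\<forall>G. inner F (emb (- U) (fn G)) = 0)"
proof -
  have U': "- U \<in> sets lebesgue" using U by (simp add: Compl_in_sets_lebesgue)
  have eq: "inner F (emb (- U) (fn G)) = inner (emb (-U) (fn F)) (emb (- U) (fn G))"
    for G
  proof -
    have "inner F (emb (- U) (fn G)) = inner (emb (- U) (fn G)) F" by (rule inner_commute)
    also have "\<dots> = (\<integral>x. fn G x * fn F x \<partial>lebesgue_on (-U))" by (rule inner_emb_left[OF U' L2_fn[OF U']])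
    also have "\<dots> = inner (emb (-U) (fn G)) (emb (- U) (fn F))" by (rule inner_emb[OF U' L2_fn[OF U'] L2_fn[OF U'], symmetric])
    also have "\<dots> = inner (emb (-U) (fn F)) (emb (- U) (fn G))" by (rule inner_commute)
    finally show ?thesis .
  qed
  have "supp_in U F \<longleftrightarrow> emb (-U) (fn F) = 0"
    unfolding emb_zero[OF U', symmetric] emb_eq_iff[OF U' L2_fn[OF U'] L2_zero] AE_lebesgue_on_iff[OF U'] supp_in_def by simp
  also have "\<dots> \<longleftrightarrow> (\<forall>G. inner F (emb (- U) (fn G)) = 0)"
    unfolding eq by (metis inner_eq_zero_iff inner_zero_left)
  finally show ?thesis .
qed

lemma weakly_supp_in:
  assumes U: "U \<in> sets lebesgue" and F: "weakly F G" and s: "\<And>n. supp_in U (F n)"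
  shows "supp_in U G"
  unfolding supp_in_iff_orthogonal[OF U]
proof
  fix H
  have "(\<lambda>n. inner (F n) (emb (- U) (fn H))) \<longlonglongrightarrow> inner G (emb (- U) (fn H))" using F by (rule weaklyD)
  moreover have "inner (F n) (emb (- U) (fn H)) = 0" for n using s[of n] unfolding supp_in_iff_orthogonal[OF U] by blast
  ultimately show "inner G (emb (- U) (fn H)) = 0" by (simp add: LIMSEQ_const_iff)
qed

section \<open>Smooth functions and test functions\<close>

text \<open>In contrast to the total function \<open>dir_deriv\<close>, this relation asserts that
  the directional derivative exists.\<close>

abbreviation dd :: "('a::euclidean_space \<Rightarrow> real) \<Rightarrow> 'a \<Rightarrow> ('a \<Rightarrow> real) \<Rightarrow> bool" where
  "dd f b g \<equiv> (\<forall>x. ((\<lambda>t. f (x + t *\<^sub>R b)) has_real_derivative g x) (at 0))"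

text \<open>A coinduction principle. Most smoothness proofs below exhibit a class of continuous
  functions closed under partial derivatives; choosing the derivatives inside the class produces the
  family \<open>D\<close> that the definition asks for.\<close>

lemma smooth_funI:
  assumes "\<phi> \<in> S" and cont: "\<And>f. f \<in> S \<Longrightarrow> continuous_on UNIV f"
    and der: "\<And>f b. f \<in> S \<Longrightarrow> b \<in> Basis \<Longrightarrow> \<exists>g\<in>S. dd f b g"
  shows "smooth_fun (\<phi> :: 'a::euclidean_space \<Rightarrow> real)"
proof -
  from der obtain G where G: "\<And>f b. f \<in> S \<Longrightarrow> b \<in> Basis \<Longrightarrow> G f b \<in> S \<and> dd f b (G f b)" by metis
  \<comment> \<open>Directions outside \<open>Basis\<close> are skipped: continuity of
    \<open>D l\<close> is required for all lists, derivatives only in basis directions.\<close>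
  define D where "D l = foldr (\<lambda>b f. if b \<in> Basis then G f b else f) l \<phi>" for l
  have DS: "D l \<in> S" for l by (induction l) (use G assms(1) in \<open>auto simp: D_def\<close>)
  have step: "D (b # l) = G (D l) b" if "b \<in> Basis" for b l using that by (simp add: D_def)
  show ?thesis unfolding smooth_fun_def
  proof (intro exI[of _ D] conjI allI impI)
    show "D [] = \<phi>" by (simp add: D_def)
    show "continuous_on UNIV (D l)" for l using cont DS by blast
    show "((\<lambda>t. D l (x + t *\<^sub>R b)) has_real_derivative D (b # l) x) (at 0)" if "b \<in> Basis" for l b x
      using G[OF DS that] step[OF that] by simp
  qed
qed

lemma dd_dir_deriv: "dd f b g \<Longrightarrow> dir_deriv f b = g"
  unfolding dir_deriv_def by (auto simp: fun_eq_iff intro: DERIV_imp_deriv)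

lemma smooth_continuous: "smooth_fun \<phi> \<Longrightarrow> continuous_on UNIV \<phi>"
  unfolding smooth_fun_def by metis

lemma smooth_dd:
  assumes "smooth_fun \<phi>" "b \<in> Basis" shows "dd \<phi> b (dir_deriv \<phi> b)"
proof -
  from assms obtain D where "D [] = \<phi>" "\<forall>l b x. b \<in> Basis \<longrightarrow> ((\<lambda>t. D l (x + t *\<^sub>R b)) has_real_derivative D (b # l) x) (at 0)"
    unfolding smooth_fun_def by blast
  then have "dd \<phi> b (D [b])" using assms(2) by metis
  then show ?thesis using dd_dir_deriv by metis
qed

lemma smooth_dir_deriv:
  assumes "smooth_fun \<phi>" "b \<in> Basis" shows "smooth_fun (dir_deriv \<phi> b)"
proof -
  from assms obtain D where D: "D [] = \<phi>" "\<forall>l. continuous_on UNIV (D l)"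
     "\<forall>l b x. b \<in> Basis \<longrightarrow> ((\<lambda>t. D l (x + t *\<^sub>R b)) has_real_derivative D (b # l) x) (at 0)"
    unfolding smooth_fun_def by blast
  have "dd \<phi> b (D [b])" using assms(2) D by metis
  then have eq: "dir_deriv \<phi> b = D [b]" by (rule dd_dir_deriv)
  show ?thesis unfolding eq
  proof (rule smooth_funI[of _ "range D"])
    show "\<exists>g\<in>range D. dd f b g" if "f \<in> range D" "b \<in> Basis" for f b
    proof -
      from that(1) obtain l where "f = D l" by blast
      then show ?thesis using D(3) that(2) by (intro bexI[of _ "D (b # l)"]) auto
    qed
  qed (use D in auto)
qed

lemma smooth_line_deriv:
  assumes "smooth_fun \<phi>" "b \<in> Basis"
  shows "((\<lambda>t. \<phi> (x + t *\<^sub>R b)) has_real_derivative dir_deriv \<phi> b (x + t *\<^sub>R b)) (at t)"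
proof -
  have "((\<lambda>h. \<phi> ((x + t *\<^sub>R b) + h *\<^sub>R b)) has_real_derivative dir_deriv \<phi> b (x + t *\<^sub>R b)) (at (0 + 0))"
    using smooth_dd[OF assms] by simp
  then have "((\<lambda>h. \<phi> ((x + t *\<^sub>R b) + (h - t) *\<^sub>R b)) has_real_derivative dir_deriv \<phi> b (x + t *\<^sub>R b)) (at t)"
    using DERIV_shift[of "\<lambda>h. \<phi> ((x + t *\<^sub>R b) + (h - t) *\<^sub>R b)" _ 0 t] by (simp add: algebra_simps)
  then show ?thesis by (simp add: algebra_simps)
qed

lemma smooth_const: "smooth_fun (\<lambda>x. c)"
  by (rule smooth_funI[of _ "range (\<lambda>c x. c)"]) (auto intro!: continuous_intros exI[of _ 0])

lemma smooth_add:
  assumes "smooth_fun f" "smooth_fun g" shows "smooth_fun (\<lambda>x. f x + g x)"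
proof (rule smooth_funI[of _ "{\<lambda>x. f x + g x | f g. smooth_fun f \<and> smooth_fun g}"])
  show "(\<lambda>x. f x + g x) \<in> {\<lambda>x. f x + g x | f g. smooth_fun f \<and> smooth_fun g}" using assms by blast
next
  fix h assume "h \<in> {\<lambda>x::'a. f x + g x | f g. smooth_fun f \<and> smooth_fun g}"
  then show "continuous_on UNIV h" using smooth_continuous by (auto intro!: continuous_intros)
next
  fix h and b :: 'a assume b: "b \<in> Basis" and "h \<in> {\<lambda>x::'a. f x + g x | f g. smooth_fun f \<and> smooth_fun g}"
  then obtain f g where "h = (\<lambda>x. f x + g x)" "smooth_fun f" "smooth_fun g" by blast
  then have "dd h b (\<lambda>x. dir_deriv f b x + dir_deriv g b x)"
    using smooth_dd[OF _ b] by (auto intro!: DERIV_add)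
  moreover have "(\<lambda>x. dir_deriv f b x + dir_deriv g b x) \<in> {\<lambda>x. f x + g x | f g. smooth_fun f \<and> smooth_fun g}"
    using smooth_dir_deriv[OF \<open>smooth_fun f\<close> b] smooth_dir_deriv[OF \<open>smooth_fun g\<close> b] by blast
  ultimately show "\<exists>k\<in>{\<lambda>x. f x + g x | f g. smooth_fun f \<and> smooth_fun g}. dd h b k"
    by (rule bexI)
qed

text \<open>The Leibniz rule leaves the class of products of two smooth functions, so sums are added
  to obtain a class closed under differentiation.\<close>

inductive_set mult_hull :: "('a::euclidean_space \<Rightarrow> real) set" where
  prod: "smooth_fun f \<Longrightarrow> smooth_fun g \<Longrightarrow> (\<lambda>x. f x * g x) \<in> mult_hull"
| plus: "f \<in> mult_hull \<Longrightarrow> g \<in> mult_hull \<Longrightarrow> (\<lambda>x. f x + g x) \<in> mult_hull"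

lemma smooth_mult_dd:
  assumes "smooth_fun f" "smooth_fun g" "b \<in> Basis"
  shows "dd (\<lambda>x. f x * g x) b (\<lambda>x. dir_deriv f b x * g x + dir_deriv g b x * f x)"
proof
  fix x
  show "((\<lambda>t. f (x + t *\<^sub>R b) * g (x + t *\<^sub>R b)) has_real_derivative
      dir_deriv f b x * g x + dir_deriv g b x * f x) (at 0)"
    using DERIV_mult[OF smooth_dd[OF assms(1,3), rule_format, of x] smooth_dd[OF assms(2,3), rule_format, of x]] by simp
qed

lemma smooth_mult:
  assumes "smooth_fun f" "smooth_fun g" shows "smooth_fun (\<lambda>x. f x * g x)"
proof (rule smooth_funI[of _ mult_hull])
  show "(\<lambda>x. f x * g x) \<in> mult_hull" using assms by (rule mult_hull.prod)
next
  fix h :: "'a \<Rightarrow> real" assume "h \<in> mult_hull"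
  then show "continuous_on UNIV h" by induction (use smooth_continuous in \<open>auto intro!: continuous_intros\<close>)
next
  fix h :: "'a \<Rightarrow> real" and b :: 'a assume "h \<in> mult_hull" and b: "b \<in> Basis"
  from this(1) show "\<exists>k\<in>mult_hull. dd h b k"
  proof induction
    case (prod f g)
    then show ?case using smooth_mult_dd[OF prod b]
      by (intro bexI[of _ "\<lambda>x. dir_deriv f b x * g x + dir_deriv g b x * f x"] mult_hull.plus mult_hull.prod)
        (auto intro: smooth_dir_deriv b)
  next
    case (plus f g)
    then obtain k l where "k \<in> mult_hull" "dd f b k" "l \<in> mult_hull" "dd g b l" by blast
    then show ?case by (intro bexI[of _ "\<lambda>x. k x + l x"] mult_hull.plus) (auto intro!: DERIV_add)
  qed
qed

lemma dir_deriv_mult: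
  "smooth_fun f \<Longrightarrow> smooth_fun g \<Longrightarrow> b \<in> Basis \<Longrightarrow>
   dir_deriv (\<lambda>x. f x * g x) b = (\<lambda>x. dir_deriv f b x * g x + dir_deriv g b x * f x)"
  by (rule dd_dir_deriv[OF smooth_mult_dd])

lemma dir_deriv_add:
  "smooth_fun f \<Longrightarrow> smooth_fun g \<Longrightarrow> b \<in> Basis \<Longrightarrow>
   dir_deriv (\<lambda>x. f x + g x) b = (\<lambda>x. dir_deriv f b x + dir_deriv g b x)"
  by (rule dd_dir_deriv) (auto intro!: DERIV_add simp: smooth_dd)

lemma dir_deriv_const: "dir_deriv (\<lambda>x. c) b = (\<lambda>x. 0)"
  by (rule dd_dir_deriv) simp

lemma dir_deriv_scale:
  "smooth_fun f \<Longrightarrow> b \<in> Basis \<Longrightarrow> dir_deriv (\<lambda>x. c * f x) b = (\<lambda>x. c * dir_deriv f b x)"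
  by (simp add: dir_deriv_mult smooth_const dir_deriv_const mult.commute)

lemma smooth_prod:
  "finite I \<Longrightarrow> (\<And>i. i \<in> I \<Longrightarrow> smooth_fun (f i)) \<Longrightarrow> smooth_fun (\<lambda>x. \<Prod>i\<in>I. f i x)"
  by (induction I rule: finite_induct) (auto intro: smooth_const smooth_mult)

lemma smooth_real_deriv:
  fixes f :: "real \<Rightarrow> real"
  assumes "smooth_fun f" shows "(f has_real_derivative dir_deriv f 1 t) (at t)"
  using smooth_line_deriv[OF assms, of 1 0 t] by simp

lemma smooth_of_linear_dd:
  fixes f :: "real \<Rightarrow> real" and v :: "'a::euclidean_space"
  assumes "smooth_fun f"
  shows "dd (\<lambda>x. f (x \<bullet> v + d)) b (\<lambda>x. (b \<bullet> v) * dir_deriv f 1 (x \<bullet> v + d))"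
proof
  fix x
  have "((\<lambda>t. (x + t *\<^sub>R b) \<bullet> v + d) has_real_derivative b \<bullet> v) (at 0)"
    by (auto simp: inner_simps intro!: derivative_eq_intros)
  from DERIV_chain2[OF _ this, of f "dir_deriv f 1 (x \<bullet> v + d)"]
  show "((\<lambda>t. f ((x + t *\<^sub>R b) \<bullet> v + d)) has_real_derivative (b \<bullet> v) * dir_deriv f 1 (x \<bullet> v + d)) (at 0)"
    using smooth_real_deriv[OF assms, of "x \<bullet> v + d"] by (simp add: mult.commute)
qed

text \<open>The class carries a scalar factor \<open>k\<close> because the chain rule produces one;
  the same device serves for \<open>diag_map\<close>.\<close>

lemma smooth_of_linear:
  fixes f :: "real \<Rightarrow> real" and v :: "'a::euclidean_space"
  assumes "smooth_fun f" shows "smooth_fun (\<lambda>x. f (x \<bullet> v + d))"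
proof (rule smooth_funI[of _ "{\<lambda>x. k * f (x \<bullet> v + d) | k f. smooth_fun f}"])
  show "(\<lambda>x. f (x \<bullet> v + d)) \<in> {\<lambda>x. k * f (x \<bullet> v + d) | k f. smooth_fun f}" using assms by (auto intro!: exI[of _ 1])
next
  fix h assume "h \<in> {\<lambda>x. k * f (x \<bullet> v + d) | k f. smooth_fun f}"
  then obtain k f where h: "h = (\<lambda>x. k * f (x \<bullet> v + d))" and f: "smooth_fun f" by blast
  have "continuous_on UNIV (\<lambda>x. x \<bullet> v + d)" by (intro continuous_intros)
  from continuous_on_compose2[OF smooth_continuous[OF f] this] show "continuous_on UNIV h"
    unfolding h by (intro continuous_on_mult_left) simp
next
  fix h and b :: 'a assume b: "b \<in> Basis" and "h \<in> {\<lambda>x. k * f (x \<bullet> v + d) | k f. smooth_fun f}"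
  then obtain k f where h: "h = (\<lambda>x. k * f (x \<bullet> v + d))" and f: "smooth_fun f" by blast
  have "dd h b (\<lambda>x. (k * (b \<bullet> v)) * dir_deriv f 1 (x \<bullet> v + d))"
    unfolding h using smooth_of_linear_dd[OF f, where v=v and d=d and b=b] by (auto intro: DERIV_cmult simp: mult.assoc)
  moreover have "smooth_fun (dir_deriv f 1)" using f by (intro smooth_dir_deriv) auto
  ultimately show "\<exists>g\<in>{\<lambda>x. k * f (x \<bullet> v + d) | k f. smooth_fun f}. dd h b g"
    by (intro bexI[of _ "\<lambda>x. (k * (b \<bullet> v)) * dir_deriv f 1 (x \<bullet> v + d)"]) auto
qed

text \<open>Covers both the translations and the thickness rescaling \<open>scale3\<close>, so that
  smoothness, chain rule and test functions are handled once for both.\<close>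

definition diag_map :: "'a \<Rightarrow> ('a \<Rightarrow> real) \<Rightarrow> 'a \<Rightarrow> 'a::euclidean_space" where
  "diag_map a c x = a + (\<Sum>j\<in>Basis. (c j * (x \<bullet> j)) *\<^sub>R j)"

lemma diag_map_inner: "j \<in> Basis \<Longrightarrow> diag_map a c x \<bullet> j = a \<bullet> j + c j * (x \<bullet> j)"
  by (simp add: diag_map_def inner_simps)

lemma diag_map_line: "b \<in> Basis \<Longrightarrow> diag_map a c (x + t *\<^sub>R b) = diag_map a c x + (c b * t) *\<^sub>R b"
  by (rule euclidean_eqI) (auto simp: diag_map_inner inner_simps inner_Basis algebra_simps)

lemma continuous_diag_map: "continuous_on S (diag_map a c)"
  unfolding diag_map_def by (intro continuous_intros)

lemma smooth_diag_map_dd: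
  assumes "smooth_fun \<phi>" "b \<in> Basis"
  shows "dd (\<lambda>x. \<phi> (diag_map a c x)) b (\<lambda>x. c b * dir_deriv \<phi> b (diag_map a c x))"
proof
  fix x
  have "((\<lambda>t. c b * t) has_real_derivative c b) (at 0)" by (auto intro!: derivative_eq_intros)
  moreover have "((\<lambda>t. \<phi> (diag_map a c x + t *\<^sub>R b)) has_real_derivative dir_deriv \<phi> b (diag_map a c x)) (at (c b * 0))"
    using smooth_dd[OF assms] by simp
  ultimately have "((\<lambda>t. \<phi> (diag_map a c x + (c b * t) *\<^sub>R b)) has_real_derivative dir_deriv \<phi> b (diag_map a c x) * c b) (at 0)"
    by (rule DERIV_chain2[rotated])
  then show "((\<lambda>t. \<phi> (diag_map a c (x + t *\<^sub>R b))) has_real_derivative c b * dir_deriv \<phi> b (diag_map a c x)) (at 0)"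
    by (simp add: diag_map_line[OF assms(2)] mult.commute)
qed

lemma dir_deriv_diag_map:
  "smooth_fun \<phi> \<Longrightarrow> b \<in> Basis \<Longrightarrow>
   dir_deriv (\<lambda>x. \<phi> (diag_map a c x)) b = (\<lambda>x. c b * dir_deriv \<phi> b (diag_map a c x))"
  by (rule dd_dir_deriv[OF smooth_diag_map_dd])

lemma smooth_diag_map:
  assumes "smooth_fun \<phi>" shows "smooth_fun (\<lambda>x. \<phi> (diag_map a c x))"
proof (rule smooth_funI[of _ "{\<lambda>x. k * \<phi> (diag_map a c x) | k \<phi>. smooth_fun \<phi>}"])
  show "(\<lambda>x. \<phi> (diag_map a c x)) \<in> {\<lambda>x. k * \<phi> (diag_map a c x) | k \<phi>. smooth_fun \<phi>}"
    using assms by (auto intro!: exI[of _ 1])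
next
  fix h assume "h \<in> {\<lambda>x. k * \<phi> (diag_map a c x) | k \<phi>. smooth_fun \<phi>}"
  then obtain k f where h: "h = (\<lambda>x. k * f (diag_map a c x))" and f: "smooth_fun f" by blast
  from continuous_on_compose2[OF smooth_continuous[OF f] continuous_diag_map] show "continuous_on UNIV h"
    unfolding h by (intro continuous_on_mult_left) simp
next
  fix h and b :: 'a assume b: "b \<in> Basis" and "h \<in> {\<lambda>x. k * \<phi> (diag_map a c x) | k \<phi>. smooth_fun \<phi>}"
  then obtain k f where h: "h = (\<lambda>x. k * f (diag_map a c x))" and f: "smooth_fun f" by blast
  have "dd h b (\<lambda>x. (k * c b) * dir_deriv f b (diag_map a c x))"
    unfolding h using smooth_diag_map_dd[OF f b, of a c] by (auto intro: DERIV_cmult simp: mult.assoc)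
  moreover have "smooth_fun (dir_deriv f b)" using f b by (rule smooth_dir_deriv)
  ultimately show "\<exists>g\<in>{\<lambda>x. k * \<phi> (diag_map a c x) | k \<phi>. smooth_fun \<phi>}. dd h b g"
    by (intro bexI[of _ "\<lambda>x. (k * c b) * dir_deriv f b (diag_map a c x)"]) auto
qed

lemma diag_map_1: "diag_map a (\<lambda>j. 1) x = x + a"
  by (rule euclidean_eqI) (simp add: diag_map_inner inner_simps)

lemma dir_deriv_translate:
  "smooth_fun \<phi> \<Longrightarrow> b \<in> Basis \<Longrightarrow> dir_deriv (\<lambda>x. \<phi> (x + a)) b = (\<lambda>x. dir_deriv \<phi> b (x + a))"
  using dir_deriv_diag_map[of \<phi> b a "\<lambda>j. 1"] by (simp add: diag_map_1)

text \<open>Any compact set off which the function vanishes may stand for the closed support; such a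
  set is easier to supply here and to use in \<open>test_funE\<close>.\<close>

lemma test_funI:
  assumes "smooth_fun \<phi>" "compact K" "K \<subseteq> U" "\<And>x. x \<notin> K \<Longrightarrow> \<phi> x = 0"
  shows "test_fun U \<phi>"
proof -
  have "closure {x. \<phi> x \<noteq> 0} \<subseteq> K" using assms by (intro closure_minimal) (auto simp: compact_imp_closed)
  moreover from this have "compact (closure {x. \<phi> x \<noteq> 0})"
    using assms(2) by (metis closed_closure compact_Int_closed inf.absorb_iff2)
  ultimately show ?thesis using assms by (auto simp: test_fun_def)
qed

lemma test_funE:
  assumes "test_fun U \<phi>"
  obtains K where "smooth_fun \<phi>" "compact K" "K \<subseteq> U" "\<And>x. x \<notin> K \<Longrightarrow> \<phi> x = 0"
  using assms closure_subset[of "{x. \<phi> x \<noteq> 0}"] unfolding test_fun_def by blast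

lemma test_smooth: "test_fun U \<phi> \<Longrightarrow> smooth_fun \<phi>"
  by (simp add: test_fun_def)

lemma test_mono: "test_fun U \<phi> \<Longrightarrow> U \<subseteq> V \<Longrightarrow> test_fun V \<phi>"
  unfolding test_fun_def by blast

lemma dir_deriv_zero_outside:
  assumes "closed K" "\<And>x. x \<notin> K \<Longrightarrow> \<phi> x = 0" "x \<notin> K"
  shows "dir_deriv \<phi> b x = (0 :: real)"
proof -
  have "continuous_on UNIV (\<lambda>t. x + t *\<^sub>R b)" by (intro continuous_intros)
  then have "open ((\<lambda>t. x + t *\<^sub>R b) -` (- K))" using assms(1) by (intro open_vimage) auto
  moreover have "0 \<in> (\<lambda>t. x + t *\<^sub>R b) -` (- K)" using assms(3) by simp
  ultimately have "((\<lambda>t. \<phi> (x + t *\<^sub>R b)) has_real_derivative 0) (at 0)"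
    using assms(2) by (intro has_field_derivative_transform_within_open[OF DERIV_const[where k="0::real"], where S="(\<lambda>t. x + t *\<^sub>R b) -` (- K)"]) auto
  then show ?thesis unfolding dir_deriv_def by (rule DERIV_imp_deriv)
qed

lemma test_dir_deriv:
  assumes "test_fun U \<phi>" "b \<in> Basis" shows "test_fun U (dir_deriv \<phi> b)"
proof -
  from assms(1) obtain K where K: "smooth_fun \<phi>" "compact K" "K \<subseteq> U" "\<And>x. x \<notin> K \<Longrightarrow> \<phi> x = 0" by (rule test_funE) blast
  show ?thesis
    by (rule test_funI[OF smooth_dir_deriv[OF K(1) assms(2)] K(2,3)])
      (use K dir_deriv_zero_outside compact_imp_closed in blast)
qed

lemma test_mult:
  assumes "test_fun U \<phi>" "smooth_fun f" shows "test_fun U (\<lambda>x. f x * \<phi> x)"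
  using assms(1) by (rule test_funE) (rule test_funI[OF smooth_mult[OF assms(2)]], auto)

lemma test_scale: "test_fun U \<phi> \<Longrightarrow> test_fun U (\<lambda>x. c * \<phi> x)"
  by (rule test_mult[OF _ smooth_const])

lemma test_add:
  assumes "test_fun U \<phi>" "test_fun U \<psi>" shows "test_fun U (\<lambda>x. \<phi> x + \<psi> x)"
proof -
  from assms(1) obtain K where K: "smooth_fun \<phi>" "compact K" "K \<subseteq> U" "\<And>x. x \<notin> K \<Longrightarrow> \<phi> x = 0" by (rule test_funE) blast
  from assms(2) obtain L where L: "smooth_fun \<psi>" "compact L" "L \<subseteq> U" "\<And>x. x \<notin> L \<Longrightarrow> \<psi> x = 0" by (rule test_funE) blast
  show ?thesis by (rule test_funI[OF smooth_add[OF K(1) L(1)] compact_Un[OF K(2) L(2)]]) (use K L in auto)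
qed

lemma test_zero: "test_fun U (\<lambda>x. 0)"
  by (rule test_funI[OF smooth_const, of "{}"]) auto

lemma test_diag_map:
  assumes "test_fun U \<phi>" and c: "\<And>j. j \<in> Basis \<Longrightarrow> c j \<noteq> 0" and V: "\<And>x. diag_map a c x \<in> U \<Longrightarrow> x \<in> V"
  shows "test_fun V (\<lambda>x. \<phi> (diag_map a c x))"
proof -
  from assms(1) obtain K where K: "smooth_fun \<phi>" "compact K" "K \<subseteq> U" "\<And>x. x \<notin> K \<Longrightarrow> \<phi> x = 0" by (rule test_funE) blast
  \<comment> \<open>\<open>B\<close> is the inverse of \<open>diag_map a c\<close>; it carries the
    old support onto the new one.\<close>
  define B where "B = diag_map (\<Sum>j\<in>Basis. (- (a \<bullet> j) / c j) *\<^sub>R j) (\<lambda>j. 1 / c j)"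
  have B: "B x \<bullet> j = (x \<bullet> j - a \<bullet> j) / c j" if "j \<in> Basis" for x j
    unfolding B_def diag_map_inner[OF that] inner_sum_left_Basis[OF that] by (simp add: diff_divide_distrib)
  have BA: "B (diag_map a c x) = x" for x
    by (rule euclidean_eqI) (use c in \<open>auto simp: B diag_map_inner\<close>)
  have AB: "diag_map a c (B x) = x" for x
    by (rule euclidean_eqI) (use c in \<open>auto simp: B diag_map_inner\<close>)
  show ?thesis
  proof (rule test_funI[OF smooth_diag_map[OF K(1)]])
    show "compact (B ` K)" unfolding B_def by (rule compact_continuous_image[OF continuous_diag_map K(2)])
    show "B ` K \<subseteq> V" using K(3) V AB by fastforce
    show "\<phi> (diag_map a c x) = 0" if "x \<notin> B ` K" for x
      using that BA K(4) by (metis imageI)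
  qed
qed

lemma test_translate: "test_fun U \<phi> \<Longrightarrow> (\<And>x. x + a \<in> U \<Longrightarrow> x \<in> V) \<Longrightarrow> test_fun V (\<lambda>x. \<phi> (x + a))"
  using test_diag_map[of U \<phi> "\<lambda>j. 1" a V] by (simp add: diag_map_1)

lemma test_continuous: "test_fun U \<phi> \<Longrightarrow> continuous_on UNIV \<phi>"
  by (rule smooth_continuous[OF test_smooth])

lemma test_bounded:
  assumes "test_fun U \<phi>" shows "\<exists>B. \<forall>x. \<bar>\<phi> x\<bar> \<le> B"
proof -
  from assms obtain K where K: "smooth_fun \<phi>" "compact K" "K \<subseteq> U" "\<And>x. x \<notin> K \<Longrightarrow> \<phi> x = 0" by (rule test_funE) blast
  have "bounded (\<phi> ` K)"
    using K(2) continuous_on_subset[OF smooth_continuous[OF K(1)]] by (intro compact_imp_bounded compact_continuous_image) auto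
  then obtain B where B: "\<And>x. x \<in> K \<Longrightarrow> \<bar>\<phi> x\<bar> \<le> B" by (auto simp: bounded_iff)
  have "\<bar>\<phi> x\<bar> \<le> max B 0" for x using B[of x] K(4)[of x] by (cases "x \<in> K") auto
  then show ?thesis by blast
qed

text \<open>Converts a uniform bound on a fixed ball into an L2 bound. The later estimates of
  difference quotients of test functions are uniform ones.\<close>

lemma bounded_support_sqi:
  fixes f :: "'a::euclidean_space \<Rightarrow> real"
  assumes m: "f \<in> borel_measurable borel" and b: "\<And>x. \<bar>f x\<bar> \<le> c" and s: "\<And>x. x \<notin> cball 0 R \<Longrightarrow> f x = 0"
  shows "sqi f" "norm (cls f) \<le> c * sqrt (measure lborel (cball (0::'a) R))"
proof -
  have c: "0 \<le> c" using b[of 0] by linarith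
  have i: "integrable lborel (\<lambda>x. c\<^sup>2 * indicator (cball (0::'a) R) x)"
    using emeasure_lborel_cball_finite[of "0::'a" R] by (intro integrable_mult_right integrable_real_indicator) auto
  have le: "(f x)\<^sup>2 \<le> c\<^sup>2 * indicator (cball 0 R) x" for x
    using power_mono[OF b[of x], of 2] s[of x] by (auto simp: indicator_def)
  show sq: "sqi f" unfolding sqi_def
    using Bochner_Integration.integrable_bound[OF i, of "\<lambda>x. (f x)\<^sup>2"] m le by (auto simp: measurable_lborel1)
  have "(norm (cls f))\<^sup>2 \<le> (\<integral>x. c\<^sup>2 * indicator (cball (0::'a) R) x \<partial>lborel)"
    unfolding norm_cls[OF sq] by (intro integral_mono sqi_square sq i le)
  also have "\<dots> = (c * sqrt (measure lborel (cball (0::'a) R)))\<^sup>2" by (simp add: power_mult_distrib)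
  finally show "norm (cls f) \<le> c * sqrt (measure lborel (cball (0::'a) R))"
    by (rule power2_le_imp_le) (use c in simp)
qed

lemma test_sqi: "test_fun U \<phi> \<Longrightarrow> sqi \<phi>"
proof -
  assume t: "test_fun U \<phi>"
  from t obtain K where K: "smooth_fun \<phi>" "compact K" "K \<subseteq> U" "\<And>x. x \<notin> K \<Longrightarrow> \<phi> x = 0" by (rule test_funE) blast
  from compact_imp_bounded[OF K(2)] obtain R where R: "K \<subseteq> cball 0 R" by (auto simp: bounded_iff subset_iff)
  from test_bounded[OF t] obtain B where B: "\<And>x. \<bar>\<phi> x\<bar> \<le> B" by blast
  show "sqi \<phi>"
  proof (rule bounded_support_sqi(1)[of _ B R])
    show "\<phi> x = 0" if "x \<notin> cball 0 R" for x using that K(4) R by blast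
  qed (use B borel_measurable_continuous_onI[OF test_continuous[OF t]] in auto)
qed

lemma test_uniformly_continuous:
  assumes "test_fun U \<phi>" "0 < e"
  shows "\<exists>d>0. \<forall>x y. dist x y < d \<longrightarrow> \<bar>\<phi> x - \<phi> y\<bar> < e"
proof -
  from assms(1) obtain K where K: "smooth_fun \<phi>" "compact K" "K \<subseteq> U" "\<And>x. x \<notin> K \<Longrightarrow> \<phi> x = 0" by (rule test_funE) blast
  from compact_imp_bounded[OF K(2)] obtain R where R: "K \<subseteq> cball 0 R" by (auto simp: bounded_iff subset_iff)
  \<comment> \<open>Because of the radius \<open>R + 1\<close>, two points at distance below 1 are
    either both in this ball or both outside the support.\<close>
  have "uniformly_continuous_on (cball 0 (R + 1)) \<phi>"
    by (rule compact_uniformly_continuous[OF continuous_on_subset[OF smooth_continuous[OF K(1)]]]) auto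
  then obtain d where d: "0 < d" "\<And>x y. x \<in> cball 0 (R+1) \<Longrightarrow> y \<in> cball 0 (R+1) \<Longrightarrow> dist x y < d \<Longrightarrow> dist (\<phi> x) (\<phi> y) < e"
    unfolding uniformly_continuous_on_def using assms(2) by metis
  have "\<bar>\<phi> x - \<phi> y\<bar> < e" if "dist x y < min d 1" for x y
  proof (cases "x \<in> cball 0 (R+1) \<and> y \<in> cball 0 (R+1)")
    case True then show ?thesis using d(2)[of x y] that by (simp add: dist_real_def)
  next
    case False
    then have "norm x > R" "norm y > R" using that norm_triangle_ineq2[of x y] norm_triangle_ineq2[of y x]
      by (auto simp: dist_norm norm_minus_commute)
    then have "x \<notin> K" "y \<notin> K" using R by auto
    then show ?thesis using K(4) assms(2) by simp
  qed
  then show ?thesis using d(1) by (intro exI[of _ "min d 1"]) auto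
qed

section \<open>Box bumps and the fundamental lemma\<close>

lemma poly_div_exp_at_top: "((\<lambda>s. poly p s / exp s) \<longlongrightarrow> (0::real)) at_top"
proof -
  have "((\<lambda>s. \<Sum>i\<le>degree p. coeff p i * (s ^ i / exp s)) \<longlongrightarrow> (\<Sum>i\<le>degree p. coeff p i * 0)) at_top"
    by (intro tendsto_sum tendsto_mult tendsto_const tendsto_power_div_exp_0)
  then show ?thesis by (simp add: poly_altdef sum_divide_distrib)
qed

text \<open>The functions p(1/t) exp(-1/t) for t > 0, extended by zero: a family closed under
  differentiation that contains the standard flat function \<open>pexp 1\<close>.\<close>

definition pexp :: "real poly \<Rightarrow> real \<Rightarrow> real" where
  "pexp p t = (if t > 0 then poly p (1/t) * exp (- (1/t)) else 0)"

text \<open>With s = 1/t, differentiation replaces p(s) by s^2 (p(s) - p'(s)), which is the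
  polynomial displayed. At t = 0 the difference quotient vanishes because exp(s) beats every
  polynomial.\<close>

lemma pexp_has_derivative:
  "(pexp p has_real_derivative pexp (monom 1 2 * (p - pderiv p)) t) (at t)"
proof -
  consider "t > 0" | "t < 0" | "t = 0" by linarith
  then show ?thesis
  proof cases
    case 1
    have inv: "((\<lambda>t. 1/t) has_real_derivative - (1/t)\<^sup>2) (at t)"
      using 1 by (auto intro!: derivative_eq_intros simp: power2_eq_square)
    have a: "((\<lambda>t. poly p (1/t)) has_real_derivative poly (pderiv p) (1/t) * (- (1/t)\<^sup>2)) (at t)"
      by (rule DERIV_chain2[OF poly_DERIV inv])
    have b: "((\<lambda>t. exp (- (1/t))) has_real_derivative exp (- (1/t)) * (- (- (1/t)\<^sup>2))) (at t)"
      by (rule DERIV_chain2[OF DERIV_exp DERIV_minus[OF inv]])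
    have "((\<lambda>t. poly p (1/t) * exp (- (1/t))) has_real_derivative pexp (monom 1 2 * (p - pderiv p)) t) (at t)"
      by (rule DERIV_cong[OF DERIV_mult[OF a b]]) (use 1 in \<open>simp add: pexp_def poly_monom algebra_simps\<close>)
    then show ?thesis
      by (rule has_field_derivative_transform_within_open[of _ _ _ "{0<..}"]) (use 1 in \<open>auto simp: pexp_def\<close>)
  next
    case 2
    have "((\<lambda>t. 0::real) has_real_derivative pexp (monom 1 2 * (p - pderiv p)) t) (at t)"
      using 2 by (simp add: pexp_def)
    then show ?thesis
      by (rule has_field_derivative_transform_within_open[of _ _ _ "{..<0}"]) (use 2 in \<open>auto simp: pexp_def\<close>)
  next
    case 3
    have "((\<lambda>h. pexp p h / h) \<longlongrightarrow> 0) (at_right 0)"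
      unfolding filterlim_at_right_to_top
    proof (rule Lim_transform_eventually[OF poly_div_exp_at_top[of "pCons 0 p"]])
      show "\<forall>\<^sub>F x in at_top. poly (pCons 0 p) x / exp x = pexp p (inverse x) / inverse x"
        using eventually_gt_at_top[of "0::real"]
        by eventually_elim (simp add: pexp_def exp_minus field_simps)
    qed
    moreover have "((\<lambda>h. pexp p h / h) \<longlongrightarrow> 0) (at_left 0)"
      by (rule Lim_transform_eventually[OF tendsto_const])
        (auto simp: pexp_def eventually_at_left_field intro!: exI[of _ "-1"])
    ultimately have "((\<lambda>h. pexp p h / h) \<longlongrightarrow> 0) (at 0)" by (simp add: filterlim_split_at)
    then show ?thesis unfolding 3 DERIV_def by (simp add: pexp_def)
  qed
qed

lemma smooth_pexp: "smooth_fun (pexp p)"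
proof (rule smooth_funI[of _ "range pexp"])
  show "continuous_on UNIV f" if "f \<in> range pexp" for f
    using that pexp_has_derivative by (auto intro!: continuous_at_imp_continuous_on DERIV_isCont)
  show "\<exists>g\<in>range pexp. dd f b g" if f: "f \<in> range pexp" and "b \<in> Basis" for f and b :: real
  proof -
    from f obtain p where p: "f = pexp p" by blast
    have b: "b = 1" using that by simp
    have "dd f b (pexp (monom 1 2 * (p - pderiv p)))"
    proof
      fix x
      have "(pexp p has_real_derivative pexp (monom 1 2 * (p - pderiv p)) x) (at (0 + x))"
        using pexp_has_derivative by simp
      then show "((\<lambda>t. f (x + t *\<^sub>R b)) has_real_derivative pexp (monom 1 2 * (p - pderiv p)) x) (at 0)"
        unfolding p b using DERIV_shift[of "pexp p" _ 0 x] by (simp add: add.commute)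
    qed
    then show ?thesis by blast
  qed
qed simp

lemma pexp1_bounds: "0 \<le> pexp 1 t" "pexp 1 t \<le> 1"
  by (auto simp: pexp_def)

lemma pexp1_tendsto: "(\<lambda>n. pexp 1 (real (Suc n) * c)) \<longlonglongrightarrow> indicator {0<..} c"
proof (cases "c > 0")
  case True
  have "(\<lambda>n. exp (- (1 / c * (1 / real (Suc n))))) \<longlonglongrightarrow> exp (- (1 / c * 0))"
    by (intro tendsto_intros LIMSEQ_Suc[OF lim_1_over_n])
  moreover have "pexp 1 (real (Suc n) * c) = exp (- (1 / c * (1 / real (Suc n))))" for n
  proof -
    have "0 < real (Suc n) * c" using True by (intro mult_pos_pos) auto
    then show ?thesis by (simp add: pexp_def mult.commute del: of_nat_Suc)
  qed
  ultimately show ?thesis using True by simp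
next
  case False
  then show ?thesis by (simp add: pexp_def zero_less_mult_iff)
qed

text \<open>A product of flat functions of the distances to the faces, steepened by
  \<open>Suc n\<close>: smooth, zero off the open box, and tending to its indicator.\<close>

definition box_bump :: "'a::euclidean_space \<Rightarrow> 'a \<Rightarrow> nat \<Rightarrow> 'a \<Rightarrow> real" where
  "box_bump a b n x = (\<Prod>i\<in>Basis. pexp 1 (real (Suc n) * (x \<bullet> i - a \<bullet> i)) * pexp 1 (real (Suc n) * (b \<bullet> i - x \<bullet> i)))"

lemma smooth_box_bump: "smooth_fun (box_bump a b n)"
proof -
  have 1: "smooth_fun (\<lambda>x::'a. pexp 1 (real (Suc n) * (x \<bullet> i - a \<bullet> i)))" for i
    using smooth_of_linear[OF smooth_pexp, of 1 "real (Suc n) *\<^sub>R i" "- (real (Suc n) * (a \<bullet> i))"]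
    by (simp add: algebra_simps del: of_nat_Suc)
  have 2: "smooth_fun (\<lambda>x::'a. pexp 1 (real (Suc n) * (b \<bullet> i - x \<bullet> i)))" for i
    using smooth_of_linear[OF smooth_pexp, of 1 "(- real (Suc n)) *\<^sub>R i" "real (Suc n) * (b \<bullet> i)"]
    by (simp add: algebra_simps del: of_nat_Suc)
  show ?thesis unfolding box_bump_def by (intro smooth_prod smooth_mult 1 2) auto
qed

lemma box_bump_bounds: "0 \<le> box_bump a b n x" "box_bump a b n x \<le> 1"
  unfolding box_bump_def by (auto intro!: prod_nonneg prod_le_1 mult_nonneg_nonneg mult_le_one pexp1_bounds)

lemma box_bump_outside: "x \<notin> box a b \<Longrightarrow> box_bump a b n x = 0"
proof -
  assume "x \<notin> box a b"
  then obtain i where i: "i \<in> Basis" "x \<bullet> i \<le> a \<bullet> i \<or> b \<bullet> i \<le> x \<bullet> i" by (auto simp: box_def not_less)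
  then have "real (Suc n) * (x \<bullet> i - a \<bullet> i) \<le> 0 \<or> real (Suc n) * (b \<bullet> i - x \<bullet> i) \<le> 0"
    by (auto intro!: mult_nonneg_nonpos)
  then have "pexp 1 (real (Suc n) * (x \<bullet> i - a \<bullet> i)) * pexp 1 (real (Suc n) * (b \<bullet> i - x \<bullet> i)) = 0"
    unfolding pexp_def by auto
  then show ?thesis unfolding box_bump_def using i(1) by (intro prod_zero) auto
qed

lemma test_box_bump: "cbox a b \<subseteq> U \<Longrightarrow> test_fun U (box_bump a b n)"
  by (rule test_funI[OF smooth_box_bump compact_cbox]) (use box_bump_outside box_subset_cbox in blast)+

lemma box_bump_tendsto_pointwise: "(\<lambda>n. box_bump a b n x) \<longlonglongrightarrow> indicator (box a b) x"
proof -
  have "(\<lambda>n. box_bump a b n x) \<longlonglongrightarrow>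
     (\<Prod>i\<in>Basis. indicator {0<..} (x \<bullet> i - a \<bullet> i) * indicator {0<..} (b \<bullet> i - x \<bullet> i))"
    unfolding box_bump_def by (intro tendsto_prod tendsto_mult pexp1_tendsto)
  moreover have "(\<Prod>i\<in>Basis. indicator {0<..} (x \<bullet> i - a \<bullet> i) * indicator {0<..} (b \<bullet> i - x \<bullet> i)) = (indicator (box a b) x :: real)"
    by (auto simp: indicator_def box_def)
  ultimately show ?thesis by simp
qed

lemma l2_dominated_convergence:
  assumes f: "\<And>n. sqi (f n)" and g: "sqi g" and w: "sqi w"
    and b: "\<And>n. AE x in lborel. \<bar>f n x\<bar> \<le> w x" and c: "AE x in lborel. (\<lambda>n. f n x) \<longlonglongrightarrow> g x"
  shows "(\<lambda>n. cls (f n)) \<longlonglongrightarrow> cls g"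
proof (rule tendsto_nn_norm[OF f g])
  note [measurable] = sqi_measurable[OF f] sqi_measurable[OF g] sqi_measurable[OF w]
  have "(\<lambda>n. \<integral>x. (f n x - g x)\<^sup>2 \<partial>lborel) \<longlonglongrightarrow> (\<integral>x. 0 \<partial>(lborel::'a measure))"
  proof (rule integral_dominated_convergence[where w="\<lambda>x. 2 * (w x)\<^sup>2 + 2 * (g x)\<^sup>2"])
    show "integrable lborel (\<lambda>x. 2 * (w x)\<^sup>2 + 2 * (g x)\<^sup>2)" using sqi_square[OF w] sqi_square[OF g] by auto
    show "AE x in lborel. (\<lambda>n. (f n x - g x)\<^sup>2) \<longlonglongrightarrow> 0"
      using c
    proof eventually_elim
      fix x assume "(\<lambda>n. f n x) \<longlonglongrightarrow> g x"
      then have "(\<lambda>n. (f n x - g x)\<^sup>2) \<longlonglongrightarrow> (g x - g x)\<^sup>2" by (intro tendsto_intros)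
      then show "(\<lambda>n. (f n x - g x)\<^sup>2) \<longlonglongrightarrow> 0" by simp
    qed
    show "AE x in lborel. norm ((f n x - g x)\<^sup>2) \<le> 2 * (w x)\<^sup>2 + 2 * (g x)\<^sup>2" for n
      using b[of n]
    proof eventually_elim
      fix x assume "\<bar>f n x\<bar> \<le> w x"
      then have "(f n x)\<^sup>2 \<le> (w x)\<^sup>2" using power_mono[of "\<bar>f n x\<bar>" "w x" 2] by simp
      moreover have "(f n x - g x)\<^sup>2 \<le> 2 * (f n x)\<^sup>2 + 2 * (g x)\<^sup>2"
        using zero_le_power2[of "f n x + g x"] by (simp add: power2_sum power2_diff)
      ultimately show "norm ((f n x - g x)\<^sup>2) \<le> 2 * (w x)\<^sup>2 + 2 * (g x)\<^sup>2" by simp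
    qed
  qed auto
  then show "(\<lambda>n. \<integral>x. (f n x - g x)\<^sup>2 \<partial>lborel) \<longlonglongrightarrow> 0" by simp
qed

lemma sqi_indicator_box: "sqi (indicator (box a b))"
proof -
  have "(\<lambda>x. (indicator (box a b) x)\<^sup>2) = (indicator (box a b) :: _ \<Rightarrow> real)" by (auto simp: indicator_def)
  then show ?thesis unfolding sqi_def by (simp add: emeasure_lborel_box_eq)
qed

lemma sqi_indicator_mult:
  assumes "sqi f" "A \<in> sets borel" shows "sqi (\<lambda>x. indicator A x * f x)"
proof -
  have eq: "(indicator A x * f x)\<^sup>2 = indicator A x * (f x)\<^sup>2" for x by (auto simp: indicator_def)
  from assms show ?thesis unfolding sqi_def eq
    using integrable_mult_indicator[of A lborel "\<lambda>x. (f x)\<^sup>2"] by auto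
qed

lemma box_bump_tendsto: "(\<lambda>n. cls (box_bump a b n)) \<longlonglongrightarrow> cls (indicator (box a b))"
proof (rule l2_dominated_convergence[where w="indicator (box a b)"])
  show "sqi (box_bump a b n)" for n by (rule test_sqi[OF test_box_bump[OF order_refl]])
  show "AE x in lborel. \<bar>box_bump a b n x\<bar> \<le> indicator (box a b) x" for n
  proof (rule AE_I2)
    fix x show "\<bar>box_bump a b n x\<bar> \<le> indicator (box a b) x"
      using box_bump_bounds[of a b n x] box_bump_outside[of x a b n] by (cases "x \<in> box a b") auto
  qed
qed (auto intro: sqi_indicator_box box_bump_tendsto_pointwise)

text \<open>The positive and negative parts of \<open>f\<close>, taken as densities, define measures
  that agree on boxes, an intersection-stable generator of the Borel sets.\<close>

lemma zero_integral_on_boxes: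
  fixes f :: "'a::euclidean_space \<Rightarrow> real"
  assumes f: "integrable lborel f" and 0: "\<And>a b. (\<integral>x. indicator (box a b) x * f x \<partial>lborel) = 0"
  shows "AE x in lborel. f x = 0"
proof -
  have [measurable]: "f \<in> borel_measurable borel" using f by auto
  define M1 where "M1 = density lborel (\<lambda>x. ennreal (f x))"
  define M2 where "M2 = density lborel (\<lambda>x. ennreal (- f x))"
  have e1: "emeasure M1 A = (\<integral>\<^sup>+x. ennreal (indicator A x * f x) \<partial>lborel)" if "A \<in> sets borel" for A
    unfolding M1_def using that
    by (subst emeasure_density) (auto intro!: nn_integral_cong simp: indicator_def)
  have e2: "emeasure M2 A = (\<integral>\<^sup>+x. ennreal (- (indicator A x * f x)) \<partial>lborel)" if "A \<in> sets borel" for A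
    unfolding M2_def using that
    by (subst emeasure_density) (auto intro!: nn_integral_cong simp: indicator_def)
  have int: "integrable lborel (\<lambda>x. indicator A x * f x)" if "A \<in> sets borel" for A
    using integrable_mult_indicator[OF _ f, of A] that by auto
  have fin1: "emeasure M1 A \<noteq> \<infinity>" if "A \<in> sets borel" for A
    using int[OF that] unfolding e1[OF that] real_integrable_def by auto
  have fin2: "emeasure M2 A \<noteq> \<infinity>" if "A \<in> sets borel" for A
    using int[OF that] unfolding e2[OF that] real_integrable_def by auto
  have eq: "emeasure M1 (box a b) = emeasure M2 (box a b)" for a b
  proof -
    have "enn2real (emeasure M1 (box a b)) - enn2real (emeasure M2 (box a b)) = 0"
      using 0[of a b] real_lebesgue_integral_def[OF int[of "box a b"]] e1[of "box a b"] e2[of "box a b"] by simp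
    then show ?thesis using fin1[of "box a b"] fin2[of "box a b"]
      by (metis borel_open eq_iff_diff_eq_0 ennreal_enn2real infinity_ennreal_def open_box top.not_eq_extremum)
  qed
  have "M1 = M2"
  proof (rule measure_eqI_generator_eq)
    let ?E = "range (\<lambda>(a, b). box a b::'a set)"
    show "Int_stable ?E" by (auto simp: Int_stable_def box_Int_box)
    show "?E \<subseteq> Pow UNIV" "sets M1 = sigma_sets UNIV ?E" "sets M2 = sigma_sets UNIV ?E"
      by (simp_all add: borel_eq_box M1_def M2_def)
    let ?A = "\<lambda>n::nat. box (- (real n *\<^sub>R One)) (real n *\<^sub>R One) :: 'a set"
    show "range ?A \<subseteq> ?E" "(\<Union>i. ?A i) = UNIV" unfolding UN_box_eq_UNIV by auto
    show "emeasure M1 (?A i) \<noteq> \<infinity>" for i by (rule fin1) simp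
    show "emeasure M1 X = emeasure M2 X" if "X \<in> ?E" for X using that eq by auto
  qed
  then have "AE x in lborel. ennreal (f x) = ennreal (- f x)"
    unfolding M1_def M2_def
    by (subst (asm) sigma_finite_measure.density_unique_iff[OF sigma_finite_lborel]) auto
  then show ?thesis
  proof eventually_elim
    fix x assume *: "ennreal (f x) = ennreal (- f x)"
    show "f x = 0"
    proof (cases "0 \<le> f x")
      case True
      then have "ennreal (f x) = 0" using * by (simp add: ennreal_neg)
      then show ?thesis using True by simp
    next
      case False
      then have "ennreal (- f x) = 0" using * by (simp add: ennreal_neg)
      then show ?thesis using False by simp
    qed
  qed
qed

text \<open>Only box bumps are used as tests. This pays off later, since a bump in three dimensions
  is the product of a planar and a one-dimensional bump.\<close>

lemma fundamental_lemma_boxes: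
  fixes F :: "'a::euclidean_space l2"
  assumes U: "open U" and 0: "\<And>a b n. cbox a b \<subseteq> U \<Longrightarrow> inner F (cls (box_bump a b n)) = 0"
  shows "AE x in lebesgue. x \<in> U \<longrightarrow> fn F x = 0"
proof -
  have box0: "AE x in lborel. x \<in> box a b \<longrightarrow> fn F x = 0" if ab: "cbox a b \<subseteq> U" for a b
  proof -
    define f where "f x = indicator (box a b) x * fn F x" for x
    have "integrable lborel (\<lambda>x. indicator (box a b) x * fn F x)"
      by (rule sqi_mult[OF sqi_indicator_box sqi_fn])
    then have int: "integrable lborel f" by (simp add: f_def[abs_def])
    have "(\<integral>x. indicator (box c d) x * f x \<partial>lborel) = 0" for c d
    proof -
      obtain p q where pq: "box c d \<inter> box a b = box p q" using box_Int_box[of c d a b] by blast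
      have "inner F (cls (indicator (box p q))) = 0"
      proof (cases "box p q = {}")
        case True
        then have "indicator (box p q) = (\<lambda>x::'a. 0::real)" by (simp add: fun_eq_iff)
        then show ?thesis by (simp flip: cls_zero)
      next
        case False
        then have "cbox p q = closure (box p q)" by simp
        also have "\<dots> \<subseteq> cbox a b" unfolding pq[symmetric]
          by (rule closure_minimal) (use box_subset_cbox in auto)
        finally have "cbox p q \<subseteq> U" using ab by blast
        from 0[OF this] have "(\<lambda>n. inner F (cls (box_bump p q n))) \<longlonglongrightarrow> 0" by simp
        moreover have "(\<lambda>n. inner F (cls (box_bump p q n))) \<longlonglongrightarrow> inner F (cls (indicator (box p q)))"
          by (intro tendsto_intros box_bump_tendsto)
        ultimately show ?thesis using LIMSEQ_unique by blast
      qed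
      moreover have "inner F (cls (indicator (box p q))) = (\<integral>x. fn F x * indicator (box p q) x \<partial>lborel)"
        using inner_cls[OF sqi_fn[of F] sqi_indicator_box[of p q]] by simp
      moreover have "fn F x * indicator (box p q) x = indicator (box c d) x * f x" for x
        unfolding f_def pq[symmetric] by (auto simp: indicator_def)
      ultimately show ?thesis by simp
    qed
    from zero_integral_on_boxes[OF int this] show ?thesis
      by eventually_elim (auto simp: f_def indicator_def)
  qed
  obtain I :: "('a \<times> 'a) set" where I: "countable I" "\<And>a b. (a, b) \<in> I \<Longrightarrow> cbox a b \<subseteq> U" "U \<subseteq> (\<Union>(a,b)\<in>I. box a b)"
  proof -
    \<comment> \<open>Boxes with rational corners inside \<open>U\<close> form a countable cover of
      \<open>U\<close>, so their exceptional null sets can be united.\<close>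
    define Q where "Q = {f \<in> (Basis :: 'a set) \<rightarrow>\<^sub>E (\<rat> :: real set). True}"
    define v where "v f = (\<Sum>i\<in>Basis. f i *\<^sub>R i :: 'a)" for f :: "'a \<Rightarrow> real"
    define I where "I = {(a,b) \<in> v ` Q \<times> v ` Q. cbox a b \<subseteq> U}"
    have "countable Q" unfolding Q_def by (simp add: countable_PiE countable_rat)
    then have "countable (v ` Q \<times> v ` Q)" by (intro countable_SIGMA countable_image)
    then have "countable I" unfolding I_def by (rule countable_subset[rotated]) auto
    moreover have "x \<in> (\<Union>(a,b)\<in>I. box a b)" if x: "x \<in> U" for x
    proof -
      obtain e where e: "0 < e" "ball x e \<subseteq> U" using U x open_contains_ball by blast
      \<comment> \<open>With an error of at most \<open>d\<close> in each of the
        \<open>DIM('a)\<close> coordinates, the l1 bound for the norm keeps the box within distance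
        \<open>e / 2\<close> of \<open>x\<close>.\<close>
      define d where "d = e / (2 * real DIM('a))"
      have d: "0 < d" using e by (simp add: d_def)
      have "\<forall>i. \<exists>r\<in>\<rat>. x \<bullet> i - d < r \<and> r < x \<bullet> i" using d by (metis Rats_dense_in_real diff_less_eq less_add_same_cancel1)
      then obtain p where p: "\<And>i. p i \<in> \<rat>" "\<And>i. x \<bullet> i - d < p i" "\<And>i. p i < x \<bullet> i" by metis
      have "\<forall>i. \<exists>r\<in>\<rat>. x \<bullet> i < r \<and> r < x \<bullet> i + d" using d by (metis Rats_dense_in_real less_add_same_cancel1)
      then obtain q where q: "\<And>i. q i \<in> \<rat>" "\<And>i. q i < x \<bullet> i + d" "\<And>i. x \<bullet> i < q i" by metis
      have vr: "v (restrict r Basis) \<bullet> i = r i" if "i \<in> Basis" for r i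
        using that by (simp add: v_def)
      have "cbox (v (restrict p Basis)) (v (restrict q Basis)) \<subseteq> ball x e"
      proof
        fix y assume y: "y \<in> cbox (v (restrict p Basis)) (v (restrict q Basis))"
        have "norm (x - y) \<le> (\<Sum>i\<in>Basis. \<bar>(x - y) \<bullet> i\<bar>)" by (rule norm_le_l1)
        also have "\<dots> \<le> (\<Sum>i\<in>(Basis::'a set). d)"
        proof (rule sum_mono)
          fix i :: 'a assume i: "i \<in> Basis"
          then have "p i \<le> y \<bullet> i" "y \<bullet> i \<le> q i" using y vr by (auto simp: mem_box)
          then show "\<bar>(x - y) \<bullet> i\<bar> \<le> d" using p(2)[of i] q(2)[of i] by (simp add: inner_diff_left)
        qed
        also have "\<dots> = e / 2" by (simp add: d_def)
        finally show "y \<in> ball x e" using e by (simp add: dist_norm)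
      qed
      moreover have "x \<in> box (v (restrict p Basis)) (v (restrict q Basis))" using p q vr by (auto simp: mem_box)
      moreover have "restrict p Basis \<in> Q" "restrict q Basis \<in> Q" using p q by (auto simp: Q_def)
      ultimately show ?thesis using e unfolding I_def by blast
    qed
    ultimately show ?thesis using that[of I] unfolding I_def by blast
  qed
  have "AE x in lborel. \<forall>(a,b)\<in>I. x \<in> box a b \<longrightarrow> fn F x = 0"
    unfolding AE_ball_countable[OF I(1)] using box0 I(2) by auto
  then have "AE x in lborel. x \<in> U \<longrightarrow> fn F x = 0"
    by eventually_elim (use I(3) in blast)
  then show ?thesis by (rule AE_completion)
qed

lemma fundamental_lemma:
  assumes U: "open U" and F: "supp_in U F" and 0: "\<And>\<phi>. test_fun U \<phi> \<Longrightarrow> inner F (cls \<phi>) = 0"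
  shows "F = 0"
proof -
  have "AE x in lebesgue. x \<in> U \<longrightarrow> fn F x = 0"
    by (rule fundamental_lemma_boxes[OF U]) (use 0 test_box_bump in blast)
  then have "AE x in lebesgue. fn F x = fn 0 x"
    using F fn_zero unfolding supp_in_def by eventually_elim auto
  then show ?thesis unfolding l2_eq_iff AE_completion_iff .
qed

lemma sets_lebesgue_open: "open U \<Longrightarrow> U \<in> sets lebesgue"
  by auto

lemma supp_in_test: "test_fun U \<phi> \<Longrightarrow> supp_in U (cls \<phi>)"
proof -
  assume t: "test_fun U \<phi>"
  then obtain K where "K \<subseteq> U" "\<And>x. x \<notin> K \<Longrightarrow> \<phi> x = 0" by (rule test_funE) blast
  then have "\<And>x. x \<notin> U \<Longrightarrow> \<phi> x = 0" by blast
  then show ?thesis unfolding supp_in_def using AE_completion[OF fn_cls[OF test_sqi[OF t]]]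
    by (auto elim!: eventually_mono)
qed

text \<open>The fundamental lemma supplies exactly the uniqueness that the density criterion asks
  for.\<close>

lemma test_dense:
  assumes U: "open U" shows "Collect (supp_in U) \<subseteq> closure (cls ` Collect (test_fun U))"
proof (rule orthogonal_subset_dense)
  show "subspace (cls ` Collect (test_fun U))" unfolding subspace_def
  proof (intro conjI ballI allI)
    show "0 \<in> cls ` Collect (test_fun U)" unfolding cls_zero using test_zero by (intro imageI) simp
    show "x + y \<in> cls ` Collect (test_fun U)" if xy: "x \<in> cls ` Collect (test_fun U)" "y \<in> cls ` Collect (test_fun U)" for x y
    proof -
      from xy obtain f g where f: "x = cls f" "test_fun U f" and g: "y = cls g" "test_fun U g" by auto
      show ?thesis unfolding f g cls_add[OF test_sqi[OF f(2)] test_sqi[OF g(2)]] using test_add[OF f(2) g(2)] by (intro imageI) simp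
    qed
    show "c *\<^sub>R x \<in> cls ` Collect (test_fun U)" if x: "x \<in> cls ` Collect (test_fun U)" for c x
    proof -
      from x obtain f where f: "x = cls f" "test_fun U f" by auto
      show ?thesis unfolding f cls_scale[OF test_sqi[OF f(2)]] using test_scale[OF f(2)] by (intro imageI) simp
    qed
  qed
  show "cls ` Collect (test_fun U) \<subseteq> Collect (supp_in U)" using supp_in_test by auto
  show "subspace (Collect (supp_in U))" unfolding subspace_def mem_Collect_eq supp_in_iff_orthogonal[OF sets_lebesgue_open[OF U]]
    by (auto simp: inner_simps)
  show "closed (Collect (supp_in U))" unfolding supp_in_iff_orthogonal[OF sets_lebesgue_open[OF U]]
    by (intro closed_Collect_all closed_Collect_eq continuous_intros)
  show "x = 0" if "x \<in> Collect (supp_in U)" "\<And>s. s \<in> cls ` Collect (test_fun U) \<Longrightarrow> inner x s = 0" for x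
    using fundamental_lemma[OF U] that by auto
qed

section \<open>Translations and Liouville's theorem\<close>

lemma lborel_integral_shift:
  fixes f :: "'a::euclidean_space \<Rightarrow> real"
  assumes [measurable]: "f \<in> borel_measurable borel"
  shows "(\<integral>x. f (x + a) \<partial>lborel) = (\<integral>x. f x \<partial>lborel)"
proof -
  have "(\<integral>x. f x \<partial>lborel) = (\<integral>x. f x \<partial>distr lborel borel ((+) a))" by (simp add: lborel_distr_plus)
  also have "\<dots> = (\<integral>x. f (a + x) \<partial>lborel)" by (subst integral_distr) auto
  finally show ?thesis by (simp add: add.commute)
qed

lemma sqi_shift:
  fixes f :: "'a::euclidean_space \<Rightarrow> real"
  assumes f: "sqi f" shows "sqi (\<lambda>x. f (x + a))"
proof -
  have [measurable]: "f \<in> borel_measurable borel" using f by (rule sqi_measurable)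
  have "integrable (distr lborel borel ((+) a)) (\<lambda>x. (f x)\<^sup>2)" using sqi_square[OF f] by (simp add: lborel_distr_plus)
  then have "integrable lborel (\<lambda>x. (f (a + x))\<^sup>2)" by (subst (asm) integrable_distr_eq) auto
  then show ?thesis by (simp add: sqi_def add.commute)
qed

lemma inner_cls_shift:
  assumes "sqi f" "sqi g"
  shows "inner (cls (\<lambda>x. f (x + a))) (cls (\<lambda>x. g (x + a))) = inner (cls f) (cls g)"
proof -
  have "(\<lambda>x. f x * g x) \<in> borel_measurable borel" using assms by (auto intro: sqi_measurable borel_measurable_times)
  from lborel_integral_shift[OF this, of a] show ?thesis by (simp add: inner_cls sqi_shift assms)
qed

lemma norm_cls_shift: "sqi f \<Longrightarrow> norm (cls (\<lambda>x. f (x + a))) = norm (cls f)"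
  by (simp add: norm_eq_sqrt_inner inner_cls_shift)

lemma test_shift: "test_fun UNIV \<phi> \<Longrightarrow> test_fun UNIV (\<lambda>x. \<phi> (x + a))"
  by (rule test_translate) auto

lemma test_support_ball:
  assumes "test_fun U \<phi>"
  shows "\<exists>R. (\<forall>x. x \<notin> cball 0 R \<longrightarrow> \<phi> x = 0) \<and> 0 < R"
proof -
  from assms obtain K where K: "smooth_fun \<phi>" "compact K" "K \<subseteq> U" "\<And>x. x \<notin> K \<Longrightarrow> \<phi> x = 0" by (rule test_funE) blast
  from compact_imp_bounded[OF K(2)] obtain R where "0 < R" "\<forall>x\<in>K. norm x \<le> R" using bounded_pos by blast
  with K(4) show ?thesis by (intro exI[of _ R]) auto
qed

text \<open>The mean value bound and uniform continuity of the derivative control the first-order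
  remainder uniformly. For increments below 1 its support stays in one ball, and the uniform bound
  becomes an L2 bound.\<close>

lemma test_shift_has_derivative:
  fixes \<phi> :: "'a::euclidean_space \<Rightarrow> real"
  assumes t: "test_fun UNIV \<phi>" and b: "b \<in> Basis"
  shows "((\<lambda>t. cls (\<lambda>x. \<phi> (x + t *\<^sub>R b))) has_vector_derivative cls (\<lambda>x. dir_deriv \<phi> b (x + t *\<^sub>R b))) (at t)"
  unfolding has_vector_derivative_def has_derivative_at_alt
proof (intro conjI allI impI)
  show "bounded_linear (\<lambda>x. x *\<^sub>R cls (\<lambda>x. dir_deriv \<phi> b (x + t *\<^sub>R b)))" by (rule bounded_linear_scaleR_left)
  fix e :: real assume e: "0 < e"
  let ?\<psi> = "dir_deriv \<phi> b"
  have t': "test_fun UNIV ?\<psi>" by (rule test_dir_deriv[OF t b])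
  obtain R where R: "\<And>x. x \<notin> cball 0 R \<Longrightarrow> \<phi> x = 0" "0 < R" using test_support_ball[OF t] by blast
  define c where "c = sqrt (measure lborel (cball (0::'a) (R + \<bar>t\<bar> + 1)))"
  have c: "0 \<le> c" by (simp add: c_def)
  define e' where "e' = e / (c + 1)"
  have e': "0 < e'" using e c by (simp add: e'_def)
  obtain d where d: "0 < d" "\<And>x y. dist x y < d \<Longrightarrow> \<bar>?\<psi> x - ?\<psi> y\<bar> < e'"
    using test_uniformly_continuous[OF t' e'] by blast
  show "\<exists>d>0. \<forall>y. norm (y - t) < d \<longrightarrow> norm (cls (\<lambda>x. \<phi> (x + y *\<^sub>R b)) - cls (\<lambda>x. \<phi> (x + t *\<^sub>R b))
        - (y - t) *\<^sub>R cls (\<lambda>x. ?\<psi> (x + t *\<^sub>R b))) \<le> e * norm (y - t)"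
  proof (intro exI[of _ "min d 1"] conjI allI impI)
    show "0 < min d 1" using d by simp
    fix y assume y: "norm (y - t) < min d 1"
    define h where "h = y - t"
    define g where "g x = \<phi> (x + y *\<^sub>R b) - \<phi> (x + t *\<^sub>R b) - h * ?\<psi> (x + t *\<^sub>R b)" for x
    have gb: "\<bar>g x\<bar> \<le> e' * \<bar>h\<bar>" for x
    proof -
      define q where "q s = \<phi> (x + t *\<^sub>R b + s *\<^sub>R b) - s * ?\<psi> (x + t *\<^sub>R b)" for s
      have "norm (q h - q 0) \<le> e' * norm (h - 0)"
      proof (rule field_differentiable_bound[where S="{-\<bar>h\<bar>..\<bar>h\<bar>}"])
        show "(q has_field_derivative ?\<psi> (x + t *\<^sub>R b + s *\<^sub>R b) - ?\<psi> (x + t *\<^sub>R b)) (at s within {-\<bar>h\<bar>..\<bar>h\<bar>})" for s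
          unfolding q_def
          by (rule DERIV_subset[OF DERIV_diff[OF smooth_line_deriv[OF test_smooth[OF t] b]]])
            (auto intro!: derivative_eq_intros)
        show "norm (?\<psi> (x + t *\<^sub>R b + s *\<^sub>R b) - ?\<psi> (x + t *\<^sub>R b)) \<le> e'" if "s \<in> {-\<bar>h\<bar>..\<bar>h\<bar>}" for s
        proof -
          have "\<bar>s\<bar> < d" using that y by (auto simp: h_def)
          then show ?thesis using d(2)[of "x + t *\<^sub>R b + s *\<^sub>R b" "x + t *\<^sub>R b"] b by (auto simp: dist_norm)
        qed
      qed auto
      moreover have "q h - q 0 = g x" by (simp add: q_def g_def h_def algebra_simps)
      ultimately show ?thesis by simp
    qed
    have gs: "g x = 0" if x: "x \<notin> cball 0 (R + \<bar>t\<bar> + 1)" for x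
    proof -
      have "norm x \<le> norm (x + s *\<^sub>R b) + \<bar>s\<bar>" for s
        using norm_triangle_ineq4[of "x + s *\<^sub>R b" "s *\<^sub>R b"] b by simp
      from this[of t] this[of y] have "x + t *\<^sub>R b \<notin> cball 0 R" "x + y *\<^sub>R b \<notin> cball 0 R" using x y by (auto simp: abs_real_def split: if_splits)
      moreover have "?\<psi> z = 0" if "z \<notin> cball 0 R" for z
        by (rule dir_deriv_zero_outside[OF closed_cball R(1) that])
      ultimately show ?thesis unfolding g_def using R(1) by simp
    qed
    have s1: "sqi (\<lambda>x. \<phi> (x + s *\<^sub>R b))" "sqi (\<lambda>x. ?\<psi> (x + s *\<^sub>R b))" for s
      using t t' by (auto intro: sqi_shift test_sqi)
    have eq: "cls (\<lambda>x. \<phi> (x + y *\<^sub>R b)) - cls (\<lambda>x. \<phi> (x + t *\<^sub>R b)) - (y - t) *\<^sub>R cls (\<lambda>x. ?\<psi> (x + t *\<^sub>R b)) = cls g"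
      unfolding g_def h_def by (simp add: cls_diff cls_scale s1 sqi_diff sqi_scale)
    have sg: "sqi g" unfolding g_def by (intro sqi_diff sqi_scale s1)
    have "norm (cls g) \<le> e' * \<bar>h\<bar> * c" unfolding c_def
      by (rule bounded_support_sqi(2)[OF sqi_measurable[OF sg] gb gs])
    also have "\<dots> = e * \<bar>h\<bar> * (c / (c + 1))" by (simp add: e'_def)
    also have "\<dots> \<le> e * \<bar>h\<bar>" using c e by (intro mult_left_le) auto
    finally show "norm (cls (\<lambda>x. \<phi> (x + y *\<^sub>R b)) - cls (\<lambda>x. \<phi> (x + t *\<^sub>R b))
        - (y - t) *\<^sub>R cls (\<lambda>x. ?\<psi> (x + t *\<^sub>R b))) \<le> e * norm (y - t)" unfolding eq by (simp add: h_def)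
  qed
qed

lemma inner_test_shift_has_derivative:
  assumes "test_fun UNIV \<phi>" "b \<in> Basis"
  shows "((\<lambda>t. inner F (cls (\<lambda>x. \<phi> (x + (y + t *\<^sub>R b))))) has_real_derivative
    inner F (cls (\<lambda>x. dir_deriv \<phi> b (x + (y + t *\<^sub>R b))))) (at t)"
proof -
  have "((\<lambda>t. inner F (cls (\<lambda>x. \<phi> (x + t *\<^sub>R b + y)))) has_vector_derivative
    inner F (cls (\<lambda>x. dir_deriv (\<lambda>x. \<phi> (x + y)) b (x + t *\<^sub>R b)))) (at t)"
    by (rule bounded_linear.has_vector_derivative[OF bounded_linear_inner_right
          test_shift_has_derivative[OF test_shift[OF assms(1)] assms(2)]])
  then show ?thesis
    by (simp add: has_real_derivative_iff_has_vector_derivative dir_deriv_translate[OF test_smooth[OF assms(1)] assms(2)] add_ac)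
qed

lemma test_shift_continuous:
  fixes \<phi> :: "'a::euclidean_space \<Rightarrow> real"
  assumes t: "test_fun UNIV \<phi>"
  shows "continuous_on UNIV (\<lambda>y. cls (\<lambda>x. \<phi> (x + y)))"
  unfolding continuous_on_iff
proof (intro ballI allI impI)
  fix z :: 'a and e :: real assume e: "0 < e"
  obtain R where R: "\<And>x. x \<notin> cball 0 R \<Longrightarrow> \<phi> x = 0" "0 < R" using test_support_ball[OF t] by blast
  define c where "c = sqrt (measure lborel (cball (0::'a) (R + norm z + 1)))"
  have c: "0 \<le> c" by (simp add: c_def)
  define e' where "e' = e / (c + 1)"
  have e': "0 < e'" using e c by (simp add: e'_def)
  obtain d where d: "0 < d" "\<And>x y. dist x y < d \<Longrightarrow> \<bar>\<phi> x - \<phi> y\<bar> < e'"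
    using test_uniformly_continuous[OF t e'] by blast
  have "dist (cls (\<lambda>x. \<phi> (x + y))) (cls (\<lambda>x. \<phi> (x + z))) < e" if y: "dist y z < min d 1" for y
  proof -
    define g where "g x = \<phi> (x + y) - \<phi> (x + z)" for x
    have sg: "sqi g" unfolding g_def using t by (intro sqi_diff sqi_shift test_sqi)
    have gb: "\<bar>g x\<bar> \<le> e'" for x using d(2)[of "x + y" "x + z"] y by (simp add: g_def less_imp_le)
    have gs: "g x = 0" if x: "x \<notin> cball 0 (R + norm z + 1)" for x
    proof -
      have "norm x \<le> norm (x + s) + norm s" for s using norm_triangle_ineq4[of "x + s" s] by simp
      moreover have "norm y \<le> norm z + 1" using y norm_triangle_ineq2[of y z] by (simp add: dist_norm)
      ultimately have "x + z \<notin> cball 0 R" "x + y \<notin> cball 0 R"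
        using x unfolding mem_cball_0 by (smt (verit))+
      then show ?thesis unfolding g_def using R(1) by simp
    qed
    have "norm (cls g) \<le> e' * c" unfolding c_def
      by (rule bounded_support_sqi(2)[OF sqi_measurable[OF sg] gb gs])
    also have "\<dots> < e' * (c + 1)" using e' by simp
    also have "\<dots> = e" using c by (simp add: e'_def)
    finally show ?thesis unfolding dist_norm g_def using t by (simp add: cls_diff sqi_shift test_sqi)
  qed
  then show "\<exists>d>0. \<forall>x'\<in>UNIV. dist x' z < d \<longrightarrow> dist (cls (\<lambda>x. \<phi> (x + x'))) (cls (\<lambda>x. \<phi> (x + z))) < e"
    using d(1) by (intro exI[of _ "min d 1"]) auto
qed

text \<open>Approximate \<open>F\<close> by a test function: after a far shift the two compact
  supports are disjoint, and shifting does not change the norm that multiplies the approximation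
  error.\<close>

lemma test_shift_decay:
  fixes F :: "'a::euclidean_space l2"
  assumes t: "test_fun UNIV \<phi>" and e: "0 < e"
  shows "\<exists>R. \<forall>y. norm y > R \<longrightarrow> \<bar>inner F (cls (\<lambda>x. \<phi> (x + y)))\<bar> < e"
proof -
  define e' where "e' = e / (norm (cls \<phi>) + 1)"
  have e': "0 < e'" using e norm_ge_zero[of "cls \<phi>"] by (simp add: e'_def add_nonneg_pos)
  have "F \<in> closure (cls ` Collect (test_fun UNIV))"
    using test_dense[of UNIV] by (auto simp: supp_in_def)
  then obtain g where g: "test_fun UNIV g" "dist (cls g) F < e'"
    using e' unfolding closure_approachable by auto
  obtain R where R: "\<And>x. x \<notin> cball 0 R \<Longrightarrow> \<phi> x = 0" using test_support_ball[OF t] by blast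
  obtain S where S: "\<And>x. x \<notin> cball 0 S \<Longrightarrow> g x = 0" using test_support_ball[OF g(1)] by blast
  have "\<bar>inner F (cls (\<lambda>x. \<phi> (x + y)))\<bar> < e" if y: "norm y > R + S" for y
  proof -
    have z: "g x * \<phi> (x + y) = 0" for x
    proof (cases "x \<in> cball 0 S")
      case True
      have "norm y \<le> norm (x + y) + norm x" using norm_triangle_ineq4[of "x + y" x] by simp
      then have "x + y \<notin> cball 0 R" using y True by auto
      then show ?thesis using R by simp
    qed (use S in simp)
    have "inner (cls g) (cls (\<lambda>x. \<phi> (x + y))) = 0"
      using g t by (simp add: inner_cls test_sqi sqi_shift z)
    then have "\<bar>inner F (cls (\<lambda>x. \<phi> (x + y)))\<bar> = \<bar>inner (F - cls g) (cls (\<lambda>x. \<phi> (x + y)))\<bar>" by (simp add: inner_simps)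
    also have "\<dots> \<le> norm (F - cls g) * norm (cls (\<lambda>x. \<phi> (x + y)))" by (rule Cauchy_Schwarz_ineq2)
    also have "\<dots> \<le> e' * norm (cls \<phi>)"
      using g(2) t e' by (intro mult_mono) (auto simp: dist_norm norm_minus_commute norm_cls_shift test_sqi)
    also have "\<dots> < e' * (norm (cls \<phi>) + 1)" using e' by simp
    also have "\<dots> = e" using norm_ge_zero[of "cls \<phi>"] unfolding e'_def by (simp add: add_nonneg_eq_0_iff)
    finally show ?thesis .
  qed
  then show ?thesis by blast
qed

text \<open>Were \<open>c\<close> positive, \<open>f'\<close> would be positive immediately to the
  right of 0 and \<open>f\<close> would exceed its maximum there.\<close>

lemma second_derivative_test_max:
  fixes f f' :: "real \<Rightarrow> real"
  assumes f: "\<And>t. (f has_real_derivative f' t) (at t)" and f': "(f' has_real_derivative c) (at 0)"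
    and r: "0 < r" and max: "\<And>t. \<bar>t\<bar> < r \<Longrightarrow> f t \<le> f 0"
  shows "c \<le> 0"
proof (rule ccontr)
  assume "\<not> c \<le> 0"
  have "f' 0 = 0" by (rule DERIV_local_max[OF f r]) (use max in auto)
  from DERIV_pos_inc_right[OF f'] \<open>\<not> c \<le> 0\<close> obtain d where d: "0 < d" "\<And>h. 0 < h \<Longrightarrow> h < d \<Longrightarrow> f' 0 < f' (0 + h)"
    by auto
  define t where "t = min d r / 2"
  have t: "0 < t" "t < d" "t < r" using d r by (auto simp: t_def)
  have "\<exists>z>0. z < t \<and> f t - f 0 = (t - 0) * f' z" by (rule MVT2) (use t f in auto)
  then obtain z where z: "0 < z" "z < t" "f t - f 0 = t * f' z" by auto
  with d(2)[of z] t \<open>f' 0 = 0\<close> have "f t - f 0 > 0" by simp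
  with max[of t] t show False by simp
qed

text \<open>A maximum principle for the pairing of \<open>F\<close> with the translates of
  \<open>\<phi>\<close>: as a function of the shift it is harmonic and vanishes at infinity. Adding
  a small multiple of the squared distance makes the Laplacian strictly positive, which contradicts
  an interior maximum.\<close>

lemma weakly_harmonic_nonpos:
  fixes F :: "'a::euclidean_space l2"
  assumes harm: "\<And>\<phi>. test_fun UNIV \<phi> \<Longrightarrow> (\<Sum>b\<in>Basis. inner F (cls (dir_deriv (dir_deriv \<phi> b) b))) = 0"
    and t: "test_fun UNIV \<phi>"
  shows "inner F (cls \<phi>) \<le> 0"
proof (rule ccontr)
  define w where "w \<psi> y = inner F (cls (\<lambda>x. \<psi> (x + y)))" for \<psi> y
  assume "\<not> inner F (cls \<phi>) \<le> 0"
  then have m: "0 < w \<phi> 0" by (simp add: w_def)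
  define m where "m = w \<phi> 0"
  obtain R0 where R0: "\<And>y. norm y > R0 \<Longrightarrow> \<bar>w \<phi> y\<bar> < m / 2"
    using test_shift_decay[OF t, of "m/2" F] m unfolding w_def m_def by auto
  define R where "R = max R0 0 + 1"
  have R: "0 < R" "R0 < R" by (auto simp: R_def)
  \<comment> \<open>On the sphere of radius \<open>R\<close> the pairing is below m/2 and the
    perturbation equals m/4; the sum is less than the value m at the origin, so the maximum over the
    ball is interior.\<close>
  define \<delta> where "\<delta> = m / (4 * R\<^sup>2)"
  have \<delta>: "0 < \<delta>" "\<delta> * R\<^sup>2 = m / 4" using m R by (auto simp: \<delta>_def m_def)
  define v where "v y = w \<phi> y + \<delta> * inner y y" for y
  have "continuous_on UNIV (w \<phi>)" unfolding w_def by (intro continuous_intros test_shift_continuous t)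
  then have "continuous_on (cball 0 R) v" unfolding v_def
    by (intro continuous_intros) (auto intro: continuous_on_subset)
  then obtain \<xi> where \<xi>: "\<xi> \<in> cball 0 R" "\<And>y. y \<in> cball 0 R \<Longrightarrow> v y \<le> v \<xi>"
    using continuous_attains_sup[OF compact_cball, of 0 R v] R by auto
  have v0: "v 0 = m" by (simp add: v_def m_def)
  have "norm \<xi> \<noteq> R"
  proof
    assume n: "norm \<xi> = R"
    then have "v \<xi> < m/2 + m/4" unfolding v_def
      using R0[of \<xi>] R \<delta> by (simp add: dot_square_norm)
    with \<xi>(2)[of 0] v0 R m show False by (simp add: m_def)
  qed
  then have \<xi>R: "norm \<xi> < R" using \<xi>(1) by simp
  have le: "w (dir_deriv (dir_deriv \<phi> b) b) \<xi> + 2 * \<delta> \<le> 0" if b: "b \<in> Basis" for b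
  proof (rule second_derivative_test_max)
    show "((\<lambda>t. v (\<xi> + t *\<^sub>R b)) has_real_derivative w (dir_deriv \<phi> b) (\<xi> + t *\<^sub>R b) + \<delta> * (2 * (inner \<xi> b + t))) (at t)" for t
      unfolding v_def w_def
      by (rule DERIV_add[OF inner_test_shift_has_derivative[OF t b]])
        (use b in \<open>auto intro!: derivative_eq_intros simp: inner_simps algebra_simps inner_commute inner_Basis\<close>)
    have "((\<lambda>t. w (dir_deriv \<phi> b) (\<xi> + t *\<^sub>R b) + \<delta> * (2 * (inner \<xi> b + t))) has_real_derivative
       w (dir_deriv (dir_deriv \<phi> b) b) (\<xi> + 0 *\<^sub>R b) + 2 * \<delta>) (at 0)"
      unfolding w_def by (rule DERIV_add[OF inner_test_shift_has_derivative[OF test_dir_deriv[OF t b] b]])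
        (auto intro!: derivative_eq_intros)
    then show "((\<lambda>t. w (dir_deriv \<phi> b) (\<xi> + t *\<^sub>R b) + \<delta> * (2 * (inner \<xi> b + t))) has_real_derivative
       w (dir_deriv (dir_deriv \<phi> b) b) \<xi> + 2 * \<delta>) (at 0)" by simp
    show "0 < R - norm \<xi>" using \<xi>R by simp
    fix t assume "\<bar>t\<bar> < R - norm \<xi>"
    then have "norm (\<xi> + t *\<^sub>R b) \<le> R" using norm_triangle_ineq[of \<xi> "t *\<^sub>R b"] b by simp
    then show "v (\<xi> + t *\<^sub>R b) \<le> v (\<xi> + 0 *\<^sub>R b)" using \<xi>(2) by simp
  qed
  have "(\<Sum>b\<in>Basis. w (dir_deriv (dir_deriv \<phi> b) b) \<xi>) = 0"
    using harm[OF test_shift[OF t, of \<xi>]]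
    by (simp add: w_def dir_deriv_translate test_smooth[OF t] smooth_dir_deriv)
  then have "(\<Sum>b\<in>(Basis::'a set). w (dir_deriv (dir_deriv \<phi> b) b) \<xi> + 2 * \<delta>) = real DIM('a) * (2 * \<delta>)"
    by (simp add: sum.distrib)
  moreover have "(\<Sum>b\<in>(Basis::'a set). w (dir_deriv (dir_deriv \<phi> b) b) \<xi> + 2 * \<delta>) \<le> 0"
    using le by (intro sum_nonpos) auto
  ultimately show False using \<delta>(1) DIM_positive[where 'a='a] by (smt (verit) mult_pos_pos of_nat_0_less_iff)
qed

lemma weakly_harmonic_zero:
  fixes F :: "'a::euclidean_space l2"
  assumes harm: "\<And>\<phi>. test_fun UNIV \<phi> \<Longrightarrow> (\<Sum>b\<in>Basis. inner F (cls (dir_deriv (dir_deriv \<phi> b) b))) = 0"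
  shows "F = 0"
proof (rule fundamental_lemma[of UNIV])
  fix \<phi> :: "'a \<Rightarrow> real" assume t: "test_fun UNIV \<phi>"
  have "inner F (cls \<phi>) \<le> 0" by (rule weakly_harmonic_nonpos[OF harm t])
  moreover have "inner F (cls (\<lambda>x. -1 * \<phi> x)) \<le> 0" by (rule weakly_harmonic_nonpos[OF harm test_scale[OF t]])
  then have "inner F ((-1) *\<^sub>R cls \<phi>) \<le> 0" by (simp only: cls_scale[OF test_sqi[OF t]])
  ultimately show "inner F (cls \<phi>) = 0" by simp
qed (auto simp: supp_in_def)

text \<open>The second difference is symmetric in \<open>a\<close> and \<open>b\<close>, and two
  mean value steps turn it into a mixed derivative at a nearby point. Comparing the two orders as
  \<open>h\<close> tends to 0 gives Schwarz's theorem.\<close>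

lemma mixed_difference:
  fixes \<phi> :: "'a::euclidean_space \<Rightarrow> real"
  assumes s: "smooth_fun \<phi>" and a: "a \<in> Basis" and b: "b \<in> Basis" and h: "0 < h"
  shows "\<exists>p. dist p x \<le> 2 * h \<and> \<phi> (x + h *\<^sub>R a + h *\<^sub>R b) - \<phi> (x + h *\<^sub>R a) - \<phi> (x + h *\<^sub>R b) + \<phi> x
      = h * (h * dir_deriv (dir_deriv \<phi> a) b p)"
proof -
  let ?g = "\<lambda>s. \<phi> (x + h *\<^sub>R b + s *\<^sub>R a) - \<phi> (x + s *\<^sub>R a)"
  have "\<exists>z>0. z < h \<and> ?g h - ?g 0 = (h - 0) * (dir_deriv \<phi> a (x + h *\<^sub>R b + z *\<^sub>R a) - dir_deriv \<phi> a (x + z *\<^sub>R a))"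
    by (rule MVT2[OF h]) (intro DERIV_diff smooth_line_deriv[OF s a])
  then obtain z where z: "0 < z" "z < h"
    and 1: "?g h - ?g 0 = h * (dir_deriv \<phi> a (x + h *\<^sub>R b + z *\<^sub>R a) - dir_deriv \<phi> a (x + z *\<^sub>R a))" by auto
  let ?k = "\<lambda>s. dir_deriv \<phi> a (x + z *\<^sub>R a + s *\<^sub>R b)"
  have "\<exists>u>0. u < h \<and> ?k h - ?k 0 = (h - 0) * dir_deriv (dir_deriv \<phi> a) b (x + z *\<^sub>R a + u *\<^sub>R b)"
    by (rule MVT2[OF h]) (rule smooth_line_deriv[OF smooth_dir_deriv[OF s a] b])
  then obtain u where u: "0 < u" "u < h" and 2: "?k h - ?k 0 = h * dir_deriv (dir_deriv \<phi> a) b (x + z *\<^sub>R a + u *\<^sub>R b)" by auto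
  have "dist (x + z *\<^sub>R a + u *\<^sub>R b) x \<le> 2 * h"
    using norm_triangle_ineq[of "z *\<^sub>R a" "u *\<^sub>R b"] a b z u by (simp add: dist_norm)
  moreover have "\<phi> (x + h *\<^sub>R a + h *\<^sub>R b) - \<phi> (x + h *\<^sub>R a) - \<phi> (x + h *\<^sub>R b) + \<phi> x = h * (?k h - ?k 0)"
    using 1 by (simp add: add_ac)
  ultimately show ?thesis using 2 by metis
qed

lemma mixed_partials:
  fixes \<phi> :: "'a::euclidean_space \<Rightarrow> real"
  assumes s: "smooth_fun \<phi>" and a: "a \<in> Basis" and b: "b \<in> Basis"
  shows "dir_deriv (dir_deriv \<phi> a) b = dir_deriv (dir_deriv \<phi> b) a"
proof
  fix x
  let ?A = "dir_deriv (dir_deriv \<phi> a) b" and ?B = "dir_deriv (dir_deriv \<phi> b) a"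
  define h where "h n = 1 / real (Suc n)" for n
  have h: "0 < h n" for n by (simp add: h_def)
  have h0: "(\<lambda>n. 2 * h n) \<longlonglongrightarrow> 0" unfolding h_def using tendsto_mult_right_zero[OF LIMSEQ_Suc[OF lim_1_over_n]] .
  from mixed_difference[OF s a b h] obtain p where p: "\<And>n. dist (p n) x \<le> 2 * h n" "\<And>n. \<phi> (x + h n *\<^sub>R a + h n *\<^sub>R b) - \<phi> (x + h n *\<^sub>R a) - \<phi> (x + h n *\<^sub>R b) + \<phi> x = h n * (h n * ?A (p n))" by metis
  from mixed_difference[OF s b a h] obtain q where q: "\<And>n. dist (q n) x \<le> 2 * h n" "\<And>n. \<phi> (x + h n *\<^sub>R b + h n *\<^sub>R a) - \<phi> (x + h n *\<^sub>R b) - \<phi> (x + h n *\<^sub>R a) + \<phi> x = h n * (h n * ?B (q n))" by metis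
  have eq: "?A (p n) = ?B (q n)" for n
  proof -
    have "h n * (h n * ?A (p n)) = h n * (h n * ?B (q n))" using p(2)[of n] q(2)[of n]
      unfolding add.assoc add.commute[of "h n *\<^sub>R b" "h n *\<^sub>R a"] by linarith
    then show ?thesis using h[of n] by simp
  qed
  have "p \<longlonglongrightarrow> x" "q \<longlonglongrightarrow> x" unfolding tendsto_dist_iff[of _ x]
    using p(1) q(1) by (auto intro!: tendsto_sandwich[OF _ _ tendsto_const h0])
  moreover have "isCont ?A x" "isCont ?B x"
    using smooth_continuous smooth_dir_deriv s a b by (meson continuous_on_eq_continuous_at open_UNIV UNIV_I)+
  ultimately have "(\<lambda>n. ?A (p n)) \<longlonglongrightarrow> ?A x" "(\<lambda>n. ?B (q n)) \<longlonglongrightarrow> ?B x" by (auto intro: isCont_tendsto_compose)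
  then show "?A x = ?B x" unfolding eq by (rule LIMSEQ_unique)
qed

section \<open>Weak derivatives\<close>

text \<open>The classes live on the whole space but are tested only inside \<open>U\<close>, so a
  weak derivative becomes unique only together with \<open>supp_in U\<close>.\<close>

definition wd :: "'a::euclidean_space set \<Rightarrow> 'a \<Rightarrow> 'a l2 \<Rightarrow> 'a l2 \<Rightarrow> bool" where
  "wd U b F G \<longleftrightarrow> (\<forall>\<phi>. test_fun U \<phi> \<longrightarrow> inner F (cls (dir_deriv \<phi> b)) = - inner G (cls \<phi>))"

lemma inner_emb_cls:
  assumes U: "U \<in> sets lebesgue" and f: "L2 U f" and g: "sqi g"
  shows "inner (emb U f) (cls g) = (\<integral>x. f x * g x \<partial>lebesgue_on U)"
  unfolding inner_emb_left[OF U f]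
proof (rule integral_cong_AE)
  note fn_measurable_lebesgue_on[measurable]
  have [measurable]: "f \<in> borel_measurable (lebesgue_on U)" using f by (simp_all add: L2_def)
  have [measurable]: "g \<in> borel_measurable (lebesgue_on U)"
    by (rule measurable_restrict_space1) (rule measurable_completion, simp add: sqi_measurable[OF g])
  show "(\<lambda>x. f x * fn (cls g) x) \<in> borel_measurable (lebesgue_on U)"
    "(\<lambda>x. f x * g x) \<in> borel_measurable (lebesgue_on U)" by measurable
  have "AE x in lebesgue_on U. fn (cls g) x = g x"
    unfolding AE_lebesgue_on_iff[OF U] using AE_completion[OF fn_cls[OF g]] by eventually_elim simp
  then show "AE x in lebesgue_on U. f x * fn (cls g) x = f x * g x" by eventually_elim simp
qed

lemma weak_pd_iff:
  assumes U: "open U" and b: "b \<in> Basis" and f: "L2 U f" and g: "L2 U g"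
  shows "weak_pd U b f g \<longleftrightarrow> wd U b (emb U f) (emb U g)"
  unfolding weak_pd_def wd_def
  using inner_emb_cls[OF sets_lebesgue_open[OF U] f test_sqi[OF test_dir_deriv[OF _ b]]]
    inner_emb_cls[OF sets_lebesgue_open[OF U] g test_sqi] by (metis (no_types, lifting))

lemma supp_in_diff:
  assumes "supp_in U F" "supp_in U G" shows "supp_in U (F - G)"
  using assms fn_diff[of F G] unfolding supp_in_def by eventually_elim auto

lemma wd_unique:
  assumes U: "open U" and "wd U b F G" "wd U b F H" "supp_in U G" "supp_in U H"
  shows "G = H"
proof -
  have "G - H = 0"
    by (rule fundamental_lemma[OF U supp_in_diff[OF assms(4,5)]])
      (use assms(2,3) in \<open>auto simp: wd_def inner_simps\<close>)
  then show ?thesis by simp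
qed

lemma wd_add: "wd U b F G \<Longrightarrow> wd U b F' G' \<Longrightarrow> wd U b (F + F') (G + G')"
  by (simp add: wd_def inner_simps)

lemma wd_diff: "wd U b F G \<Longrightarrow> wd U b F' G' \<Longrightarrow> wd U b (F - F') (G - G')"
  by (simp add: wd_def inner_simps)

lemma wd_weakly:
  assumes F: "weakly F F0" and G: "weakly G G0" and w: "\<And>n. wd U b (F n) (G n)"
  shows "wd U b F0 G0"
  unfolding wd_def
proof (intro allI impI)
  fix \<phi> assume "test_fun U \<phi>"
  then have "inner (F n) (cls (dir_deriv \<phi> b)) = - inner (G n) (cls \<phi>)" for n using w by (simp add: wd_def)
  then show "inner F0 (cls (dir_deriv \<phi> b)) = - inner G0 (cls \<phi>)"
    using LIMSEQ_unique[OF weaklyD[OF F, of "cls (dir_deriv \<phi> b)"]] tendsto_minus[OF weaklyD[OF G, of "cls \<phi>"]] by simp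
qed

lemma wpd:
  assumes "H1 U f" "b \<in> Basis"
  shows "L2 U (wpd U b f)" "weak_pd U b f (wpd U b f)"
  using assms someI_ex[of "\<lambda>g. L2 U g \<and> weak_pd U b f g"] unfolding H1_def wpd_def by auto

lemma H1_L2: "H1 U f \<Longrightarrow> L2 U f"
  by (simp add: H1_def)

lemma wd_wpd: "open U \<Longrightarrow> H1 U f \<Longrightarrow> b \<in> Basis \<Longrightarrow> wd U b (emb U f) (emb U (wpd U b f))"
  using weak_pd_iff[of U b f "wpd U b f"] wpd[of U f b] by (simp add: H1_L2)

text \<open>\<open>wpd\<close> is an arbitrary choice, but its class is not: any weak derivative
  supported in \<open>U\<close> identifies it. Concrete weak derivatives are computed in this way
  below.\<close>

lemma emb_wpd_eqI:
  assumes U: "open U" and f: "L2 U f" and b: "b \<in> Basis" and w: "wd U b (emb U f) G" and G: "supp_in U G"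
  shows "emb U (wpd U b f) = G" "L2 U (wpd U b f)"
proof -
  have "weak_pd U b f (fn G)"
    unfolding weak_pd_iff[OF U b f L2_fn[OF sets_lebesgue_open[OF U]]] emb_supp_in[OF sets_lebesgue_open[OF U] G] by (rule w)
  then have "\<exists>g. L2 U g \<and> weak_pd U b f g" using L2_fn[OF sets_lebesgue_open[OF U]] by blast
  then have *: "L2 U (wpd U b f) \<and> weak_pd U b f (wpd U b f)"
    unfolding wpd_def by (rule someI_ex)
  then show "L2 U (wpd U b f)" by blast
  show "emb U (wpd U b f) = G"
    by (rule wd_unique[OF U _ w supp_in_emb[OF sets_lebesgue_open[OF U]] G])
      (use * weak_pd_iff[OF U b f] in auto)
qed

lemma H1I:
  assumes U: "open U" and f: "L2 U f" and w: "\<And>b. b \<in> Basis \<Longrightarrow> \<exists>G. wd U b (emb U f) G \<and> supp_in U G"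
  shows "H1 U f"
  unfolding H1_def
proof (intro conjI ballI f)
  fix b :: 'a assume b: "b \<in> Basis"
  from w[OF b] obtain G where G: "wd U b (emb U f) G" "supp_in U G" by blast
  then have "wd U b (emb U f) (emb U (wpd U b f))" "L2 U (wpd U b f)"
    using emb_wpd_eqI[OF U f b G] by auto
  then show "\<exists>g. L2 U g \<and> weak_pd U b f g" using weak_pd_iff[OF U b f] by blast
qed

lemma H1_diff: assumes U: "open U" and "H1 U f" "H1 U g" 
  shows "H1 U (\<lambda>x. f x - g x)" 
    and "b \<in> Basis \<Longrightarrow> emb U (wpd U b (\<lambda>x. f x - g x)) = emb U (wpd U b f) - emb U (wpd U b g)"
proof -
  note S = sets_lebesgue_open[OF U]
  have w: "wd U b (emb U (\<lambda>x. f x - g x)) (emb U (wpd U b f) - emb U (wpd U b g))" if "b \<in> Basis" for b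
    unfolding emb_diff[OF S H1_L2[OF assms(2)] H1_L2[OF assms(3)]]
    by (rule wd_diff[OF wd_wpd[OF U assms(2) that] wd_wpd[OF U assms(3) that]])
  have s: "supp_in U (emb U (wpd U b f) - emb U (wpd U b g))" if "b \<in> Basis" for b
    by (rule supp_in_diff[OF supp_in_emb[OF S wpd(1)[OF assms(2) that]] supp_in_emb[OF S wpd(1)[OF assms(3) that]]])
  have l: "L2 U (\<lambda>x. f x - g x)" using assms by (intro L2_diff H1_L2)
  show "H1 U (\<lambda>x. f x - g x)" by (rule H1I[OF U l]) (use w s in blast)
  show "b \<in> Basis \<Longrightarrow> emb U (wpd U b (\<lambda>x. f x - g x)) = emb U (wpd U b f) - emb U (wpd U b g)"
    by (rule emb_wpd_eqI(1)[OF U l _ w s])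
qed

text \<open>Translating both factors by the same vector leaves their inner product unchanged;
  differentiating this constant at 0 gives integration by parts without iterated integrals.\<close>

lemma test_by_parts:
  fixes \<phi> \<psi> :: "'a::euclidean_space \<Rightarrow> real"
  assumes \<phi>: "test_fun UNIV \<phi>" and \<psi>: "test_fun UNIV \<psi>" and b: "b \<in> Basis"
  shows "inner (cls (dir_deriv \<psi> b)) (cls \<phi>) = - inner (cls \<psi>) (cls (dir_deriv \<phi> b))"
proof -
  let ?p = "\<lambda>t. cls (\<lambda>x. \<phi> (x + t *\<^sub>R b))" and ?q = "\<lambda>t. cls (\<lambda>x. \<psi> (x + t *\<^sub>R b))"
  have d: "(?p has_derivative (\<lambda>h. h *\<^sub>R cls (dir_deriv \<phi> b))) (at 0)" "(?q has_derivative (\<lambda>h. h *\<^sub>R cls (dir_deriv \<psi> b))) (at 0)"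
    using test_shift_has_derivative[OF \<phi> b, of 0] test_shift_has_derivative[OF \<psi> b, of 0]
    by (auto simp: has_vector_derivative_def)
  have "((\<lambda>t. inner (?q t) (?p t)) has_derivative (\<lambda>h. inner (?q 0) (h *\<^sub>R cls (dir_deriv \<phi> b)) + inner (h *\<^sub>R cls (dir_deriv \<psi> b)) (?p 0))) (at 0)"
    by (rule has_derivative_inner[OF d(2,1)])
  moreover have "(\<lambda>t. inner (?q t) (?p t)) = (\<lambda>t. inner (cls \<psi>) (cls \<phi>))"
    using \<phi> \<psi> by (simp add: inner_cls_shift test_sqi)
  moreover have "((\<lambda>t::real. inner (cls \<psi>) (cls \<phi>)) has_derivative (\<lambda>h. 0)) (at 0)" by simp
  ultimately have "(\<lambda>h. inner (?q 0) (h *\<^sub>R cls (dir_deriv \<phi> b)) + inner (h *\<^sub>R cls (dir_deriv \<psi> b)) (?p 0)) = (\<lambda>h. 0)"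
    by (simp only:) (rule has_derivative_unique)
  from fun_cong[OF this, of 1] show ?thesis by simp
qed

text \<open>The pairing of \<open>F\<close> with the translates of a test function along
  \<open>b\<close> is constant and decays at infinity, hence vanishes. This excludes nonzero square
  integrable functions that are invariant in one direction.\<close>

lemma zero_of_line_derivative:
  fixes F :: "'a::euclidean_space l2"
  assumes b: "b \<in> Basis" and 0: "\<And>\<phi>. test_fun UNIV \<phi> \<Longrightarrow> inner F (cls (dir_deriv \<phi> b)) = 0"
  shows "F = 0"
proof (rule fundamental_lemma[of UNIV])
  fix \<phi> :: "'a \<Rightarrow> real" assume t: "test_fun UNIV \<phi>"
  define q where "q s = inner F (cls (\<lambda>x. \<phi> (x + s *\<^sub>R b)))" for s
  have "(q has_real_derivative 0) (at s)" for s
  proof -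
    have "dir_deriv (\<lambda>x. \<phi> (x + s *\<^sub>R b)) b = (\<lambda>x. dir_deriv \<phi> b (x + s *\<^sub>R b))"
      by (rule dir_deriv_translate[OF test_smooth[OF t] b])
    with 0[OF test_shift[OF t, of "s *\<^sub>R b"]] inner_test_shift_has_derivative[OF t b, of F 0 s]
    show ?thesis by (simp add: q_def[abs_def])
  qed
  then have const: "q s = q 0" for s using DERIV_isconst_all by blast
  have "\<bar>q 0\<bar> < e" if "0 < e" for e
  proof -
    obtain R where R: "\<And>y. norm y > R \<Longrightarrow> \<bar>inner F (cls (\<lambda>x. \<phi> (x + y)))\<bar> < e"
      using test_shift_decay[OF t \<open>0 < e\<close>] by blast
    have "\<bar>q (\<bar>R\<bar> + 1)\<bar> < e" unfolding q_def using b by (intro R) simp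
    then show ?thesis using const by metis
  qed
  then have "q 0 = 0" by (metis abs_ge_zero dense_le less_irrefl zero_less_abs_iff)
  then show "inner F (cls \<phi>) = 0" by (simp add: q_def)
qed (auto simp: supp_in_def)

section \<open>The stray field\<close>

definition ev :: "(real^3 \<Rightarrow> real^3) \<Rightarrow> (real^3) l2 ^ 3" where
  "ev u = (\<chi> i. emb UNIV (\<lambda>x. u x $ i))"

definition curl_free :: "(real^3) l2 ^ 3 \<Rightarrow> bool" where
  "curl_free H \<longleftrightarrow> (\<forall>\<phi> i j. test_fun UNIV \<phi> \<longrightarrow>
     inner (H $ i) (cls (dir_deriv \<phi> (axis j 1))) = inner (H $ j) (cls (dir_deriv \<phi> (axis i 1))))"

definition gradc :: "(real^3 \<Rightarrow> real) \<Rightarrow> (real^3) l2 ^ 3" where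
  "gradc \<phi> = (\<chi> i. cls (dir_deriv \<phi> (axis i 1)))"

lemma axis_Basis: "axis i (1::real) \<in> Basis"
  by (auto simp: Basis_vec_def)

lemma sum_Basis_axis: "(\<Sum>b\<in>(Basis :: (real^'n) set). f b) = (\<Sum>i\<in>UNIV. f (axis i 1))"
proof -
  have "bij_betw (\<lambda>i. axis i 1) UNIV (Basis :: (real^'n) set)"
    by (auto simp: bij_betw_def Basis_vec_def inj_on_def axis_eq_axis)
  from sum.reindex_bij_betw[OF this, of f] show ?thesis by simp
qed

lemma inner_gradc: "inner H (gradc \<phi>) = (\<Sum>i\<in>UNIV. inner (H $ i) (cls (dir_deriv \<phi> (axis i 1))))"
  by (simp add: gradc_def inner_vec_def)

lemma curl_free_gradc: "test_fun UNIV \<phi> \<Longrightarrow> curl_free (gradc \<phi>)"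
  unfolding curl_free_def
proof (intro allI impI)
  fix \<psi> :: "real^3 \<Rightarrow> real" and i j :: 3
  assume \<phi>: "test_fun UNIV \<phi>" and \<psi>: "test_fun UNIV \<psi>"
  note [simp] = axis_Basis
  have "inner (cls (dir_deriv \<phi> (axis i 1))) (cls (dir_deriv \<psi> (axis j 1)))
      = - inner (cls \<phi>) (cls (dir_deriv (dir_deriv \<psi> (axis j 1)) (axis i 1)))"
    by (rule test_by_parts) (auto intro: test_dir_deriv \<phi> \<psi>)
  also have "\<dots> = - inner (cls \<phi>) (cls (dir_deriv (dir_deriv \<psi> (axis i 1)) (axis j 1)))"
    by (subst mixed_partials[OF test_smooth[OF \<psi>]]) auto
  also have "\<dots> = inner (cls (dir_deriv \<phi> (axis j 1))) (cls (dir_deriv \<psi> (axis i 1)))"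
    by (rule test_by_parts[symmetric]) (auto intro: test_dir_deriv \<phi> \<psi>)
  finally show "inner (gradc \<phi> $ i) (cls (dir_deriv \<psi> (axis j 1))) = inner (gradc \<phi> $ j) (cls (dir_deriv \<psi> (axis i 1)))"
    by (simp add: gradc_def)
qed

lemma subspace_gradc: "subspace (gradc ` Collect (test_fun UNIV))"
  unfolding subspace_def
proof (intro conjI ballI allI)
  note [simp] = axis_Basis
  have "gradc (\<lambda>x. 0) = 0" by (simp add: gradc_def vec_eq_iff dir_deriv_const cls_zero)
  then show "0 \<in> gradc ` Collect (test_fun UNIV)" using test_zero by (metis image_eqI mem_Collect_eq)
  show "x + y \<in> gradc ` Collect (test_fun UNIV)" if xy: "x \<in> gradc ` Collect (test_fun UNIV)" "y \<in> gradc ` Collect (test_fun UNIV)" for x y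
  proof -
    from xy obtain f g where f: "x = gradc f" "test_fun UNIV f" and g: "y = gradc g" "test_fun UNIV g" by auto
    have "x + y = gradc (\<lambda>x. f x + g x)" unfolding f g gradc_def vec_eq_iff
      by (simp add: dir_deriv_add[OF test_smooth[OF f(2)] test_smooth[OF g(2)]] cls_add
          test_sqi[OF test_dir_deriv[OF f(2) axis_Basis]] test_sqi[OF test_dir_deriv[OF g(2) axis_Basis]])
    then show ?thesis using test_add[OF f(2) g(2)] by blast
  qed
  show "c *\<^sub>R x \<in> gradc ` Collect (test_fun UNIV)" if x: "x \<in> gradc ` Collect (test_fun UNIV)" for c x
  proof -
    from x obtain f where f: "x = gradc f" "test_fun UNIV f" by auto
    have "c *\<^sub>R x = gradc (\<lambda>x. c * f x)" unfolding f gradc_def vec_eq_iff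
      by (simp add: dir_deriv_scale[OF test_smooth[OF f(2)]] cls_scale test_sqi[OF test_dir_deriv[OF f(2) axis_Basis]])
    then show ?thesis using test_scale[OF f(2)] by blast
  qed
qed

lemma closed_curl_free: "closed (Collect curl_free)"
proof -
  have "Collect curl_free = (\<Inter>\<phi>\<in>Collect (test_fun UNIV). \<Inter>i. \<Inter>j.
     {H. inner (H $ i) (cls (dir_deriv \<phi> (axis j 1))) = inner (H $ j) (cls (dir_deriv \<phi> (axis i 1)))})"
    by (auto simp: curl_free_def)
  moreover have "closed {H :: (real^3) l2 ^ 3. inner (H $ i) A = inner (H $ j) B}" for i j A B
    by (rule closed_Collect_eq) (intro continuous_intros)+
  ultimately show ?thesis by (auto intro!: closed_INT)
qed

lemma subspace_curl_free: "subspace (Collect curl_free)"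
  unfolding subspace_def curl_free_def by (auto simp: inner_simps)

text \<open>By Liouville's theorem the two notions of curl-free field agree.\<close>

lemma curl_free_closure: "Collect curl_free = closure (gradc ` Collect (test_fun UNIV))"
proof
  show "closure (gradc ` Collect (test_fun UNIV)) \<subseteq> Collect curl_free"
    by (rule closure_minimal[OF _ closed_curl_free]) (auto intro: curl_free_gradc)
  show "Collect curl_free \<subseteq> closure (gradc ` Collect (test_fun UNIV))"
  proof (rule orthogonal_subset_dense[OF subspace_gradc _ subspace_curl_free closed_curl_free])
    show "gradc ` Collect (test_fun UNIV) \<subseteq> Collect curl_free" by (auto intro: curl_free_gradc)
    fix H :: "(real^3) l2 ^ 3" assume "H \<in> Collect curl_free" and "\<And>s. s \<in> gradc ` Collect (test_fun UNIV) \<Longrightarrow> inner H s = 0"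
    then have c: "curl_free H" and o: "\<And>\<phi>. test_fun UNIV \<phi> \<Longrightarrow> inner H (gradc \<phi>) = 0" by auto
    have "H $ i = 0" for i
    proof (rule weakly_harmonic_zero)
      fix \<phi> :: "real^3 \<Rightarrow> real" assume t: "test_fun UNIV \<phi>"
      have "(\<Sum>b\<in>Basis. inner (H $ i) (cls (dir_deriv (dir_deriv \<phi> b) b)))
         = (\<Sum>j\<in>UNIV. inner (H $ i) (cls (dir_deriv (dir_deriv \<phi> (axis j 1)) (axis j 1))))"
        by (rule sum_Basis_axis)
      \<comment> \<open>Curl-freeness exchanges the component with the direction of differentiation.
        What remains is the divergence equation tested with a derivative of \<open>\<phi>\<close>,
        so each component is weakly harmonic.\<close>
      also have "\<dots> = (\<Sum>j\<in>UNIV. inner (H $ j) (cls (dir_deriv (dir_deriv \<phi> (axis j 1)) (axis i 1))))"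
        using c test_dir_deriv[OF t axis_Basis] unfolding curl_free_def by (intro sum.cong refl) blast
      also have "\<dots> = inner H (gradc (dir_deriv \<phi> (axis i 1)))"
        unfolding inner_gradc using mixed_partials[OF test_smooth[OF t] axis_Basis axis_Basis] by metis
      also have "\<dots> = 0" by (rule o[OF test_dir_deriv[OF t axis_Basis]])
      finally show "(\<Sum>b\<in>Basis. inner (H $ i) (cls (dir_deriv (dir_deriv \<phi> b) b))) = 0" .
    qed
    then show "H = 0" by (simp add: vec_eq_iff)
  qed
qed

lemma ev_nth: "ev u $ i = emb UNIV (\<lambda>x. u x $ i)"
  by (simp add: ev_def)

lemma L2v_nth: "L2v U u \<Longrightarrow> L2 U (\<lambda>x. u x $ i)"
  by (simp add: L2v_def)

lemma integral_ev:
  assumes "L2v UNIV u" "sqi g"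
  shows "(\<integral>x. u x $ i * g x \<partial>lebesgue) = inner (ev u $ i) (cls g)"
    and "integrable lebesgue (\<lambda>x. u x $ i * g x)"
proof -
  show "(\<integral>x. u x $ i * g x \<partial>lebesgue) = inner (ev u $ i) (cls g)"
    using inner_emb_cls[OF _ L2v_nth[OF assms(1)] assms(2), of i] by (simp add: ev_nth lebesgue_on_UNIV_eq)
  show "integrable lebesgue (\<lambda>x. u x $ i * g x)"
    using square_integrable_mult[of "\<lambda>x. u x $ i" lebesgue g] L2v_nth[OF assms(1), of i] L2_sqi[OF assms(2)]
    by (simp add: L2_def lebesgue_on_UNIV_eq)
qed

lemma is_stray_field_iff:
  assumes m: "L2v UNIV m" and h: "L2v UNIV h"
  shows "is_stray_field m h \<longleftrightarrow> curl_free (ev h) \<and> (\<forall>\<phi>. test_fun UNIV \<phi> \<longrightarrow> inner (ev h + ev m) (gradc \<phi>) = 0)"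
proof -
  have s: "sqi (dir_deriv \<phi> (axis j 1))" if "test_fun UNIV \<phi>" for \<phi> :: "real^3 \<Rightarrow> real" and j :: 3
    by (rule test_sqi[OF test_dir_deriv[OF that axis_Basis]])
  have 1: "(\<integral>x. h x $ i * dir_deriv \<phi> (axis j 1) x - h x $ j * dir_deriv \<phi> (axis i 1) x \<partial>lebesgue)
    = inner (ev h $ i) (cls (dir_deriv \<phi> (axis j 1))) - inner (ev h $ j) (cls (dir_deriv \<phi> (axis i 1)))"
    if "test_fun UNIV \<phi>" for \<phi> i j
    by (simp add: integral_ev[OF h s[OF that]])
  have 2: "(\<integral>x. (\<Sum>i\<in>UNIV. (h x $ i + m x $ i) * dir_deriv \<phi> (axis i 1) x) \<partial>lebesgue) = inner (ev h + ev m) (gradc \<phi>)"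
    if "test_fun UNIV \<phi>" for \<phi>
    by (simp add: inner_gradc distrib_right integral_ev[OF h s[OF that]] integral_ev[OF m s[OF that]] inner_simps)
  show ?thesis unfolding is_stray_field_def curl_free_def using h 1 2 by (auto simp: algebra_simps)
qed

lemma ev_surj: "\<exists>h. L2v UNIV h \<and> ev h = H"
proof (intro exI conjI)
  let ?h = "\<lambda>x. \<chi> i. fn (H $ i) x"
  show "L2v UNIV ?h" by (simp add: L2v_def L2_fn)
  show "ev ?h = H" by (simp add: ev_def vec_eq_iff emb_UNIV_fn)
qed

text \<open>Existence comes from minus the projection of \<open>ev m\<close> onto the closed
  gradients. The last identity holds for every admissible choice: a curl-free field is a limit of
  gradients and may be inserted into the divergence equation.\<close>

lemma stray_field:
  assumes m: "L2v UNIV m"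
  shows "L2v UNIV (stray_field m)" "curl_free (ev (stray_field m))"
    "test_fun UNIV \<phi> \<Longrightarrow> inner (ev (stray_field m) + ev m) (gradc \<phi>) = 0"
    "inner (ev (stray_field m) + ev m) (ev (stray_field m)) = 0"
proof -
  let ?G = "gradc ` Collect (test_fun UNIV)"
  obtain P where P: "P \<in> closure ?G" "\<forall>s\<in>closure ?G. inner (ev m - P) s = 0"
    using orthogonal_projection_exists[OF subspace_closure[OF subspace_gradc] closed_closure] by blast
  obtain h where h: "L2v UNIV h" "ev h = - P" using ev_surj by blast
  have "- P \<in> closure ?G" using P(1) subspace_neg[OF subspace_closure[OF subspace_gradc]] by blast
  then have "ev h \<in> Collect curl_free" unfolding h(2) curl_free_closure .
  then have "curl_free (ev h)" by simp
  moreover have "inner (ev h + ev m) (gradc \<phi>) = 0" if "test_fun UNIV \<phi>" for \<phi>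
  proof -
    have "gradc \<phi> \<in> closure ?G" by (rule subsetD[OF closure_subset]) (use that in simp)
    then show ?thesis using P(2) by (simp add: h(2))
  qed
  ultimately have "is_stray_field m h" using is_stray_field_iff[OF m h(1)] by blast
  then have s: "is_stray_field m (stray_field m)" unfolding stray_field_def by (rule someI[of "is_stray_field m"])
  then show L: "L2v UNIV (stray_field m)" by (simp add: is_stray_field_def)
  show c: "curl_free (ev (stray_field m))" 
    and d: "test_fun UNIV \<phi> \<Longrightarrow> inner (ev (stray_field m) + ev m) (gradc \<phi>) = 0" for \<phi>
    using s is_stray_field_iff[OF m L] by auto
  have "closure ?G \<subseteq> {X. inner (ev (stray_field m) + ev m) X = 0}"
    by (rule closure_minimal) (use d in \<open>auto intro!: closed_Collect_eq continuous_intros\<close>)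
  moreover have "ev (stray_field m) \<in> closure ?G" using c unfolding curl_free_closure[symmetric] by simp
  ultimately show "inner (ev (stray_field m) + ev m) (ev (stray_field m)) = 0" by blast
qed

section \<open>Rescaling in the thickness direction\<close>

lemma scale3_diag: "scale3 c = diag_map 0 (\<lambda>j. if j = axis 3 1 then c else 1)"
proof
  fix x :: "real^3"
  have "scale3 c x $ i = diag_map 0 (\<lambda>j. if j = axis 3 1 then c else 1) x $ i" for i
    using diag_map_inner[OF axis_Basis[of i], of 0 "\<lambda>j. if j = axis 3 1 then c else 1" x]
    by (simp add: inner_axis scale3_def axis_eq_axis)
  then show "scale3 c x = diag_map 0 (\<lambda>j. if j = axis 3 1 then c else 1) x" by (simp add: vec_eq_iff)
qed

lemma lebesgue_scale3:
  assumes c: "0 < c"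
  shows "lebesgue = density (distr lebesgue lebesgue (scale3 c)) (\<lambda>_. ennreal c)"
    and "scale3 c \<in> lebesgue \<rightarrow>\<^sub>M lebesgue"
proof -
  let ?c = "\<lambda>j :: real^3. if j = axis 3 1 then c else 1"
  have ne: "\<And>j. j \<in> Basis \<Longrightarrow> ?c j \<noteq> 0" using c by simp
  have p: "(\<Prod>j\<in>Basis. \<bar>?c j\<bar>) = c"
  proof -
    have "(\<Prod>j\<in>Basis. \<bar>?c j\<bar>) = (\<Prod>j\<in>(Basis :: (real^3) set). if j = axis 3 1 then c else 1)"
      using c by (intro prod.cong) auto
    then show ?thesis by (simp add: axis_Basis)
  qed
  show "lebesgue = density (distr lebesgue lebesgue (scale3 c)) (\<lambda>_. ennreal c)"
    using lebesgue_affine_euclidean[of ?c 0] ne unfolding p scale3_diag diag_map_def[abs_def] by simp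
  show "scale3 c \<in> lebesgue \<rightarrow>\<^sub>M lebesgue"
    using lebesgue_affine_measurable[of ?c 0] ne unfolding scale3_diag diag_map_def[abs_def] by simp
qed

lemma lebesgue_integral_scale3:
  fixes f :: "real^3 \<Rightarrow> real"
  assumes c: "0 < c" and f: "f \<in> borel_measurable lebesgue"
  shows "(\<integral>x. f x \<partial>lebesgue) = c * (\<integral>x. f (scale3 c x) \<partial>lebesgue)"
    and "integrable lebesgue f \<Longrightarrow> integrable lebesgue (\<lambda>x. f (scale3 c x))"
    and "(\<lambda>x. f (scale3 c x)) \<in> borel_measurable lebesgue"
proof -
  note m = lebesgue_scale3(2)[OF c]
  have f': "f \<in> borel_measurable (distr lebesgue lebesgue (scale3 c))" using f by simp
  have "(\<integral>x. f x \<partial>lebesgue) = (\<integral>x. f x \<partial>density (distr lebesgue lebesgue (scale3 c)) (\<lambda>_. ennreal c))"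
    using lebesgue_scale3(1)[OF c] by simp
  also have "\<dots> = (\<integral>x. c *\<^sub>R f x \<partial>distr lebesgue lebesgue (scale3 c))"
    by (rule integral_density) (use f' c in auto)
  also have "\<dots> = (\<integral>x. c *\<^sub>R f (scale3 c x) \<partial>lebesgue)"
    by (rule integral_distr[OF m]) (use f in simp)
  finally show "(\<integral>x. f x \<partial>lebesgue) = c * (\<integral>x. f (scale3 c x) \<partial>lebesgue)" by simp
  show "(\<lambda>x. f (scale3 c x)) \<in> borel_measurable lebesgue" by (rule measurable_compose[OF m f])
  assume "integrable lebesgue f"
  then have "integrable (density (distr lebesgue lebesgue (scale3 c)) (\<lambda>_. ennreal c)) f"
    using lebesgue_scale3(1)[OF c] by simp
  then have "integrable (distr lebesgue lebesgue (scale3 c)) (\<lambda>x. c *\<^sub>R f x)"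
    by (subst (asm) integrable_density) (use f' c in auto)
  then have "integrable lebesgue (\<lambda>x. c *\<^sub>R f (scale3 c x))"
    by (subst (asm) integrable_distr_eq[OF m]) (use f in auto)
  then show "integrable lebesgue (\<lambda>x. f (scale3 c x))" using c by simp
qed

lemma L2_scale3: "0 < c \<Longrightarrow> L2 UNIV f \<Longrightarrow> L2 UNIV (\<lambda>x. f (scale3 c x))"
  unfolding L2_def lebesgue_on_UNIV_eq
  using lebesgue_integral_scale3(3)[of c f] lebesgue_integral_scale3(2)[of c "\<lambda>x. (f x)\<^sup>2"]
  by (auto intro: borel_measurable_power)

lemma inner_emb_scale3:
  assumes c: "0 < c" and f: "L2 UNIV f" and g: "L2 UNIV g"
  shows "inner (emb UNIV f) (emb UNIV g) = c * inner (emb UNIV (\<lambda>x. f (scale3 c x))) (emb UNIV (\<lambda>x. g (scale3 c x)))"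
proof -
  have "(\<lambda>x. f x * g x) \<in> borel_measurable lebesgue"
    using f g by (auto simp: L2_def lebesgue_on_UNIV_eq intro: borel_measurable_times)
  from lebesgue_integral_scale3(1)[OF c this] show ?thesis
    by (simp add: inner_emb f g L2_scale3 c lebesgue_on_UNIV_eq)
qed

lemma scale3_inverse: "0 < c \<Longrightarrow> scale3 c (scale3 (1/c) x) = x" "0 < c \<Longrightarrow> scale3 (1/c) (scale3 c x) = x"
  by (auto simp: scale3_def vec_eq_iff)

text \<open>The stray field equations are tested with \<open>\<phi>\<close> composed with
  \<open>scale3 (1/\<epsilon>)\<close>. Differentiation produces the weights \<open>c i\<close>,
  while the Jacobian is common to all terms and cancels.\<close>

lemma h_eps:
  fixes m :: "real^3 \<Rightarrow> real^3"
  assumes m: "L2v UNIV m" and e: "0 < \<epsilon>"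
  defines "X \<equiv> ev (h_eps \<epsilon> m)" and "c \<equiv> \<lambda>i :: 3. if i = 3 then 1 / \<epsilon> else 1"
  shows "L2v UNIV (h_eps \<epsilon> m)"
    "test_fun UNIV \<phi> \<Longrightarrow> c j * inner (X $ i) (cls (dir_deriv \<phi> (axis j 1))) = c i * inner (X $ j) (cls (dir_deriv \<phi> (axis i 1)))"
    "test_fun UNIV \<phi> \<Longrightarrow> (\<Sum>i\<in>UNIV. c i * inner (X $ i + ev m $ i) (cls (dir_deriv \<phi> (axis i 1)))) = 0"
    "inner (X + ev m) X = 0"
proof -
  define m' where "m' = m \<circ> scale3 (1/\<epsilon>)"
  define h where "h = stray_field m'"
  have m': "L2v UNIV m'" unfolding L2v_def m'_def o_def
  proof
    fix j show "L2 UNIV (\<lambda>x. m (scale3 (1/\<epsilon>) x) $ j)"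
      by (rule L2_scale3[OF _ L2v_nth[OF m]]) (use e in simp)
  qed
  note S = stray_field[OF m', folded h_def]
  have he: "h_eps \<epsilon> m = h \<circ> scale3 \<epsilon>" by (simp add: h_eps_def h_def m'_def)
  have mm: "m = m' \<circ> scale3 \<epsilon>" using scale3_inverse[OF e] by (simp add: m'_def fun_eq_iff)
  show L: "L2v UNIV (h_eps \<epsilon> m)" unfolding L2v_def he o_def
    using L2_scale3[OF e L2v_nth[OF S(1)]] by blast
  have inn: "inner (ev u $ i) (ev v $ i) = \<epsilon> * inner (ev (u \<circ> scale3 \<epsilon>) $ i) (ev (v \<circ> scale3 \<epsilon>) $ i)"
    if "L2v UNIV u" "L2v UNIV v" for u v i
    using inner_emb_scale3[OF e L2v_nth[OF that(1)] L2v_nth[OF that(2)], of i i] by (simp add: ev_nth)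
  have inc: "inner (ev u $ i) (cls g) = \<epsilon> * inner (ev (u \<circ> scale3 \<epsilon>) $ i) (cls k)"
    if "L2v UNIV u" "sqi g" "sqi k" "\<And>x. g (scale3 \<epsilon> x) = k x" for u g k i
    using inner_emb_scale3[OF e L2v_nth[OF that(1)] L2_sqi[OF that(2)], of i] that(4)
    by (simp add: ev_nth emb_UNIV_cls that(2,3))
  have t: "test_fun UNIV (\<lambda>x. \<phi> (scale3 (1/\<epsilon>) x))" if "test_fun UNIV \<phi>" for \<phi> :: "real^3 \<Rightarrow> real"
    unfolding scale3_diag by (rule test_diag_map[OF that]) (use e in auto)
  have dt: "dir_deriv (\<lambda>x. \<phi> (scale3 (1/\<epsilon>) x)) (axis i 1) = (\<lambda>x. c i * dir_deriv \<phi> (axis i 1) (scale3 (1/\<epsilon>) x))"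
    if "test_fun UNIV \<phi>" for \<phi> :: "real^3 \<Rightarrow> real" and i
    unfolding scale3_diag dir_deriv_diag_map[OF test_smooth[OF that] axis_Basis] by (simp add: c_def axis_eq_axis)
  have key: "inner (ev u $ i) (cls (dir_deriv (\<lambda>x. \<phi> (scale3 (1/\<epsilon>) x)) (axis j 1)))
      = \<epsilon> * (c j * inner (ev (u \<circ> scale3 \<epsilon>) $ i) (cls (dir_deriv \<phi> (axis j 1))))"
    if u: "L2v UNIV u" and \<phi>: "test_fun UNIV \<phi>" for u i j and \<phi> :: "real^3 \<Rightarrow> real"
  proof -
    note sd = test_sqi[OF test_dir_deriv[OF \<phi> axis_Basis[of j]]]
    have "inner (ev u $ i) (cls (dir_deriv (\<lambda>x. \<phi> (scale3 (1/\<epsilon>) x)) (axis j 1)))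
       = \<epsilon> * inner (ev (u \<circ> scale3 \<epsilon>) $ i) (cls (\<lambda>x. c j * dir_deriv \<phi> (axis j 1) x))"
      by (rule inc[OF u test_sqi[OF test_dir_deriv[OF t[OF \<phi>] axis_Basis]] sqi_scale[OF sd]])
        (simp add: dt[OF \<phi>] scale3_inverse[OF e])
    then show ?thesis by (simp add: cls_scale[OF sd, symmetric])
  qed
  show "c j * inner (X $ i) (cls (dir_deriv \<phi> (axis j 1))) = c i * inner (X $ j) (cls (dir_deriv \<phi> (axis i 1)))"
    if \<phi>: "test_fun UNIV \<phi>" for \<phi> i j
  proof -
    have "inner (ev h $ i) (cls (dir_deriv (\<lambda>x. \<phi> (scale3 (1/\<epsilon>) x)) (axis j 1)))
        = inner (ev h $ j) (cls (dir_deriv (\<lambda>x. \<phi> (scale3 (1/\<epsilon>) x)) (axis i 1)))"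
      using S(2) t[OF \<phi>] unfolding curl_free_def by blast
    then show ?thesis unfolding key[OF S(1) \<phi>] X_def he using e by simp
  qed
  show "(\<Sum>i\<in>UNIV. c i * inner (X $ i + ev m $ i) (cls (dir_deriv \<phi> (axis i 1)))) = 0"
    if \<phi>: "test_fun UNIV \<phi>" for \<phi>
  proof -
    have "0 = (\<Sum>i\<in>UNIV. \<epsilon> * (c i * inner (X $ i + ev m $ i) (cls (dir_deriv \<phi> (axis i 1)))))"
      using S(3)[OF t[OF \<phi>]]
      by (simp add: inner_gradc inner_add_left key[OF S(1) \<phi>] key[OF m' \<phi>] he[symmetric] mm[symmetric] X_def[symmetric] distrib_left)
    also have "\<dots> = \<epsilon> * (\<Sum>i\<in>UNIV. c i * inner (X $ i + ev m $ i) (cls (dir_deriv \<phi> (axis i 1))))"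
      by (simp add: sum_distrib_left)
    finally show ?thesis using e by simp
  qed
  have "0 = inner (ev h) (ev h) + inner (ev m') (ev h)" using S(4) by (simp add: inner_add_left)
  also have "\<dots> = (\<Sum>i\<in>UNIV. \<epsilon> * inner (X $ i) (X $ i)) + (\<Sum>i\<in>UNIV. \<epsilon> * inner (ev m $ i) (X $ i))"
    unfolding inner_vec_def[of "ev _"] X_def he mm[symmetric] using inn[OF S(1) S(1)] inn[OF m' S(1)] mm by simp
  also have "\<dots> = \<epsilon> * inner (X + ev m) X"
    by (simp add: inner_vec_def sum_distrib_left sum.distrib inner_add_left distrib_left)
  finally show "inner (X + ev m) X = 0" using e by simp
qed

lemma one_neq_three: "(1::3) \<noteq> 3" and two_neq_three: "(2::3) \<noteq> 3"
  by simp_all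

text \<open>The energy identity and Cauchy-Schwarz. The bound does not depend on
  \<open>\<epsilon>\<close>, so it provides weakly convergent subsequences of rescaled
  fields.\<close>

lemma h_eps_norm_le:
  assumes "L2v UNIV m" "0 < \<epsilon>"
  shows "norm (ev (h_eps \<epsilon> m)) \<le> norm (ev m)"
proof -
  let ?X = "ev (h_eps \<epsilon> m)"
  have "(norm ?X)\<^sup>2 = - inner (ev m) ?X" using h_eps(4)[OF assms] by (simp add: inner_add_left power2_norm_eq_inner)
  also have "\<dots> \<le> norm (ev m) * norm ?X" using Cauchy_Schwarz_ineq2[of "ev m" ?X] by linarith
  finally show ?thesis by (cases "?X = 0") (auto simp: power2_eq_square)
qed

text \<open>Weak compactness only yields subsequences; this recovers convergence of the whole
  sequence when the limit is always the same.\<close>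

lemma tendsto_subsubseq:
  fixes f :: "nat \<Rightarrow> 'a::metric_space"
  assumes "\<And>r. strict_mono (r :: nat \<Rightarrow> nat) \<Longrightarrow> \<exists>s. strict_mono (s :: nat \<Rightarrow> nat) \<and> (\<lambda>n. f (r (s n))) \<longlonglongrightarrow> l"
  shows "f \<longlonglongrightarrow> l"
proof (rule ccontr)
  assume "\<not> f \<longlonglongrightarrow> l"
  then obtain e where e: "0 < e" "\<forall>N. \<exists>n\<ge>N. e \<le> dist (f n) l" by (auto simp: lim_sequentially not_less)
  then have inf: "infinite {n. e \<le> dist (f n) l}" by (auto simp: infinite_nat_iff_unbounded_le)
  define r where "r = enumerate {n. e \<le> dist (f n) l}"
  have r: "strict_mono r" unfolding r_def using inf by (rule strict_mono_enumerate)
  have rd: "e \<le> dist (f (r n)) l" for n using enumerate_in_set[OF inf, of n] by (simp add: r_def)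
  obtain s where "strict_mono (s :: nat \<Rightarrow> nat)" "(\<lambda>n. f (r (s n))) \<longlonglongrightarrow> l" using assms[OF r] by blast
  then obtain n where "dist (f (r (s n))) l < e" using metric_LIMSEQ_D[OF _ e(1)] by blast
  then show False using rd[of "s n"] by simp
qed

text \<open>Weak limits of the rescaled stray fields are determined by the limits of the curl and
  divergence equations multiplied by \<open>\<epsilon>\<close>, and the energy identity turns weak into norm convergence.\<close>

lemma h_eps_limit_weak:
  assumes m: "\<And>n. L2v UNIV (m n)" and M: "(\<lambda>n. ev (m n)) \<longlonglongrightarrow> M" and e: "\<And>n. 0 < \<epsilon> n" and e0: "\<epsilon> \<longlonglongrightarrow> 0"
    and X: "weakly (\<lambda>n. ev (h_eps (\<epsilon> n) (m n))) X" and bd: "\<And>n. norm (ev (h_eps (\<epsilon> n) (m n))) \<le> C"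
  shows "(\<lambda>n. (norm (ev (h_eps (\<epsilon> n) (m n))))\<^sup>2) \<longlonglongrightarrow> (norm (M $ 3))\<^sup>2"
proof -
  let ?X = "\<lambda>n. ev (h_eps (\<epsilon> n) (m n))"
  have Xi: "(\<lambda>n. inner (?X n $ i) v) \<longlonglongrightarrow> inner (X $ i) v" for i v
    using weaklyD[OF weakly_nth[OF X]] .
  have Mi: "(\<lambda>n. inner (ev (m n) $ i) v) \<longlonglongrightarrow> inner (M $ i) v" for i v
    using M by (intro tendsto_intros)
  have "X $ i = 0" if i: "i \<noteq> 3" for i
  proof (rule zero_of_line_derivative[OF axis_Basis[of 3]])
    fix \<phi> :: "real^3 \<Rightarrow> real" assume \<phi>: "test_fun UNIV \<phi>"
    have "inner (?X n $ i) (cls (dir_deriv \<phi> (axis 3 1))) = \<epsilon> n * inner (?X n $ 3) (cls (dir_deriv \<phi> (axis i 1)))" for n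
      using h_eps(2)[OF m[of n] e[of n] \<phi>, of 3 i] i e[of n] by (simp add: field_simps)
    then have "(\<lambda>n. inner (?X n $ i) (cls (dir_deriv \<phi> (axis 3 1)))) \<longlonglongrightarrow> 0 * inner (X $ 3) (cls (dir_deriv \<phi> (axis i 1)))"
      using tendsto_mult[OF e0 Xi] by simp
    then show "inner (X $ i) (cls (dir_deriv \<phi> (axis 3 1))) = 0" using LIMSEQ_unique[OF Xi] by simp
  qed
  then have X12: "X $ 1 = 0" "X $ 2 = 0" by auto
  have "X $ 3 + M $ 3 = 0"
  proof (rule zero_of_line_derivative[OF axis_Basis[of 3]])
    fix \<phi> :: "real^3 \<Rightarrow> real" assume \<phi>: "test_fun UNIV \<phi>"
    let ?d = "\<lambda>i. cls (dir_deriv \<phi> (axis i 1))"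
    have "inner (?X n $ 3 + ev (m n) $ 3) (?d 3) = - (\<epsilon> n * (inner (?X n $ 1 + ev (m n) $ 1) (?d 1) + inner (?X n $ 2 + ev (m n) $ 2) (?d 2)))" for n
    proof -
      have "inner (?X n $ 1 + ev (m n) $ 1) (?d 1) + inner (?X n $ 2 + ev (m n) $ 2) (?d 2) + (1 / \<epsilon> n) * inner (?X n $ 3 + ev (m n) $ 3) (?d 3) = 0"
        using h_eps(3)[OF m[of n] e[of n] \<phi>, unfolded sum_3] by (simp only: one_neq_three two_neq_three if_False refl if_True mult_1)
      then have "\<epsilon> n * (inner (?X n $ 1 + ev (m n) $ 1) (?d 1) + inner (?X n $ 2 + ev (m n) $ 2) (?d 2) + (1 / \<epsilon> n) * inner (?X n $ 3 + ev (m n) $ 3) (?d 3)) = 0" by simp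
      then show ?thesis using e[of n] by (simp add: distrib_left)
    qed
    moreover have "(\<lambda>n. - (\<epsilon> n * (inner (?X n $ 1 + ev (m n) $ 1) (?d 1) + inner (?X n $ 2 + ev (m n) $ 2) (?d 2)))) \<longlonglongrightarrow>
       - (0 * (inner (X $ 1 + M $ 1) (?d 1) + inner (X $ 2 + M $ 2) (?d 2)))"
      unfolding inner_add_left by (intro tendsto_minus tendsto_mult tendsto_add e0 Xi Mi)
    ultimately have "(\<lambda>n. inner (?X n $ 3 + ev (m n) $ 3) (?d 3)) \<longlonglongrightarrow> 0" by simp
    moreover have "(\<lambda>n. inner (?X n $ 3 + ev (m n) $ 3) (?d 3)) \<longlonglongrightarrow> inner (X $ 3 + M $ 3) (?d 3)"
      unfolding inner_add_left by (intro tendsto_add Xi Mi)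
    ultimately show "inner (X $ 3 + M $ 3) (?d 3) = 0" using LIMSEQ_unique by blast
  qed
  then have X3: "X $ 3 = - (M $ 3)" by (simp add: eq_neg_iff_add_eq_0)
  have "(\<lambda>n. - inner (?X n) (ev (m n))) \<longlonglongrightarrow> - inner X M"
    by (intro tendsto_minus weakly_strongly_inner[OF X bd M])
  moreover have "- inner X M = (norm (M $ 3))\<^sup>2"
    by (simp add: inner_vec_def sum_3 X12 X3 power2_norm_eq_inner)
  moreover have "- inner (?X n) (ev (m n)) = (norm (?X n))\<^sup>2" for n
    using h_eps(4)[OF m[of n] e[of n]] inner_commute[of "ev (m n)" "?X n"]
    by (simp add: inner_add_left power2_norm_eq_inner)
  ultimately show ?thesis by simp
qed

lemma h_eps_limit:
  assumes m: "\<And>n. L2v UNIV (m n)" and M: "(\<lambda>n. ev (m n)) \<longlonglongrightarrow> M" and e: "\<And>n. 0 < \<epsilon> n" and e0: "\<epsilon> \<longlonglongrightarrow> 0"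
  shows "(\<lambda>n. (norm (ev (h_eps (\<epsilon> n) (m n))))\<^sup>2) \<longlonglongrightarrow> (norm (M $ 3))\<^sup>2"
proof (rule tendsto_subsubseq)
  fix r :: "nat \<Rightarrow> nat" assume r: "strict_mono r"
  let ?X = "\<lambda>n. ev (h_eps (\<epsilon> n) (m n))"
  have "bounded (range (\<lambda>n. ev (m n)))" using M by (rule convergent_imp_bounded)
  then obtain C where C: "\<And>n. norm (ev (m n)) \<le> C" by (auto simp: bounded_iff)
  have bd: "norm (?X n) \<le> C" for n using h_eps_norm_le[OF m[of n] e[of n]] C[of n] by simp
  obtain s X where s: "strict_mono (s :: nat \<Rightarrow> nat)" and X: "weakly ((\<lambda>n. ?X (r n)) \<circ> s) X"
    using weakly_compact[of "\<lambda>n. ?X (r n)"] bd by blast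
  have rs: "strict_mono (\<lambda>n. r (s n))" using r s by (simp add: strict_mono_def)
  have "(\<lambda>n. (norm (?X (r (s n))))\<^sup>2) \<longlonglongrightarrow> (norm (M $ 3))\<^sup>2"
    by (rule h_eps_limit_weak[where C=C])
      (use m e bd X LIMSEQ_subseq_LIMSEQ[OF M rs] LIMSEQ_subseq_LIMSEQ[OF e0 rs] in \<open>auto simp: o_def\<close>)
  then show "\<exists>s. strict_mono (s :: nat \<Rightarrow> nat) \<and> (\<lambda>n. (norm (?X (r (s n))))\<^sup>2) \<longlonglongrightarrow> (norm (M $ 3))\<^sup>2" using s by blast
qed

section \<open>Rellich compactness for bounded sequences\<close>

definition shift :: "'a::euclidean_space \<Rightarrow> 'a l2 \<Rightarrow> 'a l2" where
  "shift y F = cls (\<lambda>x. fn F (x + y))"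

lemma norm_shift_diff: "norm (shift y F - shift y G) = norm (F - G)"
proof -
  have "shift y F - shift y G = cls (\<lambda>x. (\<lambda>x. fn F x - fn G x) (x + y))"
    unfolding shift_def by (simp add: cls_diff sqi_shift sqi_fn)
  moreover have "F - G = cls (\<lambda>x. fn F x - fn G x)"
    using cls_diff[OF sqi_fn[of F] sqi_fn[of G]] by simp
  ultimately show ?thesis using norm_cls_shift[OF sqi_diff[OF sqi_fn[of F] sqi_fn[of G]], of y] by simp
qed

lemma shift_cls:
  assumes f: "sqi f" shows "shift y (cls f) = cls (\<lambda>x. f (x + y))"
proof -
  have "shift y (cls f) - cls (\<lambda>x. f (x + y)) = cls (\<lambda>x. (\<lambda>x. fn (cls f) x - f x) (x + y))"
    unfolding shift_def using f by (simp add: cls_diff sqi_shift sqi_fn)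
  also have "norm \<dots> = norm (cls (\<lambda>x. fn (cls f) x - f x))" by (rule norm_cls_shift[OF sqi_diff[OF sqi_fn f]])
  also have "\<dots> = 0" using cls_diff[OF sqi_fn[of "cls f"] f] by simp
  finally show ?thesis by simp
qed

text \<open>The derivative of the pairing in the shift \<open>s\<close> is minus the pairing of
  \<open>D\<close> with the shifted function, bounded by \<open>C\<close> times a norm that shifts
  preserve.\<close>

lemma translation_bound_line:
  fixes F :: "'a::euclidean_space l2"
  assumes b: "b \<in> Basis" and w: "wd UNIV b F D" and D: "norm D \<le> C" and t: "test_fun UNIV \<phi>"
  shows "\<bar>inner F (cls (\<lambda>x. \<phi> (x + s *\<^sub>R b))) - inner F (cls \<phi>)\<bar> \<le> \<bar>s\<bar> * C * norm (cls \<phi>)"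
proof -
  define q where "q s = inner F (cls (\<lambda>x. \<phi> (x + s *\<^sub>R b)))" for s
  have d: "(q has_field_derivative - inner D (cls (\<lambda>x. \<phi> (x + s *\<^sub>R b)))) (at s within UNIV)" for s
  proof -
    have "dir_deriv (\<lambda>x. \<phi> (x + s *\<^sub>R b)) b = (\<lambda>x. dir_deriv \<phi> b (x + s *\<^sub>R b))"
      by (rule dir_deriv_translate[OF test_smooth[OF t] b])
    with w[unfolded wd_def, rule_format, OF test_shift[OF t, of "s *\<^sub>R b"]] inner_test_shift_has_derivative[OF t b, of F 0 s]
    show ?thesis by (simp add: q_def[abs_def])
  qed
  have "norm (q s - q 0) \<le> (C * norm (cls \<phi>)) * norm (s - 0)"
  proof (rule field_differentiable_bound[OF _ d])
    fix z
    have "\<bar>inner D (cls (\<lambda>x. \<phi> (x + z *\<^sub>R b)))\<bar> \<le> norm D * norm (cls (\<lambda>x. \<phi> (x + z *\<^sub>R b)))"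
      by (rule Cauchy_Schwarz_ineq2)
    also have "\<dots> \<le> C * norm (cls \<phi>)" using D t by (simp add: norm_cls_shift test_sqi mult_right_mono)
    finally show "norm (- inner D (cls (\<lambda>x. \<phi> (x + z *\<^sub>R b)))) \<le> C * norm (cls \<phi>)" by simp
  qed auto
  then show ?thesis by (simp add: q_def mult_ac)
qed

text \<open>One coordinate step at a time, by induction over the basis directions; each step costs
  the bound along a line.\<close>

lemma translation_bound_test:
  fixes F :: "'a::euclidean_space l2"
  assumes w: "\<And>b. b \<in> Basis \<Longrightarrow> wd UNIV b F (D b)" and D: "\<And>b. b \<in> Basis \<Longrightarrow> norm (D b) \<le> C" and t: "test_fun UNIV \<phi>"
  shows "\<bar>inner F (cls (\<lambda>x. \<phi> (x + y))) - inner F (cls \<phi>)\<bar> \<le> (\<Sum>b\<in>Basis. \<bar>y \<bullet> b\<bar>) * C * norm (cls \<phi>)"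
proof -
  have "\<bar>inner F (cls (\<lambda>x. \<phi> (x + (\<Sum>b\<in>S. (y \<bullet> b) *\<^sub>R b)))) - inner F (cls \<phi>)\<bar> \<le> (\<Sum>b\<in>S. \<bar>y \<bullet> b\<bar>) * C * norm (cls \<phi>)"
    if "finite S" "S \<subseteq> Basis" for S
    using that
  proof (induction S rule: finite_induct)
    case empty
    then show ?case by simp
  next
    case (insert b S)
    let ?u = "\<Sum>b\<in>S. (y \<bullet> b) *\<^sub>R b"
    have b: "b \<in> Basis" using insert by simp
    have "\<bar>inner F (cls (\<lambda>x. \<phi> (x + (y \<bullet> b) *\<^sub>R b + ?u))) - inner F (cls (\<lambda>x. \<phi> (x + ?u)))\<bar> \<le> \<bar>y \<bullet> b\<bar> * C * norm (cls (\<lambda>x. \<phi> (x + ?u)))"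
      by (rule translation_bound_line[OF b w[OF b] D[OF b] test_shift[OF t]])
    moreover have "norm (cls (\<lambda>x. \<phi> (x + ?u))) = norm (cls \<phi>)" by (rule norm_cls_shift[OF test_sqi[OF t]])
    moreover have "x + (\<Sum>b\<in>insert b S. (y \<bullet> b) *\<^sub>R b) = x + (y \<bullet> b) *\<^sub>R b + ?u" for x using insert by (simp add: add_ac)
    moreover have "(\<Sum>b\<in>insert b S. \<bar>y \<bullet> b\<bar>) * C * norm (cls \<phi>) = \<bar>y \<bullet> b\<bar> * C * norm (cls \<phi>) + (\<Sum>b\<in>S. \<bar>y \<bullet> b\<bar>) * C * norm (cls \<phi>)"
      using insert by (simp add: distrib_right)
    ultimately show ?case using insert.IH insert.prems by (simp only:) (simp add: add.assoc[symmetric])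
  qed
  from this[of Basis] show ?thesis by (simp add: euclidean_representation)
qed

text \<open>Density extends the bound from test functions to all \<open>G\<close>. With
  \<open>G = F\<close> it says that the autocorrelation of \<open>F\<close> at small shifts stays
  close to its squared norm.\<close>

lemma translation_bound:
  fixes F :: "'a::euclidean_space l2"
  assumes w: "\<And>b. b \<in> Basis \<Longrightarrow> wd UNIV b F (D b)" and D: "\<And>b. b \<in> Basis \<Longrightarrow> norm (D b) \<le> C"
  shows "\<bar>inner F (shift y G) - inner F G\<bar> \<le> (\<Sum>b\<in>Basis. \<bar>y \<bullet> b\<bar>) * C * norm G"
proof -
  have "G \<in> closure (cls ` Collect (test_fun UNIV))"
    using test_dense[of UNIV] by (auto simp: supp_in_def)
  then obtain g where g: "\<And>n. g n \<in> cls ` Collect (test_fun UNIV)" "g \<longlonglongrightarrow> G" unfolding closure_sequential by blast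
  have sh: "(\<lambda>n. shift y (g n)) \<longlonglongrightarrow> shift y G"
  proof -
    have "(\<lambda>n. norm (g n - G)) \<longlonglongrightarrow> 0" using g(2) by (simp add: LIM_zero tendsto_norm_zero)
    then have "(\<lambda>n. norm (shift y (g n) - shift y G)) \<longlonglongrightarrow> 0" by (simp add: norm_shift_diff)
    then show ?thesis by (simp add: LIM_zero_iff tendsto_norm_zero_iff)
  qed
  have "\<bar>inner F (shift y (g n)) - inner F (g n)\<bar> \<le> (\<Sum>b\<in>Basis. \<bar>y \<bullet> b\<bar>) * C * norm (g n)" for n
  proof -
    obtain \<phi> where \<phi>: "test_fun UNIV \<phi>" "g n = cls \<phi>" using g(1)[of n] by auto
    show ?thesis unfolding \<phi>(2) shift_cls[OF test_sqi[OF \<phi>(1)]] by (rule translation_bound_test[OF w D \<phi>(1)])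
  qed
  moreover have "(\<lambda>n. \<bar>inner F (shift y (g n)) - inner F (g n)\<bar>) \<longlonglongrightarrow> \<bar>inner F (shift y G) - inner F G\<bar>"
    using sh g(2) by (intro tendsto_intros)
  moreover have "(\<lambda>n. (\<Sum>b\<in>Basis. \<bar>y \<bullet> b\<bar>) * C * norm (g n)) \<longlonglongrightarrow> (\<Sum>b\<in>Basis. \<bar>y \<bullet> b\<bar>) * C * norm G"
    using g(2) by (intro tendsto_intros)
  ultimately show ?thesis by (meson LIMSEQ_le)
qed

section \<open>Averaged autocorrelations over small cubes\<close>

definition cube :: "real \<Rightarrow> 'a::euclidean_space set" where
  "cube \<delta> = cbox 0 (\<delta> *\<^sub>R One)"

lemma cube_measure: "0 < \<delta> \<Longrightarrow> measure lborel (cube \<delta> :: 'a::euclidean_space set) = \<delta> ^ DIM('a)"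
  unfolding cube_def by (simp add: measure_lborel_cbox_eq)

lemma cube_emeasure: "emeasure lborel (cube \<delta> :: 'a::euclidean_space set) < \<infinity>"
  unfolding cube_def by (rule emeasure_lborel_cbox_finite)

lemma cube_borel [measurable]: "cube \<delta> \<in> sets borel"
  by (simp add: cube_def)

lemma sqi_indicator_finite:
  assumes "A \<in> sets borel" "emeasure lborel A < \<infinity>" shows "sqi (indicator A)"
proof -
  have "(\<lambda>x. (indicator A x)\<^sup>2) = (indicator A :: _ \<Rightarrow> real)" by (auto simp: indicator_def)
  then show ?thesis unfolding sqi_def using assms by simp
qed

text \<open>The autocorrelation integrated over small shifts is rewritten as the integral of
  \<open>z\<close> against its own integrals over translated cubes; weak convergence acts on the
  latter at every point \<open>x\<close>.\<close>

lemma cube_correlation_Fubini: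
  fixes z :: "'a::euclidean_space \<Rightarrow> real"
  assumes [measurable]: "z \<in> borel_measurable borel" and zb: "\<And>x. \<bar>z x\<bar> \<le> B" and zs: "\<And>x. x \<notin> cball 0 R \<Longrightarrow> z x = 0"
  shows "(\<integral>y. indicator (cube \<delta>) y * inner (cls z) (shift y (cls z)) \<partial>lborel)
       = (\<integral>x. z x * inner (cls z) (cls (\<lambda>y. indicator (cube \<delta>) (y + - x))) \<partial>lborel)"
    and "integrable lborel (\<lambda>y. indicator (cube \<delta>) y * inner (cls z) (shift y (cls z)))"
proof -
  have B: "0 \<le> B" using zb[of 0] by simp
  have sz: "sqi z" by (rule bounded_support_sqi(1)[OF assms])
  let ?h = "\<lambda>x y :: 'a. indicator (cube \<delta>) y * (z x * z (x + y))"
  have int: "integrable (lborel \<Otimes>\<^sub>M lborel) (\<lambda>(x, y). ?h x y)"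
  proof (rule Bochner_Integration.integrable_bound)
    have "emeasure (lborel \<Otimes>\<^sub>M lborel) (cball (0::'a) R \<times> cube \<delta> :: ('a \<times> 'a) set) < \<infinity>"
      using emeasure_lborel_cball_finite[of "0::'a" R] cube_emeasure[of \<delta>, where 'a='a]
      by (subst lborel.emeasure_pair_measure_Times) (auto simp: ennreal_mult_less_top)
    then show "integrable (lborel \<Otimes>\<^sub>M lborel) (\<lambda>p. B * B * indicator (cball (0::'a) R \<times> cube \<delta> :: ('a \<times> 'a) set) p)"
      by (intro integrable_mult_right integrable_real_indicator) auto
    show "(\<lambda>(x, y). ?h x y) \<in> borel_measurable (lborel \<Otimes>\<^sub>M lborel)" by measurable
    show "AE p in lborel \<Otimes>\<^sub>M lborel. norm (case p of (x, y) \<Rightarrow> ?h x y) \<le> norm (B * B * indicator (cball (0::'a) R \<times> cube \<delta>) p)"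
    proof (rule AE_I2)
      fix p :: "'a \<times> 'a"
      obtain x y where p: "p = (x, y)" by (cases p)
      have "\<bar>z x\<bar> * \<bar>z (x + y)\<bar> \<le> B * B" using zb[of x] zb[of "x + y"] B by (intro mult_mono) auto
      then show "norm (case p of (x, y) \<Rightarrow> ?h x y) \<le> norm (B * B * indicator (cball (0::'a) R \<times> cube \<delta>) p)"
        using zs[of x] B unfolding p by (auto simp: indicator_def abs_mult)
    qed
  qed
  have 1: "(\<integral>x. ?h x y \<partial>lborel) = indicator (cube \<delta>) y * inner (cls z) (shift y (cls z))" for y
    by (simp add: shift_cls[OF sz] inner_cls sz sqi_shift)
  have 2: "(\<integral>y. ?h x y \<partial>lborel) = z x * inner (cls z) (cls (\<lambda>y. indicator (cube \<delta>) (y + - x)))" for x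
  proof -
    have si: "sqi (indicator (cube \<delta> :: 'a set))" by (rule sqi_indicator_finite[OF _ cube_emeasure]) simp
    have "(\<integral>y. ?h x y \<partial>lborel) = z x * (\<integral>y. (\<lambda>y. indicator (cube \<delta>) (y + - x) * z y) (y + x) \<partial>lborel)"
      by (simp add: mult_ac add.commute)
    also have "(\<integral>y. (\<lambda>y. indicator (cube \<delta>) (y + - x) * z y) (y + x) \<partial>lborel) = (\<integral>y. indicator (cube \<delta>) (y + - x) * z y \<partial>lborel)"
      by (rule lborel_integral_shift) simp
    also have "\<dots> = inner (cls z) (cls (\<lambda>y. indicator (cube \<delta>) (y + - x)))"
      using inner_cls[OF sz sqi_shift[OF si, of "-x"]] by (simp add: mult.commute)
    finally show ?thesis .
  qed
  show "(\<integral>y. indicator (cube \<delta>) y * inner (cls z) (shift y (cls z)) \<partial>lborel)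
       = (\<integral>x. z x * inner (cls z) (cls (\<lambda>y. indicator (cube \<delta>) (y + - x))) \<partial>lborel)"
    using lborel_pair.Fubini_integral[of ?h] int unfolding 1 2 by simp
  show "integrable lborel (\<lambda>y. indicator (cube \<delta>) y * inner (cls z) (shift y (cls z)))"
    using lborel_pair.integrable_snd[of ?h] int unfolding 1 by simp
qed

text \<open>The integrated autocorrelation \<open>J\<close> tends to zero by weak and dominated
  convergence. For a small cube, however, the gradient bound keeps it above the volume of the cube
  times nearly the squared norm.\<close>

lemma rellich_whole_space:
  fixes z :: "nat \<Rightarrow> 'a::euclidean_space \<Rightarrow> real"
  assumes zm [measurable]: "\<And>n. z n \<in> borel_measurable borel" and zb: "\<And>n x. \<bar>z n x\<bar> \<le> B" and zs: "\<And>n x. x \<notin> cball 0 R \<Longrightarrow> z n x = 0"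
    and w: "\<And>n b. b \<in> Basis \<Longrightarrow> wd UNIV b (cls (z n)) (D n b)" and D: "\<And>n b. b \<in> Basis \<Longrightarrow> norm (D n b) \<le> C"
    and wk: "weakly (\<lambda>n. cls (z n)) 0"
  shows "(\<lambda>n. cls (z n)) \<longlonglongrightarrow> 0"
proof -
  have B: "0 \<le> B" using zb[of 0 0] by simp
  have C: "0 \<le> C" using D[OF SOME_Basis] norm_ge_zero order_trans by blast
  have sz: "sqi (z n)" for n using bounded_support_sqi(1)[OF zm zb zs] .
  define V where "V = B * sqrt (measure lborel (cball (0::'a) R))"
  have nz: "norm (cls (z n)) \<le> V" for n unfolding V_def by (rule bounded_support_sqi(2)[OF zm zb zs])
  have V: "0 \<le> V" using nz[of 0] norm_ge_zero order_trans by blast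
  have si: "sqi (indicator (cube \<delta> :: 'a set))" for \<delta> by (rule sqi_indicator_finite[OF _ cube_emeasure]) simp
  define J where "J \<delta> n = (\<integral>y. indicator (cube \<delta>) y * inner (cls (z n)) (shift y (cls (z n))) \<partial>lborel)" for \<delta> n
  have J0: "J \<delta> \<longlonglongrightarrow> 0" for \<delta>
  proof -
    let ?a = "\<lambda>n x. inner (cls (z n)) (cls (\<lambda>y. indicator (cube \<delta>) (y + - x)))"
    have am: "(\<lambda>x. z n x * ?a n x) \<in> borel_measurable lborel" for n
    proof -
      have "?a n x = (\<integral>y. z n y * indicator (cube \<delta>) (y + - x) \<partial>lborel)" for x
        by (rule inner_cls[OF sz sqi_shift[OF si]])
      then show ?thesis by simp
    qed
    have "(\<lambda>n. \<integral>x. z n x * ?a n x \<partial>lborel) \<longlonglongrightarrow> (\<integral>x. 0 \<partial>(lborel :: 'a measure))"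
    proof (rule integral_dominated_convergence)
      show "integrable lborel (\<lambda>x. B * (V * norm (cls (indicator (cube \<delta> :: 'a set)))) * indicator (cball (0::'a) R) x)"
        using emeasure_lborel_cball_finite[of "0::'a" R] by (intro integrable_mult_right integrable_real_indicator) auto
      show "AE x in lborel. (\<lambda>n. z n x * ?a n x) \<longlonglongrightarrow> 0"
      proof (rule AE_I2)
        fix x
        have a0: "(\<lambda>n. B * \<bar>?a n x\<bar>) \<longlonglongrightarrow> 0"
          using tendsto_mult_right_zero[OF tendsto_rabs_zero[OF weaklyD[OF wk, of "cls (\<lambda>y. indicator (cube \<delta>) (y + - x))", simplified]]] by simp
        show "(\<lambda>n. z n x * ?a n x) \<longlonglongrightarrow> 0"
        proof (rule Lim_null_comparison[OF _ a0], intro always_eventually allI)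
          fix n show "norm (z n x * ?a n x) \<le> B * \<bar>?a n x\<bar>"
            unfolding real_norm_def abs_mult by (rule mult_right_mono[OF zb abs_ge_zero])
        qed
      qed
      show "AE x in lborel. norm (z n x * ?a n x) \<le> B * (V * norm (cls (indicator (cube \<delta> :: 'a set)))) * indicator (cball (0::'a) R) x" for n
      proof (rule AE_I2)
        fix x
        have "\<bar>?a n x\<bar> \<le> norm (cls (z n)) * norm (cls (\<lambda>y. indicator (cube \<delta>) (y + - x)))" by (rule Cauchy_Schwarz_ineq2)
        also have "\<dots> \<le> V * norm (cls (indicator (cube \<delta> :: 'a set)))"
          unfolding norm_cls_shift[OF si] by (rule mult_right_mono[OF nz norm_ge_zero])
        finally have "\<bar>z n x\<bar> * \<bar>?a n x\<bar> \<le> B * (V * norm (cls (indicator (cube \<delta> :: 'a set))))"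
          using zb[of n x] B by (intro mult_mono) auto
        then show "norm (z n x * ?a n x) \<le> B * (V * norm (cls (indicator (cube \<delta> :: 'a set)))) * indicator (cball (0::'a) R) x"
          using zs[of x n] by (cases "x \<in> cball 0 R") (auto simp: abs_mult)
      qed
    qed (use am in auto)
    moreover have "J \<delta> = (\<lambda>n. \<integral>x. z n x * ?a n x \<partial>lborel)"
      by (rule ext, unfold J_def) (rule cube_correlation_Fubini(1)[OF zm zb zs])
    ultimately show ?thesis by simp
  qed
  have main: "\<delta> ^ DIM('a) * ((norm (cls (z n)))\<^sup>2 - real DIM('a) * \<delta> * C * V) \<le> J \<delta> n" if \<delta>: "0 < \<delta>" for \<delta> n
  proof -
    have "\<delta> ^ DIM('a) * ((norm (cls (z n)))\<^sup>2 - real DIM('a) * \<delta> * C * V)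
       = (\<integral>y. indicator (cube \<delta> :: 'a set) y * ((norm (cls (z n)))\<^sup>2 - real DIM('a) * \<delta> * C * V) \<partial>lborel)"
      by (simp add: cube_measure \<delta>)
    also have "\<dots> \<le> J \<delta> n" unfolding J_def
    proof (rule integral_mono)
      show "integrable lborel (\<lambda>y. indicator (cube \<delta> :: 'a set) y * ((norm (cls (z n)))\<^sup>2 - real DIM('a) * \<delta> * C * V))"
        using cube_emeasure[of \<delta>, where 'a='a] by (intro integrable_mult_left integrable_real_indicator) auto
      show "integrable lborel (\<lambda>y. indicator (cube \<delta>) y * inner (cls (z n)) (shift y (cls (z n))))"
        by (rule cube_correlation_Fubini(2)[OF zm zb zs])
      fix y :: 'a
      show "indicator (cube \<delta>) y * ((norm (cls (z n)))\<^sup>2 - real DIM('a) * \<delta> * C * V)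
        \<le> indicator (cube \<delta>) y * inner (cls (z n)) (shift y (cls (z n)))"
      proof (cases "y \<in> cube \<delta>")
        case True
        have "(\<Sum>b\<in>Basis. \<bar>y \<bullet> b\<bar>) \<le> (\<Sum>b\<in>(Basis::'a set). \<delta>)"
          using True by (intro sum_mono) (auto simp: cube_def mem_box)
        then have "(\<Sum>b\<in>Basis. \<bar>y \<bullet> b\<bar>) * C * norm (cls (z n)) \<le> real DIM('a) * \<delta> * C * V"
          using C nz[of n] \<delta> by (intro mult_mono) auto
        with translation_bound[where F="cls (z n)" and D="D n", OF w D, of y "cls (z n)"] True
        show ?thesis by (simp add: power2_norm_eq_inner)
      qed simp
    qed
    finally show ?thesis .
  qed
  have "(\<lambda>n. (norm (cls (z n)))\<^sup>2) \<longlonglongrightarrow> 0"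
  proof (rule metric_LIMSEQ_I)
    fix e :: real assume e: "0 < e"
    \<comment> \<open>Makes the gradient error \<open>DIM('a) * \<delta> * C * V\<close> smaller
      than \<open>e / 2\<close>; the added 1 avoids a zero denominator.\<close>
    define \<delta> where "\<delta> = e / (2 * (real DIM('a) * C * V + 1))"
    have p: "0 < real DIM('a) * C * V + 1" using C V by (simp add: add_nonneg_pos)
    have \<delta>: "0 < \<delta>" using e p by (simp add: \<delta>_def)
    have "real DIM('a) * \<delta> * C * V = \<delta> * (real DIM('a) * C * V)" by simp
    also have "\<dots> < \<delta> * (real DIM('a) * C * V + 1)" using \<delta> by simp
    also have "\<dots> = e / 2"
    proof -
      have "e / (2 * P) * P = e / 2" if "0 < P" for P :: real using that by simp
      then show ?thesis using p unfolding \<delta>_def by blast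
    qed
    finally have small: "real DIM('a) * \<delta> * C * V < e / 2" .
    obtain N where N: "\<And>n. n \<ge> N \<Longrightarrow> \<bar>J \<delta> n\<bar> < \<delta> ^ DIM('a) * (e / 2)"
      using metric_LIMSEQ_D[OF J0[of \<delta>], of "\<delta> ^ DIM('a) * (e / 2)"] e \<delta> by (auto simp: dist_real_def)
    have "(norm (cls (z n)))\<^sup>2 < e" if "n \<ge> N" for n
    proof -
      have "\<delta> ^ DIM('a) * ((norm (cls (z n)))\<^sup>2 - real DIM('a) * \<delta> * C * V) < \<delta> ^ DIM('a) * (e / 2)"
        using main[OF \<delta>, of n] N[OF that] by linarith
      then have "(norm (cls (z n)))\<^sup>2 - real DIM('a) * \<delta> * C * V < e / 2" using \<delta> by simp
      then show ?thesis using small by linarith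
    qed
    then show "\<exists>no. \<forall>n\<ge>no. dist ((norm (cls (z n)))\<^sup>2) 0 < e" by (auto simp: dist_real_def)
  qed
  then show ?thesis using weakly_strongly[OF wk] by simp
qed

text \<open>Multiplying by a test function \<open>\<zeta>\<close> close in L2 to the indicator of
  \<open>U\<close> gives functions that are weakly differentiable on the whole space. The part
  discarded near the boundary is small uniformly in \<open>n\<close> thanks to the bound
  \<open>B\<close>.\<close>

lemma rellich_null:
  fixes W :: "nat \<Rightarrow> 'a::euclidean_space l2"
  assumes U: "open U" "bounded U" and s: "\<And>n. supp_in U (W n)" and Wb: "\<And>n. AE x in lebesgue. \<bar>fn (W n) x\<bar> \<le> B"
    and w: "\<And>n b. b \<in> Basis \<Longrightarrow> wd U b (W n) (D n b)" and D: "\<And>n b. b \<in> Basis \<Longrightarrow> norm (D n b) \<le> C" and wk: "weakly W 0"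
  shows "W \<longlonglongrightarrow> 0"
proof (rule metric_LIMSEQ_I)
  fix e :: real assume e: "0 < e"
  define B' where "B' = max B 1"
  have B': "1 \<le> B'" "B \<le> B'" by (auto simp: B'_def)
  \<comment> \<open>A Borel representative that vanishes off \<open>U\<close> and obeys the bound at
    every point, as \<open>rellich_whole_space\<close> demands.\<close>
  define v where "v n x = (if x \<in> U then max (- B') (min B' (fn (W n) x)) else 0)" for n x
  have Ub: "U \<in> sets borel" using U by simp
  have vm [measurable]: "v n \<in> borel_measurable borel" for n unfolding v_def using Ub by measurable
  have vb: "\<bar>v n x\<bar> \<le> B'" for n x using B' by (auto simp: v_def)
  from U(2) obtain R where R: "U \<subseteq> cball 0 R" by (auto simp: bounded_iff subset_iff)
  have vs: "v n x = 0" if "x \<notin> U" for n x using that by (simp add: v_def)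
  have sv: "sqi (v n)" for n by (rule bounded_support_sqi(1)[OF vm vb, of R]) (use vs R in blast)
  have Wv: "W n = cls (v n)" for n
  proof (rule AE_cls_I[OF sv])
    have "AE x in lebesgue. fn (W n) x = v n x"
      using s[of n, unfolded supp_in_def] Wb[of n] by eventually_elim (use B' in \<open>auto simp: v_def\<close>)
    then show "AE x in lborel. fn (W n) x = v n x" unfolding AE_completion_iff .
  qed
  have fin: "emeasure lborel U < \<infinity>"
    by (rule le_less_trans[OF emeasure_mono[OF R] emeasure_lborel_cball_finite]) simp
  have sU: "sqi (indicator U)" by (rule sqi_indicator_finite[OF Ub fin])
  have "supp_in U (cls (indicator U))"
    unfolding supp_in_def using AE_completion[OF fn_cls[OF sU]] by eventually_elim simp
  then have "cls (indicator U) \<in> closure (cls ` Collect (test_fun U))" using test_dense[OF U(1)] by blast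
  then obtain \<zeta> where \<zeta>: "test_fun U \<zeta>" "dist (cls \<zeta>) (cls (indicator U)) < e / (2 * B')"
    using e B' unfolding closure_approachable by (auto dest!: spec[of _ "e / (2 * B')"])
  note [measurable] = sqi_measurable[OF test_sqi[OF \<zeta>(1)]]
  have \<zeta>U: "\<zeta> x = 0" if "x \<notin> U" for x
  proof -
    from \<zeta>(1) obtain K where "K \<subseteq> U" "\<And>x. x \<notin> K \<Longrightarrow> \<zeta> x = 0" by (rule test_funE) blast
    then show ?thesis using that by blast
  qed
  obtain Z where Z: "\<And>x. \<bar>\<zeta> x\<bar> \<le> Z" using test_bounded[OF \<zeta>(1)] by blast
  have Z0: "0 \<le> Z" using Z[of 0] by simp
  define z where "z n x = \<zeta> x * v n x" for n x
  have zm: "z n \<in> borel_measurable borel" for n unfolding z_def by measurable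
  have zb: "\<bar>z n x\<bar> \<le> Z * B'" for n x unfolding z_def abs_mult using Z vb Z0 by (intro mult_mono) auto
  have zs: "z n x = 0" if "x \<notin> cball 0 R" for n x
  proof -
    have "x \<notin> U" using R that by blast
    then show ?thesis using vs[of x n] by (simp add: z_def)
  qed
  have sz: "sqi (z n)" for n by (rule bounded_support_sqi(1)[OF zm zb zs])
  have smul: "sqi (\<lambda>x. f x * g x)" if fg: "test_fun UNIV f" "sqi g" for f g :: "'a \<Rightarrow> real"
  proof -
    obtain K where K: "\<And>x. \<bar>f x\<bar> \<le> K" using test_bounded[OF fg(1)] by blast
    have "f \<in> borel_measurable (lebesgue_on UNIV)" using L2_sqi[OF test_sqi[OF fg(1)]] by (simp add: L2_def)
    have [measurable]: "f \<in> borel_measurable borel" "g \<in> borel_measurable borel"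
      using sqi_measurable[OF test_sqi[OF fg(1)]] sqi_measurable[OF fg(2)] by auto
    have "integrable lborel (\<lambda>x. (f x * g x)\<^sup>2)"
    proof (rule Bochner_Integration.integrable_bound)
      show "integrable lborel (\<lambda>x. K\<^sup>2 * (g x)\<^sup>2)" using sqi_square[OF fg(2)] by simp
      show "AE x in lborel. norm ((f x * g x)\<^sup>2) \<le> norm (K\<^sup>2 * (g x)\<^sup>2)"
      proof (rule AE_I2)
        fix x have "(f x)\<^sup>2 \<le> K\<^sup>2" using K[of x] power_mono[of "\<bar>f x\<bar>" K 2] by simp
        then show "norm ((f x * g x)\<^sup>2) \<le> norm (K\<^sup>2 * (g x)\<^sup>2)" by (simp add: power_mult_distrib mult_right_mono)
      qed
    qed simp
    then show ?thesis by (simp add: sqi_def)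
  qed
  have nmul: "norm (cls (\<lambda>x. f x * g x)) \<le> K * norm (cls g)" if "test_fun UNIV f" "sqi g" "\<And>x. \<bar>f x\<bar> \<le> K" for f g :: "'a \<Rightarrow> real" and K
  proof -
    have K: "0 \<le> K" using that(3)[of 0] by simp
    have "(norm (cls (\<lambda>x. f x * g x)))\<^sup>2 \<le> (\<integral>x. K\<^sup>2 * (g x)\<^sup>2 \<partial>lborel)"
      unfolding norm_cls[OF smul[OF that(1,2)]]
    proof (rule integral_mono)
      show "integrable lborel (\<lambda>x. (f x * g x)\<^sup>2)" by (rule sqi_square[OF smul[OF that(1,2)]])
      show "integrable lborel (\<lambda>x. K\<^sup>2 * (g x)\<^sup>2)" using sqi_square[OF that(2)] by simp
      fix x have "(f x)\<^sup>2 \<le> K\<^sup>2" using that(3)[of x] power_mono[of "\<bar>f x\<bar>" K 2] by simp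
      then show "(f x * g x)\<^sup>2 \<le> K\<^sup>2 * (g x)\<^sup>2" by (simp add: power_mult_distrib mult_right_mono)
    qed
    also have "\<dots> = (K * norm (cls g))\<^sup>2" using norm_cls[OF that(2)] by (simp add: power_mult_distrib)
    finally show ?thesis by (rule power2_le_imp_le) (use K in simp)
  qed
  have \<zeta>': "test_fun UNIV \<zeta>" using test_mono[OF \<zeta>(1)] by simp
  have imul: "inner (cls (\<lambda>x. f x * g x)) (cls k) = inner (cls g) (cls (\<lambda>x. f x * k x))"
    if "test_fun UNIV f" "sqi g" "sqi k" for f g k :: "'a \<Rightarrow> real"
    using that by (simp add: inner_cls smul mult_ac)
  have "(\<lambda>n. cls (z n)) \<longlonglongrightarrow> 0"
  proof -
    have "\<forall>b\<in>Basis. \<exists>K. \<forall>x. \<bar>dir_deriv \<zeta> b x\<bar> \<le> K" using test_bounded test_dir_deriv[OF \<zeta>(1)] by blast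
    then obtain K where K: "\<And>b x. b \<in> Basis \<Longrightarrow> \<bar>dir_deriv \<zeta> b x\<bar> \<le> K b" by metis
    define K' where "K' = (\<Sum>b\<in>(Basis::'a set). K b)"
    have Kpos: "0 \<le> K b" if "b \<in> Basis" for b using K[OF that, of 0] by linarith
    have K': "K b \<le> K'" if "b \<in> Basis" for b unfolding K'_def using that Kpos by (intro member_le_sum) auto
    have K'0: "0 \<le> K'" unfolding K'_def using Kpos by (intro sum_nonneg) auto
    define T where "T = B' * sqrt (measure lborel (cball (0::'a) R))"
    have nv: "norm (cls (v n)) \<le> T" for n
      unfolding T_def by (rule bounded_support_sqi(2)[OF vm vb]) (use vs R in blast)
    \<comment> \<open>The product rule. It holds on the whole space because \<open>\<zeta>\<close>
      times any test function is a test function on \<open>U\<close>.\<close>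
    define E where "E n b = cls (\<lambda>x. \<zeta> x * fn (D n b) x) + cls (\<lambda>x. dir_deriv \<zeta> b x * v n x)" for n b
    show ?thesis
    proof (rule rellich_whole_space[where z=z and B="Z * B'" and R=R and D=E and C="Z * C + K' * T"])
      show "wd UNIV b (cls (z n)) (E n b)" if b: "b \<in> Basis" for n b
        unfolding wd_def
      proof (intro allI impI)
        fix \<phi> :: "'a \<Rightarrow> real" assume \<phi>: "test_fun UNIV \<phi>"
        have d\<zeta>: "test_fun UNIV (dir_deriv \<zeta> b)" by (rule test_dir_deriv[OF \<zeta>' b])
        have t: "test_fun U (\<lambda>x. \<phi> x * \<zeta> x)" by (rule test_mult[OF \<zeta>(1) test_smooth[OF \<phi>]])
        note sq = test_sqi[OF \<phi>] test_sqi[OF test_dir_deriv[OF \<phi> b]]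
        have "cls (dir_deriv (\<lambda>x. \<phi> x * \<zeta> x) b) = cls (\<lambda>x. \<zeta> x * dir_deriv \<phi> b x) + cls (\<lambda>x. dir_deriv \<zeta> b x * \<phi> x)"
          using sq by (simp add: dir_deriv_mult[OF test_smooth[OF \<phi>] test_smooth[OF \<zeta>(1)] b] cls_add smul \<zeta>' d\<zeta> mult.commute[of "dir_deriv \<phi> b _"])
        then have "inner (cls (v n)) (cls (\<lambda>x. \<zeta> x * dir_deriv \<phi> b x)) = inner (cls (v n)) (cls (dir_deriv (\<lambda>x. \<phi> x * \<zeta> x) b)) - inner (cls (v n)) (cls (\<lambda>x. dir_deriv \<zeta> b x * \<phi> x))"
          by (simp add: inner_simps)
        also have "inner (cls (v n)) (cls (dir_deriv (\<lambda>x. \<phi> x * \<zeta> x) b)) = - inner (D n b) (cls (\<lambda>x. \<phi> x * \<zeta> x))"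
          using w[OF b, of n] t unfolding wd_def Wv by blast
        also have "inner (D n b) (cls (\<lambda>x. \<phi> x * \<zeta> x)) = inner (cls (\<lambda>x. \<zeta> x * fn (D n b) x)) (cls \<phi>)"
          using imul[OF \<zeta>' sqi_fn[of "D n b"] sq(1)] by (simp add: mult.commute)
        also have "inner (cls (v n)) (cls (\<lambda>x. dir_deriv \<zeta> b x * \<phi> x)) = inner (cls (\<lambda>x. dir_deriv \<zeta> b x * v n x)) (cls \<phi>)"
          by (rule imul[OF d\<zeta> sv sq(1), symmetric])
        finally show "inner (cls (z n)) (cls (dir_deriv \<phi> b)) = - inner (E n b) (cls \<phi>)"
          using imul[OF \<zeta>' sv sq(2)] unfolding z_def[abs_def] E_def by (simp add: inner_simps)
      qed
      show "norm (E n b) \<le> Z * C + K' * T" if b: "b \<in> Basis" for n b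
      proof -
        have "norm (cls (\<lambda>x. \<zeta> x * fn (D n b) x)) \<le> Z * norm (D n b)" using nmul[OF \<zeta>' sqi_fn[of "D n b"] Z] by simp
        also have "\<dots> \<le> Z * C" using D[OF b] Z0 by (intro mult_left_mono)
        finally have 1: "norm (cls (\<lambda>x. \<zeta> x * fn (D n b) x)) \<le> Z * C" .
        have "norm (cls (\<lambda>x. dir_deriv \<zeta> b x * v n x)) \<le> K b * norm (cls (v n))"
          by (rule nmul[OF test_dir_deriv[OF \<zeta>' b] sv K[OF b]])
        also have "\<dots> \<le> K' * T" using nv K'[OF b] K'0 by (intro mult_mono) auto
        finally show ?thesis using 1 unfolding E_def by (intro norm_triangle_le) simp
      qed
      show "weakly (\<lambda>n. cls (z n)) 0" unfolding weakly_def
      proof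
        fix G :: "'a l2"
        have "inner (cls (z n)) G = inner (W n) (cls (\<lambda>x. \<zeta> x * fn G x))" for n
          using imul[OF \<zeta>' sv[of n] sqi_fn[of G]] by (simp add: z_def[abs_def] Wv)
        then show "(\<lambda>n. inner (cls (z n)) G) \<longlonglongrightarrow> inner 0 G" using weaklyD[OF wk, of "cls (\<lambda>x. \<zeta> x * fn G x)"] by simp
      qed
    qed (use zm zb zs in auto)
  qed
  then obtain N where N: "\<And>n. n \<ge> N \<Longrightarrow> norm (cls (z n)) < e / 2"
    using e metric_LIMSEQ_D[of _ 0 "e/2"] by (metis dist_0_norm dist_commute half_gt_zero)
  have rest: "norm (W n - cls (z n)) \<le> e / 2" for n
  proof -
    have eq: "W n - cls (z n) = cls (\<lambda>x. (indicator U x - \<zeta> x) * v n x)"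
    proof -
      have "v n x - z n x = (indicator U x - \<zeta> x) * v n x" for x using vs[of x n] by (auto simp: z_def left_diff_distrib indicator_def)
      then show ?thesis by (simp add: Wv cls_diff sv sz)
    qed
    have sd: "sqi (\<lambda>x. indicator U x - \<zeta> x)" by (rule sqi_diff[OF sU test_sqi[OF \<zeta>(1)]])
    have eq2: "(\<lambda>x. (indicator U x - \<zeta> x) * v n x) = (\<lambda>x. v n x - z n x)" using vs by (auto simp: z_def left_diff_distrib indicator_def fun_eq_iff)
    have s2: "sqi (\<lambda>x. (indicator U x - \<zeta> x) * v n x)" unfolding eq2 by (rule sqi_diff[OF sv sz])
    have "(norm (W n - cls (z n)))\<^sup>2 \<le> (\<integral>x. B'\<^sup>2 * (indicator U x - \<zeta> x)\<^sup>2 \<partial>lborel)"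
      unfolding eq norm_cls[OF s2]
    proof (rule integral_mono)
      show "integrable lborel (\<lambda>x. ((indicator U x - \<zeta> x) * v n x)\<^sup>2)" by (rule sqi_square[OF s2])
      show "integrable lborel (\<lambda>x. B'\<^sup>2 * (indicator U x - \<zeta> x)\<^sup>2)" using sqi_square[OF sd] by simp
      fix x have "(v n x)\<^sup>2 \<le> B'\<^sup>2" using vb[of n x] power_mono[of "\<bar>v n x\<bar>" B' 2] by simp
      then show "((indicator U x - \<zeta> x) * v n x)\<^sup>2 \<le> B'\<^sup>2 * (indicator U x - \<zeta> x)\<^sup>2"
        by (simp add: power_mult_distrib mult.commute mult_right_mono)
    qed
    also have "\<dots> = (B' * norm (cls (indicator U) - cls \<zeta>))\<^sup>2"
      using norm_cls[OF sd] by (simp add: cls_diff sU test_sqi[OF \<zeta>(1)] power_mult_distrib)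
    finally have "norm (W n - cls (z n)) \<le> B' * norm (cls (indicator U) - cls \<zeta>)"
      by (rule power2_le_imp_le) (use B' in simp)
    also have "\<dots> \<le> B' * (e / (2 * B'))"
      using \<zeta>(2) B' by (intro mult_left_mono) (auto simp: dist_norm norm_minus_commute)
    also have "\<dots> = e / 2" using B' by simp
    finally show ?thesis .
  qed
  have "dist (W n) 0 < e" if "n \<ge> N" for n
    using norm_triangle_ineq[of "W n - cls (z n)" "cls (z n)"] rest[of n] N[OF that] by simp
  then show "\<exists>no. \<forall>n\<ge>no. dist (W n) 0 < e" by blast
qed

text \<open>A failure of the Cauchy property gives two index sequences along which the differences
  are weakly null yet bounded away from zero. Working with differences avoids having to establish
  bounds and derivatives for the limit \<open>G\<close>.\<close>

lemma rellich:
  fixes F :: "nat \<Rightarrow> 'a::euclidean_space l2"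
  assumes U: "open U" "bounded U" and s: "\<And>n. supp_in U (F n)" and Fb: "\<And>n. AE x in lebesgue. \<bar>fn (F n) x\<bar> \<le> B"
    and w: "\<And>n b. b \<in> Basis \<Longrightarrow> wd U b (F n) (D n b)" and D: "\<And>n b. b \<in> Basis \<Longrightarrow> norm (D n b) \<le> C" and wk: "weakly F G"
  shows "F \<longlonglongrightarrow> G"
proof -
  have "Cauchy F"
  proof (rule ccontr)
    assume "\<not> Cauchy F"
    then obtain e where e: "0 < e" "\<forall>M. \<exists>m\<ge>M. \<exists>n\<ge>M. e \<le> dist (F m) (F n)"
      unfolding Cauchy_def by (auto simp: not_less)
    from e(2) obtain p q where pq: "\<And>k. p k \<ge> k" "\<And>k. q k \<ge> k" "\<And>k. e \<le> dist (F (p k)) (F (q k))" by metis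
    have inf: "filterlim p sequentially sequentially" "filterlim q sequentially sequentially"
      using pq(1,2) by (auto intro: filterlim_at_top_mono[OF filterlim_ident])
    have "(\<lambda>k. F (p k) - F (q k)) \<longlonglongrightarrow> 0"
    proof (rule rellich_null[OF U, where B="B + B" and C="C + C" and D="\<lambda>k b. D (p k) b - D (q k) b"])
      show "supp_in U (F (p k) - F (q k))" for k by (rule supp_in_diff[OF s s])
      show "AE x in lebesgue. \<bar>fn (F (p k) - F (q k)) x\<bar> \<le> B + B" for k
        using fn_diff[of "F (p k)" "F (q k)"] Fb[of "p k"] Fb[of "q k"] by eventually_elim auto
      show "wd U b (F (p k) - F (q k)) (D (p k) b - D (q k) b)" if "b \<in> Basis" for k b by (rule wd_diff[OF w[OF that] w[OF that]])
      show "norm (D (p k) b - D (q k) b) \<le> C + C" if "b \<in> Basis" for k b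
        using norm_triangle_ineq4[of "D (p k) b" "D (q k) b"] D[OF that, of "p k"] D[OF that, of "q k"] by linarith
      show "weakly (\<lambda>k. F (p k) - F (q k)) 0" unfolding weakly_def
      proof
        fix v
        have "(\<lambda>k. inner (F (p k)) v - inner (F (q k)) v) \<longlonglongrightarrow> inner G v - inner G v"
          by (intro tendsto_diff filterlim_compose[OF weaklyD[OF wk]] inf)
        then show "(\<lambda>k. inner (F (p k) - F (q k)) v) \<longlonglongrightarrow> inner 0 v" by (simp add: inner_simps)
      qed
    qed
    from metric_LIMSEQ_D[OF this e(1)] obtain k where "dist (F (p k) - F (q k)) 0 < e" by blast
    then show False using pq(3)[of k] by (simp add: dist_norm)
  qed
  then obtain H where H: "F \<longlonglongrightarrow> H" using Cauchy_convergent convergent_def by blast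
  then have "weakly F H" by (rule strongly_weakly)
  then have "H = G" using wk weakly_unique by blast
  then show ?thesis using H by simp
qed

section \<open>Functions on the film independent of the thickness variable\<close>

definition join3 :: "(real^2) \<times> real \<Rightarrow> real^3" where
  "join3 p = (\<chi> i. if i = 1 then fst p $ 1 else if i = 2 then fst p $ 2 else snd p)"

lemma proj2_nth [simp]: "proj2 x $ 1 = x $ 1" "proj2 x $ 2 = x $ 2"
  by (simp_all add: proj2_def)

lemma join3_nth [simp]: "join3 p $ 1 = fst p $ 1" "join3 p $ 2 = fst p $ 2" "join3 p $ 3 = snd p"
  by (simp_all add: join3_def)

lemma proj2_join3 [simp]: "proj2 (join3 p) = fst p"
  by (simp add: vec_eq_iff forall_2)

lemma continuous_proj2: "continuous_on S proj2"
proof -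
  have "proj2 = (\<lambda>x. \<chi> i. if i = 1 then x $ 1 else x $ 2)" by (simp add: proj2_def fun_eq_iff)
  moreover have "continuous_on S (\<lambda>x::real^3. \<chi> i::2. if i = 1 then x $ 1 else x $ 2)"
  proof (rule continuous_on_vec_lambda)
    fix i :: 2
    show "continuous_on S (\<lambda>x::real^3. if i = 1 then x $ 1 else x $ 2)"
      by (cases "i = 1") (auto intro!: continuous_intros)
  qed
  ultimately show ?thesis by metis
qed

lemma proj2_measurable [measurable]: "proj2 \<in> borel_measurable borel"
  by (rule borel_measurable_continuous_onI[OF continuous_proj2])

lemma continuous_join3: "continuous_on S join3"
proof -
  have "continuous_on S (\<lambda>p::(real^2) \<times> real. \<chi> i::3. if i = 1 then fst p $ 1 else if i = 2 then fst p $ 2 else snd p)"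
  proof (rule continuous_on_vec_lambda)
    fix i :: 3
    show "continuous_on S (\<lambda>p::(real^2) \<times> real. if i = 1 then fst p $ 1 else if i = 2 then fst p $ 2 else snd p)"
      by (cases "i = 1"; cases "i = 2") (auto intro!: continuous_intros)
  qed
  then show ?thesis by (simp add: join3_def[abs_def])
qed

lemma join3_measurable [measurable]: "join3 \<in> borel_measurable borel"
  by (rule borel_measurable_continuous_onI[OF continuous_join3])

lemma mem_box_3: "x \<in> box l u \<longleftrightarrow> proj2 x \<in> box (proj2 l) (proj2 u) \<and> x $ 3 \<in> {l $ 3<..<u $ 3}" for x :: "real^3"
  by (auto simp: mem_box_cart forall_3 forall_2)

lemma mem_cbox_3: "x \<in> cbox l u \<longleftrightarrow> proj2 x \<in> cbox (proj2 l) (proj2 u) \<and> x $ 3 \<in> {l $ 3..u $ 3}" for x :: "real^3"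
  by (auto simp: mem_box_cart forall_3 forall_2)

lemma prod_Basis_axis: "(\<Prod>b\<in>(Basis :: (real^'n) set). f b) = (\<Prod>i\<in>UNIV. f (axis i 1))"
proof -
  have "bij_betw (\<lambda>i. axis i 1) UNIV (Basis :: (real^'n) set)"
    by (auto simp: bij_betw_def Basis_vec_def inj_on_def axis_eq_axis)
  from prod.reindex_bij_betw[OF this, of f] show ?thesis by simp
qed

lemma prod_3: "(\<Prod>i\<in>(UNIV::3 set). f i) = f 1 * f 2 * (f 3 :: 'a::comm_monoid_mult)"
  unfolding UNIV_3 by (simp add: mult.assoc)

lemma prod_2: "(\<Prod>i\<in>(UNIV::2 set). f i) = f 1 * (f 2 :: 'a::comm_monoid_mult)"
  unfolding UNIV_2 by simp

lemma le_Basis_iff: "(\<forall>b\<in>Basis. l \<bullet> b \<le> u \<bullet> b) \<longleftrightarrow> (\<forall>i. l $ i \<le> u $ i)" for l u :: "real^'n"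
  by (auto simp: Basis_vec_def inner_axis)

lemma lborel_3_eq: "lborel = distr (lborel \<Otimes>\<^sub>M lborel) borel join3"
proof (rule lborel_eqI)
  fix l u :: "real^3" assume "\<And>b. b \<in> Basis \<Longrightarrow> l \<bullet> b \<le> u \<bullet> b"
  then have le: "l $ i \<le> u $ i" for i using le_Basis_iff by blast
  have v: "join3 -` box l u = box (proj2 l) (proj2 u) \<times> box (l $ 3) (u $ 3)"
    by (auto simp: mem_box_3)
  have m: "join3 \<in> lborel \<Otimes>\<^sub>M lborel \<rightarrow>\<^sub>M borel" by (simp add: lborel_prod)
  have "emeasure (distr (lborel \<Otimes>\<^sub>M lborel) borel join3) (box l u) = emeasure (lborel \<Otimes>\<^sub>M lborel) (box (proj2 l) (proj2 u) \<times> box (l $ 3) (u $ 3))"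
    by (subst emeasure_distr[OF m]) (auto simp: v space_pair_measure)
  also have "\<dots> = emeasure lborel (box (proj2 l) (proj2 u)) * emeasure lborel (box (l $ 3) (u $ 3))"
    by (rule lborel.emeasure_pair_measure_Times) auto
  also have "\<dots> = ennreal (\<Prod>b\<in>Basis. (proj2 u - proj2 l) \<bullet> b) * ennreal (u $ 3 - l $ 3)"
  proof -
    have "\<forall>b\<in>Basis. proj2 l \<bullet> b \<le> proj2 u \<bullet> b" unfolding le_Basis_iff using le by (simp add: forall_2)
    then show ?thesis using le[of 3] by (simp add: emeasure_lborel_box_eq)
  qed
  also have "\<dots> = (\<Prod>b\<in>Basis. (u - l) \<bullet> b)"
    using le by (simp add: prod_Basis_axis prod_3 prod_2 inner_axis ennreal_mult[symmetric])
  finally show "emeasure (distr (lborel \<Otimes>\<^sub>M lborel) borel join3) (box l u) = (\<Prod>b\<in>Basis. (u - l) \<bullet> b)" .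
qed simp

section \<open>The slab of unit thickness and its projection to the plane\<close>

definition slab :: "(real^3) set" where
  "slab = {x. 0 < x $ 3 \<and> x $ 3 < 1}"

lemma slab_borel [measurable]: "slab \<in> sets borel"
proof -
  have "open slab" unfolding slab_def
    by (intro open_Collect_conj open_Collect_less continuous_intros)
  then show ?thesis by simp
qed

text \<open>The slab has thickness 1, so projecting its volume measure gives area without a
  factor.\<close>

lemma lborel_2_eq: "lborel = distr (density lborel (indicator slab)) borel proj2"
proof (rule lborel_eqI)
  fix l u :: "real^2" assume "\<And>b. b \<in> Basis \<Longrightarrow> l \<bullet> b \<le> u \<bullet> b"
  then have le: "l $ i \<le> u $ i" for i using le_Basis_iff by blast
  have m: "proj2 \<in> density lborel (indicator slab) \<rightarrow>\<^sub>M borel" by simp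
  have v: "slab \<inter> proj2 -` box l u = box (join3 (l, 0)) (join3 (u, 1))"
    by (auto simp: mem_box_3 slab_def)
  have vm: "proj2 -` box l u \<in> sets borel" using measurable_sets[OF proj2_measurable, of "box l u"] by simp
  have "emeasure (distr (density lborel (indicator slab)) borel proj2) (box l u) = emeasure (density lborel (indicator slab)) (proj2 -` box l u)"
    by (subst emeasure_distr[OF m]) auto
  also have "\<dots> = (\<integral>\<^sup>+x. indicator slab x * indicator (proj2 -` box l u) x \<partial>lborel)"
    by (rule emeasure_density) (use vm in auto)
  also have "\<dots> = (\<integral>\<^sup>+x. indicator (slab \<inter> proj2 -` box l u) x \<partial>lborel)"
    unfolding indicator_inter_arith ..
  also have "\<dots> = emeasure lborel (box (join3 (l, 0)) (join3 (u, 1)))" unfolding v by simp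
  also have "\<dots> = (\<Prod>b\<in>Basis. (join3 (u, 1) - join3 (l, 0)) \<bullet> b)"
  proof -
    have "\<forall>b\<in>Basis. join3 (l, 0) \<bullet> b \<le> join3 (u, 1) \<bullet> b" unfolding le_Basis_iff using le by (simp add: forall_3)
    then show ?thesis by (simp add: emeasure_lborel_box_eq)
  qed
  also have "\<dots> = (\<Prod>b\<in>Basis. (u - l) \<bullet> b)"
    by (simp add: prod_Basis_axis prod_3 prod_2 inner_axis)
  finally show "emeasure (distr (density lborel (indicator slab)) borel proj2) (box l u) = (\<Prod>b\<in>Basis. (u - l) \<bullet> b)" .
qed simp

lemma slab_integral:
  fixes g :: "real^2 \<Rightarrow> real"
  assumes [measurable]: "g \<in> borel_measurable borel"
  shows "(\<integral>x. indicator slab x * g (proj2 x) \<partial>lborel) = (\<integral>y. g y \<partial>lborel)"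
    and "integrable lborel (\<lambda>x. indicator slab x * g (proj2 x)) \<longleftrightarrow> integrable lborel g"
proof -
  have ind: "indicator slab = (\<lambda>x. ennreal (indicator slab x))" by (simp add: fun_eq_iff ennreal_indicator)
  have "(\<integral>y. g y \<partial>lborel) = (\<integral>y. g y \<partial>distr (density lborel (indicator slab)) borel proj2)"
    by (simp flip: lborel_2_eq)
  also have "\<dots> = (\<integral>x. g (proj2 x) \<partial>density lborel (indicator slab))" by (subst integral_distr) auto
  also have "\<dots> = (\<integral>x. indicator slab x * g (proj2 x) \<partial>lborel)"
    unfolding ind by (subst integral_density) auto
  finally show "(\<integral>x. indicator slab x * g (proj2 x) \<partial>lborel) = (\<integral>y. g y \<partial>lborel)" by simp
  have "integrable lborel g \<longleftrightarrow> integrable (distr (density lborel (indicator slab)) borel proj2) g" by (simp flip: lborel_2_eq)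
  also have "\<dots> \<longleftrightarrow> integrable (density lborel (indicator slab)) (\<lambda>x. g (proj2 x))" by (subst integrable_distr_eq) auto
  also have "\<dots> \<longleftrightarrow> integrable lborel (\<lambda>x. indicator slab x * g (proj2 x))"
    unfolding ind by (subst integrable_density) auto
  finally show "integrable lborel (\<lambda>x. indicator slab x * g (proj2 x)) \<longleftrightarrow> integrable lborel g" by simp
qed

definition cylf :: "(real^2 \<Rightarrow> real) \<Rightarrow> real^3 \<Rightarrow> real" where
  "cylf g x = indicator slab x * g (proj2 x)"

text \<open>Extension of a planar class to the slab, constant in the third variable. Unit thickness
  makes it an isometry, so planar integrals can be computed in the film.\<close>

definition cyl :: "(real^2) l2 \<Rightarrow> (real^3) l2" where
  "cyl G = cls (cylf (fn G))"

lemma sqi_cylf: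
  assumes "sqi g" shows "sqi (cylf g)"
proof -
  have [measurable]: "g \<in> borel_measurable borel" using assms by (rule sqi_measurable)
  have "(\<lambda>x. (cylf g x)\<^sup>2) = (\<lambda>x. indicator slab x * (g (proj2 x))\<^sup>2)"
    by (auto simp: cylf_def indicator_def fun_eq_iff)
  then show ?thesis unfolding sqi_def using slab_integral(2)[of "\<lambda>y. (g y)\<^sup>2"] sqi_square[OF assms]
    by (simp add: cylf_def[abs_def])
qed

lemma inner_cylf:
  assumes "sqi g" "sqi h" shows "inner (cls (cylf g)) (cls (cylf h)) = inner (cls g) (cls h)"
proof -
  have [measurable]: "g \<in> borel_measurable borel" "h \<in> borel_measurable borel" using assms by (auto intro: sqi_measurable)
  have "(\<lambda>x. cylf g x * cylf h x) = (\<lambda>x. indicator slab x * (g (proj2 x) * h (proj2 x)))"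
    by (auto simp: cylf_def indicator_def fun_eq_iff)
  then show ?thesis using slab_integral(1)[of "\<lambda>y. g y * h y"] by (simp add: inner_cls sqi_cylf assms)
qed

lemma inner_cyl: "inner (cyl G) (cyl H) = inner G H"
  using inner_cylf[OF sqi_fn[of G] sqi_fn[of H]] by (simp add: cyl_def)

lemma cyl_cls:
  assumes g: "sqi g" shows "cyl (cls g) = cls (cylf g)"
proof -
  have "inner (cyl (cls g) - cls (cylf g)) (cyl (cls g) - cls (cylf g)) = 0"
    unfolding cyl_def by (simp add: inner_simps inner_cylf sqi_fn g)
  then show ?thesis by simp
qed

lemma cyl_add: "cyl (G + H) = cyl G + cyl H"
proof -
  have "cyl (cls (\<lambda>x. fn G x + fn H x)) = cyl G + cyl H"
    unfolding cyl_cls[OF sqi_add[OF sqi_fn sqi_fn]] cyl_def[of G] cyl_def[of H] cls_add[OF sqi_cylf[OF sqi_fn] sqi_cylf[OF sqi_fn]]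
    by (simp add: cylf_def[abs_def] distrib_left)
  then show ?thesis using cls_add[OF sqi_fn[of G] sqi_fn[of H]] by simp
qed

lemma cyl_scale: "cyl (c *\<^sub>R G) = c *\<^sub>R cyl G"
proof -
  have "cyl (cls (\<lambda>x. c * fn G x)) = c *\<^sub>R cyl G"
    unfolding cyl_cls[OF sqi_scale[OF sqi_fn]] cyl_def[of G] cls_scale[OF sqi_cylf[OF sqi_fn]]
    by (simp add: cylf_def[abs_def] mult.left_commute)
  then show ?thesis using cls_scale[OF sqi_fn[of G], of c] by simp
qed

lemma cyl_diff: "cyl (G - H) = cyl G - cyl H"
  using cyl_add[of G "(-1) *\<^sub>R H"] cyl_scale[of "-1" H] by simp

lemma norm_cyl: "norm (cyl G) = norm G"
  by (simp add: norm_eq_sqrt_inner inner_cyl)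

lemma fn_cyl: "AE x in lebesgue. fn (cyl G) x = cylf (fn G) x"
  unfolding cyl_def by (rule AE_completion[OF fn_cls[OF sqi_cylf[OF sqi_fn]]])

text \<open>Fubini along the fibres: where \<open>P y\<close> fails, the whole fibre of the slab
  over \<open>y\<close> lies in the exceptional set, and its length 1 is not zero.\<close>

lemma null_cylinder:
  assumes "AE x in lebesgue. x \<in> slab \<longrightarrow> P (proj2 x)"
  shows "AE y in lebesgue. P y"
proof -
  have "AE x in lborel. x \<in> slab \<longrightarrow> P (proj2 x)" using assms unfolding AE_completion_iff .
  then obtain N where N: "{x. \<not> (x \<in> slab \<longrightarrow> P (proj2 x))} \<subseteq> N" "emeasure lborel N = 0" "N \<in> sets borel"
    by (auto elim!: AE_E)
  have m: "join3 \<in> lborel \<Otimes>\<^sub>M lborel \<rightarrow>\<^sub>M borel" by (simp add: lborel_prod)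
  have "emeasure (lborel \<Otimes>\<^sub>M lborel) (join3 -` N) = emeasure (distr (lborel \<Otimes>\<^sub>M lborel) borel join3) N"
    by (subst emeasure_distr[OF m N(3)]) (simp add: space_pair_measure)
  also have "\<dots> = 0" using N(2) by (simp flip: lborel_3_eq)
  finally have "join3 -` N \<in> null_sets (lborel \<Otimes>\<^sub>M lborel)"
    using measurable_sets[OF m N(3)] by (intro null_setsI) (auto simp: space_pair_measure)
  then have "AE p in lborel \<Otimes>\<^sub>M lborel. p \<notin> join3 -` N" by (rule AE_not_in)
  then have "AE p in lborel \<Otimes>\<^sub>M lborel. join3 p \<notin> N" by simp
  then have "AE y in lborel. AE s in (lborel :: real measure). join3 (y, s) \<notin> N" by (rule lborel_pair.AE_pair)
  then have "AE y in lborel. P y"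
  proof eventually_elim
    fix y :: "real^2" assume y: "AE s in (lborel :: real measure). join3 (y, s) \<notin> N"
    show "P y"
    proof (rule ccontr)
      assume "\<not> P y"
      then have "join3 (y, s) \<in> N" if "s \<in> {0<..<1}" for s using N(1) that by (auto simp: slab_def)
      with y have "AE s in (lborel :: real measure). s \<notin> {0<..<1}" by (auto elim: eventually_mono)
      then have "emeasure lborel {0<..<1::real} = 0"
        by (subst (asm) AE_iff_measurable[where N="{0<..<1::real}"]) auto
      then show False by simp
    qed
  qed
  then show ?thesis by (rule AE_completion)
qed

lemma film_alt: "film \<omega> = slab \<inter> proj2 -` \<omega>"
  by (auto simp: film_def slab_def)

lemma open_slab: "open slab"
  unfolding slab_def by (intro open_Collect_conj open_Collect_less continuous_intros)

lemma open_film: "open \<omega> \<Longrightarrow> open (film \<omega>)"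
  unfolding film_alt by (intro open_Int open_slab open_vimage continuous_proj2)

lemma norm_le_proj2: "norm x \<le> norm (proj2 x) + \<bar>x $ 3\<bar>" for x :: "real^3"
proof -
  have "(norm x)\<^sup>2 = (norm (proj2 x))\<^sup>2 + \<bar>x $ 3\<bar>\<^sup>2"
    by (simp add: norm_vec_def L2_set_def sum_3 sum_2 sum_nonneg)
  also have "\<dots> \<le> (norm (proj2 x) + \<bar>x $ 3\<bar>)\<^sup>2" by (simp add: power2_sum)
  finally show ?thesis by (rule power2_le_imp_le) simp
qed

lemma bounded_proj2: "bounded K \<Longrightarrow> bounded L \<Longrightarrow> bounded {x. proj2 x \<in> K \<and> x $ 3 \<in> L}"
proof -
  assume "bounded K" "bounded L"
  then obtain a b where "\<And>y. y \<in> K \<Longrightarrow> norm y \<le> a" "\<And>s. s \<in> L \<Longrightarrow> \<bar>s\<bar> \<le> b" unfolding bounded_iff by auto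
  then have "norm x \<le> a + b" if "x \<in> {x. proj2 x \<in> K \<and> x $ 3 \<in> L}" for x
    using norm_le_proj2[of x] that by (smt (verit) mem_Collect_eq)
  then show ?thesis unfolding bounded_iff by blast
qed

lemma bounded_film: "bounded \<omega> \<Longrightarrow> bounded (film \<omega>)"
  using bounded_proj2[of \<omega> "{0<..<1}"] by (rule bounded_subset) (auto simp: film_def)

definition down :: "3 \<Rightarrow> 2" where "down i = (if i = 1 then 1 else 2)"

lemma proj2_line: "proj2 (x + t *\<^sub>R axis 3 1) = proj2 x"
  "i \<noteq> 3 \<Longrightarrow> proj2 (x + t *\<^sub>R axis i 1) = proj2 x + t *\<^sub>R axis (down i) 1"
  using exhaust_3[of i] by (auto simp: vec_eq_iff forall_2 axis_def down_def)

lemma smooth_proj2_dd: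
  assumes "smooth_fun \<beta>"
  shows "dd (\<lambda>x. \<beta> (proj2 x)) (axis i 1) (\<lambda>x. if i = 3 then 0 else dir_deriv \<beta> (axis (down i) 1) (proj2 x))"
  using smooth_dd[OF assms axis_Basis[of "down i"]] by (cases "i = 3") (auto simp: proj2_line)

lemma smooth_proj2:
  assumes "smooth_fun \<beta>" shows "smooth_fun (\<lambda>x. \<beta> (proj2 x))"
proof (rule smooth_funI[of _ "{\<lambda>x. \<beta> (proj2 x) | \<beta>. smooth_fun \<beta>}"])
  show "(\<lambda>x. \<beta> (proj2 x)) \<in> {\<lambda>x. \<beta> (proj2 x) | \<beta>. smooth_fun \<beta>}" using assms by blast
next
  fix f assume "f \<in> {\<lambda>x. \<beta> (proj2 x) | \<beta>. smooth_fun \<beta>}"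
  then obtain \<beta> where f: "f = (\<lambda>x. \<beta> (proj2 x))" and s: "smooth_fun \<beta>" by blast
  show "continuous_on UNIV f" unfolding f
    by (rule continuous_on_compose2[OF smooth_continuous[OF s] continuous_proj2]) simp
next
  fix f and b :: "real^3" assume "f \<in> {\<lambda>x. \<beta> (proj2 x) | \<beta>. smooth_fun \<beta>}" and b: "b \<in> Basis"
  then obtain \<beta> where f: "f = (\<lambda>x. \<beta> (proj2 x))" and s: "smooth_fun \<beta>" by blast
  from b obtain i where i: "b = axis i 1" by (auto simp: Basis_vec_def)
  show "\<exists>g\<in>{\<lambda>x. \<beta> (proj2 x) | \<beta>. smooth_fun \<beta>}. dd f b g"
  proof (cases "i = 3")
    case True
    then show ?thesis using smooth_proj2_dd[OF s, of i] smooth_const[of 0] unfolding f i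
      by (intro bexI[of _ "\<lambda>x. (\<lambda>y. 0) (proj2 x)"]) auto
  next
    case False
    then show ?thesis using smooth_proj2_dd[OF s, of i] smooth_dir_deriv[OF s axis_Basis[of "down i"]] unfolding f i
      by (intro bexI[of _ "\<lambda>x. dir_deriv \<beta> (axis (down i) 1) (proj2 x)"]) auto
  qed
qed

text \<open>Products of a vertical and a planar factor. Box bumps in three dimensions have this
  form, and vertical derivatives act on the first factor alone.\<close>

definition tens :: "(real^2 \<Rightarrow> real) \<Rightarrow> (real \<Rightarrow> real) \<Rightarrow> real^3 \<Rightarrow> real" where
  "tens \<beta> \<tau> x = \<tau> (x $ 3) * \<beta> (proj2 x)"

lemma smooth_third_dd:
  assumes "smooth_fun \<tau>"
  shows "dd (\<lambda>x::real^3. \<tau> (x $ 3)) (axis i 1) (\<lambda>x. if i = 3 then dir_deriv \<tau> 1 (x $ 3) else 0)"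
  using smooth_of_linear_dd[OF assms, where v="axis 3 1 :: real^3" and d=0 and b="axis i 1"]
proof -
  have n: "(x + t *\<^sub>R axis i 1) \<bullet> axis 3 1 = (x + t *\<^sub>R axis i 1) $ 3" for x :: "real^3" and t :: real
    by (simp add: inner_axis)
  have m: "axis i 1 \<bullet> (axis 3 1 :: real^3) = (if i = 3 then 1 else 0)"
    by (simp add: inner_axis_axis)
  show ?thesis
    using smooth_of_linear_dd[OF assms, where v="axis 3 1 :: real^3" and d=0 and b="axis i 1"]
    unfolding m n by (cases "i = 3") (simp_all add: inner_axis)
qed

lemma smooth_third: "smooth_fun \<tau> \<Longrightarrow> smooth_fun (\<lambda>x::real^3. \<tau> (x $ 3))"
  using smooth_of_linear[of \<tau> "axis 3 1 :: real^3" 0] by (simp add: inner_axis)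

lemma tens_dd:
  assumes "smooth_fun \<beta>" "smooth_fun \<tau>"
  shows "dir_deriv (tens \<beta> \<tau>) (axis i 1) = (if i = 3 then tens \<beta> (dir_deriv \<tau> 1) else tens (dir_deriv \<beta> (axis (down i) 1)) \<tau>)"
  unfolding tens_def dir_deriv_mult[OF smooth_third[OF assms(2)] smooth_proj2[OF assms(1)] axis_Basis]
    dd_dir_deriv[OF smooth_proj2_dd[OF assms(1)]] dd_dir_deriv[OF smooth_third_dd[OF assms(2)]]
  by (auto simp: tens_def fun_eq_iff)

lemma test_tens:
  assumes "test_fun \<omega> \<beta>" "test_fun {0<..<1} \<tau>" shows "test_fun (film \<omega>) (tens \<beta> \<tau>)"
proof -
  from assms(1) obtain K where K: "smooth_fun \<beta>" "compact K" "K \<subseteq> \<omega>" "\<And>x. x \<notin> K \<Longrightarrow> \<beta> x = 0" by (rule test_funE) blast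
  from assms(2) obtain L where L: "smooth_fun \<tau>" "compact L" "L \<subseteq> {0<..<1}" "\<And>x. x \<notin> L \<Longrightarrow> \<tau> x = 0" by (rule test_funE) blast
  show ?thesis
  proof (rule test_funI[of _ "{x. proj2 x \<in> K \<and> x $ 3 \<in> L}"])
    show "smooth_fun (tens \<beta> \<tau>)" unfolding tens_def[abs_def] by (rule smooth_mult[OF smooth_third[OF L(1)] smooth_proj2[OF K(1)]])
    have "closed (proj2 -` K \<inter> (\<lambda>x::real^3. x $ 3) -` L)"
      by (intro closed_Int closed_vimage compact_imp_closed K(2) L(2) continuous_proj2 continuous_intros)
    moreover have "proj2 -` K \<inter> (\<lambda>x::real^3. x $ 3) -` L = {x. proj2 x \<in> K \<and> x $ 3 \<in> L}" by auto
    ultimately show "compact {x. proj2 x \<in> K \<and> x $ 3 \<in> L}"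
      using bounded_proj2[OF compact_imp_bounded[OF K(2)] compact_imp_bounded[OF L(2)]] by (simp add: compact_eq_bounded_closed)
    show "{x. proj2 x \<in> K \<and> x $ 3 \<in> L} \<subseteq> film \<omega>" using K(3) L(3) by (auto simp: film_def)
    show "tens \<beta> \<tau> x = 0" if "x \<notin> {x. proj2 x \<in> K \<and> x $ 3 \<in> L}" for x using that K(4) L(4) by (auto simp: tens_def)
  qed
qed

lemma box_bump_tens: "box_bump a b n = tens (box_bump (proj2 a) (proj2 b) n) (box_bump (a $ 3) (b $ 3) n)" for a b :: "real^3"
  unfolding box_bump_def tens_def by (simp add: fun_eq_iff prod_Basis_axis prod_3 prod_2 inner_axis)

text \<open>The zero mean makes the primitive vanish to the right of the support as well, so it is
  again compactly supported in the interval.\<close>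

lemma antiderivative_test:
  fixes q :: "real \<Rightarrow> real"
  assumes q: "test_fun {0<..<1} q" and 0: "(\<integral>s. q s \<partial>lborel) = 0"
  shows "\<exists>\<tau>. test_fun {0<..<1} \<tau> \<and> dir_deriv \<tau> 1 = q"
proof -
  from q obtain L where L: "smooth_fun q" "compact L" "L \<subseteq> {0<..<1}" "\<And>x. x \<notin> L \<Longrightarrow> q x = 0" by (rule test_funE) blast
  obtain c d where cd: "0 < c" "d < 1" "L \<subseteq> {c..d}"
  proof (cases "L = {}")
    case True then show ?thesis using that[of "1/2" "1/2"] by simp
  next
    case False
    then have "Inf L \<in> L" "Sup L \<in> L" using L(2) by (auto simp: closed_contains_Inf closed_contains_Sup compact_imp_closed compact_imp_bounded bounded_imp_bdd_below bounded_imp_bdd_above)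
    moreover have "bdd_below L" "bdd_above L"
      using compact_imp_bounded[OF L(2)] by (simp_all add: bounded_imp_bdd_below bounded_imp_bdd_above)
    then have "L \<subseteq> {Inf L..Sup L}" by (auto intro: cInf_lower cSup_upper)
    ultimately show ?thesis using that[of "Inf L" "Sup L"] L(3) greaterThanLessThan_iff by blast
  qed
  have qc: "continuous_on S q" for S using smooth_continuous[OF L(1)] continuous_on_subset by blast
  have q0: "q s = 0" if "s < c \<or> d < s" for s using L(4) cd(3) that by (meson atLeastAtMost_iff not_less subsetD)
  \<comment> \<open>The base point -1 lies to the left of the support of \<open>q\<close>.\<close>
  define \<tau> where "\<tau> s = integral {-1..s} q" for s
  have \<tau>0: "\<tau> s = 0" if "s < c" for s
  proof -
    have "integral {-1..s} q = integral {-1..s} (\<lambda>s. 0)" by (rule integral_cong) (use q0 that in auto)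
    then show ?thesis by (simp add: \<tau>_def)
  qed
  have der: "(\<tau> has_real_derivative q s) (at s)" for s
  proof (cases "s < c")
    case True
    have "((\<lambda>s. 0) has_real_derivative q s) (at s)" using q0 True by simp
    then show ?thesis
      by (rule has_field_derivative_transform_within_open[where S="{..<c}"]) (use True \<tau>0 in auto)
  next
    case False
    have "(\<tau> has_real_derivative q s) (at s within {-1..s+1})"
      unfolding \<tau>_def[abs_def] by (rule integral_has_real_derivative[OF qc]) (use False cd in auto)
    moreover have "at s within {-1..s+1} = at s" by (rule at_within_interior) (use False cd in auto)
    ultimately show ?thesis by simp
  qed
  have dd: "dd \<tau> 1 q"
  proof
    fix x
    show "((\<lambda>t. \<tau> (x + t *\<^sub>R 1)) has_real_derivative q x) (at 0)"
      using DERIV_shift[of \<tau> "q x" 0 x] der[of x] by (simp add: add.commute)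
  qed
  have sm: "smooth_fun \<tau>"
  proof (rule smooth_funI[of _ "insert \<tau> (Collect smooth_fun)"])
    show "continuous_on UNIV f" if "f \<in> insert \<tau> (Collect smooth_fun)" for f
    proof (cases "f = \<tau>")
      case True
      then show ?thesis using der by (auto intro!: continuous_at_imp_continuous_on DERIV_isCont)
    next
      case False
      then show ?thesis using that smooth_continuous by auto
    qed
    show "\<exists>g\<in>insert \<tau> (Collect smooth_fun). dd f b g" if "f \<in> insert \<tau> (Collect smooth_fun)" "b \<in> Basis" for f b
    proof (cases "f = \<tau>")
      case True
      then show ?thesis using dd L(1) that(2) by (intro bexI[of _ q]) auto
    next
      case False
      then have "smooth_fun f" using that(1) by simp
      then show ?thesis using smooth_dd[OF _ that(2)] smooth_dir_deriv[OF _ that(2)] by (intro bexI[of _ "dir_deriv f b"]) auto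
    qed
  qed simp
  have \<tau>1: "\<tau> s = 0" if "d < s" for s
  proof -
    have qi: "q absolutely_integrable_on {-1..s}" by (rule absolutely_integrable_continuous_real[OF qc])
    have "\<tau> s = (\<integral>x. indicator {-1..s} x *\<^sub>R q x \<partial>lebesgue)"
      unfolding \<tau>_def using set_lebesgue_integral_eq_integral(2)[OF qi] by (simp add: set_lebesgue_integral_def)
    also have "(\<lambda>x. indicator {-1..s} x *\<^sub>R q x) = q"
    proof
      fix x show "indicator {-1..s} x *\<^sub>R q x = q x" using q0[of x] cd that by (cases "x < c \<or> d < x") (auto simp: indicator_def)
    qed
    also have "(\<integral>x. q x \<partial>lebesgue) = (\<integral>x. q x \<partial>lborel)"
      by (rule integral_completion) (simp add: borel_measurable_continuous_onI[OF qc])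
    finally show ?thesis using 0 by simp
  qed
  have "test_fun {0<..<1} \<tau>"
    by (rule test_funI[OF sm, of "{c..d}"]) (use cd \<tau>0 \<tau>1 in \<open>auto simp: not_le\<close>)
  then show ?thesis using dd_dir_deriv[OF dd] by blast
qed

text \<open>Vertical cut-offs: the margin \<open>1 / real (Suc k)\<close> keeps the support
  compactly inside (0,1), while the growing steepness makes them tend to 1 there.\<close>

definition etab :: "nat \<Rightarrow> real \<Rightarrow> real" where
  "etab k = box_bump (1 / real (Suc k)) (1 - 1 / real (Suc k)) k"

lemma test_etab: "test_fun {0<..<1} (etab k)"
proof -
  have "0 < 1 / real (Suc k)" by simp
  then have "x \<in> {0<..<1}" if "x \<in> cbox (1 / real (Suc k)) (1 - 1 / real (Suc k))" for x
    using that unfolding greaterThanLessThan_iff box_real atLeastAtMost_iff by argo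
  then have "cbox (1 / real (Suc k)) (1 - 1 / real (Suc k)) \<subseteq> {0<..<1}" by blast
  then show ?thesis unfolding etab_def by (rule test_box_bump)
qed

lemma etab_bounds: "0 \<le> etab k s" "etab k s \<le> indicator {0<..<1} s"
proof -
  show "0 \<le> etab k s" unfolding etab_def by (rule box_bump_bounds)
  show "etab k s \<le> indicator {0<..<1} s"
  proof (cases "s \<in> {0<..<1}")
    case True
    then show ?thesis unfolding etab_def using box_bump_bounds(2) by simp
  next
    case False
    have "0 < 1 / real (Suc k)" by simp
    then have "s \<notin> box (1 / real (Suc k)) (1 - 1 / real (Suc k))"
      using False unfolding greaterThanLessThan_iff box_real by argo
    then show ?thesis unfolding etab_def using False box_bump_outside[of s] by simp
  qed
qed

lemma etab_tendsto: "(\<lambda>k. etab k s) \<longlonglongrightarrow> indicator {0<..<1} s"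
proof (cases "s \<in> {0<..<1}")
  case False
  then have "etab k s = 0" for k using etab_bounds[of k s] by simp
  then show ?thesis using False by simp
next
  case True
  have lim: "(\<lambda>k. pexp 1 (real (Suc k) * c - 1)) \<longlonglongrightarrow> 1" if c: "0 < c" for c
  proof -
    have "filterlim (\<lambda>k. real (Suc k)) at_top sequentially"
      by (rule filterlim_compose[OF filterlim_real_sequentially filterlim_Suc])
    then have "filterlim (\<lambda>k. c * real (Suc k)) at_top sequentially"
      by (rule filterlim_tendsto_pos_mult_at_top[OF tendsto_const c])
    then have "filterlim (\<lambda>k. (-1) + c * real (Suc k)) at_top sequentially"
      by (rule filterlim_tendsto_add_at_top[OF tendsto_const])
    then have g: "filterlim (\<lambda>k. real (Suc k) * c - 1) at_top sequentially" by (simp add: mult.commute)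
    have "((\<lambda>t. exp (- (1 / t))) \<longlongrightarrow> exp (- 0)) (at_top :: real filter)"
      by (intro tendsto_intros tendsto_divide_0[OF tendsto_const] filterlim_at_top_imp_at_infinity filterlim_ident)
    moreover have "\<forall>\<^sub>F t in at_top. exp (- (1 / t)) = pexp 1 t"
      using eventually_gt_at_top[of "0::real"] by eventually_elim (simp add: pexp_def)
    ultimately have "((\<lambda>t. pexp 1 t) \<longlongrightarrow> exp (- 0)) at_top"
      by (rule Lim_transform_eventually)
    then have "((\<lambda>t. pexp 1 t) \<longlongrightarrow> 1) at_top" by simp
    from filterlim_compose[OF this g] show ?thesis .
  qed
  \<comment> \<open>The margin costs exactly 1 in each argument, since it is multiplied by the
    steepness \<open>Suc k\<close>.\<close>
  have "etab k s = pexp 1 (real (Suc k) * s - 1) * pexp 1 (real (Suc k) * (1 - s) - 1)" for k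
  proof -
    have "real (Suc k) * (s - 1 / real (Suc k)) = real (Suc k) * s - 1"
      "real (Suc k) * (1 - 1 / real (Suc k) - s) = real (Suc k) * (1 - s) - 1"
      by (simp_all add: field_simps)
    then show ?thesis unfolding etab_def box_bump_def by simp
  qed
  moreover have "(\<lambda>k. pexp 1 (real (Suc k) * s - 1) * pexp 1 (real (Suc k) * (1 - s) - 1)) \<longlonglongrightarrow> 1 * 1"
    using True by (intro tendsto_mult lim) auto
  ultimately show ?thesis using True by simp
qed

lemma integral_etab: "(\<lambda>k. \<integral>s. etab k s \<partial>lborel) \<longlonglongrightarrow> 1"
proof -
  have "(\<lambda>k. \<integral>s. etab k s \<partial>lborel) \<longlonglongrightarrow> (\<integral>s. indicator {0<..<1} s \<partial>(lborel::real measure))"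
  proof (rule integral_dominated_convergence[where w="indicator {0<..<1}"])
    show "etab k \<in> borel_measurable lborel" for k using sqi_measurable[OF test_sqi[OF test_etab[of k]]] by simp
    show "AE s in lborel. norm (etab k s) \<le> indicator {0<..<1} s" for k using etab_bounds[of k] by simp
  qed (auto intro: etab_tendsto)
  then show ?thesis by simp
qed

lemma tens_etab_tendsto:
  assumes "test_fun \<omega> \<beta>" shows "(\<lambda>k. cls (tens \<beta> (etab k))) \<longlonglongrightarrow> cls (cylf \<beta>)"
proof (rule l2_dominated_convergence[where w="cylf (\<lambda>x. \<bar>\<beta> x\<bar>)"])
  have sq: "sqi \<beta>" by (rule test_sqi[OF assms])
  show "sqi (tens \<beta> (etab k))" for k by (rule test_sqi[OF test_tens[OF assms test_etab]])
  show "sqi (cylf \<beta>)" by (rule sqi_cylf[OF sq])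
  show "sqi (cylf (\<lambda>x. \<bar>\<beta> x\<bar>))" using sq by (intro sqi_cylf) (auto simp: sqi_def)
  show "AE x in lborel. \<bar>tens \<beta> (etab k) x\<bar> \<le> cylf (\<lambda>x. \<bar>\<beta> x\<bar>) x" for k
  proof (rule AE_I2)
    fix x
    show "\<bar>tens \<beta> (etab k) x\<bar> \<le> cylf (\<lambda>x. \<bar>\<beta> x\<bar>) x"
      using etab_bounds[of k "x $ 3"] by (auto simp: tens_def cylf_def abs_mult slab_def indicator_def intro!: mult_left_le_one_le)
  qed
  show "AE x in lborel. (\<lambda>k. tens \<beta> (etab k) x) \<longlonglongrightarrow> cylf \<beta> x"
  proof (rule AE_I2)
    fix x
    have "(\<lambda>k. etab k (x $ 3) * \<beta> (proj2 x)) \<longlonglongrightarrow> indicator {0<..<1} (x $ 3) * \<beta> (proj2 x)"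
      by (intro tendsto_mult tendsto_const etab_tendsto)
    then show "(\<lambda>k. tens \<beta> (etab k) x) \<longlonglongrightarrow> cylf \<beta> x"
      by (simp add: tens_def cylf_def slab_def indicator_def)
  qed
qed

text \<open>The idea is that \<open>\<psi> \<integral>\<eta> - \<eta> \<integral>\<psi>\<close> has an antiderivative that is again a test function.\<close>

lemma orthogonal_to_cylinders_zero:
  assumes om: "open \<omega>" and s: "supp_in (film \<omega>) Q" and w: "wd (film \<omega>) (axis 3 1) Q 0"
    and orth: "\<And>G. supp_in \<omega> G \<Longrightarrow> inner Q (cyl G) = 0"
  shows "Q = 0"
proof -
  have tens0: "inner Q (cls (tens \<beta> \<psi>)) = 0" if \<beta>: "test_fun \<omega> \<beta>" and \<psi>: "test_fun {0<..<1} \<psi>" for \<beta> \<psi>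
  proof -
    let ?I = "\<lambda>f. \<integral>s. f s \<partial>(lborel :: real measure)"
    have int: "integrable lborel f" if "test_fun {0<..<1} f" for f :: "real \<Rightarrow> real"
    proof -
      from that obtain L where L: "smooth_fun f" "compact L" "\<And>x. x \<notin> L \<Longrightarrow> f x = 0" by (rule test_funE) blast
      have "integrable lborel (\<lambda>x. indicator L x *\<^sub>R f x)"
        using L(2) smooth_continuous[OF L(1)] continuous_on_subset by (intro borel_integrable_compact) auto
      moreover have "(\<lambda>x. indicator L x *\<^sub>R f x) = f" using L(3) by (auto simp: indicator_def fun_eq_iff)
      ultimately show ?thesis by simp
    qed
    have eq: "?I (etab k) * inner Q (cls (tens \<beta> \<psi>)) = ?I \<psi> * inner Q (cls (tens \<beta> (etab k)))" for k
    proof -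
      define q where "q s = ?I (etab k) * \<psi> s + (- ?I \<psi>) * etab k s" for s
      have tq: "test_fun {0<..<1} q" unfolding q_def by (intro test_add test_scale \<psi> test_etab)
      have "?I q = 0" unfolding q_def using int[OF \<psi>] int[OF test_etab] by simp
      from antiderivative_test[OF tq this] obtain \<tau> where \<tau>: "test_fun {0<..<1} \<tau>" "dir_deriv \<tau> 1 = q" by blast
      have "inner Q (cls (tens \<beta> q)) = 0"
        using w[unfolded wd_def, rule_format, OF test_tens[OF \<beta> \<tau>(1)]] \<tau>(2)
        by (simp add: tens_dd[OF test_smooth[OF \<beta>] test_smooth[OF \<tau>(1)]])
      moreover have "cls (tens \<beta> q) = ?I (etab k) *\<^sub>R cls (tens \<beta> \<psi>) + (- ?I \<psi>) *\<^sub>R cls (tens \<beta> (etab k))"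
        unfolding cls_scale[OF test_sqi[OF test_tens[OF \<beta> \<psi>]]] cls_scale[OF test_sqi[OF test_tens[OF \<beta> test_etab]]]
          cls_add[OF sqi_scale[OF test_sqi[OF test_tens[OF \<beta> \<psi>]]] sqi_scale[OF test_sqi[OF test_tens[OF \<beta> test_etab]]]]
        by (simp add: tens_def[abs_def] q_def algebra_simps)
      ultimately show ?thesis by (simp add: inner_simps)
    qed
    \<comment> \<open>As \<open>k\<close> grows, the left side isolates the pairing with
      \<open>tens \<beta> \<psi>\<close>, and the right side tends to a multiple of the pairing of
      \<open>Q\<close> with a cylinder, which is zero.\<close>
    have "(\<lambda>k. ?I (etab k) * inner Q (cls (tens \<beta> \<psi>))) \<longlonglongrightarrow> 1 * inner Q (cls (tens \<beta> \<psi>))"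
      by (intro tendsto_mult integral_etab tendsto_const)
    moreover have "(\<lambda>k. ?I \<psi> * inner Q (cls (tens \<beta> (etab k)))) \<longlonglongrightarrow> ?I \<psi> * inner Q (cls (cylf \<beta>))"
      by (intro tendsto_intros tens_etab_tendsto[OF \<beta>])
    moreover have "inner Q (cls (cylf \<beta>)) = 0"
      using orth[OF supp_in_test[OF \<beta>]] by (simp add: cyl_cls test_sqi[OF \<beta>])
    ultimately show ?thesis unfolding eq using LIMSEQ_unique by fastforce
  qed
  have "AE x in lebesgue. x \<in> film \<omega> \<longrightarrow> fn Q x = 0"
  proof (rule fundamental_lemma_boxes[OF open_film[OF om]])
    fix a b :: "real^3" and n assume ab: "cbox a b \<subseteq> film \<omega>"
    show "inner Q (cls (box_bump a b n)) = 0"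
    proof (cases "cbox a b = {}")
      case True
      then have "box_bump a b n x = 0" for x
        using box_subset_cbox[of a b] by (intro box_bump_outside) auto
      then have "box_bump a b n = (\<lambda>x. 0)" by (simp add: fun_eq_iff)
      then show ?thesis by (simp flip: cls_zero)
    next
      case False
      then have le: "a $ i \<le> b $ i" for i by (simp add: interval_ne_empty_cart)
      have "cbox (proj2 a) (proj2 b) \<subseteq> \<omega>"
      proof
        fix y assume "y \<in> cbox (proj2 a) (proj2 b)"
        then have "join3 (y, a $ 3) \<in> cbox a b" using le[of 3] by (simp add: mem_cbox_3)
        then show "y \<in> \<omega>" using ab by (auto simp: film_def)
      qed
      moreover have "cbox (a $ 3) (b $ 3) \<subseteq> {0<..<1}"
      proof
        fix t assume "t \<in> cbox (a $ 3) (b $ 3)"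
        moreover have "proj2 a \<in> cbox (proj2 a) (proj2 b)" using le by (simp add: mem_box_cart forall_2)
        ultimately have "join3 (proj2 a, t) \<in> cbox a b" by (simp add: mem_cbox_3)
        then show "t \<in> {0<..<1}" using ab by (auto simp: film_def)
      qed
      ultimately show ?thesis unfolding box_bump_tens by (intro tens0 test_box_bump)
    qed
  qed
  then have "AE x in lebesgue. fn Q x = fn 0 x"
    using s fn_zero unfolding supp_in_def by eventually_elim auto
  then show ?thesis unfolding l2_eq_iff AE_completion_iff .
qed

section \<open>Translation invariance and vanishing vertical derivative\<close>

lemma AE_lebesgue_shift:
  fixes a :: "'a::euclidean_space"
  assumes "AE x in lebesgue. P x" shows "AE x in lebesgue. P (x + a)"
proof -
  have "AE x in lborel. P x" using assms unfolding AE_completion_iff .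
  then obtain N where N: "{x. \<not> P x} \<subseteq> N" "emeasure lborel N = 0" "N \<in> sets borel"
    by (auto elim!: AE_E)
  have "emeasure lborel ((+) a -` N) = emeasure (distr lborel borel ((+) a)) N"
    using N(3) by (subst emeasure_distr) auto
  also have "\<dots> = 0" using N(2) by (simp add: lborel_distr_plus)
  finally have "emeasure lborel ((+) a -` N) = 0" .
  moreover have "(+) a -` N \<in> sets borel" using measurable_sets[of "(+) a" borel borel N] N(3) by auto
  ultimately have "(+) a -` N \<in> null_sets lborel" by (intro null_setsI) auto
  then have "AE x in lborel. x \<notin> (+) a -` N" by (rule AE_not_in)
  then have "AE x in lborel. P (x + a)" by eventually_elim (use N(1) in \<open>auto simp: add.commute\<close>)
  then show ?thesis by (rule AE_completion)
qed

text \<open>By a change of variables the pairing with \<open>\<phi>\<close> shifted along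
  \<open>b\<close> is constant for small shifts; its derivative at 0 is the pairing with the
  derivative of \<open>\<phi>\<close>.\<close>

lemma wd_zero_of_translation_invariant:
  fixes F :: "'a::euclidean_space l2"
  assumes U: "open U" and b: "b \<in> Basis"
    and inv: "\<And>t. AE x in lebesgue. x \<in> U \<longrightarrow> x + t *\<^sub>R b \<in> U \<longrightarrow> fn F (x + t *\<^sub>R b) = fn F x"
  shows "wd U b F 0"
  unfolding wd_def
proof (intro allI impI)
  fix \<phi> :: "'a \<Rightarrow> real" assume \<phi>: "test_fun U \<phi>"
  then obtain K where K: "compact K" "K \<subseteq> U" "\<And>x. x \<notin> K \<Longrightarrow> \<phi> x = 0" by (rule test_funE) blast
  have \<phi>': "test_fun UNIV \<phi>" using test_mono[OF \<phi>] by simp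
  \<comment> \<open>For shifts below the distance from the support to the complement of
    \<open>U\<close>, points of the support stay in \<open>U\<close>, where the invariance may be
    used.\<close>
  obtain \<delta> where \<delta>: "0 < \<delta>" "\<And>x y. x \<in> K \<Longrightarrow> dist x y < \<delta> \<Longrightarrow> y \<in> U"
  proof (cases "K = {} \<or> U = UNIV")
    case True then show ?thesis using that[of 1] by auto
  next
    case False
    then have "0 < setdist K (- U)" using setdist_gt_0_compact_closed[OF K(1), of "-U"] U K(2) by auto
    moreover have "y \<in> U" if "x \<in> K" "dist x y < setdist K (- U)" for x y
      using setdist_le_dist[of x K y "-U"] that by (auto simp: not_less)
    ultimately show ?thesis using that[of "setdist K (- U)"] by blast
  qed
  define q where "q t = inner F (cls (\<lambda>x. \<phi> (x + t *\<^sub>R b)))" for t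
  have der: "(q has_real_derivative inner F (cls (dir_deriv \<phi> b))) (at 0)"
    using inner_test_shift_has_derivative[OF \<phi>' b, of F 0 0] by (simp add: q_def[abs_def])
  have const: "q t = q 0" if t: "\<bar>t\<bar> < \<delta>" for t
  proof -
    have "q t = (\<integral>x. fn F x * \<phi> (x + t *\<^sub>R b) \<partial>lborel)"
      using inner_cls[OF sqi_fn[of F] sqi_shift[OF test_sqi[OF \<phi>]]] by (simp add: q_def)
    also have "\<dots> = (\<integral>x. (\<lambda>x. fn F (x + (- t) *\<^sub>R b) * \<phi> x) (x + t *\<^sub>R b) \<partial>lborel)" by (simp add: algebra_simps)
    also have "\<dots> = (\<integral>x. fn F (x + (- t) *\<^sub>R b) * \<phi> x \<partial>lborel)"
      by (rule lborel_integral_shift) (use sqi_measurable[OF test_sqi[OF \<phi>]] in measurable)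
    also have "\<dots> = (\<integral>x. fn F x * \<phi> x \<partial>lborel)"
    proof (rule integral_cong_AE)
      have "AE x in lborel. x \<in> U \<longrightarrow> x + (- t) *\<^sub>R b \<in> U \<longrightarrow> fn F (x + (- t) *\<^sub>R b) = fn F x"
        using inv[of "- t"] unfolding AE_completion_iff .
      then show "AE x in lborel. fn F (x + (- t) *\<^sub>R b) * \<phi> x = fn F x * \<phi> x"
      proof eventually_elim
        fix x assume *: "x \<in> U \<longrightarrow> x + (- t) *\<^sub>R b \<in> U \<longrightarrow> fn F (x + (- t) *\<^sub>R b) = fn F x"
        show "fn F (x + (- t) *\<^sub>R b) * \<phi> x = fn F x * \<phi> x"
        proof (cases "x \<in> K")
          case True
          then have "x + (- t) *\<^sub>R b \<in> U" using \<delta>(2)[OF True, of "x + (- t) *\<^sub>R b"] t b by (simp add: dist_norm)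
          then show ?thesis using * True K(2) by auto
        qed (simp add: K(3))
      qed
    qed (use sqi_measurable[OF test_sqi[OF \<phi>]] in measurable)
    also have "\<dots> = q 0" using inner_cls[OF sqi_fn[of F] test_sqi[OF \<phi>]] by (simp add: q_def)
    finally show ?thesis .
  qed
  have "((\<lambda>t. q 0) has_real_derivative inner F (cls (dir_deriv \<phi> b))) (at 0)"
  proof (rule has_field_derivative_transform_within_open[OF der, where S="{-\<delta><..<\<delta>}"])
    show "q t = q 0" if "t \<in> {-\<delta><..<\<delta>}" for t by (rule const) (use that in auto)
  qed (use \<delta>(1) in auto)
  then have "inner F (cls (dir_deriv \<phi> b)) = 0" using DERIV_unique DERIV_const by blast
  then show "inner F (cls (dir_deriv \<phi> b)) = - inner 0 (cls \<phi>)" by simp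
qed

lemma supp_in_cyl: "supp_in \<omega> G \<Longrightarrow> open \<omega> \<Longrightarrow> supp_in (film \<omega>) (cyl G)"
proof -
  assume s: "supp_in \<omega> G" and om: "open \<omega>"
  note S = sets_lebesgue_open[OF om]
  have om_b: "\<omega> \<in> sets borel" using om by simp
  have sq: "sqi (\<lambda>x. indicator \<omega> x * fn G x)" by (rule sqi_indicator_mult[OF sqi_fn om_b])
  have "G = cls (\<lambda>x. indicator \<omega> x * fn G x)"
  proof (rule AE_cls_I[OF sq])
    have "AE x in lebesgue. fn G x = indicator \<omega> x * fn G x"
      using s unfolding supp_in_def by eventually_elim (auto simp: indicator_def)
    then show "AE x in lborel. fn G x = indicator \<omega> x * fn G x" unfolding AE_completion_iff .
  qed
  then have "cyl G = cls (cylf (\<lambda>x. indicator \<omega> x * fn G x))" using cyl_cls[OF sq] by simp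
  then have "AE x in lebesgue. fn (cyl G) x = cylf (\<lambda>x. indicator \<omega> x * fn G x) x"
    using AE_completion[OF fn_cls[OF sqi_cylf[OF sq]]] by simp
  then show ?thesis unfolding supp_in_def
    by eventually_elim (auto simp: cylf_def film_alt indicator_def)
qed

lemma wd_cyl:
  assumes "open \<omega>" shows "wd (film \<omega>) (axis 3 1) (cyl G) 0"
proof (rule wd_zero_of_translation_invariant[OF open_film[OF assms] axis_Basis])
  fix t
  show "AE x in lebesgue. x \<in> film \<omega> \<longrightarrow> x + t *\<^sub>R axis 3 1 \<in> film \<omega> \<longrightarrow> fn (cyl G) (x + t *\<^sub>R axis 3 1) = fn (cyl G) x"
    using fn_cyl[of G] AE_lebesgue_shift[OF fn_cyl[of G], of "t *\<^sub>R axis 3 1"]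
  proof eventually_elim
    case (elim x)
    then show ?case by (auto simp: cylf_def film_alt proj2_line)
  qed
qed

text \<open>The cylinders form a closed subspace, being an isometric image of a complete one. The
  error of the orthogonal projection onto it vanishes by
  \<open>orthogonal_to_cylinders_zero\<close>.\<close>

lemma cylindrical_of_wd_zero:
  assumes om: "open \<omega>" and s: "supp_in (film \<omega>) F" and w: "wd (film \<omega>) (axis 3 1) F 0"
  shows "\<exists>G. supp_in \<omega> G \<and> F = cyl G"
proof -
  let ?S = "Collect (supp_in \<omega>)" and ?V = "cyl ` Collect (supp_in \<omega>)"
  note So = sets_lebesgue_open[OF om]
  have S: "subspace ?S" unfolding subspace_def mem_Collect_eq supp_in_iff_orthogonal[OF So]
    by (auto simp: inner_simps)
  have Sc: "closed ?S" unfolding supp_in_iff_orthogonal[OF So]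
    by (intro closed_Collect_all closed_Collect_eq continuous_intros)
  have cyl0: "cyl 0 = 0" using cyl_scale[of 0 0] by simp
  have V: "subspace ?V" unfolding subspace_def
  proof (intro conjI ballI allI)
    show "0 \<in> ?V" using cyl0 subspace_0[OF S] by (metis image_eqI)
    show "x + y \<in> ?V" if "x \<in> ?V" "y \<in> ?V" for x y
      using that subspace_add[OF S] by (auto simp: cyl_add[symmetric] intro!: imageI)
    show "c *\<^sub>R x \<in> ?V" if "x \<in> ?V" for c x
      using that subspace_scale[OF S] by (auto simp: cyl_scale[symmetric] intro!: imageI)
  qed
  have Vc: "closed ?V" unfolding closed_sequential_limits
  proof (intro allI impI, elim conjE)
    fix x l assume x: "\<forall>n. x n \<in> ?V" and l: "x \<longlonglongrightarrow> l"
    from x have "\<forall>n. \<exists>g. g \<in> ?S \<and> x n = cyl g" by blast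
    then obtain g where g: "\<And>n. g n \<in> ?S" "\<And>n. x n = cyl (g n)" by metis
    have dg: "dist (cyl a) (cyl b) = dist a b" for a b by (simp add: dist_norm cyl_diff[symmetric] norm_cyl)
    have "Cauchy x" using l by (rule LIMSEQ_imp_Cauchy)
    then have "Cauchy g" unfolding Cauchy_def g(2) dg .
    then obtain h where h: "g \<longlonglongrightarrow> h" using Cauchy_convergent convergent_def by blast
    have "h \<in> ?S" using closed_sequentially[OF Sc g(1) h] .
    have "x \<longlonglongrightarrow> cyl h" using h unfolding tendsto_dist_iff[of x] tendsto_dist_iff[of g] g(2) dg .
    then have "l = cyl h" using l LIMSEQ_unique by blast
    then show "l \<in> ?V" using \<open>h \<in> ?S\<close> by blast
  qed
  obtain P where P: "P \<in> ?V" "\<forall>s\<in>?V. inner (F - P) s = 0" using orthogonal_projection_exists[OF V Vc] by blast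
  then obtain G where G: "supp_in \<omega> G" "P = cyl G" by auto
  have "F - P = 0"
  proof (rule orthogonal_to_cylinders_zero[OF om])
    show "supp_in (film \<omega>) (F - P)" using supp_in_diff[OF s supp_in_cyl[OF G(1) om]] G(2) by simp
    show "wd (film \<omega>) (axis 3 1) (F - P) 0" using wd_diff[OF w wd_cyl[OF om, of G]] G(2) by simp
    show "inner (F - P) (cyl G) = 0" if "supp_in \<omega> G" for G using P(2) that by auto
  qed
  then show ?thesis using G by auto
qed

text \<open>Symmetry of the second derivatives of the test function: if \<open>F\<close> does not
  vary along \<open>b\<close>, neither do its other derivatives.\<close>

lemma wd_mixed:
  assumes "wd U a F G" "wd U b F 0" "a \<in> Basis" "b \<in> Basis"
  shows "wd U b G 0"
  unfolding wd_def
proof (intro allI impI)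
  fix \<phi> assume \<phi>: "test_fun U \<phi>"
  have "inner G (cls (dir_deriv \<phi> b)) = - inner F (cls (dir_deriv (dir_deriv \<phi> b) a))"
    using assms(1) test_dir_deriv[OF \<phi> assms(4)] unfolding wd_def by simp
  also have "dir_deriv (dir_deriv \<phi> b) a = dir_deriv (dir_deriv \<phi> a) b"
    by (rule mixed_partials[OF test_smooth[OF \<phi>] assms(4,3)])
  also have "inner F (cls (dir_deriv (dir_deriv \<phi> a) b)) = 0"
    using assms(2) test_dir_deriv[OF \<phi> assms(3)] unfolding wd_def by simp
  finally show "inner G (cls (dir_deriv \<phi> b)) = - inner 0 (cls \<phi>)" by simp
qed

text \<open>A planar test function has no compact support in the film, so it is first multiplied by
  the cut-offs \<open>etab k\<close>; they are removed in the limit.\<close>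

lemma wd_cyl_down:
  assumes i: "i \<noteq> 3" and w: "wd (film \<omega>) (axis i 1) (cyl G) (cyl H)"
  shows "wd \<omega> (axis (down i) 1) G H"
  unfolding wd_def
proof (intro allI impI)
  fix \<beta> assume \<beta>: "test_fun \<omega> \<beta>"
  have d\<beta>: "test_fun \<omega> (dir_deriv \<beta> (axis (down i) 1))" by (rule test_dir_deriv[OF \<beta> axis_Basis])
  have "inner (cyl G) (cls (tens (dir_deriv \<beta> (axis (down i) 1)) (etab k))) = - inner (cyl H) (cls (tens \<beta> (etab k)))" for k
    using w[unfolded wd_def, rule_format, OF test_tens[OF \<beta> test_etab[of k]]] i
    by (simp add: tens_dd[OF test_smooth[OF \<beta>] test_smooth[OF test_etab]])
  moreover have "(\<lambda>k. inner (cyl G) (cls (tens (dir_deriv \<beta> (axis (down i) 1)) (etab k)))) \<longlonglongrightarrow> inner (cyl G) (cls (cylf (dir_deriv \<beta> (axis (down i) 1))))"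
    by (intro tendsto_intros tens_etab_tendsto[OF d\<beta>])
  moreover have "(\<lambda>k. - inner (cyl H) (cls (tens \<beta> (etab k)))) \<longlonglongrightarrow> - inner (cyl H) (cls (cylf \<beta>))"
    by (intro tendsto_intros tens_etab_tendsto[OF \<beta>])
  ultimately have "inner (cyl G) (cls (cylf (dir_deriv \<beta> (axis (down i) 1)))) = - inner (cyl H) (cls (cylf \<beta>))"
    using LIMSEQ_unique by fastforce
  then show "inner G (cls (dir_deriv \<beta> (axis (down i) 1))) = - inner H (cls \<beta>)"
    unfolding cyl_cls[OF test_sqi[OF \<beta>], symmetric] cyl_cls[OF test_sqi[OF d\<beta>], symmetric] inner_cyl .
qed

section \<open>Multiplication by bounded functions\<close>

definition mul :: "('a::euclidean_space \<Rightarrow> real) \<Rightarrow> 'a l2 \<Rightarrow> 'a l2" where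
  "mul f F = cls (\<lambda>x. f x * fn F x)"

locale bounded_multiplier =
  fixes f :: "'a::euclidean_space \<Rightarrow> real" and K :: real
  assumes fm [measurable]: "f \<in> borel_measurable borel" and fb: "\<And>x. \<bar>f x\<bar> \<le> K"
begin

lemma K_nonneg: "0 \<le> K"
  using fb[of 0] by simp

lemma square_le: "(f x * y)\<^sup>2 \<le> K\<^sup>2 * y\<^sup>2"
  using fb[of x] power_mono[of "\<bar>f x\<bar>" K 2] by (simp add: power_mult_distrib mult_right_mono)

lemma sqi_mul: assumes g: "sqi g" shows "sqi (\<lambda>x. f x * g x)"
proof -
  have [measurable]: "g \<in> borel_measurable borel" using g by (rule sqi_measurable)
  have "integrable lborel (\<lambda>x. (f x * g x)\<^sup>2)"
    by (rule Bochner_Integration.integrable_bound[of _ "\<lambda>x. K\<^sup>2 * (g x)\<^sup>2"])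
      (use sqi_square[OF g] square_le in auto)
  then show ?thesis by (simp add: sqi_def)
qed

lemma mul_cls: assumes g: "sqi g" shows "mul f (cls g) = cls (\<lambda>x. f x * g x)"
  unfolding mul_def cls_eq_iff[OF sqi_mul[OF sqi_fn] sqi_mul[OF g]] using fn_cls[OF g] by eventually_elim simp

lemma norm_mul: "norm (mul f F) \<le> K * norm F"
proof -
  have "(norm (mul f F))\<^sup>2 \<le> (\<integral>x. K\<^sup>2 * (fn F x)\<^sup>2 \<partial>lborel)"
    unfolding mul_def norm_cls[OF sqi_mul[OF sqi_fn]]
    by (intro integral_mono sqi_square sqi_mul sqi_fn square_le integrable_mult_right)
  also have "\<dots> = (K * norm F)\<^sup>2" using norm_cls[OF sqi_fn[of F]] by (simp add: power_mult_distrib)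
  finally show ?thesis by (rule power2_le_imp_le) (simp add: K_nonneg)
qed

lemma inner_mul: "inner (mul f F) G = inner F (mul f G)"
  using inner_cls[OF sqi_mul[OF sqi_fn[of F]] sqi_fn[of G]] inner_cls[OF sqi_fn[of F] sqi_mul[OF sqi_fn[of G]]]
  by (simp add: mul_def mult_ac)

lemma fn_mul: "AE x in lebesgue. fn (mul f F) x = f x * fn F x"
  unfolding mul_def by (rule AE_completion[OF fn_cls[OF sqi_mul[OF sqi_fn]]])

lemma supp_in_mul: "supp_in U F \<Longrightarrow> supp_in U (mul f F)"
  unfolding supp_in_def using fn_mul[of F] by (auto elim: eventually_elim2)

lemma f_lebesgue: "f \<in> borel_measurable (lebesgue_on U)"
  by (rule measurable_restrict_space1) (rule measurable_completion, simp)

lemma emb_mul: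
  assumes U: "U \<in> sets lebesgue" and g: "L2 U g"
  shows "L2 U (\<lambda>x. f x * g x)" "emb U (\<lambda>x. f x * g x) = mul f (emb U g)"
proof -
  show l: "L2 U (\<lambda>x. f x * g x)" by (rule L2_mult_bounded[OF g f_lebesgue fb])
  have "AE x in lebesgue. fn (mul f (emb U g)) x = indicator U x * (f x * g x)"
    using fn_mul[of "emb U g"] fn_emb[OF U g] by eventually_elim simp
  then show "emb U (\<lambda>x. f x * g x) = mul f (emb U g)" by (rule emb_eqI[OF U l])
qed

end

text \<open>The multiplier is moved to the test function, where the classical Leibniz rule
  applies.\<close>

lemma wd_mul:
  assumes f: "bounded_multiplier f K" "smooth_fun f" and f': "bounded_multiplier (dir_deriv f b) K'"
    and b: "b \<in> Basis" and w: "wd U b F D"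
  shows "wd U b (mul f F) (mul f D + mul (dir_deriv f b) F)"
  unfolding wd_def
proof (intro allI impI)
  interpret f: bounded_multiplier f K by fact
  interpret f': bounded_multiplier "dir_deriv f b" K' by fact
  fix \<phi> assume \<phi>: "test_fun U \<phi>"
  note s = test_sqi[OF \<phi>] test_sqi[OF test_dir_deriv[OF \<phi> b]]
  have t: "test_fun U (\<lambda>x. f x * \<phi> x)" by (rule test_mult[OF \<phi> f(2)])
  have "cls (dir_deriv (\<lambda>x. f x * \<phi> x) b) = cls (\<lambda>x. dir_deriv f b x * \<phi> x) + cls (\<lambda>x. f x * dir_deriv \<phi> b x)"
    unfolding dir_deriv_mult[OF f(2) test_smooth[OF \<phi>] b] cls_add[OF f'.sqi_mul[OF s(1)] f.sqi_mul[OF s(2)]]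
    by (simp add: mult.commute)
  moreover have "inner F (cls (dir_deriv (\<lambda>x. f x * \<phi> x) b)) = - inner D (cls (\<lambda>x. f x * \<phi> x))"
    using w t unfolding wd_def by blast
  ultimately show "inner (mul f F) (cls (dir_deriv \<phi> b)) = - inner (mul f D + mul (dir_deriv f b) F) (cls \<phi>)"
    unfolding inner_add_left f.inner_mul f'.inner_mul f.mul_cls[OF s(1)] f.mul_cls[OF s(2)] f'.mul_cls[OF s(1)]
    by (simp add: inner_add_right)
qed

lemma smooth_trig:
  shows "smooth_fun (\<lambda>t::real. a * cos t + b * sin t)"
    and "dir_deriv (\<lambda>t::real. a * cos t + b * sin t) 1 = (\<lambda>t. b * cos t + (- a) * sin t)"
proof -
  have d: "dd (\<lambda>t::real. a * cos t + b * sin t) 1 (\<lambda>t. b * cos t + (- a) * sin t)" for a b :: real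
    by (auto intro!: derivative_eq_intros)
  show "smooth_fun (\<lambda>t::real. a * cos t + b * sin t)"
  proof (rule smooth_funI[of _ "range (\<lambda>(a, b) t. a * cos t + b * sin t)"])
    show "(\<lambda>t::real. a * cos t + b * sin t) \<in> range (\<lambda>(a, b) t. a * cos t + b * sin t)"
      by (rule image_eqI[of _ _ "(a, b)"]) auto
    show "continuous_on UNIV f" if "f \<in> range (\<lambda>(a, b) (t::real). a * cos t + b * sin t)" for f
      using that by (auto intro!: continuous_intros)
    show "\<exists>g\<in>range (\<lambda>(a, b) t. a * cos t + b * sin t). dd f c g"
      if f: "f \<in> range (\<lambda>(a, b) (t::real). a * cos t + b * sin t)" and c: "c \<in> Basis" for f c
    proof -
      from f obtain a b where "f = (\<lambda>t. a * cos t + b * sin t)" by auto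
      then show ?thesis using d[of a b] c by (intro bexI[of _ "\<lambda>t. b * cos t + (- a) * sin t"] image_eqI[of _ _ "(b, - a)"]) auto
    qed
  qed
  show "dir_deriv (\<lambda>t::real. a * cos t + b * sin t) 1 = (\<lambda>t. b * cos t + (- a) * sin t)"
    by (rule dd_dir_deriv[OF d])
qed

text \<open>The entries of the rotations about the third axis by the angle \<open>l * x $ 3\<close>
  are of this form; the two coefficients make the family closed under differentiation.\<close>

definition trig :: "real \<Rightarrow> real \<Rightarrow> real \<Rightarrow> real^3 \<Rightarrow> real" where
  "trig l a b x = a * cos (l * x $ 3) + b * sin (l * x $ 3)"

lemma trig_smooth: "smooth_fun (trig l a b)"
  using smooth_of_linear[OF smooth_trig(1)[of a b], of "axis 3 l :: real^3" 0]
  by (simp add: trig_def[abs_def] inner_axis mult.commute)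

lemma trig_deriv: "dir_deriv (trig l a b) (axis i 1) = (if i = 3 then trig l (l * b) (- (l * a)) else (\<lambda>x. 0))"
proof (rule dd_dir_deriv)
  have "((\<lambda>t. a * cos (l * (y + t)) + b * sin (l * (y + t))) has_real_derivative
      l * b * cos (l * y) + - (l * a) * sin (l * y)) (at 0)" for y
    by (auto intro!: derivative_eq_intros)
  then show "dd (trig l a b) (axis i 1) (if i = 3 then trig l (l * b) (- (l * a)) else (\<lambda>x. 0))"
    by (cases "i = 3") (auto simp: trig_def[abs_def] axis_def)
qed

lemma trig_multiplier: "bounded_multiplier (trig l a b) (\<bar>a\<bar> + \<bar>b\<bar>)"
proof
  show "trig l a b \<in> borel_measurable borel"
    by (rule borel_measurable_continuous_onI[OF smooth_continuous[OF trig_smooth]])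
  fix x :: "real^3"
  have "\<bar>a * cos (l * x $ 3)\<bar> \<le> \<bar>a\<bar>" "\<bar>b * sin (l * x $ 3)\<bar> \<le> \<bar>b\<bar>"
    unfolding abs_mult by (simp_all add: mult_left_le)
  then show "\<bar>trig l a b x\<bar> \<le> \<bar>a\<bar> + \<bar>b\<bar>" unfolding trig_def by linarith
qed

lemma zero_multiplier: "bounded_multiplier (\<lambda>x. 0) 0"
  by unfold_locales auto

lemma mul_zero: "mul (\<lambda>x. 0) F = 0"
  by (simp add: mul_def cls_zero)

lemma wd_trig:
  assumes "wd U (axis i 1) F D"
  shows "wd U (axis i 1) (mul (trig l a b) F) (mul (trig l a b) D + (if i = 3 then mul (trig l (l * b) (- (l * a))) F else 0))"
proof (cases "i = 3")
  case True
  have "bounded_multiplier (dir_deriv (trig l a b) (axis i 1)) (\<bar>l * b\<bar> + \<bar>- (l * a)\<bar>)"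
    unfolding trig_deriv using True trig_multiplier[of l "l * b" "- (l * a)"] by simp
  from wd_mul[OF trig_multiplier trig_smooth this axis_Basis assms] show ?thesis using True by (simp add: trig_deriv)
next
  case False
  have "bounded_multiplier (dir_deriv (trig l a b) (axis i 1)) 0"
    unfolding trig_deriv using False zero_multiplier by simp
  from wd_mul[OF trig_multiplier trig_smooth this axis_Basis assms] show ?thesis using False by (simp add: trig_deriv mul_zero)
qed

lemma mul_trig_tendsto:
  assumes "l \<longlonglongrightarrow> 0" shows "(\<lambda>n. mul (trig (l n) a b) F) \<longlonglongrightarrow> a *\<^sub>R F"
proof -
  have "(\<lambda>n. cls (\<lambda>x. trig (l n) a b x * fn F x)) \<longlonglongrightarrow> cls (\<lambda>x. a * fn F x)"
  proof (rule l2_dominated_convergence[where w="\<lambda>x. (\<bar>a\<bar> + \<bar>b\<bar>) * \<bar>fn F x\<bar>"])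
    show "sqi (\<lambda>x. trig (l n) a b x * fn F x)" for n by (rule bounded_multiplier.sqi_mul[OF trig_multiplier sqi_fn])
    have "sqi (\<lambda>x. \<bar>fn F x\<bar>)" using sqi_fn[of F] by (auto simp: sqi_def)
    then show "sqi (\<lambda>x. (\<bar>a\<bar> + \<bar>b\<bar>) * \<bar>fn F x\<bar>)" by (rule sqi_scale)
    show "AE x in lborel. \<bar>trig (l n) a b x * fn F x\<bar> \<le> (\<bar>a\<bar> + \<bar>b\<bar>) * \<bar>fn F x\<bar>" for n
      using bounded_multiplier.fb[OF trig_multiplier] by (auto simp: abs_mult intro!: mult_right_mono)
    show "AE x in lborel. (\<lambda>n. trig (l n) a b x * fn F x) \<longlonglongrightarrow> a * fn F x"
    proof (rule AE_I2)
      fix x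
      have "(\<lambda>n. (a * cos (l n * x $ 3) + b * sin (l n * x $ 3)) * fn F x) \<longlonglongrightarrow> (a * cos (0 * x $ 3) + b * sin (0 * x $ 3)) * fn F x"
        by (intro tendsto_intros assms)
      then show "(\<lambda>n. trig (l n) a b x * fn F x) \<longlonglongrightarrow> a * fn F x" by (simp add: trig_def)
    qed
  qed (auto intro: sqi_scale sqi_fn)
  then show ?thesis by (simp add: mul_def cls_scale[OF sqi_fn, symmetric])
qed

section \<open>The graph embedding of the Sobolev space\<close>

definition Uv :: "(real^3) set \<Rightarrow> (real^3 \<Rightarrow> real^3) \<Rightarrow> (real^3) l2 ^ 3" where
  "Uv M u = (\<chi> j. emb M (\<lambda>x. u x $ j))"

definition Dv :: "(real^3) set \<Rightarrow> (real^3 \<Rightarrow> real^3) \<Rightarrow> (real^3) l2 ^ 3 ^ 3" where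
  "Dv M u = (\<chi> i j. emb M (wpd M (axis i 1) (\<lambda>y. u y $ j)))"

definition Gr :: "(real^3) set \<Rightarrow> (real^3 \<Rightarrow> real^3) \<Rightarrow> ((real^3) l2 ^ 3) \<times> ((real^3) l2 ^ 3 ^ 3)" where
  "Gr M u = (Uv M u, Dv M u)"

text \<open>Pairs that will be shown to be exactly the graphs of H1 maps. The conditions concern
  classes only and are stable under weak limits.\<close>

definition graphs :: "(real^3) set \<Rightarrow> (((real^3) l2 ^ 3) \<times> ((real^3) l2 ^ 3 ^ 3)) set" where
  "graphs M = {(F, D). (\<forall>j. supp_in M (F $ j)) \<and> (\<forall>i j. supp_in M (D $ i $ j) \<and> wd M (axis i 1) (F $ j) (D $ i $ j))}"

lemma H1v_nth: "H1v M u \<Longrightarrow> H1 M (\<lambda>x. u x $ j)"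
  by (simp add: H1v_def)

text \<open>Transfers weak and strong H1 convergence to a complete space of classes, where the
  abstract Hilbert space results apply.\<close>

lemma H1_inner_Gr:
  assumes M: "open M" and u: "H1v M u" and v: "H1v M v"
  shows "H1_inner M u v = inner (Gr M u) (Gr M v)"
proof -
  note S = sets_lebesgue_open[OF M]
  have "H1_inner M u v = (\<Sum>j\<in>UNIV. inner (Uv M u $ j) (Uv M v $ j) + (\<Sum>i\<in>UNIV. inner (Dv M u $ i $ j) (Dv M v $ i $ j)))"
    unfolding H1_inner_def sum_Basis_axis
    by (simp add: Uv_def Dv_def inner_emb[OF S] H1_L2[OF H1v_nth[OF u]] H1_L2[OF H1v_nth[OF v]]
        wpd(1)[OF H1v_nth[OF u] axis_Basis] wpd(1)[OF H1v_nth[OF v] axis_Basis])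
  also have "\<dots> = inner (Uv M u) (Uv M v) + (\<Sum>j\<in>UNIV. \<Sum>i\<in>UNIV. inner (Dv M u $ i $ j) (Dv M v $ i $ j))"
    by (simp add: sum.distrib inner_vec_def)
  also have "(\<Sum>j\<in>UNIV. \<Sum>i\<in>UNIV. inner (Dv M u $ i $ j) (Dv M v $ i $ j)) = inner (Dv M u) (Dv M v)"
    by (subst sum.swap) (simp add: inner_vec_def)
  finally show ?thesis by (simp add: Gr_def)
qed

lemma Gr_in_graphs:
  assumes M: "open M" and u: "H1v M u" shows "Gr M u \<in> graphs M"
proof -
  note S = sets_lebesgue_open[OF M]
  have "supp_in M (Uv M u $ j)" for j
    unfolding Uv_def using supp_in_emb[OF S H1_L2[OF H1v_nth[OF u]]] by simp
  moreover have "supp_in M (Dv M u $ i $ j)" for i j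
    unfolding Dv_def using supp_in_emb[OF S wpd(1)[OF H1v_nth[OF u] axis_Basis]] by simp
  moreover have "wd M (axis i 1) (Uv M u $ j) (Dv M u $ i $ j)" for i j
    unfolding Uv_def Dv_def using wd_wpd[OF M H1v_nth[OF u] axis_Basis] by simp
  ultimately show ?thesis by (simp add: graphs_def Gr_def)
qed

text \<open>Weak limits are obtained as pairs of classes; this turns such a pair back into an actual
  map.\<close>

lemma graphs_surj:
  assumes M: "open M" and X: "X \<in> graphs M"
  shows "H1v M (\<lambda>x. \<chi> j. fn (fst X $ j) x)" "Gr M (\<lambda>x. \<chi> j. fn (fst X $ j) x) = X"
proof -
  note S = sets_lebesgue_open[OF M]
  have s: "supp_in M (fst X $ j)" "supp_in M (snd X $ i $ j)" "wd M (axis i 1) (fst X $ j) (snd X $ i $ j)" for i j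
    using X by (auto simp: graphs_def)
  have e: "emb M (fn (fst X $ j)) = fst X $ j" for j by (rule emb_supp_in[OF S s(1)])
  have l: "L2 M (fn (fst X $ j))" for j by (rule L2_fn[OF S])
  show "H1v M (\<lambda>x. \<chi> j. fn (fst X $ j) x)" unfolding H1v_def vec_lambda_beta
  proof
    fix j show "H1 M (fn (fst X $ j))"
    proof (rule H1I[OF M l])
      fix b :: "real^3" assume "b \<in> Basis"
      then obtain i where "b = axis i 1" by (auto simp: Basis_vec_def)
      then show "\<exists>G. wd M b (emb M (fn (fst X $ j))) G \<and> supp_in M G" using s e by metis
    qed
  qed
  have "emb M (wpd M (axis i 1) (fn (fst X $ j))) = snd X $ i $ j" for i j
    by (rule emb_wpd_eqI(1)[OF M l axis_Basis]) (use s e in auto)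
  then show "Gr M (\<lambda>x. \<chi> j. fn (fst X $ j) x) = X"
    by (simp add: Gr_def Uv_def Dv_def e vec_eq_iff prod_eq_iff)
qed

lemma graphs_eqI:
  assumes M: "open M" and "(F, D) \<in> graphs M" "(F, D') \<in> graphs M" shows "D = D'"
proof -
  have "D $ i $ j = D' $ i $ j" for i j
    using assms by (intro wd_unique[OF M, of "axis i 1" "F $ j"]) (auto simp: graphs_def)
  then show ?thesis by (simp add: vec_eq_iff)
qed

lemma Gr_eqI: "open M \<Longrightarrow> H1v M u \<Longrightarrow> H1v M v \<Longrightarrow> Uv M u = Uv M v \<Longrightarrow> Gr M u = Gr M v"
  using graphs_eqI[of M "Uv M u" "Dv M u" "Dv M v"] Gr_in_graphs[of M u] Gr_in_graphs[of M v] by (simp add: Gr_def)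

lemma graphs_weakly:
  assumes M: "open M" and X: "\<And>n. X n \<in> graphs M" and w: "weakly X Y"
  shows "Y \<in> graphs M"
proof -
  note S = sets_lebesgue_open[OF M]
  have s: "supp_in M (fst (X n) $ j)" "supp_in M (snd (X n) $ i $ j)" "wd M (axis i 1) (fst (X n) $ j) (snd (X n) $ i $ j)" for n i j
    using X[of n] by (auto simp: graphs_def)
  have 1: "weakly (\<lambda>n. fst (X n) $ j) (fst Y $ j)" for j by (rule weakly_nth[OF weakly_fst[OF w]])
  have 2: "weakly (\<lambda>n. snd (X n) $ i $ j) (snd Y $ i $ j)" for i j by (rule weakly_nth[OF weakly_nth[OF weakly_snd[OF w]]])
  have "supp_in M (fst Y $ j) \<and> supp_in M (snd Y $ i $ j) \<and> wd M (axis i 1) (fst Y $ j) (snd Y $ i $ j)" for i j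
    using weakly_supp_in[OF S 1 s(1)] weakly_supp_in[OF S 2 s(2)] wd_weakly[OF 1 2 s(3)] by blast
  then show ?thesis by (auto simp: graphs_def case_prod_beta)
qed

lemma Gr_diff:
  assumes M: "open M" and u: "H1v M u" and v: "H1v M v"
  shows "H1v M (\<lambda>x. u x - v x)" "Gr M (\<lambda>x. u x - v x) = Gr M u - Gr M v"
  unfolding H1v_def Gr_def Uv_def Dv_def
  using H1_diff[OF M H1v_nth[OF u] H1v_nth[OF v]] emb_diff[OF sets_lebesgue_open[OF M] H1_L2[OF H1v_nth[OF u]] H1_L2[OF H1v_nth[OF v]]]
  by (auto simp: vec_eq_iff axis_Basis)

section \<open>Sphere-valued maps\<close>

lemma H1S2_iff:
  assumes M: "open M" and u: "H1v M u"
  shows "H1S2 M u \<longleftrightarrow> (AE x in lebesgue. x \<in> M \<longrightarrow> (\<Sum>j\<in>UNIV. (fn (Uv M u $ j) x)\<^sup>2) = 1)"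
proof -
  note S = sets_lebesgue_open[OF M]
  have "AE x in lebesgue. \<forall>j\<in>UNIV. fn (Uv M u $ j) x = indicator M x * u x $ j"
    using fn_emb[OF S H1_L2[OF H1v_nth[OF u]]] by (intro AE_finite_allI) (auto simp: Uv_def)
  then have *: "AE x in lebesgue. x \<in> M \<longrightarrow> (norm (u x) = 1 \<longleftrightarrow> (\<Sum>j\<in>UNIV. (fn (Uv M u $ j) x)\<^sup>2) = 1)"
  proof eventually_elim
    case (elim x)
    have "(norm (u x))\<^sup>2 = (\<Sum>j\<in>UNIV. (u x $ j)\<^sup>2)"
      unfolding power2_norm_eq_inner inner_vec_def inner_real_def by (simp add: power2_eq_square)
    moreover have "norm (u x) = 1 \<longleftrightarrow> (norm (u x))\<^sup>2 = 1" by (simp add: abs_square_eq_1)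
    ultimately show ?case using elim by auto
  qed
  show ?thesis unfolding H1S2_def AE_lebesgue_on_iff[OF S] using u *
    by (auto elim: eventually_elim2)
qed

lemma H1S2_H1v: "H1S2 M u \<Longrightarrow> H1v M u"
  by (simp add: H1S2_def)

lemma H1S2_bound:
  assumes M: "open M" and u: "H1S2 M u"
  shows "AE x in lebesgue. \<bar>fn (Uv M u $ j) x\<bar> \<le> 1"
proof -
  note S = sets_lebesgue_open[OF M]
  have "supp_in M (Uv M u $ j)" unfolding Uv_def using supp_in_emb[OF S H1_L2[OF H1v_nth[OF H1S2_H1v[OF u]]]] by simp
  moreover have "AE x in lebesgue. x \<in> M \<longrightarrow> (\<Sum>j\<in>UNIV. (fn (Uv M u $ j) x)\<^sup>2) = 1"
    using u H1S2_iff[OF M H1S2_H1v[OF u]] by blast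
  ultimately show ?thesis unfolding supp_in_def
  proof eventually_elim
    case (elim x)
    show ?case
    proof (cases "x \<in> M")
      case True
      have "(fn (Uv M u $ j) x)\<^sup>2 \<le> (\<Sum>j\<in>UNIV. (fn (Uv M u $ j) x)\<^sup>2)" by (rule member_le_sum) auto
      then have "(fn (Uv M u $ j) x)\<^sup>2 \<le> 1" using elim True by simp
      then show ?thesis by (simp add: abs_square_le_1)
    qed (use elim in simp)
  qed
qed

lemma norm_vec_sq: "(norm (x :: 'a::real_inner^'n::finite))\<^sup>2 = (\<Sum>i\<in>UNIV. (norm (x $ i))\<^sup>2)"
  by (simp add: power2_norm_eq_inner inner_vec_def)

lemma norm_component_le: "norm (x $ i) \<le> norm (x :: 'a::real_inner^'n::finite)"
proof (rule power2_le_imp_le)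
  show "(norm (x $ i))\<^sup>2 \<le> (norm x)\<^sup>2" unfolding norm_vec_sq by (rule member_le_sum) auto
qed simp

text \<open>The sphere constraint fixes the L2 norm, so only the derivatives have to be bounded by
  the energy.\<close>

lemma H1S2_norm:
  assumes M: "open M" "bounded M" and u: "H1S2 M u"
  shows "(norm (Uv M u))\<^sup>2 = measure lebesgue M"
proof -
  note S = sets_lebesgue_open[OF M(1)]
  note U = H1S2_H1v[OF u]
  have i: "integrable (lebesgue_on M) (\<lambda>x. (u x $ j)\<^sup>2)" for j using H1_L2[OF H1v_nth[OF U]] by (simp add: L2_def)
  have m: "u \<in> borel_measurable (lebesgue_on M)"
    using H1_L2[OF H1v_nth[OF U]] by (intro borel_measurable_euclidean_space[THEN iffD2]) (auto simp: Basis_vec_def inner_axis L2_def)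
  have "(norm (Uv M u))\<^sup>2 = (\<Sum>j\<in>UNIV. \<integral>x. (u x $ j)\<^sup>2 \<partial>lebesgue_on M)"
    unfolding norm_vec_sq by (simp add: Uv_def norm_emb[OF S] H1_L2[OF H1v_nth[OF U]])
  also have "\<dots> = (\<integral>x. (norm (u x))\<^sup>2 \<partial>lebesgue_on M)"
    unfolding power2_norm_eq_inner inner_vec_def inner_real_def power2_eq_square[symmetric] using i by simp
  also have "\<dots> = (\<integral>x. 1 \<partial>lebesgue_on M)"
  proof (rule integral_cong_AE)
    show "AE x in lebesgue_on M. (norm (u x))\<^sup>2 = 1" using u unfolding H1S2_def by (auto elim: eventually_mono)
  qed (use m in auto)
  also have "\<dots> = measure lebesgue M" using S by (simp add: measure_restrict_space)
  finally show ?thesis .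
qed

text \<open>Along a subsequence the squared distances tend to zero almost everywhere, and the
  constraint passes to the pointwise limit.\<close>

lemma H1S2_strong_limit:
  assumes M: "open M" and us: "\<And>n. H1S2 M (us n)" and u: "H1v M u" and lim: "(\<lambda>n. Uv M (us n)) \<longlonglongrightarrow> Uv M u"
  shows "H1S2 M u"
proof -
  define d where "d n x = (\<Sum>j\<in>UNIV. (fn (Uv M (us n) $ j) x - fn (Uv M u $ j) x)\<^sup>2)" for n x
  have sd: "sqi (\<lambda>x. fn (Uv M (us n) $ j) x - fn (Uv M u $ j) x)" for n j by (rule sqi_diff[OF sqi_fn sqi_fn])
  have id: "integrable lborel (d n)" for n unfolding d_def[abs_def] using sqi_square[OF sd] by simp
  have "(\<integral>x. norm (d n x) \<partial>lborel) = (norm (Uv M (us n) - Uv M u))\<^sup>2" for n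
  proof -
    have "(\<integral>x. norm (d n x) \<partial>lborel) = (\<Sum>j\<in>UNIV. \<integral>x. (fn (Uv M (us n) $ j) x - fn (Uv M u $ j) x)\<^sup>2 \<partial>lborel)"
      using sqi_square[OF sd] by (simp add: d_def sum_nonneg)
    also have "\<dots> = (\<Sum>j\<in>UNIV. (norm (Uv M (us n) $ j - Uv M u $ j))\<^sup>2)"
      by (simp add: norm_cls[OF sd, symmetric] cls_diff[OF sqi_fn sqi_fn, symmetric])
    finally show ?thesis by (simp add: norm_vec_sq)
  qed
  moreover have "(\<lambda>n. (norm (Uv M (us n) - Uv M u))\<^sup>2) \<longlonglongrightarrow> (norm (Uv M u - Uv M u))\<^sup>2"
    by (intro tendsto_intros lim)
  ultimately have "(\<lambda>n. \<integral>x. norm (d n x) \<partial>lborel) \<longlonglongrightarrow> 0" by simp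
  from tendsto_L1_AE_subseq[OF id this] obtain r where r: "strict_mono r" "AE x in lborel. (\<lambda>n. d (r n) x) \<longlonglongrightarrow> 0" by blast
  have "AE x in lebesgue. \<forall>n. x \<in> M \<longrightarrow> (\<Sum>j\<in>UNIV. (fn (Uv M (us n) $ j) x)\<^sup>2) = 1"
    unfolding AE_all_countable using us H1S2_iff[OF M H1S2_H1v[OF us]] by blast
  with AE_completion[OF r(2)] have "AE x in lebesgue. x \<in> M \<longrightarrow> (\<Sum>j\<in>UNIV. (fn (Uv M u $ j) x)\<^sup>2) = 1"
  proof eventually_elim
    case (elim x)
    show ?case
    proof
      assume x: "x \<in> M"
      have "(\<lambda>n. fn (Uv M (us (r n)) $ j) x) \<longlonglongrightarrow> fn (Uv M u $ j) x" for j
      proof -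
        have lim0: "(\<lambda>n. sqrt (d (r n) x)) \<longlonglongrightarrow> 0" using tendsto_real_sqrt[OF elim(1)] by simp
        have "norm (fn (Uv M (us (r n)) $ j) x - fn (Uv M u $ j) x) \<le> sqrt (d (r n) x)" for n
        proof -
          have "(fn (Uv M (us (r n)) $ j) x - fn (Uv M u $ j) x)\<^sup>2 \<le> d (r n) x"
            unfolding d_def by (rule member_le_sum) auto
          then show ?thesis by (intro real_le_rsqrt) simp
        qed
        then have "(\<lambda>n. fn (Uv M (us (r n)) $ j) x - fn (Uv M u $ j) x) \<longlonglongrightarrow> 0"
          by (intro Lim_null_comparison[OF _ lim0] always_eventually allI)
        then show ?thesis by (simp add: LIM_zero_iff)
      qed
      then have "(\<lambda>n. \<Sum>j\<in>UNIV. (fn (Uv M (us (r n)) $ j) x)\<^sup>2) \<longlonglongrightarrow> (\<Sum>j\<in>UNIV. (fn (Uv M u $ j) x)\<^sup>2)"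
        by (intro tendsto_intros)
      moreover have "(\<Sum>j\<in>UNIV. (fn (Uv M (us (r n)) $ j) x)\<^sup>2) = 1" for n using elim(2) x by blast
      ultimately show "(\<Sum>j\<in>UNIV. (fn (Uv M u $ j) x)\<^sup>2) = 1" by (simp add: LIMSEQ_const_iff)
    qed
  qed
  then show ?thesis using H1S2_iff[OF M u] by blast
qed

text \<open>Weak compactness of the graphs, followed by Rellich in each component; the uniform bound
  that Rellich requires is the bound 1 given by the sphere.\<close>

lemma H1S2_compactness:
  assumes M: "open M" "bounded M" and us: "\<And>n. H1S2 M (us n)" and bd: "\<And>n i. norm (Dv M (us n) $ i) \<le> C"
  shows "\<exists>r u. strict_mono (r :: nat \<Rightarrow> nat) \<and> H1S2 M u \<and> weakly (\<lambda>n. Gr M (us (r n))) (Gr M u) \<and> (\<lambda>n. Uv M (us (r n))) \<longlonglongrightarrow> Uv M u"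
proof -
  have C: "0 \<le> C" using bd[of 0] norm_ge_zero order_trans by blast
  define B where "B = sqrt (measure lebesgue M) + sqrt (3 * C\<^sup>2)"
  have "norm (Gr M (us n)) \<le> B" for n
  proof -
    have "(norm (Dv M (us n)))\<^sup>2 \<le> (\<Sum>i\<in>(UNIV::3 set). C\<^sup>2)"
      unfolding norm_vec_sq[of "Dv M (us n)"] using bd by (intro sum_mono power_mono) auto
    then have "norm (Dv M (us n)) \<le> sqrt (3 * C\<^sup>2)" by (intro real_le_rsqrt) simp
    moreover have "norm (Uv M (us n)) = sqrt (measure lebesgue M)"
      using H1S2_norm[OF M us[of n]] by (metis norm_ge_zero real_sqrt_abs abs_of_nonneg)
    ultimately show ?thesis unfolding Gr_def B_def using norm_Pair_le[of "Uv M (us n)" "Dv M (us n)"] by linarith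
  qed
  from weakly_compact[of "\<lambda>n. Gr M (us n)", OF this] obtain r Y where r: "strict_mono (r :: nat \<Rightarrow> nat)" and w: "weakly ((\<lambda>n. Gr M (us n)) \<circ> r) Y" by blast
  have w': "weakly (\<lambda>n. Gr M (us (r n))) Y" using w by (simp add: o_def)
  have Y: "Y \<in> graphs M" by (rule graphs_weakly[OF M(1) Gr_in_graphs[OF M(1) H1S2_H1v[OF us]] w'])
  define u where "u = (\<lambda>x. \<chi> j. fn (fst Y $ j) x)"
  have u: "H1v M u" "Gr M u = Y" unfolding u_def using graphs_surj[OF M(1) Y] by auto
  have wU: "weakly (\<lambda>n. Uv M (us (r n)) $ j) (Uv M u $ j)" for j
    using weakly_nth[OF weakly_fst[OF w'[folded u(2)]]] by (simp add: Gr_def)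
  have "(\<lambda>n. Uv M (us (r n)) $ j) \<longlonglongrightarrow> Uv M u $ j" for j
  proof (rule rellich[OF M _ H1S2_bound[OF M(1) us] _ _ wU, where D="\<lambda>n b. emb M (wpd M b (\<lambda>y. us (r n) y $ j))" and C=C])
    fix n
    note h = H1v_nth[OF H1S2_H1v[OF us[of "r n"]], of j]
    show "supp_in M (Uv M (us (r n)) $ j)" unfolding Uv_def using supp_in_emb[OF sets_lebesgue_open[OF M(1)] H1_L2[OF h]] by simp
    fix b :: "real^3" assume b: "b \<in> Basis"
    show "wd M b (Uv M (us (r n)) $ j) (emb M (wpd M b (\<lambda>y. us (r n) y $ j)))" unfolding Uv_def using wd_wpd[OF M(1) h b] by simp
    from b obtain i where i: "b = axis i 1" by (auto simp: Basis_vec_def)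
    have "norm (Dv M (us (r n)) $ i $ j) \<le> norm (Dv M (us (r n)) $ i)" by (rule norm_component_le)
    then show "norm (emb M (wpd M b (\<lambda>y. us (r n) y $ j))) \<le> C" using bd[of "r n" i] by (simp add: i Dv_def)
  qed
  then have U: "(\<lambda>n. Uv M (us (r n))) \<longlonglongrightarrow> Uv M u" by (rule vec_tendstoI)
  have "H1S2 M u" by (rule H1S2_strong_limit[OF M(1) us u(1) U])
  then show ?thesis using r w' u U by blast
qed

section \<open>The energies in terms of graphs\<close>

text \<open>The integral of curl_omega u . u, the chiral term of the two in-plane derivatives. Here
  \<open>D $ i $ j\<close> is the derivative of component j in direction i.\<close>

definition c12 :: "(real^3) l2 ^ 3 ^ 3 \<Rightarrow> (real^3) l2 ^ 3 \<Rightarrow> real" where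
  "c12 D U = inner (D $ 1 $ 2) (U $ 3) - inner (D $ 1 $ 3) (U $ 2) + inner (D $ 2 $ 3) (U $ 1) - inner (D $ 2 $ 1) (U $ 3)"

text \<open>The class of \<open>u \<times> e\<^sub>3\<close>.\<close>

definition Jv :: "(real^3) l2 ^ 3 \<Rightarrow> (real^3) l2 ^ 3" where
  "Jv U = (\<chi> j. if j = 1 then U $ 2 else if j = 2 then - (U $ 1) else 0)"

lemma Jv_nth: "Jv U $ 1 = U $ 2" "Jv U $ 2 = - (U $ 1)" "Jv U $ 3 = 0"
  by (simp_all add: Jv_def)

lemma inner_Jv: "inner X (Jv U) = inner (X $ 1) (U $ 2) - inner (X $ 2) (U $ 1)"
  by (simp add: inner_vec_def sum_3 Jv_nth)

lemma norm_Jv: "(norm (Jv U))\<^sup>2 = (norm U)\<^sup>2 - (norm (U $ 3))\<^sup>2"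
  unfolding norm_vec_sq[of "Jv U"] norm_vec_sq[of U] by (simp add: sum_3 Jv_nth)

lemma norm_Jv_le: "norm (Jv U) \<le> norm U"
  by (rule power2_le_imp_le) (simp_all add: norm_Jv)

lemma zero_ext_L2v:
  assumes M: "open M" and u: "H1v M u"
  shows "L2v UNIV (zero_ext M u)" "ev (zero_ext M u) = Uv M u"
proof -
  note S = sets_lebesgue_open[OF M]
  have eq: "zero_ext M u x $ j = indicator M x * u x $ j" for x j by (simp add: zero_ext_def indicator_def)
  have l: "L2 UNIV (\<lambda>x. indicator M x * u x $ j)" for j
    using H1_L2[OF H1v_nth[OF u], of j] unfolding L2_iff[OF S] by (simp add: L2_def lebesgue_on_UNIV_eq)
  then show "L2v UNIV (zero_ext M u)" by (simp add: L2v_def eq)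
  have "emb UNIV (\<lambda>x. indicator M x * u x $ j) = emb M (\<lambda>x. u x $ j)" for j
    by (rule emb_eqI) (use l fn_emb[OF S H1_L2[OF H1v_nth[OF u]], of j] in auto)
  then show "ev (zero_ext M u) = Uv M u" by (simp add: ev_def Uv_def eq vec_eq_iff)
qed

text \<open>Twice the stray field energy.\<close>

definition hn :: "(real^3) set \<Rightarrow> real \<Rightarrow> (real^3 \<Rightarrow> real^3) \<Rightarrow> real" where
  "hn M \<epsilon> u = (norm (ev (h_eps \<epsilon> (zero_ext M u))))\<^sup>2"

lemma sum_norm_integral:
  assumes h: "L2v UNIV h" shows "(\<integral>x. (norm (h x))\<^sup>2 \<partial>lebesgue) = (norm (ev h))\<^sup>2"
proof -
  have i: "integrable lebesgue (\<lambda>x. (h x $ j)\<^sup>2)" for j using L2v_nth[OF h, of j] by (simp add: L2_def lebesgue_on_UNIV_eq)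
  have "(\<integral>x. (norm (h x))\<^sup>2 \<partial>lebesgue) = (\<Sum>j\<in>UNIV. \<integral>x. (h x $ j)\<^sup>2 \<partial>lebesgue)"
    unfolding norm_vec_sq using i by simp
  also have "\<dots> = (norm (ev h))\<^sup>2"
    unfolding norm_vec_sq[of "ev h"] by (simp add: ev_nth norm_emb L2v_nth[OF h] lebesgue_on_UNIV_eq)
  finally show ?thesis .
qed

lemma cross3_axis:
  "cross3 (axis 1 1) p \<bullet> v = p $ 2 * v $ 3 - p $ 3 * v $ 2"
  "cross3 (axis 2 1) p \<bullet> v = p $ 3 * v $ 1 - p $ 1 * v $ 3"
  "cross3 (axis 3 1) p \<bullet> v = p $ 1 * v $ 2 - p $ 2 * v $ 1"
  by (simp_all add: cross3_def inner_vec_def sum_3 axis_def)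

lemma F_eps_formula:
  assumes om: "open \<omega>" and u: "H1v (film \<omega>) u" and e: "0 < \<epsilon>"
  defines "M \<equiv> film \<omega>"
  shows "F_eps \<omega> \<kappa> \<epsilon> u = 1/2 * ((norm (Dv M u $ 1))\<^sup>2 + (norm (Dv M u $ 2))\<^sup>2 + (norm (Dv M u $ 3))\<^sup>2 / \<epsilon>\<^sup>2)
    + \<kappa> * (c12 (Dv M u) (Uv M u) + inner (Dv M u $ 3) (Jv (Uv M u)) / \<epsilon>) + 1/2 * hn M \<epsilon> u"
proof -
  have M: "open M" unfolding M_def by (rule open_film[OF om])
  note S = sets_lebesgue_open[OF M]
  have u: "H1v M u" using u by (simp add: M_def)
  note h = H1v_nth[OF u]
  define g where "g i j = wpd M (axis i 1) (\<lambda>y. u y $ j)" for i j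
  define c where "c i = (if i = 3 then 1 / \<epsilon> else 1)" for i :: 3
  have gl: "L2 M (g i j)" for i j unfolding g_def by (rule wpd(1)[OF h axis_Basis])
  have ul: "L2 M (\<lambda>x. u x $ j)" for j by (rule H1_L2[OF h])
  have ge: "emb M (g i j) = Dv M u $ i $ j" for i j by (simp add: g_def Dv_def)
  have ue: "emb M (\<lambda>x. u x $ j) = Uv M u $ j" for j by (simp add: Uv_def)
  have grad: "grad_eps M \<epsilon> i u x $ j = c i * g i j x" for i j x by (simp add: grad_eps_def c_def g_def)
  have isq: "integrable (lebesgue_on M) (\<lambda>x. (g i j x)\<^sup>2)" for i j using gl[of i j] by (simp add: L2_def)
  have ipr: "integrable (lebesgue_on M) (\<lambda>x. g i j x * u x $ k)" for i j k
    using square_integrable_mult[of "g i j" "lebesgue_on M" "\<lambda>x. u x $ k"] gl[of i j] ul[of k] by (simp add: L2_def)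
  have pr: "(\<integral>x. g i j x * u x $ k \<partial>lebesgue_on M) = inner (Dv M u $ i $ j) (Uv M u $ k)" for i j k
    using inner_emb[OF S gl ul, of i j k] by (simp add: ge ue)
  have sq: "(\<integral>x. (g i j x)\<^sup>2 \<partial>lebesgue_on M) = (norm (Dv M u $ i $ j))\<^sup>2" for i j
    using norm_emb[OF S gl, of i j] by (simp add: ge)
  have "(\<Sum>i\<in>UNIV. (norm (grad_eps M \<epsilon> i u x))\<^sup>2) = (\<Sum>i\<in>UNIV. \<Sum>j\<in>UNIV. (c i)\<^sup>2 * (g i j x)\<^sup>2)" for x
    unfolding norm_vec_sq grad by (simp add: power_mult_distrib)
  then have "(\<integral>x. (\<Sum>i\<in>UNIV. (norm (grad_eps M \<epsilon> i u x))\<^sup>2) \<partial>lebesgue_on M) = (\<Sum>i\<in>UNIV. \<Sum>j\<in>UNIV. (c i)\<^sup>2 * (norm (Dv M u $ i $ j))\<^sup>2)"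
    using isq by (simp add: sq)
  also have "\<dots> = (\<Sum>i\<in>UNIV. (c i)\<^sup>2 * (norm (Dv M u $ i))\<^sup>2)"
    unfolding norm_vec_sq[of "Dv M u $ _"] by (simp add: sum_distrib_left)
  also have "\<dots> = (norm (Dv M u $ 1))\<^sup>2 + (norm (Dv M u $ 2))\<^sup>2 + (norm (Dv M u $ 3))\<^sup>2 / \<epsilon>\<^sup>2"
    by (simp add: sum_3 c_def power_divide)
  finally have 1: "(\<integral>x. (\<Sum>i\<in>UNIV. (norm (grad_eps M \<epsilon> i u x))\<^sup>2) \<partial>lebesgue_on M)
     = (norm (Dv M u $ 1))\<^sup>2 + (norm (Dv M u $ 2))\<^sup>2 + (norm (Dv M u $ 3))\<^sup>2 / \<epsilon>\<^sup>2" .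
  have "curl_eps M \<epsilon> u x \<bullet> u x = (g 1 2 x * u x $ 3 - g 1 3 x * u x $ 2) + (g 2 3 x * u x $ 1 - g 2 1 x * u x $ 3)
      + (1/\<epsilon>) * (g 3 1 x * u x $ 2 - g 3 2 x * u x $ 1)" for x
    unfolding curl_eps_def sum_3 inner_add_left cross3_axis grad by (simp add: c_def algebra_simps diff_divide_distrib)
  then have 2: "(\<integral>x. curl_eps M \<epsilon> u x \<bullet> u x \<partial>lebesgue_on M) = c12 (Dv M u) (Uv M u) + inner (Dv M u $ 3) (Jv (Uv M u)) / \<epsilon>"
    using ipr by (simp add: pr c12_def inner_Jv)
  have 3: "(\<integral>x. (norm (h_eps \<epsilon> (zero_ext M u) x))\<^sup>2 \<partial>lebesgue) = hn M \<epsilon> u"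
    unfolding hn_def by (rule sum_norm_integral[OF h_eps(1)[OF zero_ext_L2v(1)[OF M u] e]])
  show ?thesis unfolding F_eps_def M_def[symmetric] 1 2 3 by simp
qed

text \<open>The sphere constraint evaluates the zeroth-order remainder of the square as the volume
  of the film minus the squared norm of the third component.\<close>

lemma F_eps_square:
  assumes om: "open \<omega>" "bounded \<omega>" and u: "H1S2 (film \<omega>) u" and e: "0 < \<epsilon>"
  defines "M \<equiv> film \<omega>"
  shows "F_eps \<omega> \<kappa> \<epsilon> u = 1/2 * ((norm (Dv M u $ 1))\<^sup>2 + (norm (Dv M u $ 2))\<^sup>2) + \<kappa> * c12 (Dv M u) (Uv M u)
    + 1/2 * (norm ((1/\<epsilon>) *\<^sub>R Dv M u $ 3 + \<kappa> *\<^sub>R Jv (Uv M u)))\<^sup>2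
    - \<kappa>\<^sup>2 / 2 * (measure lebesgue M - (norm (Uv M u $ 3))\<^sup>2) + 1/2 * hn M \<epsilon> u"
proof -
  have "(norm ((1/\<epsilon>) *\<^sub>R Dv M u $ 3 + \<kappa> *\<^sub>R Jv (Uv M u)))\<^sup>2
     = (norm (Dv M u $ 3))\<^sup>2 / \<epsilon>\<^sup>2 + 2 * \<kappa> * inner (Dv M u $ 3) (Jv (Uv M u)) / \<epsilon> + \<kappa>\<^sup>2 * (norm (Jv (Uv M u)))\<^sup>2"
    unfolding power2_norm_eq_inner by (simp add: inner_simps inner_commute power2_eq_square field_simps)
  moreover have "(norm (Jv (Uv M u)))\<^sup>2 = measure lebesgue M - (norm (Uv M u $ 3))\<^sup>2"
    unfolding norm_Jv M_def using H1S2_norm[OF open_film[OF om(1)] bounded_film[OF om(2)] u] by simp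
  moreover have "F_eps \<omega> \<kappa> \<epsilon> u = 1/2 * ((norm (Dv M u $ 1))\<^sup>2 + (norm (Dv M u $ 2))\<^sup>2 + (norm (Dv M u $ 3))\<^sup>2 / \<epsilon>\<^sup>2)
    + \<kappa> * (c12 (Dv M u) (Uv M u) + inner (Dv M u $ 3) (Jv (Uv M u)) / \<epsilon>) + 1/2 * hn M \<epsilon> u"
    unfolding M_def by (rule F_eps_formula[OF om(1) H1S2_H1v[OF u] e])
  ultimately show ?thesis by (simp only:) (simp add: algebra_simps)
qed

lemma c12_bound: "\<bar>c12 D U\<bar> \<le> 2 * (norm (D $ 1) + norm (D $ 2)) * norm U"
proof -
  have b: "\<bar>inner (D $ i $ j) (U $ k)\<bar> \<le> norm (D $ i) * norm U" for i j k
    using Cauchy_Schwarz_ineq2[of "D $ i $ j" "U $ k"] mult_mono[OF norm_component_le[of "D $ i" j] norm_component_le[of U k]] by simp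
  show ?thesis unfolding c12_def using b[of 1 2 3] b[of 1 3 2] b[of 2 3 1] b[of 2 1 3]
    by (simp add: algebra_simps) 
qed

text \<open>The in-plane chiral term is linear in the gradient with a coefficient of norm
  \<open>sqrt m\<close>. Young's inequality absorbs it into half of the quadratic term at the cost
  \<open>8 * k^2\<close>; the bound on the completed square then controls the third derivative
  divided by \<open>\<epsilon>\<close>.\<close>

lemma coercive:
  assumes om: "open \<omega>" "bounded \<omega>"
  defines "M \<equiv> film \<omega>"
  shows "\<exists>C\<ge>0. \<forall>\<epsilon> u. 0 < \<epsilon> \<longrightarrow> H1S2 M u \<longrightarrow> F_eps \<omega> \<kappa> \<epsilon> u \<le> C0 \<longrightarrow>
     norm (Dv M u $ 1) \<le> C \<and> norm (Dv M u $ 2) \<le> C \<and> norm (Dv M u $ 3) \<le> \<epsilon> * C"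
proof -
  define m where "m = measure lebesgue M"
  define k where "k = \<bar>\<kappa>\<bar> * sqrt m"
  have k: "0 \<le> k" "k\<^sup>2 = \<kappa>\<^sup>2 * m" by (auto simp: k_def m_def power_mult_distrib)
  \<comment> \<open>Four times the right-hand side left after the absorption bounds both squared
    in-plane derivatives and the completed square; the absolute value makes \<open>B\<close>
    nonnegative.\<close>
  define B where "B = \<bar>4 * (C0 + \<kappa>\<^sup>2 / 2 * m + 8 * k\<^sup>2)\<bar>"
  define C where "C = sqrt B + k"
  have "norm (Dv M u $ 1) \<le> C \<and> norm (Dv M u $ 2) \<le> C \<and> norm (Dv M u $ 3) \<le> \<epsilon> * C"
    if e: "0 < \<epsilon>" and u: "H1S2 M u" and F: "F_eps \<omega> \<kappa> \<epsilon> u \<le> C0" for \<epsilon> u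
  proof -
    define a b where "a = norm (Dv M u $ 1)" and "b = norm (Dv M u $ 2)"
    define Q where "Q = (1/\<epsilon>) *\<^sub>R Dv M u $ 3 + \<kappa> *\<^sub>R Jv (Uv M u)"
    have ab: "0 \<le> a" "0 \<le> b" by (auto simp: a_def b_def)
    have nU: "norm (Uv M u) = sqrt m"
      using H1S2_norm[OF open_film[OF om(1)] bounded_film[OF om(2)] u[unfolded M_def]] unfolding m_def M_def
      by (metis norm_ge_zero real_sqrt_abs abs_of_nonneg)
    have "\<bar>\<kappa> * c12 (Dv M u) (Uv M u)\<bar> \<le> \<bar>\<kappa>\<bar> * (2 * (a + b) * sqrt m)"
      unfolding abs_mult using c12_bound[of "Dv M u" "Uv M u"] unfolding nU a_def b_def by (intro mult_left_mono) auto
    then have c: "\<kappa> * c12 (Dv M u) (Uv M u) \<ge> - (2 * k * (a + b))" by (simp add: k_def algebra_simps abs_le_iff)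
    have "F_eps \<omega> \<kappa> \<epsilon> u = 1/2 * (a\<^sup>2 + b\<^sup>2) + \<kappa> * c12 (Dv M u) (Uv M u) + 1/2 * (norm Q)\<^sup>2 - \<kappa>\<^sup>2 / 2 * (m - (norm (Uv M u $ 3))\<^sup>2) + 1/2 * hn M \<epsilon> u"
      unfolding a_def b_def Q_def m_def M_def by (rule F_eps_square[OF om u[unfolded M_def] e])
    moreover have "\<kappa>\<^sup>2 / 2 * (m - (norm (Uv M u $ 3))\<^sup>2) \<le> \<kappa>\<^sup>2 / 2 * m" by (intro mult_left_mono) auto
    moreover have "0 \<le> hn M \<epsilon> u" by (simp add: hn_def)
    \<comment> \<open>Young's inequality in the form 2ka \<le> a^2/4 + 4k^2, and the same for
      b.\<close>
    moreover have "0 \<le> (a / 2 - 2 * k)\<^sup>2" "0 \<le> (b / 2 - 2 * k)\<^sup>2" by auto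
    then have "2 * k * a \<le> a\<^sup>2 / 4 + 4 * k\<^sup>2" "2 * k * b \<le> b\<^sup>2 / 4 + 4 * k\<^sup>2"
      by (auto simp: power2_diff power_divide algebra_simps power_mult_distrib)
    moreover have "2 * k * (a + b) = 2 * k * a + 2 * k * b" by (simp add: algebra_simps)
    ultimately have "a\<^sup>2 / 4 + b\<^sup>2 / 4 + 1/2 * (norm Q)\<^sup>2 \<le> C0 + \<kappa>\<^sup>2 / 2 * m + 8 * k\<^sup>2"
      using c F by argo
    moreover have "0 \<le> a\<^sup>2" "0 \<le> b\<^sup>2" "0 \<le> (norm Q)\<^sup>2" by auto
    ultimately have "a\<^sup>2 \<le> B" "b\<^sup>2 \<le> B" "(norm Q)\<^sup>2 \<le> B" unfolding B_def by argo+
    then have s: "a \<le> sqrt B" "b \<le> sqrt B" "norm Q \<le> sqrt B" by (auto intro: real_le_rsqrt)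
    have "norm (\<kappa> *\<^sub>R Jv (Uv M u)) \<le> k"
      using norm_Jv_le[of "Uv M u"] unfolding nU k_def by (simp add: mult_left_mono)
    then have "norm ((1/\<epsilon>) *\<^sub>R Dv M u $ 3) \<le> C"
      using norm_triangle_ineq4[of Q "\<kappa> *\<^sub>R Jv (Uv M u)"] s(3) by (simp add: Q_def C_def)
    then have "norm (Dv M u $ 3) \<le> \<epsilon> * C" using e by (simp add: field_simps)
    then show ?thesis using s k unfolding a_def b_def C_def by simp
  qed
  moreover have "0 \<le> C" using k by (simp add: C_def B_def)
  ultimately show ?thesis by blast
qed

text \<open>Limit of everything but the squares: the chiral term, the remainder of the completed
  square, and the limiting stray field energy, which is half the squared norm of the third
  component.\<close>

definition T0 :: "(real^3) set \<Rightarrow> real \<Rightarrow> (real^3 \<Rightarrow> real^3) \<Rightarrow> real" where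
  "T0 M \<kappa> u = \<kappa> * c12 (Dv M u) (Uv M u) - \<kappa>\<^sup>2 / 2 * (measure lebesgue M - (norm (Uv M u $ 3))\<^sup>2) + 1/2 * (norm (Uv M u $ 3))\<^sup>2"

definition G0 :: "(real^3) set \<Rightarrow> real \<Rightarrow> (real^3 \<Rightarrow> real^3) \<Rightarrow> real" where
  "G0 M \<kappa> u = 1/2 * ((norm (Dv M u $ 1))\<^sup>2 + (norm (Dv M u $ 2))\<^sup>2) + T0 M \<kappa> u"

lemma indep_s_imp_Dv3_zero:
  assumes om: "open \<omega>" and u: "H1v (film \<omega>) u" and i: "indep_s \<omega> u v"
  shows "Dv (film \<omega>) u $ 3 = 0"
proof -
  let ?M = "film \<omega>"
  have M: "open ?M" by (rule open_film[OF om])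
  note S = sets_lebesgue_open[OF M]
  have "Dv ?M u $ 3 $ j = 0" for j
  proof -
    note h = H1v_nth[OF u, of j]
    have a: "AE x in lebesgue. x \<in> ?M \<longrightarrow> fn (Uv ?M u $ j) x = v (proj2 x) $ j"
      using fn_emb[OF S H1_L2[OF h]] i[unfolded indep_s_def AE_lebesgue_on_iff[OF S]]
      unfolding Uv_def by eventually_elim auto
    have "wd ?M (axis 3 1) (Uv ?M u $ j) 0"
    proof (rule wd_zero_of_translation_invariant[OF M axis_Basis])
      fix t
      show "AE x in lebesgue. x \<in> ?M \<longrightarrow> x + t *\<^sub>R axis 3 1 \<in> ?M \<longrightarrow> fn (Uv ?M u $ j) (x + t *\<^sub>R axis 3 1) = fn (Uv ?M u $ j) x"
        using a AE_lebesgue_shift[OF a, of "t *\<^sub>R axis 3 1"] by eventually_elim (simp add: proj2_line)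
    qed
    moreover have "wd ?M (axis 3 1) (Uv ?M u $ j) (Dv ?M u $ 3 $ j)" "supp_in ?M (Dv ?M u $ 3 $ j)"
      using Gr_in_graphs[OF M u] by (auto simp: graphs_def Gr_def)
    moreover have "supp_in ?M 0" unfolding supp_in_def using fn_zero by eventually_elim simp
    ultimately show ?thesis using wd_unique[OF M] by blast
  qed
  then show ?thesis by (simp add: vec_eq_iff)
qed

lemma Dv3_zero_imp_cylindrical:
  assumes om: "open \<omega>" and u: "H1v (film \<omega>) u" and z: "Dv (film \<omega>) u $ 3 = 0"
  shows "\<exists>G. \<forall>j. supp_in \<omega> (G j) \<and> Uv (film \<omega>) u $ j = cyl (G j)"
    and "\<exists>H. \<forall>i j. supp_in \<omega> (H i j) \<and> Dv (film \<omega>) u $ i $ j = cyl (H i j)"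
proof -
  let ?M = "film \<omega>"
  have M: "open ?M" by (rule open_film[OF om])
  have g: "supp_in ?M (Uv ?M u $ j)" "supp_in ?M (Dv ?M u $ i $ j)" "wd ?M (axis i 1) (Uv ?M u $ j) (Dv ?M u $ i $ j)" for i j
    using Gr_in_graphs[OF M u] by (auto simp: graphs_def Gr_def)
  have z': "wd ?M (axis 3 1) (Uv ?M u $ j) 0" for j using g(3)[of 3 j] z by simp
  show "\<exists>G. \<forall>j. supp_in \<omega> (G j) \<and> Uv ?M u $ j = cyl (G j)"
    using cylindrical_of_wd_zero[OF om g(1) z'] by metis
  have "\<forall>i j. \<exists>H. supp_in \<omega> H \<and> Dv ?M u $ i $ j = cyl H"
    using cylindrical_of_wd_zero[OF om g(2) wd_mixed[OF g(3) z' axis_Basis axis_Basis]] by blast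
  then show "\<exists>H. \<forall>i j. supp_in \<omega> (H i j) \<and> Dv ?M u $ i $ j = cyl (H i j)" by metis
qed

text \<open>Converse of \<open>indep_s_imp_Dv3_zero\<close>: together they replace the condition
  under which \<open>F_0\<close> is finite by the vanishing of the third weak derivative, a
  condition stable under weak limits.\<close>

lemma Dv3_zero_imp_indep_s:
  assumes om: "open \<omega>" and u: "H1v (film \<omega>) u" and z: "Dv (film \<omega>) u $ 3 = 0"
  shows "\<exists>v. indep_s \<omega> u v"
proof -
  let ?M = "film \<omega>"
  have M: "open ?M" by (rule open_film[OF om])
  note S = sets_lebesgue_open[OF M]
  obtain G where G: "\<And>j. supp_in \<omega> (G j)" "\<And>j. Uv ?M u $ j = cyl (G j)" using Dv3_zero_imp_cylindrical(1)[OF assms] by blast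
  have "AE x in lebesgue. \<forall>j\<in>UNIV. x \<in> ?M \<longrightarrow> u x $ j = fn (G j) (proj2 x)"
  proof (rule AE_finite_allI)
    fix j
    show "AE x in lebesgue. x \<in> ?M \<longrightarrow> u x $ j = fn (G j) (proj2 x)"
      using fn_cyl[of "G j"] fn_emb[OF S H1_L2[OF H1v_nth[OF u, of j]]]
    proof eventually_elim
      case (elim x)
      have "emb ?M (\<lambda>x. u x $ j) = cyl (G j)" using G(2)[of j] by (simp add: Uv_def)
      then show ?case using elim by (auto simp: cylf_def film_alt)
    qed
  qed simp
  then have "AE x in lebesgue. x \<in> ?M \<longrightarrow> u x = (\<lambda>y. \<chi> j. fn (G j) y) (proj2 x)"
    by eventually_elim (simp add: vec_eq_iff)
  then have "indep_s \<omega> u (\<lambda>y. \<chi> j. fn (G j) y)" unfolding indep_s_def AE_lebesgue_on_iff[OF S] .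
  then show ?thesis by blast
qed

lemma measure_film:
  assumes om: "open \<omega>" "bounded \<omega>" shows "measure lebesgue (film \<omega>) = measure lebesgue \<omega>"
proof -
  have [measurable]: "\<omega> \<in> sets borel" using om by simp
  have "(\<integral>x. indicator slab x * indicat_real \<omega> (proj2 x) \<partial>lborel) = (\<integral>y. indicat_real \<omega> y \<partial>(lborel :: (real^2) measure))"
    by (rule slab_integral(1)) simp
  moreover have "(\<lambda>x. indicator slab x * indicat_real \<omega> (proj2 x)) = (indicator (film \<omega>) :: real^3 \<Rightarrow> real)"
    by (auto simp: film_alt indicator_def fun_eq_iff)
  ultimately have "measure lborel (film \<omega>) = measure lborel \<omega>" by simp
  then show ?thesis using om(1) open_film[OF om(1)] by (simp add: measure_completion)
qed

text \<open>The profile \<open>v\<close> is tied to \<open>u\<close> only almost everywhere in the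
  film. The film map supplies planar classes \<open>G\<close> and \<open>H\<close> for the profile
  and its derivatives, and the isometry \<open>cyl\<close> turns the planar integrals into film
  ones.\<close>

lemma F0_2d_formula:
  assumes om: "open \<omega>" "bounded \<omega>" and u: "H1v (film \<omega>) u" and i: "indep_s \<omega> u v"
  shows "F0_2d \<omega> \<kappa> v = G0 (film \<omega>) \<kappa> u"
proof -
  let ?M = "film \<omega>"
  have M: "open ?M" by (rule open_film[OF om(1)])
  note S = sets_lebesgue_open[OF M]
  note So = sets_lebesgue_open[OF om(1)]
  have z: "Dv ?M u $ 3 = 0" by (rule indep_s_imp_Dv3_zero[OF om(1) u i])
  obtain G where G: "\<And>j. supp_in \<omega> (G j)" "\<And>j. Uv ?M u $ j = cyl (G j)"
    using Dv3_zero_imp_cylindrical(1)[OF om(1) u z] by blast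
  obtain H where H: "\<And>i j. supp_in \<omega> (H i j)" "\<And>i j. Dv ?M u $ i $ j = cyl (H i j)"
    using Dv3_zero_imp_cylindrical(2)[OF om(1) u z] by blast
  \<comment> \<open>Fubini carries the identity from the film down to the plane; measurability and
    integrability of \<open>v\<close> follow from it.\<close>
  have vG: "AE y in lebesgue_on \<omega>. v y $ j = fn (G j) y" for j
  proof -
    have "AE x in lebesgue. x \<in> slab \<longrightarrow> (\<lambda>y. y \<in> \<omega> \<longrightarrow> v y $ j = fn (G j) y) (proj2 x)"
      using fn_cyl[of "G j"] fn_emb[OF S H1_L2[OF H1v_nth[OF u, of j]]] i[unfolded indep_s_def AE_lebesgue_on_iff[OF S]]
    proof eventually_elim
      case (elim x)
      have "emb ?M (\<lambda>x. u x $ j) = cyl (G j)" using G(2)[of j] by (simp add: Uv_def)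
      then show ?case using elim by (auto simp: cylf_def film_alt)
    qed
    from null_cylinder[OF this] show ?thesis unfolding AE_lebesgue_on_iff[OF So] .
  qed
  have vl: "L2 \<omega> (\<lambda>y. v y $ j)" for j by (rule L2_cong_AE[OF So L2_fn[OF So] vG])
  have ve: "emb \<omega> (\<lambda>y. v y $ j) = G j" for j
  proof -
    have "emb \<omega> (\<lambda>y. v y $ j) = emb \<omega> (fn (G j))" using emb_eq_iff[OF So vl L2_fn[OF So]] vG by blast
    then show ?thesis using emb_supp_in[OF So G(1)] by simp
  qed
  have w: "wd \<omega> (axis (down i) 1) (G j) (H i j)" if "i \<noteq> 3" for i j
  proof (rule wd_cyl_down[OF that])
    show "wd ?M (axis i 1) (cyl (G j)) (cyl (H i j))"
      using Gr_in_graphs[OF M u] by (auto simp: graphs_def Gr_def G(2)[symmetric] H(2)[symmetric])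
  qed
  define g where "g i j = wpd \<omega> (axis i 1) (\<lambda>y. v y $ j)" for i :: 2 and j :: 3
  have ge: "emb \<omega> (g (down i) j) = H i j" "L2 \<omega> (g (down i) j)" if "i \<noteq> 3" for i j
    unfolding g_def using emb_wpd_eqI[OF om(1) vl axis_Basis _ H(1), of "down i" j i j] w[OF that, of j] by (simp_all add: ve)
  have d: "down 1 = 1" "down 2 = 2" by (simp_all add: down_def)
  have gl: "L2 \<omega> (g 1 j)" "L2 \<omega> (g 2 j)" and gH: "emb \<omega> (g 1 j) = H 1 j" "emb \<omega> (g 2 j) = H 2 j" for j
    using ge[of 1 j] ge[of 2 j] d by auto
  have grad: "grad2 \<omega> i v y $ j = g i j y" for i j y by (simp add: grad2_def g_def)
  have isq: "integrable (lebesgue_on \<omega>) (\<lambda>y. (g 1 j y)\<^sup>2)" "integrable (lebesgue_on \<omega>) (\<lambda>y. (g 2 j y)\<^sup>2)" for j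
    using gl[of j] by (auto simp: L2_def)
  have ipr: "integrable (lebesgue_on \<omega>) (\<lambda>y. g 1 j y * v y $ k)" "integrable (lebesgue_on \<omega>) (\<lambda>y. g 2 j y * v y $ k)" for j k
    using square_integrable_mult[of "g 1 j" "lebesgue_on \<omega>" "\<lambda>y. v y $ k"] square_integrable_mult[of "g 2 j" "lebesgue_on \<omega>" "\<lambda>y. v y $ k"]
      gl[of j] vl[of k] by (auto simp: L2_def)
  have pr: "(\<integral>y. g 1 j y * v y $ k \<partial>lebesgue_on \<omega>) = inner (Dv ?M u $ 1 $ j) (Uv ?M u $ k)"
    "(\<integral>y. g 2 j y * v y $ k \<partial>lebesgue_on \<omega>) = inner (Dv ?M u $ 2 $ j) (Uv ?M u $ k)" for j k
    using inner_emb[OF So gl(1) vl, of j k] inner_emb[OF So gl(2) vl, of j k]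
    by (simp_all add: gH ve G(2) H(2) inner_cyl)
  have sq: "(\<integral>y. (g 1 j y)\<^sup>2 \<partial>lebesgue_on \<omega>) = (norm (Dv ?M u $ 1 $ j))\<^sup>2"
    "(\<integral>y. (g 2 j y)\<^sup>2 \<partial>lebesgue_on \<omega>) = (norm (Dv ?M u $ 2 $ j))\<^sup>2" for j
    using norm_emb[OF So gl(1), of j] norm_emb[OF So gl(2), of j] by (simp_all add: gH H(2) norm_cyl)
  have 1: "(\<integral>y. (norm (grad2 \<omega> 1 v y))\<^sup>2 + (norm (grad2 \<omega> 2 v y))\<^sup>2 \<partial>lebesgue_on \<omega>) = (norm (Dv ?M u $ 1))\<^sup>2 + (norm (Dv ?M u $ 2))\<^sup>2"
    unfolding norm_vec_sq[of "grad2 _ _ _ _"] grad norm_vec_sq[of "Dv ?M u $ _"] using isq by (simp add: sq)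
  have "curl2 \<omega> v y \<bullet> v y = (g 1 2 y * v y $ 3 - g 1 3 y * v y $ 2) + (g 2 3 y * v y $ 1 - g 2 1 y * v y $ 3)" for y
    unfolding curl2_def inner_add_left cross3_axis grad by simp
  then have 2: "(\<integral>y. curl2 \<omega> v y \<bullet> v y \<partial>lebesgue_on \<omega>) = c12 (Dv ?M u) (Uv ?M u)"
    using ipr by (simp add: pr c12_def)
  have 3: "(\<integral>y. (v y \<bullet> axis 3 1)\<^sup>2 \<partial>lebesgue_on \<omega>) = (norm (Uv ?M u $ 3))\<^sup>2"
    using norm_emb[OF So vl, of 3] by (simp add: ve G(2) norm_cyl inner_axis)
  show ?thesis unfolding F0_2d_def 1 2 3 G0_def T0_def measure_film[OF om] by (simp add: field_simps)
qed

text \<open>The choice by SOME in \<open>F_0\<close> is harmless, since the planar energy of every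
  admissible profile equals \<open>G0\<close>.\<close>

lemma F_0_formula:
  assumes om: "open \<omega>" "bounded \<omega>" and u: "H1v (film \<omega>) u"
  shows "F_0 \<omega> \<kappa> u = (if Dv (film \<omega>) u $ 3 = 0 then ereal (G0 (film \<omega>) \<kappa> u) else \<infinity>)"
proof (cases "\<exists>v. indep_s \<omega> u v")
  case True
  then have "indep_s \<omega> u (SOME v. indep_s \<omega> u v)" by (rule someI_ex)
  then show ?thesis unfolding F_0_def
    using True F0_2d_formula[OF om u] indep_s_imp_Dv3_zero[OF om(1) u] by simp
next
  case False
  then show ?thesis unfolding F_0_def using Dv3_zero_imp_indep_s[OF om(1) u] by auto
qed

section \<open>Gamma-convergence\<close>

locale thin_film =
  fixes \<omega> :: "(real^2) set" and \<kappa> :: real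
  assumes open_om: "open \<omega>" and bounded_om: "bounded \<omega>"
begin

abbreviation "M \<equiv> film \<omega>"

lemma open_M: "open M" by (rule open_film[OF open_om])
lemma bounded_M: "bounded M" by (rule bounded_film[OF bounded_om])

text \<open>After completing the square, \<open>rest\<close> passes to the limit along weakly convergent sequences, and
  \<open>squares\<close> is only lower semicontinuous.\<close>

definition rest :: "real \<Rightarrow> (real^3 \<Rightarrow> real^3) \<Rightarrow> real" where
  "rest \<epsilon> u = \<kappa> * c12 (Dv M u) (Uv M u) - \<kappa>\<^sup>2 / 2 * (measure lebesgue M - (norm (Uv M u $ 3))\<^sup>2) + 1/2 * hn M \<epsilon> u"

definition squares :: "real \<Rightarrow> (real^3 \<Rightarrow> real^3) \<Rightarrow> real" where
  "squares \<epsilon> u = 1/2 * ((norm (Dv M u $ 1))\<^sup>2 + (norm (Dv M u $ 2))\<^sup>2)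
     + 1/2 * (norm ((1/\<epsilon>) *\<^sub>R Dv M u $ 3 + \<kappa> *\<^sub>R Jv (Uv M u)))\<^sup>2"

lemma F_eps_split: "H1S2 M u \<Longrightarrow> 0 < \<epsilon> \<Longrightarrow> F_eps \<omega> \<kappa> \<epsilon> u = squares \<epsilon> u + rest \<epsilon> u"
  using F_eps_square[OF open_om bounded_om, of u \<epsilon> \<kappa>] by (simp add: squares_def rest_def)

definition wconv :: "(nat \<Rightarrow> real^3 \<Rightarrow> real^3) \<Rightarrow> (real^3 \<Rightarrow> real^3) \<Rightarrow> bool" where
  "wconv us u \<longleftrightarrow> (\<forall>n. H1S2 M (us n)) \<and> H1S2 M u \<and> weakly (\<lambda>n. Gr M (us n)) (Gr M u) \<and> (\<lambda>n. Uv M (us n)) \<longlonglongrightarrow> Uv M u"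

lemma wconv_Dv:
  assumes "wconv us u"
  shows "weakly (\<lambda>n. Dv M (us n) $ i) (Dv M u $ i)" "weakly (\<lambda>n. Dv M (us n) $ i $ j) (Dv M u $ i $ j)"
proof -
  show 1: "weakly (\<lambda>n. Dv M (us n) $ i) (Dv M u $ i)"
    using weakly_nth[OF weakly_snd[of "\<lambda>n. Gr M (us n)" "Gr M u"]] assms by (simp add: wconv_def Gr_def)
  show "weakly (\<lambda>n. Dv M (us n) $ i $ j) (Dv M u $ i $ j)" by (rule weakly_nth[OF 1])
qed

text \<open>Each chiral product pairs a weakly convergent derivative with a strongly convergent
  component; the stray field term converges by \<open>h_eps_limit\<close>.\<close>

lemma rest_limit:
  assumes w: "wconv us u" and bd: "\<And>n i. norm (Dv M (us n) $ i) \<le> C"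
    and e: "\<And>n. 0 < \<epsilon> n" and e0: "\<epsilon> \<longlonglongrightarrow> 0"
  shows "(\<lambda>n. rest (\<epsilon> n) (us n)) \<longlonglongrightarrow> T0 M \<kappa> u"
proof -
  have us: "H1S2 M (us n)" for n using w by (simp add: wconv_def)
  have U: "(\<lambda>n. Uv M (us n)) \<longlonglongrightarrow> Uv M u" using w by (simp add: wconv_def)
  have Uj: "(\<lambda>n. Uv M (us n) $ j) \<longlonglongrightarrow> Uv M u $ j" for j by (intro tendsto_vec_nth U)
  have pr: "(\<lambda>n. inner (Dv M (us n) $ i $ j) (Uv M (us n) $ k)) \<longlonglongrightarrow> inner (Dv M u $ i $ j) (Uv M u $ k)" for i j k
  proof (rule weakly_strongly_inner[OF wconv_Dv(2)[OF w] _ Uj])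
    show "norm (Dv M (us n) $ i $ j) \<le> C" for n using norm_component_le[of "Dv M (us n) $ i" j] bd[of n i] by simp
  qed
  have "(\<lambda>n. hn M (\<epsilon> n) (us n)) \<longlonglongrightarrow> (norm (Uv M u $ 3))\<^sup>2"
    unfolding hn_def
    by (rule h_eps_limit[OF zero_ext_L2v(1)[OF open_M H1S2_H1v[OF us]] _ e e0])
      (simp add: zero_ext_L2v(2)[OF open_M H1S2_H1v[OF us]] U)
  then show ?thesis unfolding rest_def T0_def c12_def by (intro tendsto_intros pr Uj)
qed

text \<open>The tangent inequality 2 a.b - |b|^2 \<le> |a|^2 for the in-plane squares; the completed
  square is dropped.\<close>

lemma squares_lower:
  "1/2 * (2 * inner (Dv M v $ 1) D1 - (norm D1)\<^sup>2 + 2 * inner (Dv M v $ 2) D2 - (norm D2)\<^sup>2) \<le> squares \<epsilon> v"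
proof -
  have "0 \<le> (norm (Dv M v $ 1 - D1))\<^sup>2" "0 \<le> (norm (Dv M v $ 2 - D2))\<^sup>2" by auto
  then have "2 * inner (Dv M v $ 1) D1 - (norm D1)\<^sup>2 \<le> (norm (Dv M v $ 1))\<^sup>2"
    "2 * inner (Dv M v $ 2) D2 - (norm D2)\<^sup>2 \<le> (norm (Dv M v $ 2))\<^sup>2"
    unfolding power2_norm_eq_inner by (auto simp: inner_simps inner_commute)
  moreover have "0 \<le> (norm ((1/\<epsilon>) *\<^sub>R Dv M v $ 3 + \<kappa> *\<^sub>R Jv (Uv M v)))\<^sup>2" by simp
  ultimately show ?thesis unfolding squares_def by argo
qed

text \<open>The energy with its in-plane squares replaced by their tangents at the limit
  \<open>u\<close> and without the completed square. It lies below the energy, converges along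
  weakly convergent sequences, and its gap to the energy measures strong convergence.\<close>

definition low :: "real \<Rightarrow> (real^3 \<Rightarrow> real^3) \<Rightarrow> (real^3 \<Rightarrow> real^3) \<Rightarrow> real" where
  "low \<epsilon> u v = 1/2 * (2 * inner (Dv M v $ 1) (Dv M u $ 1) - (norm (Dv M u $ 1))\<^sup>2
      + 2 * inner (Dv M v $ 2) (Dv M u $ 2) - (norm (Dv M u $ 2))\<^sup>2) + rest \<epsilon> v"

lemma low_le: "H1S2 M v \<Longrightarrow> 0 < \<epsilon> \<Longrightarrow> low \<epsilon> u v \<le> F_eps \<omega> \<kappa> \<epsilon> v"
  using squares_lower[of v "Dv M u $ 1" "Dv M u $ 2" \<epsilon>] by (simp add: low_def F_eps_split)

lemma low_limit:
  assumes w: "wconv us u" and bd: "\<And>n i. norm (Dv M (us n) $ i) \<le> C"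
    and e: "\<And>n. 0 < \<epsilon> n" and e0: "\<epsilon> \<longlonglongrightarrow> 0"
  shows "(\<lambda>n. low (\<epsilon> n) u (us n)) \<longlonglongrightarrow> G0 M \<kappa> u"
proof -
  have "(\<lambda>n. low (\<epsilon> n) u (us n)) \<longlonglongrightarrow> 1/2 * (2 * inner (Dv M u $ 1) (Dv M u $ 1) - (norm (Dv M u $ 1))\<^sup>2
      + 2 * inner (Dv M u $ 2) (Dv M u $ 2) - (norm (Dv M u $ 2))\<^sup>2) + T0 M \<kappa> u"
    unfolding low_def by (intro tendsto_add tendsto_diff tendsto_mult tendsto_const rest_limit[OF assms] weaklyD[OF wconv_Dv(1)[OF w]])
  then show ?thesis by (simp add: G0_def power2_norm_eq_inner add.commute)
qed

text \<open>The bound \<open>\<epsilon> * C\<close> on the third derivative makes it tend to zero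
  strongly, so every limit is independent of the thickness variable.\<close>

lemma bounded_energy_compactness:
  assumes us: "\<And>n. H1S2 M (us n)" and e: "\<And>n. 0 < \<epsilon> n" "\<And>n. \<epsilon> n < 1" and e0: "\<epsilon> \<longlonglongrightarrow> 0"
    and F: "\<And>n. F_eps \<omega> \<kappa> (\<epsilon> n) (us n) \<le> C0"
  shows "\<exists>r u. strict_mono (r :: nat \<Rightarrow> nat) \<and> wconv (\<lambda>n. us (r n)) u \<and> Dv M u $ 3 = 0
     \<and> (\<lambda>n. Dv M (us (r n)) $ 3) \<longlonglongrightarrow> 0
     \<and> (\<lambda>n. low (\<epsilon> (r n)) u (us (r n))) \<longlonglongrightarrow> G0 M \<kappa> u \<and> (\<lambda>n. rest (\<epsilon> (r n)) (us (r n))) \<longlonglongrightarrow> T0 M \<kappa> u"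
proof -
  obtain C where "0 \<le> C" and C': "\<forall>\<epsilon> u. 0 < \<epsilon> \<longrightarrow> H1S2 M u \<longrightarrow> F_eps \<omega> \<kappa> \<epsilon> u \<le> C0 \<longrightarrow>
     norm (Dv M u $ 1) \<le> C \<and> norm (Dv M u $ 2) \<le> C \<and> norm (Dv M u $ 3) \<le> \<epsilon> * C"
    using coercive[OF open_om bounded_om, of \<kappa> C0] by (elim exE conjE)
  note C = \<open>0 \<le> C\<close> C'[rule_format, OF e(1) us F]
  have "norm (Dv M (us n) $ i) \<le> C" for n i
  proof -
    have "\<epsilon> n * C \<le> 1 * C" using e[of n] C(1) by (intro mult_right_mono) auto
    then show ?thesis using C(2)[of n] exhaust_3[of i] by auto
  qed
  note bd = this
  from H1S2_compactness[where us = us and C = C, OF open_M bounded_M us bd] obtain r u where r: "strict_mono (r :: nat \<Rightarrow> nat)"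
    and u: "H1S2 M u" "weakly (\<lambda>n. Gr M (us (r n))) (Gr M u)" "(\<lambda>n. Uv M (us (r n))) \<longlonglongrightarrow> Uv M u" by (elim exE conjE)
  have w: "wconv (\<lambda>n. us (r n)) u" using us u by (simp add: wconv_def)
  have e0r: "(\<lambda>n. \<epsilon> (r n)) \<longlonglongrightarrow> 0" using LIMSEQ_subseq_LIMSEQ[OF e0 r] by (simp add: o_def)
  have D3: "(\<lambda>n. Dv M (us (r n)) $ 3) \<longlonglongrightarrow> 0"
  proof (rule Lim_null_comparison)
    show "\<forall>\<^sub>F n in sequentially. norm (Dv M (us (r n)) $ 3) \<le> \<epsilon> (r n) * C" using C(2) by simp
    show "(\<lambda>n. \<epsilon> (r n) * C) \<longlonglongrightarrow> 0" using tendsto_mult_left_zero[OF e0r] .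
  qed
  have "Dv M u $ 3 = 0" using weakly_unique[OF wconv_Dv(1)[OF w] strongly_weakly[OF D3]] .
  moreover note low_limit[OF w bd e(1) e0r] rest_limit[OF w bd e(1) e0r]
  ultimately show ?thesis using r w D3 by blast
qed

text \<open>\<open>H1_weak_conv\<close> tests with H1 maps only, \<open>weakly\<close> with all
  vectors of the product space; the difference of the two limits is an admissible test for both and
  identifies them.\<close>

lemma Gr_eq_of_weak_limits:
  assumes "H1v M u" "H1v M u'" and us: "\<And>n. H1v M (us n)" and w: "H1_weak_conv M us u"
    and r: "strict_mono r" and w': "weakly (\<lambda>n. Gr M (us (r n))) (Gr M u')"
  shows "Gr M u = Gr M u'"
proof -
  let ?d = "\<lambda>x. u x - u' x"
  note d = Gr_diff[OF open_M assms(1,2)]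
  have "(\<lambda>n. H1_inner M (us n) ?d) \<longlonglongrightarrow> H1_inner M u ?d" using w d(1) unfolding H1_weak_conv_def by blast
  then have "(\<lambda>n. inner (Gr M (us n)) (Gr M ?d)) \<longlonglongrightarrow> inner (Gr M u) (Gr M ?d)"
    by (simp add: H1_inner_Gr[OF open_M] us d(1) assms(1))
  from LIMSEQ_subseq_LIMSEQ[OF this r] have "(\<lambda>n. inner (Gr M (us (r n))) (Gr M ?d)) \<longlonglongrightarrow> inner (Gr M u) (Gr M ?d)"
    by (simp add: o_def)
  from LIMSEQ_unique[OF this weaklyD[OF w']] have "inner (Gr M u - Gr M u') (Gr M u - Gr M u') = 0"
    unfolding d(2) by (simp add: inner_simps)
  then show ?thesis by simp
qed

lemma G0_cong: "Gr M u = Gr M v \<Longrightarrow> G0 M \<kappa> u = G0 M \<kappa> v"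
  by (simp add: Gr_def G0_def T0_def)

lemma liminf_inequality:
  assumes e: "\<And>n. 0 < \<epsilon> n" "\<And>n. \<epsilon> n < 1" and e0: "\<epsilon> \<longlonglongrightarrow> 0"
    and u: "H1S2 M u" and us: "\<And>n. H1S2 M (us n)" and w: "H1_weak_conv M us u"
  shows "F_0 \<omega> \<kappa> u \<le> liminf (\<lambda>n. ereal (F_eps \<omega> \<kappa> (\<epsilon> n) (us n)))"
proof (rule ccontr)
  assume "\<not> ?thesis"
  \<comment> \<open>A number strictly between the two sides selects infinitely many indices with
    energy below \<open>c\<close>, along which compactness applies.\<close>
  then obtain c where c: "liminf (\<lambda>n. ereal (F_eps \<omega> \<kappa> (\<epsilon> n) (us n))) < ereal c" "ereal c < F_0 \<omega> \<kappa> u"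
    using ereal_dense2[of "liminf (\<lambda>n. ereal (F_eps \<omega> \<kappa> (\<epsilon> n) (us n)))" "F_0 \<omega> \<kappa> u"] by (auto simp: not_le)
  have "\<exists>\<^sub>F n in sequentially. F_eps \<omega> \<kappa> (\<epsilon> n) (us n) < c"
  proof (rule ccontr)
    assume "\<not> ?thesis"
    then have "\<forall>\<^sub>F n in sequentially. ereal c \<le> ereal (F_eps \<omega> \<kappa> (\<epsilon> n) (us n))" by (simp add: not_frequently not_less)
    then have "ereal c \<le> liminf (\<lambda>n. ereal (F_eps \<omega> \<kappa> (\<epsilon> n) (us n)))" by (rule Liminf_bounded)
    then show False using c(1) by simp
  qed
  then have inf: "infinite {n. F_eps \<omega> \<kappa> (\<epsilon> n) (us n) < c}"
    unfolding frequently_sequentially infinite_nat_iff_unbounded_le by auto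
  define r where "r = enumerate {n. F_eps \<omega> \<kappa> (\<epsilon> n) (us n) < c}"
  have r: "strict_mono r" unfolding r_def using inf by (rule strict_mono_enumerate)
  have Fc: "F_eps \<omega> \<kappa> (\<epsilon> (r n)) (us (r n)) \<le> c" for n using enumerate_in_set[OF inf, of n] by (simp add: r_def)
  have e0r: "(\<lambda>n. \<epsilon> (r n)) \<longlonglongrightarrow> 0" using LIMSEQ_subseq_LIMSEQ[OF e0 r] by (simp add: o_def)
  obtain s u' where s: "strict_mono (s :: nat \<Rightarrow> nat)" and w': "wconv (\<lambda>n. us (r (s n))) u'" and D3: "Dv M u' $ 3 = 0"
    and l: "(\<lambda>n. low (\<epsilon> (r (s n))) u' (us (r (s n)))) \<longlonglongrightarrow> G0 M \<kappa> u'"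
    using bounded_energy_compactness[of "\<lambda>n. us (r n)" "\<lambda>n. \<epsilon> (r n)" c, OF us e e0r Fc] by blast
  have "low (\<epsilon> (r (s n))) u' (us (r (s n))) \<le> c" for n
    using low_le[OF us e(1), of "r (s n)" u' "r (s n)"] Fc[of "s n"] by linarith
  then have G: "G0 M \<kappa> u' \<le> c" using LIMSEQ_le_const2[OF l] by blast
  have "strict_mono (\<lambda>n. r (s n))" using r s by (simp add: strict_mono_def)
  then have Gr: "Gr M u = Gr M u'"
    using Gr_eq_of_weak_limits[OF H1S2_H1v[OF u] _ H1S2_H1v[OF us] w] w' unfolding wconv_def by (meson H1S2_H1v)
  then have "Dv M u $ 3 = 0" using D3 by (simp add: Gr_def)
  then have "F_0 \<omega> \<kappa> u = ereal (G0 M \<kappa> u)" by (simp add: F_0_formula[OF open_om bounded_om H1S2_H1v[OF u]])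
  then show False using c(2) G G0_cong[OF Gr] by simp
qed

text \<open>Recovery sequences rotate \<open>u\<close> about \<open>e\<^sub>3\<close> by the angle \<open>\<kappa> \<epsilon> s\<close>, which makes the completed square vanish.\<close>

definition rot :: "real \<Rightarrow> (real^3 \<Rightarrow> real^3) \<Rightarrow> real^3 \<Rightarrow> real^3" where
  "rot l u x = (\<chi> j. if j = 1 then trig l 1 0 x * u x $ 1 + trig l 0 (-1) x * u x $ 2
     else if j = 2 then trig l 0 1 x * u x $ 1 + trig l 1 0 x * u x $ 2 else u x $ 3)"

lemma rot_nth:
  "rot l u x $ 1 = trig l 1 0 x * u x $ 1 + trig l 0 (-1) x * u x $ 2"
  "rot l u x $ 2 = trig l 0 1 x * u x $ 1 + trig l 1 0 x * u x $ 2"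
  "rot l u x $ 3 = u x $ 3"
  by (simp_all add: rot_def)

definition rotU :: "real \<Rightarrow> (real^3) l2 ^ 3 \<Rightarrow> (real^3) l2 ^ 3" where
  "rotU l F = (\<chi> j. if j = 1 then mul (trig l 1 0) (F $ 1) + mul (trig l 0 (-1)) (F $ 2)
     else if j = 2 then mul (trig l 0 1) (F $ 1) + mul (trig l 1 0) (F $ 2) else F $ 3)"

lemma rotU_nth:
  "rotU l F $ 1 = mul (trig l 1 0) (F $ 1) + mul (trig l 0 (-1)) (F $ 2)"
  "rotU l F $ 2 = mul (trig l 0 1) (F $ 1) + mul (trig l 1 0) (F $ 2)"
  "rotU l F $ 3 = F $ 3"
  by (simp_all add: rotU_def)

lemma rotU_tendsto: "l \<longlonglongrightarrow> 0 \<Longrightarrow> (\<lambda>n. rotU (l n) F) \<longlonglongrightarrow> F"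
proof -
  assume l: "l \<longlonglongrightarrow> 0"
  show ?thesis
  proof (rule vec_tendstoI)
    fix i :: 3
    have "(\<lambda>n. rotU (l n) F $ 1) \<longlonglongrightarrow> 1 *\<^sub>R F $ 1 + 0 *\<^sub>R F $ 2" "(\<lambda>n. rotU (l n) F $ 2) \<longlonglongrightarrow> 0 *\<^sub>R F $ 1 + 1 *\<^sub>R F $ 2"
      "(\<lambda>n. rotU (l n) F $ 3) \<longlonglongrightarrow> F $ 3"
      unfolding rotU_nth by (intro tendsto_add mul_trig_tendsto l tendsto_const)+
    then show "(\<lambda>n. rotU (l n) F $ i) \<longlonglongrightarrow> F $ i" using exhaust_3[of i] by auto
  qed
qed

lemma mul_trig_scale: "mul (trig l (c * a) (c * b)) F = c *\<^sub>R mul (trig l a b) F"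
proof -
  have "c *\<^sub>R mul (trig l a b) F = cls (\<lambda>x. c * (trig l a b x * fn F x))"
    unfolding mul_def by (rule cls_scale[OF bounded_multiplier.sqi_mul[OF trig_multiplier sqi_fn]])
  then show ?thesis by (simp add: mul_def trig_def algebra_simps)
qed

text \<open>Rotation about the third axis preserves the sphere and commutes with the in-plane
  derivatives. As \<open>u\<close> does not depend on the third variable, the third derivative acts
  on the angle alone, and the generator of the rotation is minus \<open>Jv\<close>.\<close>

lemma rot_graph:
  assumes u: "H1S2 M u" and z: "Dv M u $ 3 = 0"
  shows "H1S2 M (rot l u)" "Uv M (rot l u) = rotU l (Uv M u)"
    "i \<noteq> 3 \<Longrightarrow> Dv M (rot l u) $ i = rotU l (Dv M u $ i)"
    "Dv M (rot l u) $ 3 = - (l *\<^sub>R Jv (Uv M (rot l u)))"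
proof -
  note S = sets_lebesgue_open[OF open_M]
  note h = H1v_nth[OF H1S2_H1v[OF u]]
  note hl = H1_L2[OF h]
  have g: "supp_in M (Uv M u $ j)" "supp_in M (Dv M u $ i $ j)" "wd M (axis i 1) (Uv M u $ j) (Dv M u $ i $ j)" for i j
    using Gr_in_graphs[OF open_M H1S2_H1v[OF u]] by (auto simp: graphs_def Gr_def)
  note em = bounded_multiplier.emb_mul[OF trig_multiplier S hl]
  have ue: "emb M (\<lambda>x. u x $ j) = Uv M u $ j" for j by (simp add: Uv_def)
  have e1: "L2 M (\<lambda>x. rot l u x $ 1)" "emb M (\<lambda>x. rot l u x $ 1) = rotU l (Uv M u) $ 1"
    unfolding rot_nth rotU_nth by (simp_all add: L2_add em emb_add[OF S] ue)
  have e2: "L2 M (\<lambda>x. rot l u x $ 2)" "emb M (\<lambda>x. rot l u x $ 2) = rotU l (Uv M u) $ 2"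
    unfolding rot_nth rotU_nth by (simp_all add: L2_add em emb_add[OF S] ue)
  have e3: "L2 M (\<lambda>x. rot l u x $ 3)" "emb M (\<lambda>x. rot l u x $ 3) = rotU l (Uv M u) $ 3"
    unfolding rot_nth rotU_nth by (simp_all add: hl ue)
  have el: "L2 M (\<lambda>x. rot l u x $ j)" "emb M (\<lambda>x. rot l u x $ j) = rotU l (Uv M u) $ j" for j
    using e1 e2 e3 exhaust_3[of j] by auto
  show U: "Uv M (rot l u) = rotU l (Uv M u)" by (simp add: Uv_def vec_eq_iff) (simp add: el(2) Uv_def)
  \<comment> \<open>Candidates for the derivatives, verified weakly below and then identified with
    \<open>Dv\<close> by \<open>emb_wpd_eqI\<close>.\<close>
  define E where "E i = (if i = 3 then - (l *\<^sub>R Jv (rotU l (Uv M u))) else rotU l (Dv M u $ i))" for i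
  have s_mul: "supp_in M (mul (trig l a b) F)" if "supp_in M F" for a b F
    by (rule bounded_multiplier.supp_in_mul[OF trig_multiplier that])
  have s_add: "supp_in M (F + G)" if "supp_in M F" "supp_in M G" for F G
    using that fn_add[of F G] unfolding supp_in_def by eventually_elim auto
  have s_scale: "supp_in M (c *\<^sub>R F)" if "supp_in M F" for c F
    using that fn_scale[of c F] unfolding supp_in_def by eventually_elim auto
  have s_minus: "supp_in M (- F)" if "supp_in M F" for F using s_scale[OF that, of "-1"] by simp
  have s0: "supp_in M 0" unfolding supp_in_def using fn_zero by eventually_elim simp
  have s_rot: "supp_in M (rotU l F $ j)" if "\<And>j. supp_in M (F $ j)" for F j
    using exhaust_3[of j] by (auto simp: rotU_nth intro!: s_add s_mul that)
  have s_J: "supp_in M (Jv F $ j)" if "\<And>j. supp_in M (F $ j)" for F j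
    using exhaust_3[of j] by (auto simp: Jv_nth s0 intro!: s_minus that)
  have Es: "supp_in M (E i $ j)" for i j
    unfolding E_def using s_rot[OF g(1)] s_rot[OF g(2)] s_J[OF s_rot[OF g(1)]] by (auto intro!: s_minus s_scale)
  have wt: "wd M (axis i 1) (mul (trig l a b) (Uv M u $ j)) (mul (trig l a b) (Dv M u $ i $ j) + (if i = 3 then mul (trig l (l * b) (- (l * a))) (Uv M u $ j) else 0))" for i j a b
    by (rule wd_trig[OF g(3)])
  have Ew: "wd M (axis i 1) (rotU l (Uv M u) $ j) (E i $ j)" for i j
  proof (cases "i = 3")
    case False
    have w: "wd M (axis i 1) (mul (trig l a b) (Uv M u $ j)) (mul (trig l a b) (Dv M u $ i $ j))" for j a b
      using wt[of i a b j] False by simp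
    show ?thesis using exhaust_3[of j] False g(3)[of i 3] by (auto simp: rotU_nth E_def intro!: wd_add w)
  next
    case True
    have m0: "mul f 0 = 0" if "bounded_multiplier f K" for f K
      using bounded_multiplier.norm_mul[OF that, of 0] by simp
    have w: "wd M (axis 3 1) (mul (trig l a b) (Uv M u $ j)) (l *\<^sub>R mul (trig l b (- a)) (Uv M u $ j))" for j a b
      using wt[of 3 a b j] mul_trig_scale[of l l b "- a"] z by (simp add: m0[OF trig_multiplier])
    have "wd M (axis 3 1) (rotU l (Uv M u) $ 1) (l *\<^sub>R mul (trig l 0 (-1)) (Uv M u $ 1) + l *\<^sub>R mul (trig l (-1) 0) (Uv M u $ 2))"
      unfolding rotU_nth using wd_add[OF w[of 1 0 1] w[of 0 "-1" 2]] by simp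
    moreover have "mul (trig l (-1) 0) F = - mul (trig l 1 0) F" "mul (trig l 0 (-1)) F = - mul (trig l 0 1) F" for F
      using mul_trig_scale[of l "-1" 1 0 F] mul_trig_scale[of l "-1" 0 1 F] by simp_all
    ultimately have 1: "wd M (axis 3 1) (rotU l (Uv M u) $ 1) (E 3 $ 1)"
      by (simp add: E_def Jv_nth rotU_nth scaleR_add_right)
    have "wd M (axis 3 1) (rotU l (Uv M u) $ 2) (l *\<^sub>R mul (trig l 1 0) (Uv M u $ 1) + l *\<^sub>R mul (trig l 0 (-1)) (Uv M u $ 2))"
      unfolding rotU_nth using wd_add[OF w[of 0 1 1] w[of 1 0 2]] by simp
    then have 2: "wd M (axis 3 1) (rotU l (Uv M u) $ 2) (E 3 $ 2)"
      by (simp add: E_def Jv_nth rotU_nth scaleR_diff_right add.commute)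
    have 3: "wd M (axis 3 1) (rotU l (Uv M u) $ 3) (E 3 $ 3)"
      using g(3)[of 3 3] z by (simp add: E_def Jv_nth rotU_nth)
    show ?thesis using 1 2 3 exhaust_3[of j] True by auto
  qed
  have H: "H1v M (rot l u)" unfolding H1v_def
  proof
    fix j show "H1 M (\<lambda>x. rot l u x $ j)"
    proof (rule H1I[OF open_M el(1)])
      fix b :: "real^3" assume "b \<in> Basis"
      then obtain i where "b = axis i 1" by (auto simp: Basis_vec_def)
      then show "\<exists>G. wd M b (emb M (\<lambda>x. rot l u x $ j)) G \<and> supp_in M G" using Ew[of i j] Es[of i j] el(2)[of j] by metis
    qed
  qed
  have D: "Dv M (rot l u) $ i = E i" for i
    unfolding Dv_def vec_eq_iff
    using emb_wpd_eqI(1)[OF open_M el(1) axis_Basis _ Es] Ew el(2) by simp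
  show "i \<noteq> 3 \<Longrightarrow> Dv M (rot l u) $ i = rotU l (Dv M u $ i)" using D[of i] by (simp add: E_def)
  show "Dv M (rot l u) $ 3 = - (l *\<^sub>R Jv (Uv M (rot l u)))" using D[of 3] by (simp add: E_def U)
  have "(norm (rot l u x))\<^sup>2 = (norm (u x))\<^sup>2" for x
  proof -
    have "(norm (rot l u x))\<^sup>2 = ((cos (l * x $ 3))\<^sup>2 + (sin (l * x $ 3))\<^sup>2) * ((u x $ 1)\<^sup>2 + (u x $ 2)\<^sup>2) + (u x $ 3)\<^sup>2"
      unfolding norm_vec_sq sum_3 rot_nth trig_def real_norm_def power2_abs by algebra
    also have "\<dots> = (norm (u x))\<^sup>2" unfolding norm_vec_sq sum_3 by simp
    finally show ?thesis .
  qed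
  then have "norm (rot l u x) = norm (u x)" for x by (metis norm_ge_zero power2_eq_iff_nonneg)
  then show "H1S2 M (rot l u)" using u H by (simp add: H1S2_def)
qed

lemma recovery:
  assumes e: "\<And>n. 0 < \<epsilon> n" and e0: "\<epsilon> \<longlonglongrightarrow> 0" and u: "H1S2 M u" and z: "Dv M u $ 3 = 0"
  defines "us \<equiv> \<lambda>n. rot (\<kappa> * \<epsilon> n) u"
  shows "\<And>n. H1S2 M (us n)" "(\<lambda>n. Gr M (us n)) \<longlonglongrightarrow> Gr M u" "(\<lambda>n. F_eps \<omega> \<kappa> (\<epsilon> n) (us n)) \<longlonglongrightarrow> G0 M \<kappa> u"
proof -
  have l0: "(\<lambda>n. \<kappa> * \<epsilon> n) \<longlonglongrightarrow> 0" using tendsto_mult_right_zero[OF e0] .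
  note R = rot_graph[OF u z]
  show us: "H1S2 M (us n)" for n unfolding us_def by (rule R(1))
  have U: "(\<lambda>n. Uv M (us n)) \<longlonglongrightarrow> Uv M u" unfolding us_def R(2) by (rule rotU_tendsto[OF l0])
  have D12: "(\<lambda>n. Dv M (us n) $ i) \<longlonglongrightarrow> Dv M u $ i" if "i \<noteq> 3" for i
    unfolding us_def R(3)[OF that] by (rule rotU_tendsto[OF l0])
  have Jb: "norm (Jv (Uv M (us n))) \<le> sqrt (measure lebesgue M)" for n
    using norm_Jv_le[of "Uv M (us n)"] H1S2_norm[OF open_M bounded_M us[of n]]
    by (metis norm_ge_zero real_sqrt_abs abs_of_nonneg)
  have D3: "(\<lambda>n. Dv M (us n) $ 3) \<longlonglongrightarrow> 0"
  proof (rule Lim_null_comparison)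
    have "norm (Dv M (us n) $ 3) \<le> \<bar>\<kappa> * \<epsilon> n\<bar> * sqrt (measure lebesgue M)" for n
      using mult_left_mono[OF Jb[of n], of "\<bar>\<kappa> * \<epsilon> n\<bar>"] R(4)[of "\<kappa> * \<epsilon> n"] by (simp add: us_def)
    then show "\<forall>\<^sub>F n in sequentially. norm (Dv M (us n) $ 3) \<le> \<bar>\<kappa> * \<epsilon> n\<bar> * sqrt (measure lebesgue M)" by simp
    show "(\<lambda>n. \<bar>\<kappa> * \<epsilon> n\<bar> * sqrt (measure lebesgue M)) \<longlonglongrightarrow> 0"
      by (rule tendsto_mult_left_zero[OF tendsto_rabs_zero[OF l0]])
  qed
  have D: "(\<lambda>n. Dv M (us n)) \<longlonglongrightarrow> Dv M u"
  proof (rule vec_tendstoI)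
    fix i show "(\<lambda>n. Dv M (us n) $ i) \<longlonglongrightarrow> Dv M u $ i" using D12[of i] D3 z by (cases "i = 3") auto
  qed
  show G: "(\<lambda>n. Gr M (us n)) \<longlonglongrightarrow> Gr M u" unfolding Gr_def by (intro tendsto_Pair U D)
  have w: "wconv us u" using us u U strongly_weakly[OF G] by (simp add: wconv_def)
  obtain C where C: "\<And>n. norm (Dv M (us n)) \<le> C" using convergent_imp_bounded[OF D] by (auto simp: bounded_iff)
  have bd: "norm (Dv M (us n) $ i) \<le> C" for n i using norm_component_le[of "Dv M (us n)" i] C[of n] by simp
  have "squares (\<epsilon> n) (us n) = 1/2 * ((norm (Dv M (us n) $ 1))\<^sup>2 + (norm (Dv M (us n) $ 2))\<^sup>2)" for n
  proof -
    have "(1/\<epsilon> n) *\<^sub>R Dv M (us n) $ 3 + \<kappa> *\<^sub>R Jv (Uv M (us n)) = 0"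
      using R(4)[of "\<kappa> * \<epsilon> n"] e[of n] by (simp add: us_def)
    then show ?thesis by (simp add: squares_def)
  qed
  then have "(\<lambda>n. squares (\<epsilon> n) (us n)) \<longlonglongrightarrow> 1/2 * ((norm (Dv M u $ 1))\<^sup>2 + (norm (Dv M u $ 2))\<^sup>2)"
    by (simp only:) (intro tendsto_intros D12, auto)
  from tendsto_add[OF this rest_limit[OF w bd e e0]] show "(\<lambda>n. F_eps \<omega> \<kappa> (\<epsilon> n) (us n)) \<longlonglongrightarrow> G0 M \<kappa> u"
    by (simp add: F_eps_split[OF us e] G0_def)
qed

lemma weak_conv_of_weakly:
  assumes "H1v M u" "\<And>n. H1v M (us n)" "weakly (\<lambda>n. Gr M (us n)) (Gr M u)"
  shows "H1_weak_conv M us u"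
  unfolding H1_weak_conv_def using weaklyD[OF assms(3)] by (simp add: H1_inner_Gr[OF open_M] assms(1,2))

lemma limsup_inequality:
  assumes e: "\<And>n. 0 < \<epsilon> n" and e0: "\<epsilon> \<longlonglongrightarrow> 0" and u: "H1S2 M u"
  shows "\<exists>us. (\<forall>n. H1S2 M (us n)) \<and> H1_weak_conv M us u \<and> limsup (\<lambda>n. ereal (F_eps \<omega> \<kappa> (\<epsilon> n) (us n))) \<le> F_0 \<omega> \<kappa> u"
proof (cases "Dv M u $ 3 = 0")
  case True
  let ?us = "\<lambda>n. rot (\<kappa> * \<epsilon> n) u"
  note R = recovery[OF e e0 u True]
  have "H1_weak_conv M ?us u"
    by (rule weak_conv_of_weakly[OF H1S2_H1v[OF u] H1S2_H1v[OF R(1)] strongly_weakly[OF R(2)]])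
  moreover have "(\<lambda>n. ereal (F_eps \<omega> \<kappa> (\<epsilon> n) (?us n))) \<longlonglongrightarrow> ereal (G0 M \<kappa> u)"
    using R(3) by (intro tendsto_intros)
  then have "limsup (\<lambda>n. ereal (F_eps \<omega> \<kappa> (\<epsilon> n) (?us n))) = F_0 \<omega> \<kappa> u"
    using F_0_formula[OF open_om bounded_om H1S2_H1v[OF u]] True by (simp add: lim_imp_Limsup)
  ultimately show ?thesis using R(1) by (intro exI[of _ ?us]) auto
next
  case False
  \<comment> \<open>With an infinite right-hand side the constant sequence suffices.\<close>
  then have "F_0 \<omega> \<kappa> u = \<infinity>" by (simp add: F_0_formula[OF open_om bounded_om H1S2_H1v[OF u]])
  moreover have "H1_weak_conv M (\<lambda>n. u) u" by (simp add: H1_weak_conv_def)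
  ultimately show ?thesis using u by (intro exI[of _ "\<lambda>n. u"]) auto
qed

text \<open>A competitor whose energy is bounded uniformly in \<open>\<epsilon>\<close>: it has
  neither exchange nor chiral energy, and its stray field is no larger than the
  magnetization.\<close>

lemma constant_map:
  defines "e \<equiv> \<lambda>x. axis 1 1 :: real^3"
  shows "H1S2 M e" "Dv M e = 0" "0 < \<epsilon> \<Longrightarrow> F_eps \<omega> \<kappa> \<epsilon> e \<le> 1/2 * measure lebesgue M"
proof -
  note S = sets_lebesgue_open[OF open_M]
  have fin: "M \<in> lmeasurable" using bounded_M open_M by (simp add: bounded_set_imp_lmeasurable)
  have l: "L2 M (\<lambda>x. e x $ j)" for j
    unfolding L2_def e_def using fin by (auto simp: integrable_const_ivl intro!: finite_measure.integrable_const finite_measure_lebesgue_on)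
  have w: "wd M (axis i 1) (emb M (\<lambda>x. e x $ j)) 0" for i j
  proof (rule wd_zero_of_translation_invariant[OF open_M axis_Basis])
    fix t
    have a: "AE x in lebesgue. x \<in> M \<longrightarrow> fn (emb M (\<lambda>x. e x $ j)) x = axis 1 1 $ j"
      using fn_emb[OF S l[of j]] by eventually_elim (simp add: e_def)
    show "AE x in lebesgue. x \<in> M \<longrightarrow> x + t *\<^sub>R axis i 1 \<in> M \<longrightarrow> fn (emb M (\<lambda>x. e x $ j)) (x + t *\<^sub>R axis i 1) = fn (emb M (\<lambda>x. e x $ j)) x"
      using a AE_lebesgue_shift[OF a, of "t *\<^sub>R axis i 1"] by eventually_elim simp
  qed
  have s0: "supp_in M 0" unfolding supp_in_def using fn_zero by eventually_elim simp
  have h: "H1v M e" unfolding H1v_def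
  proof
    fix j show "H1 M (\<lambda>x. e x $ j)"
    proof (rule H1I[OF open_M l])
      fix b :: "real^3" assume "b \<in> Basis"
      then obtain i where "b = axis i 1" by (auto simp: Basis_vec_def)
      then show "\<exists>G. wd M b (emb M (\<lambda>x. e x $ j)) G \<and> supp_in M G" using w s0 by blast
    qed
  qed
  show e: "H1S2 M e" using h by (simp add: H1S2_def e_def)
  show D: "Dv M e = 0" unfolding Dv_def vec_eq_iff using emb_wpd_eqI(1)[OF open_M l axis_Basis w s0] by simp
  show "F_eps \<omega> \<kappa> \<epsilon> e \<le> 1/2 * measure lebesgue M" if \<epsilon>: "0 < \<epsilon>"
  proof -
    have "hn M \<epsilon> e \<le> (norm (Uv M e))\<^sup>2" unfolding hn_def
      using h_eps_norm_le[OF zero_ext_L2v(1)[OF open_M h] \<epsilon>] zero_ext_L2v(2)[OF open_M h] by (intro power_mono) auto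
    then show ?thesis unfolding F_eps_formula[OF open_om h \<epsilon>] D
      using H1S2_norm[OF open_M bounded_M e] by (simp add: c12_def)
  qed
qed

text \<open>Recovery sequences compete with the minimisers. Those of an arbitrary \<open>v\<close>
  show that the limit is a minimiser; the one of the limit itself gives convergence of the energies,
  so that the gap to \<open>low\<close> tends to zero.\<close>

lemma minimizers_converge:
  assumes e: "\<And>n. 0 < \<epsilon> n" "\<And>n. \<epsilon> n < 1" and e0: "\<epsilon> \<longlonglongrightarrow> 0"
    and us: "\<And>n. H1S2 M (us n)" and min: "\<And>n v. H1S2 M v \<Longrightarrow> F_eps \<omega> \<kappa> (\<epsilon> n) (us n) \<le> F_eps \<omega> \<kappa> (\<epsilon> n) v"
  shows "\<exists>r u. strict_mono (r :: nat \<Rightarrow> nat) \<and> H1S2 M u \<and> (\<forall>v. H1S2 M v \<longrightarrow> F_0 \<omega> \<kappa> u \<le> F_0 \<omega> \<kappa> v)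
     \<and> H1_strong_conv M (\<lambda>n. us (r n)) u"
proof -
  have F: "F_eps \<omega> \<kappa> (\<epsilon> n) (us n) \<le> 1/2 * measure lebesgue M" for n
    using min[OF constant_map(1), of n] constant_map(3)[OF e(1), of n] by linarith
  obtain r u where r: "strict_mono (r :: nat \<Rightarrow> nat)" and w: "wconv (\<lambda>n. us (r n)) u" and D3: "Dv M u $ 3 = 0"
    and D30: "(\<lambda>n. Dv M (us (r n)) $ 3) \<longlonglongrightarrow> 0"
    and l: "(\<lambda>n. low (\<epsilon> (r n)) u (us (r n))) \<longlonglongrightarrow> G0 M \<kappa> u"
    and rl: "(\<lambda>n. rest (\<epsilon> (r n)) (us (r n))) \<longlonglongrightarrow> T0 M \<kappa> u"
    using bounded_energy_compactness[of us \<epsilon>, OF us e e0 F] by blast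
  have u: "H1S2 M u" and U: "(\<lambda>n. Uv M (us (r n))) \<longlonglongrightarrow> Uv M u" using w by (auto simp: wconv_def)
  have e0r: "(\<lambda>n. \<epsilon> (r n)) \<longlonglongrightarrow> 0" using LIMSEQ_subseq_LIMSEQ[OF e0 r] by (simp add: o_def)
  have lowF: "low (\<epsilon> (r n)) u (us (r n)) \<le> F_eps \<omega> \<kappa> (\<epsilon> (r n)) (us (r n))" for n by (rule low_le[OF us e(1)])
  have le: "G0 M \<kappa> u \<le> G0 M \<kappa> v" if v: "H1S2 M v" "Dv M v $ 3 = 0" for v
  proof (rule LIMSEQ_le[OF l recovery(3)[of "\<lambda>n. \<epsilon> (r n)", OF e(1) e0r v]], intro exI allI impI)
    fix n
    show "low (\<epsilon> (r n)) u (us (r n)) \<le> F_eps \<omega> \<kappa> (\<epsilon> (r n)) (rot (\<kappa> * \<epsilon> (r n)) v)"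
      using lowF[of n] min[OF rot_graph(1)[OF v], of "r n"] by (rule order_trans)
  qed
  have "F_0 \<omega> \<kappa> u \<le> F_0 \<omega> \<kappa> v" if v: "H1S2 M v" for v
    using le[OF v] D3 F_0_formula[OF open_om bounded_om H1S2_H1v[OF v]] F_0_formula[OF open_om bounded_om H1S2_H1v[OF u]] by auto
  moreover have "H1_strong_conv M (\<lambda>n. us (r n)) u"
  proof -
    have FG: "(\<lambda>n. F_eps \<omega> \<kappa> (\<epsilon> (r n)) (us (r n))) \<longlonglongrightarrow> G0 M \<kappa> u"
    proof (rule tendsto_sandwich[OF _ _ l recovery(3)[of "\<lambda>n. \<epsilon> (r n)", OF e(1) e0r u D3]])
      show "\<forall>\<^sub>F n in sequentially. low (\<epsilon> (r n)) u (us (r n)) \<le> F_eps \<omega> \<kappa> (\<epsilon> (r n)) (us (r n))" using lowF by simp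
      show "\<forall>\<^sub>F n in sequentially. F_eps \<omega> \<kappa> (\<epsilon> (r n)) (us (r n)) \<le> F_eps \<omega> \<kappa> (\<epsilon> (r n)) (rot (\<kappa> * \<epsilon> (r n)) u)"
        using min[OF rot_graph(1)[OF u D3]] by simp
    qed
    have gap: "(\<lambda>n. 2 * (F_eps \<omega> \<kappa> (\<epsilon> (r n)) (us (r n)) - low (\<epsilon> (r n)) u (us (r n)))) \<longlonglongrightarrow> 2 * (G0 M \<kappa> u - G0 M \<kappa> u)"
      by (intro tendsto_mult tendsto_const tendsto_diff FG l)
    have gap_ge: "(norm (Dv M (us (r n)) $ i - Dv M u $ i))\<^sup>2 \<le> 2 * (F_eps \<omega> \<kappa> (\<epsilon> (r n)) (us (r n)) - low (\<epsilon> (r n)) u (us (r n)))" if "i \<noteq> 3" for n i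
    proof -
      let ?v = "us (r n)"
      let ?q = "(norm ((1/\<epsilon> (r n)) *\<^sub>R Dv M ?v $ 3 + \<kappa> *\<^sub>R Jv (Uv M ?v)))\<^sup>2"
      have ex: "(norm (Dv M ?v $ k - Dv M u $ k))\<^sup>2 = (norm (Dv M ?v $ k))\<^sup>2 - 2 * inner (Dv M ?v $ k) (Dv M u $ k) + (norm (Dv M u $ k))\<^sup>2" for k
        unfolding power2_norm_eq_inner by (simp add: inner_simps inner_commute)
      \<comment> \<open>\<open>rest\<close> cancels, and the tangent defect of each in-plane square
        is the squared distance to the limit.\<close>
      have "2 * (F_eps \<omega> \<kappa> (\<epsilon> (r n)) ?v - low (\<epsilon> (r n)) u ?v) = (norm (Dv M ?v $ 1 - Dv M u $ 1))\<^sup>2 + (norm (Dv M ?v $ 2 - Dv M u $ 2))\<^sup>2 + ?q"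
        unfolding F_eps_split[OF us e(1)] low_def squares_def ex by argo
      moreover have "0 \<le> (norm (Dv M ?v $ 1 - Dv M u $ 1))\<^sup>2" "0 \<le> (norm (Dv M ?v $ 2 - Dv M u $ 2))\<^sup>2" "0 \<le> ?q" by auto
      ultimately have "(norm (Dv M ?v $ 1 - Dv M u $ 1))\<^sup>2 \<le> 2 * (F_eps \<omega> \<kappa> (\<epsilon> (r n)) ?v - low (\<epsilon> (r n)) u ?v)"
        "(norm (Dv M ?v $ 2 - Dv M u $ 2))\<^sup>2 \<le> 2 * (F_eps \<omega> \<kappa> (\<epsilon> (r n)) ?v - low (\<epsilon> (r n)) u ?v)"
        by linarith+
      moreover have "i = 1 \<or> i = 2" using that exhaust_3[of i] by auto
      ultimately show ?thesis by (elim disjE) (simp_all only:)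
    qed
    have D12: "(\<lambda>n. Dv M (us (r n)) $ i) \<longlonglongrightarrow> Dv M u $ i" if "i \<noteq> 3" for i
    proof -
      have "(\<lambda>n. (norm (Dv M (us (r n)) $ i - Dv M u $ i))\<^sup>2) \<longlonglongrightarrow> 0"
        by (rule tendsto_sandwich[OF _ _ tendsto_const gap[simplified]]) (use gap_ge[OF that] in \<open>auto intro: always_eventually\<close>)
      from tendsto_real_sqrt[OF this] have "(\<lambda>n. norm (Dv M (us (r n)) $ i - Dv M u $ i)) \<longlonglongrightarrow> 0" by simp
      then show ?thesis by (simp add: LIM_zero_iff tendsto_norm_zero_iff)
    qed
    have D: "(\<lambda>n. Dv M (us (r n))) \<longlonglongrightarrow> Dv M u"
    proof (rule vec_tendstoI)
      fix i show "(\<lambda>n. Dv M (us (r n)) $ i) \<longlonglongrightarrow> Dv M u $ i" using D12[of i] D30 D3 by (cases "i = 3") auto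
    qed
    have G: "(\<lambda>n. Gr M (us (r n))) \<longlonglongrightarrow> Gr M u" unfolding Gr_def by (intro tendsto_Pair U D)
    have "H1_inner M (\<lambda>x. us (r n) x - u x) (\<lambda>x. us (r n) x - u x) = (norm (Gr M (us (r n)) - Gr M u))\<^sup>2" for n
      using Gr_diff[OF open_M H1S2_H1v[OF us] H1S2_H1v[OF u]] by (simp add: H1_inner_Gr[OF open_M] power2_norm_eq_inner)
    moreover have "(\<lambda>n. (norm (Gr M (us (r n)) - Gr M u))\<^sup>2) \<longlonglongrightarrow> (norm (Gr M u - Gr M u))\<^sup>2" by (intro tendsto_intros G)
    ultimately show ?thesis unfolding H1_strong_conv_def by simp
  qed
  ultimately show ?thesis using r u by blast
qed

text \<open>Equal classes make the two rescaled sources satisfy the same stray field predicate, so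
  SOME picks literally the same field for both.\<close>

lemma hn_cong:
  assumes u: "H1v M u" and v: "H1v M v" and eq: "Uv M u = Uv M v" and e: "0 < \<epsilon>"
  shows "hn M \<epsilon> u = hn M \<epsilon> v"
proof -
  let ?S = "\<lambda>w. zero_ext M w \<circ> scale3 (1/\<epsilon>)"
  have L: "L2v UNIV (?S w)" if "H1v M w" for w
    unfolding L2v_def o_def using L2_scale3[OF _ L2v_nth[OF zero_ext_L2v(1)[OF open_M that]], of "1/\<epsilon>"] e by auto
  have "ev (?S u) = ev (?S v)"
  proof -
    have "ev (?S u) $ j = ev (?S v) $ j" for j
    proof -
      let ?f = "\<lambda>x. zero_ext M u x $ j - zero_ext M v x $ j"
      have ul: "L2 UNIV (\<lambda>x. zero_ext M u x $ j)" "L2 UNIV (\<lambda>x. zero_ext M v x $ j)"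
        using L2v_nth[OF zero_ext_L2v(1)[OF open_M u]] L2v_nth[OF zero_ext_L2v(1)[OF open_M v]] by auto
      have fl: "L2 UNIV ?f" by (rule L2_diff[OF ul])
      have "emb UNIV ?f = ev (zero_ext M u) $ j - ev (zero_ext M v) $ j"
        by (simp add: ev_nth emb_diff ul)
      then have "inner (emb UNIV ?f) (emb UNIV ?f) = 0"
        by (simp add: zero_ext_L2v(2)[OF open_M u] zero_ext_L2v(2)[OF open_M v] eq)
      then have "emb UNIV (\<lambda>x. ?f (scale3 (1/\<epsilon>) x)) = 0"
        using inner_emb_scale3[OF _ fl fl, of "1/\<epsilon>"] e by simp
      moreover have "emb UNIV (\<lambda>x. ?f (scale3 (1/\<epsilon>) x)) = ev (?S u) $ j - ev (?S v) $ j"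
        using L2v_nth[OF L[OF u]] L2v_nth[OF L[OF v]] by (simp add: ev_nth emb_diff o_def)
      ultimately show ?thesis by simp
    qed
    then show ?thesis by (simp add: vec_eq_iff)
  qed
  then have "is_stray_field (?S u) h \<longleftrightarrow> is_stray_field (?S v) h" for h
    using is_stray_field_iff[OF L[OF u], of h] is_stray_field_iff[OF L[OF v], of h]
    by (cases "L2v UNIV h") (auto simp: is_stray_field_def)
  then have "is_stray_field (?S u) = is_stray_field (?S v)" by blast
  then show ?thesis by (simp add: hn_def h_eps_def stray_field_def)
qed

lemma F_eps_cong:
  assumes "H1v M u" "H1v M v" "Uv M u = Uv M v" "0 < \<epsilon>"
  shows "F_eps \<omega> \<kappa> \<epsilon> u = F_eps \<omega> \<kappa> \<epsilon> v"
  using Gr_eqI[OF open_M assms(1,2,3)] hn_cong[OF assms]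
  by (simp add: F_eps_formula[OF open_om] assms(1,2,4) Gr_def)

text \<open>The compact set consists of one representative for each class of maps in a bounded set; there the
  weak topology coincides with the (metrizable) strong topology of the Lebesgue space.\<close>

lemma equicoercive:
  "\<exists>K. K \<noteq> {} \<and> K \<subseteq> {u. H1S2 M u} \<and> compactin (H1_weak_topology M) K \<and>
     (\<forall>\<epsilon>. 0 < \<epsilon> \<and> \<epsilon> < 1 \<longrightarrow> (INF u\<in>{u. H1S2 M u}. ereal (F_eps \<omega> \<kappa> \<epsilon> u)) = (INF u\<in>K. ereal (F_eps \<omega> \<kappa> \<epsilon> u)))"
proof -
  obtain C where "0 \<le> C" and C': "\<forall>\<epsilon> u. 0 < \<epsilon> \<longrightarrow> H1S2 M u \<longrightarrow> F_eps \<omega> \<kappa> \<epsilon> u \<le> 1/2 * measure lebesgue M \<longrightarrow>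
     norm (Dv M u $ 1) \<le> C \<and> norm (Dv M u $ 2) \<le> C \<and> norm (Dv M u $ 3) \<le> \<epsilon> * C"
    using coercive[OF open_om bounded_om, of \<kappa> "1/2 * measure lebesgue M"] by (elim exE conjE)
  note C = \<open>0 \<le> C\<close> C'[rule_format]
  \<comment> \<open>\<open>C\<close> belongs to the energy bound of the constant map. As
    \<open>\<epsilon> < 1\<close>, every map whose energy is at most that bound lies in
    \<open>B\<close>, and the constant map beats all the others.\<close>
  define B where "B = {u. H1S2 M u \<and> (\<forall>i. norm (Dv M u $ i) \<le> C)}"
  define A where "A = Uv M ` B"
  define \<psi> where "\<psi> F = (SOME u. u \<in> B \<and> Uv M u = F)" for F
  have \<psi>: "\<psi> F \<in> B" "Uv M (\<psi> F) = F" if "F \<in> A" for F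
    using someI_ex[of "\<lambda>u. u \<in> B \<and> Uv M u = F"] that unfolding \<psi>_def A_def by auto
  have BH: "H1v M u" if "u \<in> B" for u using that H1S2_H1v by (auto simp: B_def)
  have cpt: "\<exists>r u. strict_mono (r :: nat \<Rightarrow> nat) \<and> u \<in> B \<and> weakly (\<lambda>n. Gr M (us (r n))) (Gr M u) \<and> (\<lambda>n. Uv M (us (r n))) \<longlonglongrightarrow> Uv M u"
    if us: "\<And>n. us n \<in> B" for us
  proof -
    have us2: "H1S2 M (us n)" "norm (Dv M (us n) $ i) \<le> C" for n i using us[of n] by (auto simp: B_def)
    obtain r u where r: "strict_mono (r :: nat \<Rightarrow> nat)" "H1S2 M u" "weakly (\<lambda>n. Gr M (us (r n))) (Gr M u)" "(\<lambda>n. Uv M (us (r n))) \<longlonglongrightarrow> Uv M u"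
      using H1S2_compactness[where us = us and C = C, OF open_M bounded_M us2] by (elim exE conjE)
    then have w: "wconv (\<lambda>n. us (r n)) u" using us2 by (simp add: wconv_def)
    have "norm (Dv M u $ i) \<le> C" for i by (rule weakly_norm_le_bound[OF wconv_Dv(1)[OF w] us2(2)])
    then show ?thesis using r by (auto simp: B_def)
  qed
  have "compact A" unfolding compact_eq_seq_compact_metric seq_compact_def
  proof (intro allI impI)
    fix f :: "nat \<Rightarrow> (real^3) l2 ^ 3" assume f: "\<forall>n. f n \<in> A"
    obtain r u where "strict_mono (r :: nat \<Rightarrow> nat)" "u \<in> B" "(\<lambda>n. Uv M (\<psi> (f (r n)))) \<longlonglongrightarrow> Uv M u"
      using cpt[of "\<lambda>n. \<psi> (f n)"] f \<psi>(1) by blast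
    moreover have "Uv M (\<psi> (f (r n))) = f (r n)" for n using f \<psi>(2) by blast
    ultimately show "\<exists>l\<in>A. \<exists>r. strict_mono r \<and> (f \<circ> r) \<longlonglongrightarrow> l" by (auto simp: A_def o_def)
  qed
  \<comment> \<open>The map determines its gradient, so all weakly convergent subsequences of the
    graphs have the same limit.\<close>
  have cont: "continuous_on A (\<lambda>F. inner (Gr M (\<psi> F)) X)" for X
    unfolding continuous_on_sequentially
  proof (intro allI ballI impI, elim conjE)
    fix f and F assume F: "F \<in> A" and f: "\<forall>n. f n \<in> A" and lim: "f \<longlonglongrightarrow> F"
    show "((\<lambda>F. inner (Gr M (\<psi> F)) X) \<circ> f) \<longlonglongrightarrow> inner (Gr M (\<psi> F)) X"
    proof (rule tendsto_subsubseq)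
      fix r :: "nat \<Rightarrow> nat" assume r: "strict_mono r"
      obtain s u where s: "strict_mono (s :: nat \<Rightarrow> nat)" and u: "u \<in> B" and w: "weakly (\<lambda>n. Gr M (\<psi> (f (r (s n))))) (Gr M u)"
        and U: "(\<lambda>n. Uv M (\<psi> (f (r (s n))))) \<longlonglongrightarrow> Uv M u"
        using cpt[of "\<lambda>n. \<psi> (f (r n))"] f \<psi>(1) by blast
      have "strict_mono (\<lambda>n. r (s n))" using r s by (simp add: strict_mono_def)
      from LIMSEQ_subseq_LIMSEQ[OF lim this] have "(\<lambda>n. f (r (s n))) \<longlonglongrightarrow> F" by (simp add: o_def)
      moreover have "Uv M (\<psi> (f (r (s n)))) = f (r (s n))" for n using f \<psi>(2) by blast
      ultimately have "Uv M u = F" using U LIMSEQ_unique by fastforce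
      then have "Gr M u = Gr M (\<psi> F)" using Gr_eqI[OF open_M BH[OF u] BH[OF \<psi>(1)[OF F]]] \<psi>(2)[OF F] by simp
      then show "\<exists>s. strict_mono (s :: nat \<Rightarrow> nat) \<and> (\<lambda>n. ((\<lambda>F. inner (Gr M (\<psi> F)) X) \<circ> f) (r (s n))) \<longlonglongrightarrow> inner (Gr M (\<psi> F)) X"
        using s weaklyD[OF w, of X] by auto
    qed
  qed
  have "continuous_map (top_of_set A) (H1_weak_topology M) \<psi>"
    unfolding H1_weak_topology_def
  proof (rule continuous_on_generated_topo)
    show "openin (top_of_set A) (\<psi> -` W \<inter> topspace (top_of_set A))"
      if "W \<in> {{u. H1v M u \<and> H1_inner M u v \<in> V} | v V. H1v M v \<and> open V}" for W
    proof -
      from that obtain v V where W: "W = {u. H1v M u \<and> H1_inner M u v \<in> V}" "H1v M v" "open V" by blast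
      have "\<psi> -` W \<inter> topspace (top_of_set A) = A \<inter> (\<lambda>F. inner (Gr M (\<psi> F)) (Gr M v)) -` V"
        using BH \<psi>(1) by (auto simp: W(1) H1_inner_Gr[OF open_M _ W(2)])
      then show ?thesis using continuous_openin_preimage_gen[OF cont W(3)] by simp
    qed
    have "u \<in> \<Union> {{u. H1v M u \<and> H1_inner M u v \<in> V} | v V. H1v M v \<and> open V}" if "u \<in> B" for u
    proof -
      have "u \<in> {w. H1v M w \<and> H1_inner M w u \<in> UNIV}" using BH[OF that] by simp
      then show ?thesis using BH[OF that] open_UNIV by blast
    qed
    then show "\<psi> ` topspace (top_of_set A) \<subseteq> \<Union> {{u. H1v M u \<and> H1_inner M u v \<in> V} | v V. H1v M v \<and> open V}"
      using \<psi>(1) by auto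
  qed
  moreover have "compactin (top_of_set A) A" using \<open>compact A\<close> by (simp add: compactin_subtopology)
  ultimately have K: "compactin (H1_weak_topology M) (\<psi> ` A)" by (rule image_compactin[rotated])
  let ?e = "\<lambda>x. axis 1 1 :: real^3"
  have eB: "?e \<in> B" unfolding B_def using constant_map(1,2) C(1) by simp
  have rep: "\<exists>k\<in>\<psi> ` A. \<forall>\<epsilon>>0. F_eps \<omega> \<kappa> \<epsilon> k = F_eps \<omega> \<kappa> \<epsilon> u" if "u \<in> B" for u
  proof -
    have "Uv M u \<in> A" using that by (simp add: A_def)
    then show ?thesis using F_eps_cong[OF BH[OF \<psi>(1)] BH[OF that] \<psi>(2)] by blast
  qed
  have "(INF u\<in>{u. H1S2 M u}. ereal (F_eps \<omega> \<kappa> \<epsilon> u)) = (INF u\<in>\<psi> ` A. ereal (F_eps \<omega> \<kappa> \<epsilon> u))" if e: "0 < \<epsilon>" "\<epsilon> < 1" for \<epsilon>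
  proof (rule antisym)
    show "(INF u\<in>{u. H1S2 M u}. ereal (F_eps \<omega> \<kappa> \<epsilon> u)) \<le> (INF u\<in>\<psi> ` A. ereal (F_eps \<omega> \<kappa> \<epsilon> u))"
      by (rule INF_superset_mono) (use \<psi>(1) in \<open>auto simp: B_def\<close>)
    show "(INF u\<in>\<psi> ` A. ereal (F_eps \<omega> \<kappa> \<epsilon> u)) \<le> (INF u\<in>{u. H1S2 M u}. ereal (F_eps \<omega> \<kappa> \<epsilon> u))"
    proof (rule INF_mono)
      fix u assume "u \<in> {u. H1S2 M u}"
      then have u: "H1S2 M u" by simp
      show "\<exists>k\<in>\<psi> ` A. ereal (F_eps \<omega> \<kappa> \<epsilon> k) \<le> ereal (F_eps \<omega> \<kappa> \<epsilon> u)"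
      proof (cases "F_eps \<omega> \<kappa> \<epsilon> u \<le> 1/2 * measure lebesgue M")
        case True
        have "\<epsilon> * C \<le> 1 * C" using e C(1) by (intro mult_right_mono) auto
        then have "norm (Dv M u $ i) \<le> C" for i using C(2)[OF e(1) u True] exhaust_3[of i] by auto
        then have "u \<in> B" using u by (simp add: B_def)
        from rep[OF this] obtain k where "k \<in> \<psi> ` A" "F_eps \<omega> \<kappa> \<epsilon> k = F_eps \<omega> \<kappa> \<epsilon> u" using e(1) by blast
        then show ?thesis by (intro bexI[of _ k]) auto
      next
        case False
        from rep[OF eB] obtain k where "k \<in> \<psi> ` A" "F_eps \<omega> \<kappa> \<epsilon> k = F_eps \<omega> \<kappa> \<epsilon> (\<lambda>x. axis 1 1)" using e(1) by blast
        then show ?thesis using constant_map(3)[OF e(1)] False by (intro bexI[of _ k]) auto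
      qed
    qed
  qed
  moreover have "\<psi> ` A \<noteq> {}" using eB by (auto simp: A_def)
  moreover have "\<psi> ` A \<subseteq> {u. H1S2 M u}" using \<psi>(1) by (auto simp: B_def)
  ultimately show ?thesis using K by (intro exI[of _ "\<psi> ` A"] conjI allI impI) (assumption | simp)+
qed

end

theorem theorem1p1:
  fixes \<omega> :: "(real^2) set" and \<kappa> :: real
  assumes "lipschitz_domain2 \<omega>"
  shows
    "(\<exists>K. K \<noteq> {} \<and> K \<subseteq> {u. H1S2 (film \<omega>) u} \<and> compactin (H1_weak_topology (film \<omega>)) K \<and>
        (\<forall>\<epsilon>. 0 < \<epsilon> \<and> \<epsilon> < 1 \<longrightarrow>
           (INF u\<in>{u. H1S2 (film \<omega>) u}. ereal (F_eps \<omega> \<kappa> \<epsilon> u)) = (INF u\<in>K. ereal (F_eps \<omega> \<kappa> \<epsilon> u))))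
   \<and> (\<forall>\<epsilon>s :: nat \<Rightarrow> real. (\<forall>n. 0 < \<epsilon>s n \<and> \<epsilon>s n < 1) \<and> \<epsilon>s \<longlonglongrightarrow> 0 \<longrightarrow>
        (\<forall>u us. H1S2 (film \<omega>) u \<and> (\<forall>n. H1S2 (film \<omega>) (us n)) \<and> H1_weak_conv (film \<omega>) us u \<longrightarrow>
           F_0 \<omega> \<kappa> u \<le> liminf (\<lambda>n. ereal (F_eps \<omega> \<kappa> (\<epsilon>s n) (us n))))
      \<and> (\<forall>u. H1S2 (film \<omega>) u \<longrightarrow>
           (\<exists>us. (\<forall>n. H1S2 (film \<omega>) (us n)) \<and> H1_weak_conv (film \<omega>) us u \<and>
                 limsup (\<lambda>n. ereal (F_eps \<omega> \<kappa> (\<epsilon>s n) (us n))) \<le> F_0 \<omega> \<kappa> u)))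
   \<and> (\<forall>ue :: real \<Rightarrow> real^3 \<Rightarrow> real^3.
        (\<forall>\<epsilon>. 0 < \<epsilon> \<and> \<epsilon> < 1 \<longrightarrow> H1S2 (film \<omega>) (ue \<epsilon>) \<and>
              (\<forall>v. H1S2 (film \<omega>) v \<longrightarrow> F_eps \<omega> \<kappa> \<epsilon> (ue \<epsilon>) \<le> F_eps \<omega> \<kappa> \<epsilon> v)) \<longrightarrow>
        (\<forall>\<epsilon>s :: nat \<Rightarrow> real. (\<forall>n. 0 < \<epsilon>s n \<and> \<epsilon>s n < 1) \<and> \<epsilon>s \<longlonglongrightarrow> 0 \<longrightarrow>
           (\<exists>r u. strict_mono r \<and> H1S2 (film \<omega>) u \<and>
                  (\<forall>v. H1S2 (film \<omega>) v \<longrightarrow> F_0 \<omega> \<kappa> u \<le> F_0 \<omega> \<kappa> v) \<and>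
                  H1_strong_conv (film \<omega>) (\<lambda>n. ue (\<epsilon>s (r n))) u)))"
proof -
  interpret thin_film \<omega> \<kappa> by unfold_locales (use assms in \<open>auto simp: lipschitz_domain2_def\<close>)
  show ?thesis
  proof (intro conjI allI impI; (elim conjE)?)
    show "\<exists>K. K \<noteq> {} \<and> K \<subseteq> {u. H1S2 M u} \<and> compactin (H1_weak_topology M) K \<and>
        (\<forall>\<epsilon>. 0 < \<epsilon> \<and> \<epsilon> < 1 \<longrightarrow>
           (INF u\<in>{u. H1S2 M u}. ereal (F_eps \<omega> \<kappa> \<epsilon> u)) = (INF u\<in>K. ereal (F_eps \<omega> \<kappa> \<epsilon> u)))"
      by (rule equicoercive)
  next
    fix \<epsilon>s :: "nat \<Rightarrow> real" and u us
    assume "\<forall>n. 0 < \<epsilon>s n \<and> \<epsilon>s n < 1" "\<epsilon>s \<longlonglongrightarrow> 0" "H1S2 M u" "\<forall>n. H1S2 M (us n)" "H1_weak_conv M us u"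
    then show "F_0 \<omega> \<kappa> u \<le> liminf (\<lambda>n. ereal (F_eps \<omega> \<kappa> (\<epsilon>s n) (us n)))"
      by (intro liminf_inequality) auto
  next
    fix \<epsilon>s :: "nat \<Rightarrow> real" and u
    assume "\<forall>n. 0 < \<epsilon>s n \<and> \<epsilon>s n < 1" "\<epsilon>s \<longlonglongrightarrow> 0" "H1S2 M u"
    then show "\<exists>us. (\<forall>n. H1S2 M (us n)) \<and> H1_weak_conv M us u \<and>
                 limsup (\<lambda>n. ereal (F_eps \<omega> \<kappa> (\<epsilon>s n) (us n))) \<le> F_0 \<omega> \<kappa> u"
      by (intro limsup_inequality) auto
  next
    fix ue :: "real \<Rightarrow> real^3 \<Rightarrow> real^3" and \<epsilon>s :: "nat \<Rightarrow> real"
    assume ue: "\<forall>\<epsilon>. 0 < \<epsilon> \<and> \<epsilon> < 1 \<longrightarrow> H1S2 M (ue \<epsilon>) \<and> (\<forall>v. H1S2 M v \<longrightarrow> F_eps \<omega> \<kappa> \<epsilon> (ue \<epsilon>) \<le> F_eps \<omega> \<kappa> \<epsilon> v)"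
      and es: "\<forall>n. 0 < \<epsilon>s n \<and> \<epsilon>s n < 1" "\<epsilon>s \<longlonglongrightarrow> 0"
    show "\<exists>r u. strict_mono r \<and> H1S2 M u \<and> (\<forall>v. H1S2 M v \<longrightarrow> F_0 \<omega> \<kappa> u \<le> F_0 \<omega> \<kappa> v) \<and>
                  H1_strong_conv M (\<lambda>n. ue (\<epsilon>s (r n))) u"
      by (rule minimizers_converge[of \<epsilon>s "\<lambda>n. ue (\<epsilon>s n)"]) (use ue es in auto)
  qed
qed

end
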